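(* There exists a $\delta>0$ such that for all odd functions $f,g\in C^\infty([-1,1])$ with $\|(f,g)\|_{\mathcal{H}}<\delta$, the equation $$u(s,\cdot)=C(s)f+S(s)g-\int_0^s S(s-s')\left(u(s',\cdot)^3\right)ds',\qquad s\ge 0,$$ has a unique solution $u$ in $C([0,\infty),L^6_{\mathrm{odd}}(-1,1))$. Furthermore, $u\in L^p((0,\infty),L^6_{\mathrm{odd}}(-1,1))$ for any $p\in[3,\infty]$.
   Context: Energy norm: $\|(f,g)\|_{\mathcal{H}}^2:=\int_{-1}^1(1-y^2)|f'(y)|^2dy+\int_{-1}^1|g(y)|^2dy$. For $q\in[1,\infty)$, $L^q_{\mathrm{odd}}(-1,1)$ denotes the completion of $\{f\in C^\infty([-1,1]): f\text{ odd}\}$ with respect to $\|\cdot\|_{L^q(-1,1)}$. Wave propagators: for odd $f,g\in C^\infty([-1,1])$ let $u_{f,g}\in C^\infty([0,\infty)\times(-1,1))$ be the unique smooth solution of the linear initial value problem $$[\partial_s^2+2y\partial_s\partial_y+\partial_s-(1-y^2)\partial_y^2+2y\partial_y-1]u(s,y)=0\ \text{ on }(0,\infty)\times(-1,1),\quad u(0,\cdot)=f,\ \partial_su(0,\cdot)=g,$$ satisfying $\|(u(s,\cdot),\partial_su(s,\cdot))\|_{\mathcal{H}}<\infty$ for each $s\ge0$. Set $C(s)f:=u_{f,0}(s,\cdot)$ and $S(s)g:=u_{0,g}(s,\cdot)$. There is a bound $\|S(s)g\|_{L^6(-1,1)}\lesssim\|g\|_{L^2(-1,1)}$ for all $s\geq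 0$, so $S(s)$ extends uniquely to a bounded operator $S(s):L^2_{\mathrm{odd}}(-1,1)\to L^6_{\mathrm{odd}}(-1,1)$; this extension is the one used in the equation (note that $u(s',\cdot)\in L^6_{\mathrm{odd}}$ implies $u(s',\cdot)^3\in L^2_{\mathrm{odd}}$). The equation is the Duhamel (weak) formulation of the problem $[\partial_s^2+2y\partial_s\partial_y+\partial_s-(1-y^2)\partial_y^2+2y\partial_y-1]u=-u^3$, $u(0,\cdot)=f$, $\partial_su(0,\cdot)=g$. *)

theory Defs
  imports "HOL-Analysis.Analysis"
begin

section \<open>Smooth functions\<close>

text \<open>
  \<open>C\<^sup>\<infinity>\<close> on a set \<open>A\<close>, up to those boundary points that belong to \<open>A\<close>: \<open>D vs x\<close> is the iterated
  derivative of \<open>f\<close> at \<open>x\<close> in the directions \<open>vs\<close>, and each of these functions is Frechet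
  differentiable within \<open>A\<close>.  Only the values of \<open>f\<close> on \<open>A\<close> matter.
\<close>

definition smooth_on :: "'a::euclidean_space set \<Rightarrow> ('a \<Rightarrow> 'b::real_normed_vector) \<Rightarrow> bool" where
  "smooth_on A f \<longleftrightarrow> (\<exists>D :: 'a list \<Rightarrow> 'a \<Rightarrow> 'b.
     (\<forall>x\<in>A. D [] x = f x) \<and>
     (\<forall>vs. \<forall>x\<in>A. (D vs has_derivative (\<lambda>v. D (v # vs) x)) (at x within A)))"

lemma smooth_on_continuous:
  assumes "smooth_on A f"
  shows "continuous_on A f"
proof -
  from assms obtain D where
    "(\<forall>x\<in>A. D [] x = f x) \<and>
     (\<forall>vs. \<forall>x\<in>A. (D vs has_derivative (\<lambda>v. D (v # vs) x)) (at x within A))"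
    unfolding smooth_on_def by (elim exE)
  then have D: "\<And>x. x \<in> A \<Longrightarrow> D [] x = f x"
    "\<And>vs x. x \<in> A \<Longrightarrow> (D vs has_derivative (\<lambda>v. D (v # vs) x)) (at x within A)"
    by simp_all
  have "continuous_on A (D [])"
    using D(2) by (meson continuous_on_eq_continuous_within has_derivative_continuous)
  with D(1) show ?thesis by (simp cong: continuous_on_cong)
qed

lemma smooth_on_const: "smooth_on A (\<lambda>x. c)"
  unfolding smooth_on_def
  by (rule exI[of _ "\<lambda>vs x. if vs = [] then c else 0"]) (auto intro!: derivative_eq_intros)

lemma smooth_on_id: "smooth_on A (\<lambda>x. x)"
  unfolding smooth_on_def
proof (rule exI[of _ "\<lambda>vs x. case vs of [] \<Rightarrow> x | [v] \<Rightarrow> v | _ \<Rightarrow> 0"], intro conjI ballI allI)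
  fix vs :: "'a list" and x assume "x \<in> A"
  show "((\<lambda>x. case vs of [] \<Rightarrow> x | [v] \<Rightarrow> v | v # a # list \<Rightarrow> 0) has_derivative
        (\<lambda>v. case v # vs of [] \<Rightarrow> x | [v] \<Rightarrow> v | v # a # list \<Rightarrow> 0)) (at x within A)"
    by (cases vs; cases "tl vs") (auto intro!: derivative_eq_intros)
qed auto

lemma smooth_on_add:
  assumes "smooth_on A f" "smooth_on A g"
  shows "smooth_on A (\<lambda>x. f x + g x)"
proof -
  from assms(1) obtain D where
    "(\<forall>x\<in>A. D [] x = f x) \<and>
     (\<forall>vs. \<forall>x\<in>A. (D vs has_derivative (\<lambda>v. D (v # vs) x)) (at x within A))"
    unfolding smooth_on_def by (elim exE)
  then have D: "\<And>x. x \<in> A \<Longrightarrow> D [] x = f x"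
    "\<And>vs x. x \<in> A \<Longrightarrow> (D vs has_derivative (\<lambda>v. D (v # vs) x)) (at x within A)"
    by simp_all
  from assms(2) obtain E where
    "(\<forall>x\<in>A. E [] x = g x) \<and>
     (\<forall>vs. \<forall>x\<in>A. (E vs has_derivative (\<lambda>v. E (v # vs) x)) (at x within A))"
    unfolding smooth_on_def by (elim exE)
  then have E: "\<And>x. x \<in> A \<Longrightarrow> E [] x = g x"
    "\<And>vs x. x \<in> A \<Longrightarrow> (E vs has_derivative (\<lambda>v. E (v # vs) x)) (at x within A)"
    by simp_all
  show ?thesis
    unfolding smooth_on_def
    by (intro exI[of _ "\<lambda>vs x. D vs x + E vs x"] conjI allI ballI has_derivative_add D(2) E(2))
      (simp_all add: D(1) E(1))
qed

primrec splits :: "'a list \<Rightarrow> ('a list \<times> 'a list) list" where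
  "splits [] = [([], [])]"
| "splits (v # vs) = map (\<lambda>(a, b). (v # a, b)) (splits vs) @ map (\<lambda>(a, b). (a, v # b)) (splits vs)"

lemma smooth_on_mult:
  fixes f g :: "'a::euclidean_space \<Rightarrow> real"
  assumes "smooth_on A f" "smooth_on A g"
  shows "smooth_on A (\<lambda>x. f x * g x)"
proof -
  from assms(1) obtain D where
    "(\<forall>x\<in>A. D [] x = f x) \<and>
     (\<forall>vs. \<forall>x\<in>A. (D vs has_derivative (\<lambda>v. D (v # vs) x)) (at x within A))"
    unfolding smooth_on_def by (elim exE)
  then have D: "\<And>x. x \<in> A \<Longrightarrow> D [] x = f x"
    "\<And>vs x. x \<in> A \<Longrightarrow> (D vs has_derivative (\<lambda>v. D (v # vs) x)) (at x within A)"
    by simp_all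
  from assms(2) obtain E where
    "(\<forall>x\<in>A. E [] x = g x) \<and>
     (\<forall>vs. \<forall>x\<in>A. (E vs has_derivative (\<lambda>v. E (v # vs) x)) (at x within A))"
    unfolding smooth_on_def by (elim exE)
  then have E: "\<And>x. x \<in> A \<Longrightarrow> E [] x = g x"
    "\<And>vs x. x \<in> A \<Longrightarrow> (E vs has_derivative (\<lambda>v. E (v # vs) x)) (at x within A)"
    by simp_all
  define P where "P ps x = (\<Sum>(a, b)\<leftarrow>ps. D a x * E b x)" for ps x
  have P: "(P ps has_derivative (\<lambda>v. P (map (\<lambda>(a, b). (v # a, b)) ps) x
             + P (map (\<lambda>(a, b). (a, v # b)) ps) x)) (at x within A)" if "x \<in> A" for ps x
  proof (induction ps)
    case Nil
    show ?case by (simp add: P_def)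
  next
    case (Cons p ps)
    obtain a b where p: "p = (a, b)" by (cases p)
    have "((\<lambda>x. D a x * E b x + P ps x) has_derivative
       (\<lambda>v. (D a x * E (v # b) x + D (v # a) x * E b x) + (P (map (\<lambda>(a, b). (v # a, b)) ps) x
             + P (map (\<lambda>(a, b). (a, v # b)) ps) x))) (at x within A)"
      by (intro has_derivative_add has_derivative_mult D E Cons.IH that)
    then show ?case
      by (simp add: P_def p algebra_simps)
  qed
  show ?thesis
    unfolding smooth_on_def
  proof (rule exI[of _ "\<lambda>vs. P (splits vs)"], intro conjI ballI allI)
    show "P (splits []) x = f x * g x" if "x \<in> A" for x
      using D(1) E(1) that by (simp add: P_def)
    show "(P (splits vs) has_derivative (\<lambda>v. P (splits (v # vs)) x)) (at x within A)"
      if "x \<in> A" for vs x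
      using P[OF that, of "splits vs"] by (simp add: P_def)
  qed
qed

lemma smooth_on_power: "smooth_on A f \<Longrightarrow> smooth_on A (\<lambda>x. (f x :: real) ^ n)"
  by (induction n) (auto intro: smooth_on_const smooth_on_mult)

lemma smooth_on_sum:
  "(\<And>i. i \<in> I \<Longrightarrow> smooth_on A (f i)) \<Longrightarrow> smooth_on A (\<lambda>x. \<Sum>i\<in>I. f i x)"
  by (induction I rule: infinite_finite_induct) (auto intro: smooth_on_const smooth_on_add)

definition smooth_odd :: "(real \<Rightarrow> real) \<Rightarrow> bool" where
  "smooth_odd f \<longleftrightarrow> smooth_on {-1..1} f \<and> (\<forall>y\<in>{-1..1}. f (- y) = - f y)"

lemma smooth_odd_zero: "smooth_odd (\<lambda>x. 0)"
  by (simp add: smooth_odd_def smooth_on_const)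

lemma smooth_odd_add: "smooth_odd f \<Longrightarrow> smooth_odd g \<Longrightarrow> smooth_odd (\<lambda>x. f x + g x)"
  by (auto simp: smooth_odd_def smooth_on_add)

lemma smooth_odd_scale: "smooth_odd f \<Longrightarrow> smooth_odd (\<lambda>x. c * f x)"
  by (auto simp: smooth_odd_def smooth_on_mult smooth_on_const)

lemma smooth_odd_cube: "smooth_odd f \<Longrightarrow> smooth_odd (\<lambda>x. f x ^ 3)"
  by (auto simp: smooth_odd_def smooth_on_power)


section \<open>The spaces \<open>L\<^sup>q\<close> of odd functions on \<open>(-1,1)\<close>\<close>

definition Lq_space :: "real \<Rightarrow> (real \<Rightarrow> real) set" where
  "Lq_space q = {f \<in> borel_measurable (lebesgue_on {-1<..<1}).
     integrable (lebesgue_on {-1<..<1}) (\<lambda>y. \<bar>f y\<bar> powr q)}"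

definition Lq_norm :: "real \<Rightarrow> (real \<Rightarrow> real) \<Rightarrow> real" where
  "Lq_norm q f = (LINT y|lebesgue_on {-1<..<1}. \<bar>f y\<bar> powr q) powr (1 / q)"

text \<open>
  The completion of the smooth odd functions, realised as their closure in the complete space
  \<open>L\<^sup>q(-1,1)\<close>.  Functions that agree almost everywhere are identified in the type below.
\<close>

definition Lq_odd :: "real \<Rightarrow> (real \<Rightarrow> real) set" where
  "Lq_odd q = {f \<in> Lq_space q. \<forall>e>0. \<exists>\<phi>. smooth_odd \<phi> \<and> Lq_norm q (\<lambda>y. f y - \<phi> y) < e}"

abbreviation I1 :: "real measure" where "I1 \<equiv> lebesgue_on {-1<..<1}"

lemma finite_measure_I1: "finite_measure I1"
  by (rule finite_measureI) (simp add: emeasure_restrict_space space_restrict_space)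

lemma Lq_spaceD:
  assumes "f \<in> Lq_space q"
  shows "f \<in> borel_measurable I1" "integrable I1 (\<lambda>y. \<bar>f y\<bar> powr q)"
  using assms by (auto simp: Lq_space_def)

lemma Lq_norm_nonneg: "0 \<le> Lq_norm q f"
  by (simp add: Lq_norm_def)

lemma Lq_norm_powr: "q \<ge> 1 \<Longrightarrow> Lq_norm q f powr q = (LINT y|I1. \<bar>f y\<bar> powr q)"
  by (simp add: Lq_norm_def powr_powr integral_nonneg)

lemma convex_powr_ineq:
  fixes q :: real
  assumes "q \<ge> 1" "a \<ge> 0" "b \<ge> 0" "0 \<le> t" "t \<le> 1"
  shows "(t * a + (1 - t) * b) powr q \<le> t * a powr q + (1 - t) * b powr q"
proof -
  have small: "t powr q \<le> t" if "0 \<le> t" "t \<le> 1" for t :: real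
    using powr_mono'[of 1 q t] that assms by (cases "t = 0") auto
  show ?thesis
  proof (cases "a = 0 \<or> b = 0")
    case True
    then show ?thesis
    proof
      assume "a = 0"
      then show ?thesis
        using small[of "1 - t"] assms by (auto simp: powr_mult intro!: mult_right_mono)
    next
      assume "b = 0"
      then show ?thesis
        using small[of "t"] assms by (auto simp: powr_mult intro!: mult_right_mono)
    qed
  next
    case False
    then show ?thesis
      using convex_onD[OF powr_convex[OF assms(1)], of "1 - t" a b] assms by simp
  qed
qed

lemma Lq_space_scale:
  assumes "f \<in> Lq_space q"
  shows "(\<lambda>y. c * f y) \<in> Lq_space q"
  using assms by (auto simp: Lq_space_def abs_mult powr_mult)

lemma Lq_norm_scale:
  assumes "q \<ge> 1"
  shows "Lq_norm q (\<lambda>y. c * f y) = \<bar>c\<bar> * Lq_norm q f"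
  using assms by (simp add: Lq_norm_def abs_mult powr_mult powr_powr integral_nonneg)

lemma powr_sum_le:
  fixes q :: real
  assumes "q \<ge> 1"
  shows "\<bar>a + b\<bar> powr q \<le> 2 powr q * (\<bar>a\<bar> powr q + \<bar>b\<bar> powr q)"
proof -
  have "\<bar>a + b\<bar> powr q \<le> (2 * max \<bar>a\<bar> \<bar>b\<bar>) powr q"
    using assms by (intro powr_mono2) auto
  also have "\<dots> = 2 powr q * max \<bar>a\<bar> \<bar>b\<bar> powr q"
    by (simp add: powr_mult)
  also have "\<dots> \<le> 2 powr q * (\<bar>a\<bar> powr q + \<bar>b\<bar> powr q)"
    by (intro mult_left_mono) (auto simp: max_def)
  finally show ?thesis .
qed

lemma Lq_space_add:
  assumes q: "q \<ge> 1" and f: "f \<in> Lq_space q" and g: "g \<in> Lq_space q"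
  shows "(\<lambda>y. f y + g y) \<in> Lq_space q"
proof -
  note [measurable] = Lq_spaceD(1)[OF f] Lq_spaceD(1)[OF g]
  have "integrable I1 (\<lambda>y. \<bar>f y + g y\<bar> powr q)"
  proof (rule Bochner_Integration.integrable_bound)
    show "integrable I1 (\<lambda>y. 2 powr q * (\<bar>f y\<bar> powr q + \<bar>g y\<bar> powr q))"
      using Lq_spaceD(2)[OF f] Lq_spaceD(2)[OF g] by simp
  qed (use powr_sum_le[OF q] in \<open>auto intro!: AE_I2 order_trans[OF _ abs_ge_self]\<close>)
  then show ?thesis by (simp add: Lq_space_def)
qed

lemma Lq_space_diff:
  assumes q: "q \<ge> 1" and f: "f \<in> Lq_space q" and g: "g \<in> Lq_space q"
  shows "(\<lambda>y. f y - g y) \<in> Lq_space q"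
  using Lq_space_add[OF q f Lq_space_scale[OF g, of "-1"]] by simp

lemma Lq_norm_cong_AE:
  assumes "f \<in> Lq_space q" "g \<in> Lq_space q" "AE y in I1. f y = g y"
  shows "Lq_norm q f = Lq_norm q g"
proof -
  note [measurable] = Lq_spaceD(1)[OF assms(1)] Lq_spaceD(1)[OF assms(2)]
  have "(LINT y|I1. \<bar>f y\<bar> powr q) = (LINT y|I1. \<bar>g y\<bar> powr q)"
    using assms(3) by (intro integral_cong_AE) auto
  then show ?thesis by (simp add: Lq_norm_def)
qed

lemma Lq_norm_eq_0_iff:
  assumes "q \<ge> 1" "f \<in> Lq_space q"
  shows "Lq_norm q f = 0 \<longleftrightarrow> (AE y in I1. f y = 0)"
proof -
  have "Lq_norm q f = 0 \<longleftrightarrow> (LINT y|I1. \<bar>f y\<bar> powr q) = 0"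
    using assms by (simp add: Lq_norm_def)
  also have "\<dots> \<longleftrightarrow> (AE y in I1. \<bar>f y\<bar> powr q = 0)"
    using Lq_spaceD(2)[OF assms(2)] by (intro integral_nonneg_eq_0_iff_AE) auto
  finally show ?thesis by simp
qed

lemma Lq_norm_triangle:
  assumes q: "q \<ge> 1" and f: "f \<in> Lq_space q" and g: "g \<in> Lq_space q"
  shows "Lq_norm q (\<lambda>y. f y + g y) \<le> Lq_norm q f + Lq_norm q g"
proof -
  note fg = Lq_space_add[OF q f g]
  define A where "A = Lq_norm q f"
  define B where "B = Lq_norm q g"
  consider "A = 0" | "B = 0" | "A > 0" "B > 0"
    using Lq_norm_nonneg[of q f] Lq_norm_nonneg[of q g] unfolding A_def B_def by linarith
  then show ?thesis
  proof cases
    case 1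
    then have "AE y in I1. f y = 0"
      using Lq_norm_eq_0_iff[OF q f] by (simp add: A_def)
    then have "Lq_norm q (\<lambda>y. f y + g y) = Lq_norm q g"
      by (intro Lq_norm_cong_AE fg g) auto
    then show ?thesis using 1 by (simp add: A_def)
  next
    case 2
    then have "AE y in I1. g y = 0"
      using Lq_norm_eq_0_iff[OF q g] by (simp add: B_def)
    then have "Lq_norm q (\<lambda>y. f y + g y) = Lq_norm q f"
      by (intro Lq_norm_cong_AE fg f) auto
    then show ?thesis using 2 by (simp add: B_def)
  next
    case 3
    define t where "t = A / (A + B)"
    have t: "0 \<le> t" "t \<le> 1" "t / A = 1 / (A + B)" "(1 - t) / B = 1 / (A + B)"
      using 3 by (simp_all add: t_def diff_divide_eq_iff)
    have AB: "(LINT y|I1. \<bar>f y\<bar> powr q) = A powr q" "(LINT y|I1. \<bar>g y\<bar> powr q) = B powr q"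
      using q by (simp_all add: A_def B_def Lq_norm_powr)
    have pt: "\<bar>f y + g y\<bar> powr q \<le>
      (A + B) powr q * (t * (\<bar>f y\<bar> powr q / A powr q) + (1 - t) * (\<bar>g y\<bar> powr q / B powr q))" for y
    proof -
      have "\<bar>f y + g y\<bar> \<le> (A + B) * (t * (\<bar>f y\<bar> / A) + (1 - t) * (\<bar>g y\<bar> / B))"
      proof -
        have "t * (\<bar>f y\<bar> / A) = \<bar>f y\<bar> * (t / A)" "(1 - t) * (\<bar>g y\<bar> / B) = \<bar>g y\<bar> * ((1 - t) / B)"
          by simp_all
        then have "(A + B) * (t * (\<bar>f y\<bar> / A) + (1 - t) * (\<bar>g y\<bar> / B)) = \<bar>f y\<bar> + \<bar>g y\<bar>"
          unfolding t(3,4) using 3 by (simp add: add_divide_distrib[symmetric])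
        then show ?thesis by (simp add: abs_triangle_ineq)
      qed
      then have "\<bar>f y + g y\<bar> powr q \<le> ((A + B) * (t * (\<bar>f y\<bar> / A) + (1 - t) * (\<bar>g y\<bar> / B))) powr q"
        using q by (intro powr_mono2) auto
      also have "\<dots> = (A + B) powr q * (t * (\<bar>f y\<bar> / A) + (1 - t) * (\<bar>g y\<bar> / B)) powr q"
        by (rule powr_mult)
      also have "\<dots> \<le> (A + B) powr q * (t * (\<bar>f y\<bar> / A) powr q + (1 - t) * (\<bar>g y\<bar> / B) powr q)"
        using 3 t q by (intro mult_left_mono convex_powr_ineq) auto
      finally show ?thesis using 3 by (simp add: powr_divide)
    qed
    have "(LINT y|I1. \<bar>f y + g y\<bar> powr q) \<le> (LINT y|I1. (A + B) powr q *
        (t * (\<bar>f y\<bar> powr q / A powr q) + (1 - t) * (\<bar>g y\<bar> powr q / B powr q)))"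
      using Lq_spaceD(2)[OF fg] Lq_spaceD(2)[OF f] Lq_spaceD(2)[OF g] pt
      by (intro integral_mono) auto
    also have "\<dots> = (A + B) powr q"
      using Lq_spaceD(2)[OF f] Lq_spaceD(2)[OF g] 3 by (simp add: AB)
    finally have "Lq_norm q (\<lambda>y. f y + g y) \<le> ((A + B) powr q) powr (1 / q)"
      unfolding Lq_norm_def using q by (intro powr_mono2) (auto simp: integral_nonneg)
    also have "\<dots> = A + B"
      using 3 q by (simp add: powr_powr)
    finally show ?thesis by (simp add: A_def B_def)
  qed
qed


lemma bounded_in_Lq_space:
  assumes q: "q \<ge> 1" and "continuous_on {-1<..<1} f" and B: "\<And>y. y \<in> {-1<..<1} \<Longrightarrow> \<bar>f y\<bar> \<le> B"
  shows "f \<in> Lq_space q" "Lq_norm q f \<le> 2 * B"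
proof -
  have B0: "B \<ge> 0" using B[of 0] by simp
  have [measurable]: "f \<in> borel_measurable I1"
    using assms(2) by (intro continuous_imp_measurable_on_sets_lebesgue) auto
  interpret finite_measure I1 by (rule finite_measure_I1)
  have le: "\<bar>f y\<bar> powr q \<le> B powr q" if "y \<in> space I1" for y
    using that B[of y] q by (intro powr_mono2) auto
  have int: "integrable I1 (\<lambda>y. \<bar>f y\<bar> powr q)"
    by (rule integrable_const_bound[where B = "B powr q"]) (use le in auto)
  then show "f \<in> Lq_space q" by (simp add: Lq_space_def)
  have "measure I1 (space I1) = 2"
    by (simp add: measure_restrict_space space_restrict_space)
  then have "(LINT y|I1. \<bar>f y\<bar> powr q) \<le> 2 * B powr q"
    using integral_mono[OF int integrable_const[of "B powr q"] le] by simp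
  then have "Lq_norm q f \<le> (2 * B powr q) powr (1 / q)"
    unfolding Lq_norm_def using q by (intro powr_mono2) (auto simp: integral_nonneg)
  also have "\<dots> = 2 powr (1 / q) * B"
    using q B0 by (simp add: powr_mult powr_powr)
  also have "\<dots> \<le> 2 powr 1 * B"
    using q B0 by (intro mult_right_mono powr_mono) auto
  finally show "Lq_norm q f \<le> 2 * B" by simp
qed

lemma smooth_odd_in_Lq_space:
  assumes "q \<ge> 1" "smooth_odd f"
  shows "f \<in> Lq_space q"
proof -
  have c: "continuous_on {-1..1} f"
    using assms by (simp add: smooth_odd_def smooth_on_continuous)
  then have "bounded (f ` {-1..1})"
    by (intro compact_imp_bounded compact_continuous_image) auto
  then obtain B where "\<forall>z\<in>f ` {-1..1}. norm z \<le> B"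
    unfolding bounded_iff by blast
  then have "\<And>y. y \<in> {-1..1} \<Longrightarrow> \<bar>f y\<bar> \<le> B"
    by auto
  moreover have "continuous_on {-1<..<1} f"
    by (rule continuous_on_subset[OF c]) auto
  ultimately show ?thesis
    using assms(1) by (intro bounded_in_Lq_space(1)[where B = B]) auto
qed

lemma Lq_oddD:
  assumes "f \<in> Lq_odd q"
  shows "f \<in> Lq_space q"
    "\<And>e. e > 0 \<Longrightarrow> \<exists>\<phi>. smooth_odd \<phi> \<and> Lq_norm q (\<lambda>y. f y - \<phi> y) < e"
  using assms by (auto simp: Lq_odd_def)

lemma smooth_odd_in_Lq_odd:
  assumes "q \<ge> 1" "smooth_odd f"
  shows "f \<in> Lq_odd q"
proof -
  have "Lq_norm q (\<lambda>y. f y - f y) = 0"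
    by (simp add: Lq_norm_def)
  then show ?thesis
    using assms smooth_odd_in_Lq_space[OF assms]
    by (auto simp: Lq_odd_def intro!: exI[of _ f])
qed

lemma Lq_norm_triangle_diff:
  assumes q: "q \<ge> 1" and "f \<in> Lq_space q" "g \<in> Lq_space q" "h \<in> Lq_space q"
  shows "Lq_norm q (\<lambda>y. f y - h y) \<le> Lq_norm q (\<lambda>y. f y - g y) + Lq_norm q (\<lambda>y. g y - h y)"
  using Lq_norm_triangle[OF q Lq_space_diff[OF q assms(2,3)] Lq_space_diff[OF q assms(3,4)]]
  by simp

lemma Lq_odd_closed:
  assumes q: "q \<ge> 1" and f: "f \<in> Lq_space q"
    and *: "\<And>e. e > 0 \<Longrightarrow> \<exists>g\<in>Lq_odd q. Lq_norm q (\<lambda>y. f y - g y) < e"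
  shows "f \<in> Lq_odd q"
proof -
  have "\<exists>\<phi>. smooth_odd \<phi> \<and> Lq_norm q (\<lambda>y. f y - \<phi> y) < e" if e: "e > 0" for e
  proof -
    obtain g where g: "g \<in> Lq_odd q" "Lq_norm q (\<lambda>y. f y - g y) < e / 2"
      using bexE[OF *[OF half_gt_zero[OF e]]] .
    obtain \<phi> where \<phi>: "smooth_odd \<phi>" "Lq_norm q (\<lambda>y. g y - \<phi> y) < e / 2"
      using Lq_oddD(2)[OF g(1), of "e / 2"] e by auto
    have "Lq_norm q (\<lambda>y. f y - \<phi> y) < e"
      using Lq_norm_triangle_diff[OF q f Lq_oddD(1)[OF g(1)] smooth_odd_in_Lq_space[OF q \<phi>(1)]]
        g(2) \<phi>(2) by linarith
    with \<phi>(1) show ?thesis by blast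
  qed
  with f show ?thesis by (simp add: Lq_odd_def)
qed

lemma Lq_odd_zero: "q \<ge> 1 \<Longrightarrow> (\<lambda>y. 0) \<in> Lq_odd q"
  by (intro smooth_odd_in_Lq_odd smooth_odd_zero)

lemma Lq_odd_scale:
  assumes q: "q \<ge> 1" and f: "f \<in> Lq_odd q"
  shows "(\<lambda>y. c * f y) \<in> Lq_odd q"
proof (rule Lq_odd_closed[OF q Lq_space_scale[OF Lq_oddD(1)[OF f]]])
  fix e :: real assume e: "e > 0"
  obtain \<phi> where \<phi>: "smooth_odd \<phi>" "Lq_norm q (\<lambda>y. f y - \<phi> y) < e / (\<bar>c\<bar> + 1)"
    using Lq_oddD(2)[OF f, of "e / (\<bar>c\<bar> + 1)"] e by auto
  have "Lq_norm q (\<lambda>y. c * f y - c * \<phi> y) = \<bar>c\<bar> * Lq_norm q (\<lambda>y. f y - \<phi> y)"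
    using Lq_norm_scale[OF q, of c "\<lambda>y. f y - \<phi> y"] by (simp add: algebra_simps)
  also have "\<dots> \<le> (\<bar>c\<bar> + 1) * Lq_norm q (\<lambda>y. f y - \<phi> y)"
    by (intro mult_right_mono Lq_norm_nonneg) simp
  also have "\<dots> < e"
    using \<phi>(2) by (simp add: pos_less_divide_eq mult.commute)
  finally show "\<exists>g\<in>Lq_odd q. Lq_norm q (\<lambda>y. c * f y - g y) < e"
    using smooth_odd_in_Lq_odd[OF q smooth_odd_scale[OF \<phi>(1), of c]]
    by (intro bexI[of _ "\<lambda>y. c * \<phi> y"]) auto
qed

lemma Lq_odd_add:
  assumes q: "q \<ge> 1" and f: "f \<in> Lq_odd q" and g: "g \<in> Lq_odd q"
  shows "(\<lambda>y. f y + g y) \<in> Lq_odd q"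
proof (rule Lq_odd_closed[OF q Lq_space_add[OF q Lq_oddD(1)[OF f] Lq_oddD(1)[OF g]]])
  fix e :: real assume e: "e > 0"
  obtain \<phi> where \<phi>: "smooth_odd \<phi>" "Lq_norm q (\<lambda>y. f y - \<phi> y) < e / 2"
    using Lq_oddD(2)[OF f, of "e / 2"] e by auto
  obtain \<psi> where \<psi>: "smooth_odd \<psi>" "Lq_norm q (\<lambda>y. g y - \<psi> y) < e / 2"
    using Lq_oddD(2)[OF g, of "e / 2"] e by auto
  have "Lq_norm q (\<lambda>y. (f y - \<phi> y) + (g y - \<psi> y)) < e"
    using Lq_norm_triangle[OF q Lq_space_diff[OF q Lq_oddD(1)[OF f] smooth_odd_in_Lq_space[OF q \<phi>(1)]]
        Lq_space_diff[OF q Lq_oddD(1)[OF g] smooth_odd_in_Lq_space[OF q \<psi>(1)]]] \<phi>(2) \<psi>(2)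
    by linarith
  then have "Lq_norm q (\<lambda>y. f y + g y - (\<phi> y + \<psi> y)) < e"
    by (simp add: algebra_simps)
  then show "\<exists>h\<in>Lq_odd q. Lq_norm q (\<lambda>y. f y + g y - h y) < e"
    using smooth_odd_in_Lq_odd[OF q smooth_odd_add[OF \<phi>(1) \<psi>(1)]]
    by (intro bexI[of _ "\<lambda>y. \<phi> y + \<psi> y"]) auto
qed

lemma Lq_odd_diff:
  assumes q: "q \<ge> 1" and f: "f \<in> Lq_odd q" and g: "g \<in> Lq_odd q"
  shows "(\<lambda>y. f y - g y) \<in> Lq_odd q"
  using Lq_odd_add[OF q f Lq_odd_scale[OF q g, of "-1"]] by simp

lemma nn_integral_Lq:
  assumes "q \<ge> 1" "f \<in> Lq_space q"
  shows "(\<integral>\<^sup>+y. ennreal (\<bar>f y\<bar> powr q) \<partial>I1) = ennreal (Lq_norm q f powr q)"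
  using Lq_spaceD(2)[OF assms(2)] assms(1) by (simp add: nn_integral_eq_integral Lq_norm_powr)

lemma nn_integral_Lq_le:
  assumes q: "q \<ge> 1" and [measurable]: "f \<in> borel_measurable I1" and "e \<ge> 0"
    and le: "(\<integral>\<^sup>+y. ennreal (\<bar>f y\<bar> powr q) \<partial>I1) \<le> ennreal (e powr q)"
  shows "f \<in> Lq_space q" "Lq_norm q f \<le> e"
proof -
  have "integrable I1 (\<lambda>y. \<bar>f y\<bar> powr q)"
    using le_less_trans[OF le ennreal_less_top] by (intro integrableI_bounded) auto
  then show f: "f \<in> Lq_space q" by (simp add: Lq_space_def)
  have "Lq_norm q f powr q \<le> e powr q"
    using le by (simp add: nn_integral_Lq[OF q f])
  then show "Lq_norm q f \<le> e"
    using powr_less_mono2[of q e "Lq_norm q f"] q \<open>e \<ge> 0\<close> by linarith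
qed


text \<open>Riesz--Fischer\<close>

lemma Lq_odd_complete:
  assumes q: "q \<ge> 1" and X: "\<And>n. X n \<in> Lq_odd q"
    and Cauchy: "\<And>e. e > 0 \<Longrightarrow> \<exists>N. \<forall>m\<ge>N. \<forall>n\<ge>N. Lq_norm q (\<lambda>y. X m y - X n y) < e"
  shows "\<exists>f\<in>Lq_odd q. (\<lambda>n. Lq_norm q (\<lambda>y. X n y - f y)) \<longlonglongrightarrow> 0"
proof -
  have XL: "X n \<in> Lq_space q" for n
    using X Lq_oddD(1) by blast
  note [measurable] = Lq_spaceD(1)[OF XL]
  have "\<forall>k. \<exists>N. \<forall>m\<ge>N. \<forall>n\<ge>N. Lq_norm q (\<lambda>y. X m y - X n y) < (1/4) ^ k"
    using Cauchy by simp
  then obtain N where N: "\<And>k m n. m \<ge> N k \<Longrightarrow> n \<ge> N k \<Longrightarrow> Lq_norm q (\<lambda>y. X m y - X n y) < (1/4) ^ k"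
    by metis
  define r where "r k = (\<Sum>j\<le>k. N j) + k" for k
  have r: "r k \<ge> N k" "r (Suc k) \<ge> N k" "r k \<ge> k" for k
    using member_le_sum[of k "{..k}" N] unfolding r_def by auto
  define d where "d k y = X (r (Suc k)) y - X (r k) y" for k y
  have dL: "d k \<in> Lq_space q" for k
    unfolding d_def by (intro Lq_space_diff q XL)
  note [measurable] = Lq_spaceD(1)[OF dL]
  have dn: "Lq_norm q (d k) \<le> (1/4) ^ k" for k
    unfolding d_def by (intro less_imp_le N r)
  have "(\<integral>\<^sup>+y. (\<Sum>k. ennreal (\<bar>2 ^ k * d k y\<bar> powr q)) \<partial>I1)
      = (\<Sum>k. \<integral>\<^sup>+y. ennreal (\<bar>2 ^ k * d k y\<bar> powr q) \<partial>I1)"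
    by (intro nn_integral_suminf) auto
  also have "\<dots> \<le> (\<Sum>k. ennreal ((1/2) ^ k))"
  proof (intro suminf_le)
    fix k
    have eq: "(\<integral>\<^sup>+y. ennreal (\<bar>2 ^ k * d k y\<bar> powr q) \<partial>I1)
      = ennreal (Lq_norm q (\<lambda>y. 2 ^ k * d k y) powr q)"
      by (intro nn_integral_Lq q Lq_space_scale dL)
    have "Lq_norm q (\<lambda>y. 2 ^ k * d k y) \<le> 2 ^ k * (1/4) ^ k"
      using dn[of k] by (simp add: Lq_norm_scale[OF q])
    also have "2 ^ k * (1/4) ^ k = (1/2 :: real) ^ k"
      by (simp flip: power_mult_distrib)
    finally have 1: "Lq_norm q (\<lambda>y. 2 ^ k * d k y) powr q \<le> ((1/2) ^ k) powr q"
      using q by (intro powr_mono2 Lq_norm_nonneg) auto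
    have 2: "((1/2 :: real) ^ k) powr q \<le> ((1/2) ^ k) powr 1"
      using q by (intro powr_mono') (auto simp: power_le_one)
    show "(\<integral>\<^sup>+y. ennreal (\<bar>2 ^ k * d k y\<bar> powr q) \<partial>I1) \<le> ennreal ((1/2) ^ k)"
      unfolding eq using 1 2 by (intro ennreal_leI) simp
  qed auto
  also have "\<dots> = ennreal (\<Sum>k. (1/2) ^ k)"
    by (intro suminf_ennreal_eq summable_sums) (auto simp: summable_geometric)
  also have "\<dots> < \<infinity>" by simp
  finally have "(\<integral>\<^sup>+y. (\<Sum>k. ennreal (\<bar>2 ^ k * d k y\<bar> powr q)) \<partial>I1) \<noteq> \<infinity>" by simp
  then have "AE y in I1. (\<Sum>k. ennreal (\<bar>2 ^ k * d k y\<bar> powr q)) \<noteq> \<infinity>"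
    by (intro nn_integral_PInf_AE) auto
  then have conv: "AE y in I1. (\<lambda>k. X (r k) y) \<longlonglongrightarrow> lim (\<lambda>k. X (r k) y)"
  proof eventually_elim
    case (elim y)
    have "summable (\<lambda>k. \<bar>2 ^ k * d k y\<bar> powr q)"
      using elim by (intro summable_suminf_not_top) auto
    then have "(\<lambda>k. \<bar>2 ^ k * d k y\<bar> powr q) \<longlonglongrightarrow> 0"
      by (rule summable_LIMSEQ_zero)
    then have "\<forall>\<^sub>F k in sequentially. \<bar>2 ^ k * d k y\<bar> powr q < 1"
      by (rule order_tendstoD) simp
    then have "\<forall>\<^sub>F k in sequentially. norm (d k y) \<le> (1/2) ^ k"
    proof eventually_elim
      case (elim k)
      have "\<bar>2 ^ k * d k y\<bar> < 1"
        using elim q ge_one_powr_ge_zero[of "\<bar>2 ^ k * d k y\<bar>" q] by linarith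
      then show ?case by (simp add: abs_mult power_one_over field_simps)
    qed
    then have "summable (\<lambda>k. d k y)"
      by (rule summable_comparison_test_ev) (simp add: summable_geometric)
    then have "convergent (\<lambda>n. \<Sum>k<n. d k y)"
      by (simp add: summable_iff_convergent)
    moreover have "(\<Sum>k<n. d k y) = X (r n) y - X (r 0) y" for n
      unfolding d_def by (rule sum_lessThan_telescope)
    ultimately have "convergent (\<lambda>n. X (r n) y - X (r 0) y)"
      by simp
    then have "convergent (\<lambda>n. X (r n) y)"
      by (simp add: convergent_diff_const_right_iff)
    then show ?case by (simp add: convergent_LIMSEQ_iff)
  qed
  define f where "f y = lim (\<lambda>k. X (r k) y)" for y
  have [measurable]: "f \<in> borel_measurable I1"
    unfolding f_def by measurable
  have close: "(\<lambda>y. X n y - f y) \<in> Lq_space q \<and> Lq_norm q (\<lambda>y. X n y - f y) \<le> e"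
    if "e > 0" and M: "\<forall>m\<ge>M. \<forall>n\<ge>M. Lq_norm q (\<lambda>y. X m y - X n y) < e" and "n \<ge> M" for e M n
  proof -
    have "(\<integral>\<^sup>+y. ennreal (\<bar>X n y - f y\<bar> powr q) \<partial>I1)
        = (\<integral>\<^sup>+y. liminf (\<lambda>k. ennreal (\<bar>X n y - X (r k) y\<bar> powr q)) \<partial>I1)"
    proof (intro nn_integral_cong_AE)
      show "AE y in I1. ennreal (\<bar>X n y - f y\<bar> powr q) = liminf (\<lambda>k. ennreal (\<bar>X n y - X (r k) y\<bar> powr q))"
        using conv
      proof eventually_elim
        case (elim y)
        have "(\<lambda>k. ennreal (\<bar>X n y - X (r k) y\<bar> powr q)) \<longlonglongrightarrow> ennreal (\<bar>X n y - f y\<bar> powr q)"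
          using q elim unfolding f_def
          by (intro tendsto_ennrealI tendsto_powr' tendsto_intros) auto
        then show ?case
          by (intro lim_imp_Liminf[symmetric]) auto
      qed
    qed
    also have "\<dots> \<le> liminf (\<lambda>k. \<integral>\<^sup>+y. ennreal (\<bar>X n y - X (r k) y\<bar> powr q) \<partial>I1)"
      by (intro nn_integral_liminf) auto
    also have "\<dots> \<le> liminf (\<lambda>k::nat. ennreal (e powr q))"
    proof (intro Liminf_mono eventually_sequentiallyI)
      fix k assume "k \<ge> M"
      then have "r k \<ge> M" using r(3)[of k] by linarith
      then have "Lq_norm q (\<lambda>y. X n y - X (r k) y) < e"
        using M \<open>n \<ge> M\<close> by blast
      then show "(\<integral>\<^sup>+y. ennreal (\<bar>X n y - X (r k) y\<bar> powr q) \<partial>I1) \<le> ennreal (e powr q)"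
        using q by (simp add: nn_integral_Lq[OF q Lq_space_diff[OF q XL XL]] powr_mono2 Lq_norm_nonneg)
    qed
    also have "\<dots> = ennreal (e powr q)" by (intro Liminf_const) simp
    finally show ?thesis
      using nn_integral_Lq_le[OF q, of "\<lambda>y. X n y - f y" e] \<open>e > 0\<close> by simp
  qed
  have fL: "f \<in> Lq_space q"
  proof -
    obtain M where "\<forall>m\<ge>M. \<forall>n\<ge>M. Lq_norm q (\<lambda>y. X m y - X n y) < 1"
      using Cauchy[of 1] by auto
    from close[OF _ this, of M] have "(\<lambda>y. X M y - f y) \<in> Lq_space q" by simp
    from Lq_space_diff[OF q XL[of M] this] show ?thesis by simp
  qed
  have lim: "(\<lambda>n. Lq_norm q (\<lambda>y. X n y - f y)) \<longlonglongrightarrow> 0"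
  proof (rule LIMSEQ_I)
    fix e :: real assume "e > 0"
    then obtain M where M: "\<forall>m\<ge>M. \<forall>n\<ge>M. Lq_norm q (\<lambda>y. X m y - X n y) < e / 2"
      using Cauchy[of "e / 2"] by auto
    have "norm (Lq_norm q (\<lambda>y. X n y - f y) - 0) < e" if "n \<ge> M" for n
      using close[OF _ M that] \<open>e > 0\<close> Lq_norm_nonneg[of q "\<lambda>y. X n y - f y"] by auto
    then show "\<exists>M. \<forall>n\<ge>M. norm (Lq_norm q (\<lambda>y. X n y - f y) - 0) < e" by blast
  qed
  have "f \<in> Lq_odd q"
  proof (rule Lq_odd_closed[OF q fL])
    fix e :: real assume "e > 0"
    with lim have "\<forall>\<^sub>F n in sequentially. Lq_norm q (\<lambda>y. X n y - f y) < e"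
      by (rule order_tendstoD(2))
    then obtain n where n: "Lq_norm q (\<lambda>y. X n y - f y) < e"
      by (auto simp: eventually_sequentially)
    have "Lq_norm q (\<lambda>y. f y - X n y) = Lq_norm q (\<lambda>y. X n y - f y)"
      by (simp add: Lq_norm_def abs_minus_commute)
    with n X show "\<exists>g\<in>Lq_odd q. Lq_norm q (\<lambda>y. f y - g y) < e"
      by (intro bexI[of _ "X n"]) auto
  qed
  with lim show ?thesis by blast
qed


lemma Lq_norm_6: "Lq_norm 6 f ^ 6 = (LINT y|I1. f y ^ 6)"
proof -
  have "Lq_norm 6 f ^ 6 = Lq_norm 6 f powr 6"
    by (simp add: Lq_norm_nonneg)
  also have "\<dots> = (LINT y|I1. f y ^ 6)"
    by (simp add: Lq_norm_powr)
  finally show ?thesis .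
qed

lemma Lq_space_6: "f \<in> Lq_space 6 \<Longrightarrow> integrable I1 (\<lambda>y. f y ^ 6)"
  by (drule Lq_spaceD(2)) simp

lemma Lq_space_cube:
  assumes "f \<in> Lq_space 6"
  shows "(\<lambda>y. f y ^ 3) \<in> Lq_space 2"
proof -
  have "\<bar>f y ^ 3\<bar> powr 2 = f y ^ 6" for y
    by (simp flip: power_mult)
  then show ?thesis
    using Lq_spaceD(1)[OF assms] Lq_space_6[OF assms] by (simp add: Lq_space_def)
qed

lemma cube_diff_bound:
  fixes a b c :: real
  assumes "c > 0"
  shows "(a ^ 3 - b ^ 3)\<^sup>2 \<le> 9/4 * ((a - b) ^ 6 / c\<^sup>2 + 4 * c * (a ^ 6 + b ^ 6))"
proof -
  define x where "x = (a - b)\<^sup>2"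
  define w where "w = a\<^sup>2 + b\<^sup>2"
  have xw: "x \<ge> 0" "w \<ge> 0" by (auto simp: x_def w_def)
  have "\<bar>a\<^sup>2 + a * b + b\<^sup>2\<bar> \<le> 3/2 * w"
  proof -
    have "0 \<le> (a - b)\<^sup>2" "0 \<le> (a + b)\<^sup>2" by auto
    then show ?thesis unfolding w_def power2_diff power2_sum by (simp add: abs_le_iff)
  qed
  then have "\<bar>a\<^sup>2 + a * b + b\<^sup>2\<bar>\<^sup>2 \<le> (3/2 * w)\<^sup>2"
    by (intro power_mono) auto
  then have "x * (a\<^sup>2 + a * b + b\<^sup>2)\<^sup>2 \<le> x * (9/4 * w\<^sup>2)"
    using xw by (intro mult_left_mono) (simp_all add: power_mult_distrib power_divide)
  moreover have "(a ^ 3 - b ^ 3)\<^sup>2 = x * (a\<^sup>2 + a * b + b\<^sup>2)\<^sup>2"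
    unfolding x_def power_mult_distrib[symmetric] by (rule arg_cong[where f = "\<lambda>z. z\<^sup>2"]) algebra
  moreover have "x * w\<^sup>2 \<le> x ^ 3 / c\<^sup>2 + c * w ^ 3"
  proof (cases "x \<le> c * w")
    case True
    then have "x * w\<^sup>2 \<le> c * w * w\<^sup>2" by (intro mult_right_mono) auto
    moreover have "c * w * w\<^sup>2 = c * w ^ 3" by algebra
    moreover have "0 \<le> x ^ 3 / c\<^sup>2" using xw by simp
    ultimately show ?thesis by linarith
  next
    case False
    then have "w \<le> x / c" using assms by (simp add: field_simps)
    then have "x * w\<^sup>2 \<le> x * (x / c)\<^sup>2" using xw by (intro mult_left_mono power_mono) auto
    moreover have "x * (x / c)\<^sup>2 = x ^ 3 / c\<^sup>2" by (simp add: power_divide power2_eq_square power3_eq_cube)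
    moreover have "0 \<le> c * w ^ 3" using xw assms by simp
    ultimately show ?thesis by linarith
  qed
  moreover have "w ^ 3 \<le> 4 * (a ^ 6 + b ^ 6)"
  proof -
    have "4 * (a ^ 6 + b ^ 6) - w ^ 3 = 3 * w * (a\<^sup>2 - b\<^sup>2)\<^sup>2"
      unfolding w_def by algebra
    then show ?thesis using xw by (smt (verit) mult_nonneg_nonneg zero_le_power2)
  qed
  then have "c * w ^ 3 \<le> 4 * c * (a ^ 6 + b ^ 6)"
    using assms by simp
  moreover have "x ^ 3 = (a - b) ^ 6"
    by (simp add: x_def flip: power_mult)
  ultimately show ?thesis by simp
qed

lemma Lq_odd_cube:
  assumes f: "f \<in> Lq_odd 6"
  shows "(\<lambda>y. f y ^ 3) \<in> Lq_odd 2"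
proof (rule Lq_odd_closed)
  note fL = Lq_oddD(1)[OF f]
  show "(\<lambda>y. f y ^ 3) \<in> Lq_space 2" by (rule Lq_space_cube[OF fL])
  fix e :: real assume e: "e > 0"
  define K where "K = (Lq_norm 6 f + 1) ^ 6"
  have K: "K \<ge> 1" unfolding K_def using Lq_norm_nonneg[of 6 f] by (intro one_le_power) auto
  define c where "c = e\<^sup>2 / (40 * K)"
  have c: "c > 0" using e K by (simp add: c_def)
  define \<delta> where "\<delta> = min 1 (c\<^sup>2 * e\<^sup>2 / 9)"
  have \<delta>: "0 < \<delta>" "\<delta> \<le> 1" "\<delta> \<le> c\<^sup>2 * e\<^sup>2 / 9" using c e by (auto simp: \<delta>_def)
  obtain \<phi> where \<phi>: "smooth_odd \<phi>" "Lq_norm 6 (\<lambda>y. f y - \<phi> y) < \<delta>"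
    using Lq_oddD(2)[OF f \<delta>(1)] by auto
  have \<phi>L: "\<phi> \<in> Lq_space 6" using smooth_odd_in_Lq_space[OF _ \<phi>(1)] by simp
  have dL: "(\<lambda>y. f y - \<phi> y) \<in> Lq_space 6" using Lq_space_diff[OF _ fL \<phi>L] by simp
  have "Lq_norm 6 \<phi> \<le> Lq_norm 6 f + 1"
  proof -
    have "Lq_norm 6 (\<lambda>y. - (f y - \<phi> y)) < 1"
      using \<phi>(2) \<delta>(2) Lq_norm_scale[of 6 "-1" "\<lambda>y. f y - \<phi> y"] by simp
    then show ?thesis
      using Lq_norm_triangle[OF _ fL Lq_space_scale[OF dL, of "-1"]] by simp
  qed
  then have "(LINT y|I1. \<phi> y ^ 6) \<le> K"
    unfolding Lq_norm_6[symmetric] K_def by (intro power_mono Lq_norm_nonneg)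
  moreover have "(LINT y|I1. f y ^ 6) \<le> K"
    unfolding Lq_norm_6[symmetric] K_def by (intro power_mono Lq_norm_nonneg) simp
  moreover have "(LINT y|I1. (f y - \<phi> y) ^ 6) \<le> c\<^sup>2 * e\<^sup>2 / 9"
  proof -
    have "(LINT y|I1. (f y - \<phi> y) ^ 6) \<le> \<delta> ^ 6"
      unfolding Lq_norm_6[of "\<lambda>y. f y - \<phi> y", symmetric]
      using \<phi>(2) by (intro power_mono Lq_norm_nonneg) simp
    also have "\<dots> \<le> \<delta>"
      using \<delta> power_decreasing[of 1 6 \<delta>] by simp
    finally show ?thesis using \<delta>(3) by linarith
  qed
  ultimately have "9/4 * ((LINT y|I1. (f y - \<phi> y) ^ 6) / c\<^sup>2
      + 4 * c * ((LINT y|I1. f y ^ 6) + (LINT y|I1. \<phi> y ^ 6))) \<le> 9/4 * ((c\<^sup>2 * e\<^sup>2 / 9) / c\<^sup>2 + 4 * c * (K + K))"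
    using c by (intro mult_left_mono add_mono divide_right_mono) auto
  also have "\<dots> = e\<^sup>2 / 4 + 18 * (c * K)" using c by (simp add: field_simps)
  also have "c * K = e\<^sup>2 / 40" using K by (simp add: c_def)
  also have "e\<^sup>2 / 4 + 18 * (e\<^sup>2 / 40) < e\<^sup>2" using e by simp
  finally have small: "9/4 * ((LINT y|I1. (f y - \<phi> y) ^ 6) / c\<^sup>2
      + 4 * c * ((LINT y|I1. f y ^ 6) + (LINT y|I1. \<phi> y ^ 6))) < e\<^sup>2" .
  note ints = Lq_space_6[OF fL] Lq_space_6[OF \<phi>L] Lq_space_6[OF dL]
  have L2: "(\<lambda>y. f y ^ 3 - \<phi> y ^ 3) \<in> Lq_space 2"
    using Lq_space_diff[OF _ Lq_space_cube[OF fL] Lq_space_cube[OF \<phi>L]] by simp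
  have "(Lq_norm 2 (\<lambda>y. f y ^ 3 - \<phi> y ^ 3))\<^sup>2 = Lq_norm 2 (\<lambda>y. f y ^ 3 - \<phi> y ^ 3) powr 2"
    by (simp add: Lq_norm_nonneg)
  also have "\<dots> = (LINT y|I1. (f y ^ 3 - \<phi> y ^ 3)\<^sup>2)"
    by (simp add: Lq_norm_powr)
  also have "\<dots> \<le> (LINT y|I1. 9/4 * ((f y - \<phi> y) ^ 6 / c\<^sup>2 + 4 * c * (f y ^ 6 + \<phi> y ^ 6)))"
    using Lq_spaceD(2)[OF L2] ints by (intro integral_mono cube_diff_bound c) auto
  also have "\<dots> = 9/4 * ((LINT y|I1. (f y - \<phi> y) ^ 6) / c\<^sup>2
      + 4 * c * ((LINT y|I1. f y ^ 6) + (LINT y|I1. \<phi> y ^ 6)))"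
    using ints by simp
  also note small
  finally have "Lq_norm 2 (\<lambda>y. f y ^ 3 - \<phi> y ^ 3) < e"
    using e by (rule power2_less_imp_less[OF _ less_imp_le])
  then show "\<exists>g\<in>Lq_odd 2. Lq_norm 2 (\<lambda>y. f y ^ 3 - g y) < e"
    using smooth_odd_in_Lq_odd[OF _ smooth_odd_cube[OF \<phi>(1)], of 2]
    by (intro bexI[of _ "\<lambda>y. \<phi> y ^ 3"]) auto
qed simp


definition rat_odd_poly :: "rat list \<Rightarrow> real \<Rightarrow> real" where
  "rat_odd_poly cs y = (\<Sum>i<length cs. (if odd i then of_rat (cs ! i) else 0) * y ^ i)"

lemma smooth_odd_rat_odd_poly: "smooth_odd (rat_odd_poly cs)"
  unfolding smooth_odd_def
proof
  have "smooth_on {-1..1} (\<lambda>y::real. \<Sum>i<length cs. (if odd i then of_rat (cs ! i) else 0) * y ^ i)"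
    by (intro smooth_on_sum smooth_on_mult smooth_on_power smooth_on_const smooth_on_id)
  then show "smooth_on {-1..1} (rat_odd_poly cs)"
    by (simp add: rat_odd_poly_def[abs_def])
  show "\<forall>y\<in>{-1..1}. rat_odd_poly cs (- y) = - rat_odd_poly cs y"
    by (auto simp: rat_odd_poly_def simp flip: sum_negf intro!: sum.cong)
qed

lemma Lq_odd_separable:
  assumes q: "q \<ge> 1" and f: "f \<in> Lq_odd q" and e: "e > 0"
  shows "\<exists>cs. Lq_norm q (\<lambda>y. f y - rat_odd_poly cs y) < e"
proof -
  obtain \<phi> where \<phi>: "smooth_odd \<phi>" "Lq_norm q (\<lambda>y. f y - \<phi> y) < e / 2"
    using Lq_oddD(2)[OF f, of "e / 2"] e by auto
  define h where "h = e / 10"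
  have h: "h > 0" using e by (simp add: h_def)
  have cont: "continuous_on {-1..1} \<phi>"
    using \<phi>(1) by (simp add: smooth_odd_def smooth_on_continuous)
  obtain p where p: "real_polynomial_function p" "\<And>y. y \<in> {-1..1} \<Longrightarrow> \<bar>\<phi> y - p y\<bar> < h"
    using Stone_Weierstrass_real_polynomial_function[OF _ cont h] by auto
  obtain a n where pa: "p = (\<lambda>y. \<Sum>i\<le>n. a i * y ^ i)"
    using p(1) real_polynomial_function_iff_sum by auto
  have "\<exists>c::rat. \<bar>a i - of_rat c\<bar> < h / (n + 1)" for i
  proof -
    obtain c where "a i - h / (n + 1) < of_rat c" "of_rat c < a i + h / (n + 1)"
      using of_rat_dense[of "a i - h / (n + 1)" "a i + h / (n + 1)"] h by auto
    then show ?thesis by (intro exI[of _ c]) auto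
  qed
  then obtain c :: "nat \<Rightarrow> rat" where c: "\<And>i. \<bar>a i - of_rat (c i)\<bar> < h / (n + 1)" by metis
  define cs where "cs = map c [0..<Suc n]"
  have bd: "\<bar>\<phi> y - rat_odd_poly cs y\<bar> \<le> 2 * h" if y: "y \<in> {-1<..<1}" for y
  proof -
    have "\<phi> (- y) = - \<phi> y" using \<phi>(1) y by (simp add: smooth_odd_def)
    moreover have "\<bar>\<phi> y - p y\<bar> < h" "\<bar>\<phi> (- y) - p (- y)\<bar> < h" using p(2) y by auto
    moreover have "2 * ((p y - p (- y)) / 2) = p y - p (- y)" by simp
    ultimately have 1: "\<bar>\<phi> y - (p y - p (- y)) / 2\<bar> < h" by (smt (verit))
    have "(p y - p (- y)) / 2 = (\<Sum>i\<le>n. (a i * y ^ i - a i * (- y) ^ i) / 2)"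
      by (simp add: pa sum_subtractf sum_divide_distrib[symmetric])
    also have "\<dots> = (\<Sum>i\<le>n. (if odd i then a i else 0) * y ^ i)"
      by (intro sum.cong) auto
    finally have 2: "(p y - p (- y)) / 2 = (\<Sum>i\<le>n. (if odd i then a i else 0) * y ^ i)" .
    have 3: "rat_odd_poly cs y = (\<Sum>i\<le>n. (if odd i then of_rat (c i) else 0) * y ^ i)"
    proof -
      have "cs ! i = c i" if "i \<le> n" for i
        unfolding cs_def using that nth_map_upt[of i "Suc n" 0 c] by (simp del: upt_Suc)
      moreover have "length cs = Suc n" by (simp add: cs_def)
      ultimately show ?thesis
        unfolding rat_odd_poly_def lessThan_Suc_atMost[symmetric] by (intro sum.cong) auto
    qed
    have "\<bar>(p y - p (- y)) / 2 - rat_odd_poly cs y\<bar>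
        = \<bar>\<Sum>i\<le>n. (if odd i then a i - of_rat (c i) else 0) * y ^ i\<bar>"
      unfolding 2 3 sum_subtractf[symmetric] by (intro arg_cong[where f = abs] sum.cong) (auto simp: algebra_simps)
    also have "\<dots> \<le> (\<Sum>i\<le>n. h / (n + 1))"
    proof (rule order_trans[OF sum_abs sum_mono])
      fix i
      have "\<bar>y ^ i\<bar> \<le> 1" using y unfolding power_abs by (intro power_le_one) auto
      moreover have "\<bar>if odd i then a i - of_rat (c i) else 0\<bar> \<le> h / (n + 1)"
        using c[of i] h by (auto simp: less_imp_le)
      ultimately show "\<bar>(if odd i then a i - of_rat (c i) else 0) * y ^ i\<bar> \<le> h / (n + 1)"
        using mult_mono[of _ "h / (n + 1)" "\<bar>y ^ i\<bar>" 1] h unfolding abs_mult by auto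
    qed
    also have "\<dots> = h" by simp
    finally show ?thesis using 1 by linarith
  qed
  note P = smooth_odd_rat_odd_poly[of cs]
  have "continuous_on {-1..1} (rat_odd_poly cs)"
    using P by (simp add: smooth_odd_def smooth_on_continuous)
  then have "continuous_on {-1<..<1} (\<lambda>y. \<phi> y - rat_odd_poly cs y)"
    using cont by (intro continuous_on_diff; elim continuous_on_subset) auto
  then have "Lq_norm q (\<lambda>y. \<phi> y - rat_odd_poly cs y) \<le> 2 * (2 * h)"
    using bd by (intro bounded_in_Lq_space q)
  then have "Lq_norm q (\<lambda>y. f y - rat_odd_poly cs y) < e"
    using Lq_norm_triangle_diff[OF q Lq_oddD(1)[OF f] smooth_odd_in_Lq_space[OF q \<phi>(1)]
        smooth_odd_in_Lq_space[OF q P]] \<phi>(2) e unfolding h_def by simp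
  then show ?thesis by blast
qed


lemma card_ge_1: "1 \<le> real CARD('q::finite)"
  using zero_less_card_finite[where 'a='q] by linarith

text \<open>
  The Banach space \<open>L\<^sup>q\<close> of odd functions for integral \<open>q\<close>, as a type of classes modulo equality
  almost everywhere: the exponent is the cardinality of the type argument, so that \<open>2 Lodd\<close> and
  \<open>6 Lodd\<close> are the spaces for \<open>q = 2\<close> and \<open>q = 6\<close>.
\<close>

definition Lq_class :: "real \<Rightarrow> (real \<Rightarrow> real) \<Rightarrow> (real \<Rightarrow> real) set" where
  "Lq_class q f = {g \<in> Lq_odd q. AE y in lebesgue_on {-1<..<1}. g y = f y}"

typedef ('q::finite) Lodd = "Lq_class (real CARD('q)) ` Lq_odd (real CARD('q))"
  using Lq_odd_zero[OF card_ge_1] by blast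

text \<open>
  \<open>Lclass f\<close> is the element given by a function \<open>f\<close> in \<open>Lq_odd\<close> (it is unspecified for other \<open>f\<close>),
  and \<open>Lrep u\<close> is some representative of \<open>u\<close>.
\<close>

definition Lclass :: "(real \<Rightarrow> real) \<Rightarrow> 'q::finite Lodd" where
  "Lclass f = Abs_Lodd (Lq_class (real CARD('q)) f)"

definition Lrep :: "'q::finite Lodd \<Rightarrow> real \<Rightarrow> real" where
  "Lrep u = (SOME f. f \<in> Rep_Lodd u)"

lemma Lodd_exhaust:
  fixes u :: "'q::finite Lodd"
  obtains f where "f \<in> Lq_odd (real CARD('q))" "u = Lclass f"
  by (cases u) (auto simp: Lclass_def)

lemma Rep_Lclass:
  assumes "f \<in> Lq_odd (real CARD('q::finite))"
  shows "Rep_Lodd (Lclass f :: 'q Lodd) = Lq_class (real CARD('q)) f"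
  using assms by (simp add: Lclass_def Abs_Lodd_inverse)

lemma Lclass_eq_iff:
  assumes "f \<in> Lq_odd (real CARD('q::finite))" "g \<in> Lq_odd (real CARD('q))"
  shows "(Lclass f :: 'q Lodd) = Lclass g \<longleftrightarrow> (AE y in I1. f y = g y)"
proof -
  have "(Lclass f :: 'q Lodd) = Lclass g \<longleftrightarrow> Lq_class (real CARD('q)) f = Lq_class (real CARD('q)) g"
    by (simp add: Rep_Lodd_inject[symmetric] Rep_Lclass assms)
  also have "\<dots> \<longleftrightarrow> (AE y in I1. f y = g y)"
  proof
    assume "Lq_class (real CARD('q)) f = Lq_class (real CARD('q)) g"
    moreover have "f \<in> Lq_class (real CARD('q)) f"
      using assms by (simp add: Lq_class_def)
    ultimately show "AE y in I1. f y = g y"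
      by (simp add: Lq_class_def)
  next
    assume fg: "AE y in I1. f y = g y"
    have "(AE y in I1. h y = f y) \<longleftrightarrow> (AE y in I1. h y = g y)" for h
    proof
      assume "AE y in I1. h y = f y"
      with fg show "AE y in I1. h y = g y" by eventually_elim simp
    next
      assume "AE y in I1. h y = g y"
      with fg show "AE y in I1. h y = f y" by eventually_elim simp
    qed
    then show "Lq_class (real CARD('q)) f = Lq_class (real CARD('q)) g"
      by (simp add: Lq_class_def)
  qed
  finally show ?thesis .
qed

lemma Lrep_in: "Lrep (u :: 'q::finite Lodd) \<in> Lq_odd (real CARD('q))"
  and Lclass_Lrep: "Lclass (Lrep u) = u"
proof -
  obtain f where f: "f \<in> Lq_odd (real CARD('q))" "u = Lclass f" by (rule Lodd_exhaust)
  have "f \<in> Rep_Lodd u"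
    using f by (simp add: Rep_Lclass Lq_class_def)
  then have "Lrep u \<in> Rep_Lodd u"
    unfolding Lrep_def by (rule someI[of "\<lambda>f. f \<in> Rep_Lodd u"])
  then have *: "Lrep u \<in> Lq_odd (real CARD('q))" "AE y in I1. Lrep u y = f y"
    using f by (simp_all add: Rep_Lclass Lq_class_def)
  then show "Lrep u \<in> Lq_odd (real CARD('q))" by blast
  show "Lclass (Lrep u) = u"
    using * f by (simp add: Lclass_eq_iff)
qed

lemma Lrep_Lclass:
  assumes "f \<in> Lq_odd (real CARD('q::finite))"
  shows "AE y in I1. Lrep (Lclass f :: 'q Lodd) y = f y"
  using Lclass_eq_iff[OF Lrep_in assms] Lclass_Lrep by blast

instantiation Lodd :: (finite) real_normed_vector
begin

definition zero_Lodd :: "'a Lodd" where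
  "0 = Lclass (\<lambda>y. 0)"

definition plus_Lodd :: "'a Lodd \<Rightarrow> 'a Lodd \<Rightarrow> 'a Lodd" where
  "u + v = Lclass (\<lambda>y. Lrep u y + Lrep v y)"

definition uminus_Lodd :: "'a Lodd \<Rightarrow> 'a Lodd" where
  "- u = Lclass (\<lambda>y. - Lrep u y)"

definition minus_Lodd :: "'a Lodd \<Rightarrow> 'a Lodd \<Rightarrow> 'a Lodd" where
  "u - v = Lclass (\<lambda>y. Lrep u y - Lrep v y)"

definition scaleR_Lodd :: "real \<Rightarrow> 'a Lodd \<Rightarrow> 'a Lodd" where
  "c *\<^sub>R u = Lclass (\<lambda>y. c * Lrep u y)"

definition norm_Lodd :: "'a Lodd \<Rightarrow> real" where
  "norm u = Lq_norm (real CARD('a)) (Lrep u)"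

definition sgn_Lodd :: "'a Lodd \<Rightarrow> 'a Lodd" where
  "sgn u = inverse (norm (u :: 'a Lodd)) *\<^sub>R u"

definition dist_Lodd :: "'a Lodd \<Rightarrow> 'a Lodd \<Rightarrow> real" where
  "dist u v = norm (u - v :: 'a Lodd)"

definition uniformity_Lodd :: "('a Lodd \<times> 'a Lodd) filter" where
  "uniformity = (INF e\<in>{0<..}. principal {(u :: 'a Lodd, v). dist u v < e})"

definition open_Lodd :: "'a Lodd set \<Rightarrow> bool" where
  "open (U :: 'a Lodd set) \<longleftrightarrow> (\<forall>f\<in>U. eventually (\<lambda>(f', g). f' = f \<longrightarrow> g \<in> U) uniformity)"

lemma Lclass_add:
  assumes "f \<in> Lq_odd (real CARD('a))" "g \<in> Lq_odd (real CARD('a))"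
  shows "Lclass f + Lclass g = (Lclass (\<lambda>y. f y + g y) :: 'a Lodd)"
proof -
  have "AE y in I1. Lrep (Lclass f :: 'a Lodd) y + Lrep (Lclass g :: 'a Lodd) y = f y + g y"
    using Lrep_Lclass[OF assms(1)] Lrep_Lclass[OF assms(2)] by eventually_elim simp
  then show ?thesis
    unfolding plus_Lodd_def by (subst Lclass_eq_iff) (auto intro!: Lq_odd_add card_ge_1 assms Lrep_in)
qed

lemma Lclass_diff:
  assumes "f \<in> Lq_odd (real CARD('a))" "g \<in> Lq_odd (real CARD('a))"
  shows "Lclass f - Lclass g = (Lclass (\<lambda>y. f y - g y) :: 'a Lodd)"
proof -
  have "AE y in I1. Lrep (Lclass f :: 'a Lodd) y - Lrep (Lclass g :: 'a Lodd) y = f y - g y"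
    using Lrep_Lclass[OF assms(1)] Lrep_Lclass[OF assms(2)] by eventually_elim simp
  then show ?thesis
    unfolding minus_Lodd_def by (subst Lclass_eq_iff) (auto intro!: Lq_odd_diff card_ge_1 assms Lrep_in)
qed

lemma Lclass_scaleR:
  assumes "f \<in> Lq_odd (real CARD('a))"
  shows "c *\<^sub>R Lclass f = (Lclass (\<lambda>y. c * f y) :: 'a Lodd)"
proof -
  have "AE y in I1. c * Lrep (Lclass f :: 'a Lodd) y = c * f y"
    using Lrep_Lclass[OF assms(1)] by eventually_elim simp
  then show ?thesis
    unfolding scaleR_Lodd_def by (subst Lclass_eq_iff) (auto intro!: Lq_odd_scale card_ge_1 assms Lrep_in)
qed

lemma uminus_Lodd_eq: "- u = (-1) *\<^sub>R (u :: 'a Lodd)"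
  by (simp add: uminus_Lodd_def scaleR_Lodd_def)

lemma norm_Lclass:
  assumes "f \<in> Lq_odd (real CARD('a))"
  shows "norm (Lclass f :: 'a Lodd) = Lq_norm (real CARD('a)) f"
  unfolding norm_Lodd_def using Lrep_Lclass[OF assms] Lrep_in assms
  by (intro Lq_norm_cong_AE Lq_oddD(1))

instance
proof
  let ?q = "real CARD('a)"
  fix u v w :: "'a Lodd" and a b :: real
  obtain f where f: "f \<in> Lq_odd ?q" "u = Lclass f" by (rule Lodd_exhaust)
  obtain g where g: "g \<in> Lq_odd ?q" "v = Lclass g" by (rule Lodd_exhaust)
  obtain h where h: "h \<in> Lq_odd ?q" "w = Lclass h" by (rule Lodd_exhaust)
  note mem = f(1) g(1) h(1) Lq_odd_add[OF card_ge_1] Lq_odd_diff[OF card_ge_1]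
    Lq_odd_scale[OF card_ge_1] Lq_odd_zero[OF card_ge_1]
  note rules = f(2) g(2) h(2) Lclass_add Lclass_diff Lclass_scaleR uminus_Lodd_eq zero_Lodd_def norm_Lclass
  show "u + v + w = u + (v + w)" by (simp add: rules mem add.assoc)
  show "u + v = v + u" by (simp add: rules mem add.commute)
  show "0 + u = u" by (simp add: rules mem)
  show "- u + u = 0" by (simp add: rules mem Lq_odd_scale[OF card_ge_1, of _ "-1", simplified]
    Lclass_scaleR[of _ "-1", simplified])
  show "u - v = u + - v" using mem(6)[OF g(1), of "-1"] by (simp add: rules mem)
  show "a *\<^sub>R (u + v) = a *\<^sub>R u + a *\<^sub>R v" by (simp add: rules mem distrib_left)
  show "(a + b) *\<^sub>R u = a *\<^sub>R u + b *\<^sub>R u" by (simp add: rules mem distrib_right)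
  show "a *\<^sub>R b *\<^sub>R u = (a * b) *\<^sub>R u" by (simp add: rules mem mult.assoc)
  show "1 *\<^sub>R u = u" by (simp add: rules mem)
  show "dist u v = norm (u - v)" by (rule dist_Lodd_def)
  show "sgn u = inverse (norm u) *\<^sub>R u" by (rule sgn_Lodd_def)
  show "(uniformity :: ('a Lodd \<times> 'a Lodd) filter) = (INF e\<in>{0<..}. principal {(u, v). dist u v < e})"
    by (rule uniformity_Lodd_def)
  show "open U \<longleftrightarrow> (\<forall>u\<in>U. \<forall>\<^sub>F (u', v) in uniformity. u' = u \<longrightarrow> v \<in> U)" for U :: "'a Lodd set"
    by (rule open_Lodd_def)
  show "norm u = 0 \<longleftrightarrow> u = 0"
    using f by (simp add: rules mem Lclass_eq_iff Lq_norm_eq_0_iff[OF card_ge_1 Lq_oddD(1)])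
  show "norm (u + v) \<le> norm u + norm v"
    by (simp add: rules mem Lq_norm_triangle[OF card_ge_1 Lq_oddD(1) Lq_oddD(1)])
  show "norm (a *\<^sub>R u) = \<bar>a\<bar> * norm u"
    by (simp add: rules mem Lq_norm_scale[OF card_ge_1])
qed

end


instance Lodd :: (finite) banach
proof
  fix X :: "nat \<Rightarrow> 'a Lodd"
  let ?q = "real CARD('a)"
  assume "Cauchy X"
  define F where "F n = Lrep (X n)" for n
  have F: "F n \<in> Lq_odd ?q" "X n = Lclass (F n)" for n
    unfolding F_def by (rule Lrep_in, rule Lclass_Lrep[symmetric])
  have dist: "dist (X m) (X n) = Lq_norm ?q (\<lambda>y. F m y - F n y)" for m n
    by (simp add: dist_norm F Lclass_diff norm_Lclass Lq_odd_diff[OF card_ge_1])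
  have "\<exists>f\<in>Lq_odd ?q. (\<lambda>n. Lq_norm ?q (\<lambda>y. F n y - f y)) \<longlonglongrightarrow> 0"
    using \<open>Cauchy X\<close> by (intro Lq_odd_complete card_ge_1 F) (simp add: Cauchy_def dist)
  then obtain f where f: "f \<in> Lq_odd ?q" "(\<lambda>n. Lq_norm ?q (\<lambda>y. F n y - f y)) \<longlonglongrightarrow> 0"
    by blast
  have "(\<lambda>n. dist (X n) (Lclass f)) = (\<lambda>n. Lq_norm ?q (\<lambda>y. F n y - f y))"
    by (simp add: dist_norm F f(1) Lclass_diff norm_Lclass Lq_odd_diff[OF card_ge_1])
  with f(2) have "X \<longlonglongrightarrow> Lclass f"
    by (subst tendsto_dist_iff) simp
  then show "convergent X" by (rule convergentI)
qed

instance Lodd :: (finite) second_countable_topology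
proof
  let ?q = "real CARD('a)"
  define P :: "'a Lodd set" where "P = range (\<lambda>cs. Lclass (rat_odd_poly cs))"
  define B where "B = (\<lambda>(p, n::nat). ball p (1 / Suc n)) ` (P \<times> UNIV)"
  have dense: "\<exists>p\<in>P. dist p u < e" if "e > 0" for u :: "'a Lodd" and e
  proof -
    obtain f where f: "f \<in> Lq_odd ?q" "u = Lclass f" by (rule Lodd_exhaust)
    obtain cs where cs: "Lq_norm ?q (\<lambda>y. f y - rat_odd_poly cs y) < e"
      using Lq_odd_separable[OF card_ge_1 f(1) \<open>e > 0\<close>] by blast
    have "rat_odd_poly cs \<in> Lq_odd ?q"
      by (intro smooth_odd_in_Lq_odd card_ge_1 smooth_odd_rat_odd_poly)
    then have "dist u (Lclass (rat_odd_poly cs)) < e"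
      using cs f by (simp add: dist_norm Lclass_diff norm_Lclass Lq_odd_diff[OF card_ge_1])
    then show ?thesis by (auto simp: P_def dist_commute)
  qed
  have "topological_basis B"
  proof (rule topological_basisI)
    fix U :: "'a Lodd set" and u assume "open U" "u \<in> U"
    then obtain e where e: "e > 0" "ball u e \<subseteq> U" by (meson openE)
    then obtain n where n: "1 / Suc n < e / 2"
      using nat_approx_posE[of "e / 2"] by auto
    obtain p where p: "p \<in> P" "dist p u < 1 / Suc n" using dense[of "1 / Suc n" u] by auto
    have "ball p (1 / Suc n) \<subseteq> ball u e"
    proof
      fix v assume "v \<in> ball p (1 / Suc n)"
      then have "dist u v < e"
        using n p(2) dist_triangle[of u v p] by (simp add: dist_commute)
      then show "v \<in> ball u e" by simp
    qed
    then have "ball p (1 / Suc n) \<subseteq> U" "u \<in> ball p (1 / Suc n)" "ball p (1 / Suc n) \<in> B"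
      using e(2) p by (auto simp: B_def)
    then show "\<exists>b\<in>B. u \<in> b \<and> b \<subseteq> U" by blast
  qed (auto simp: B_def)
  moreover have "countable B"
    unfolding B_def P_def by (intro countable_image countable_SIGMA) auto
  ultimately show "\<exists>B :: 'a Lodd set set. countable B \<and> open = generate_topology B"
    using topological_basis_imp_subbasis by blast
qed

definition cube :: "6 Lodd \<Rightarrow> 2 Lodd" where
  "cube u = Lclass (\<lambda>y. Lrep u y ^ 3)"

lemma cube_Lclass:
  assumes "f \<in> Lq_odd 6"
  shows "cube (Lclass f) = Lclass (\<lambda>y. f y ^ 3)"
proof -
  have "AE y in I1. Lrep (Lclass f :: 6 Lodd) y ^ 3 = f y ^ 3"
    using Lrep_Lclass[of f, where 'q = 6, simplified, OF assms] by eventually_elim simp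
  then show ?thesis
    unfolding cube_def using Lrep_in[of "Lclass f :: 6 Lodd"] assms
    by (subst Lclass_eq_iff) (auto intro!: Lq_odd_cube)
qed


text \<open>The Bochner space \<open>L\<^sup>p(A; E)\<close> for \<open>p \<in> [1,\<infinity>]\<close>, for functions of one real variable.\<close>

definition in_Bochner_Lp ::
    "ereal \<Rightarrow> real set \<Rightarrow> (real \<Rightarrow> 'b::{banach,second_countable_topology}) \<Rightarrow> bool" where
  "in_Bochner_Lp p A u \<longleftrightarrow> u \<in> borel_measurable (lebesgue_on A) \<and>
     (if p = \<infinity> then \<exists>B. AE s in lebesgue_on A. norm (u s) \<le> B
      else integrable (lebesgue_on A) (\<lambda>s. norm (u s) powr real_of_ereal p))"


section \<open>The wave propagators and the Duhamel equation\<close>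

definition energy_norm :: "(real \<Rightarrow> real) \<Rightarrow> (real \<Rightarrow> real) \<Rightarrow> real" where
  "energy_norm f g = sqrt ((LBINT y:{-1<..<1}. (1 - y\<^sup>2) * \<bar>deriv f y\<bar>\<^sup>2) + (LBINT y:{-1<..<1}. \<bar>g y\<bar>\<^sup>2))"

text \<open>The two integrals converge, i.e. the energy norm is finite.\<close>

definition finite_energy :: "(real \<Rightarrow> real) \<Rightarrow> (real \<Rightarrow> real) \<Rightarrow> bool" where
  "finite_energy f g \<longleftrightarrow> set_integrable lborel {-1<..<1} (\<lambda>y. (1 - y\<^sup>2) * \<bar>deriv f y\<bar>\<^sup>2) \<and>
     set_integrable lborel {-1<..<1} (\<lambda>y. \<bar>g y\<bar>\<^sup>2)"

text \<open>Functions of \<open>(s, y)\<close> are curried; the time derivative at \<open>s = 0\<close> is one-sided.\<close>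

definition time_deriv :: "(real \<Rightarrow> real \<Rightarrow> real) \<Rightarrow> real \<Rightarrow> real \<Rightarrow> real" where
  "time_deriv u s y = vector_derivative (\<lambda>s'. u s' y) (at s within {0..})"

definition space_deriv :: "(real \<Rightarrow> real \<Rightarrow> real) \<Rightarrow> real \<Rightarrow> real \<Rightarrow> real" where
  "space_deriv u s y = deriv (u s) y"

definition wave_op :: "(real \<Rightarrow> real \<Rightarrow> real) \<Rightarrow> real \<Rightarrow> real \<Rightarrow> real" where
  "wave_op u s y = time_deriv (time_deriv u) s y + 2 * y * time_deriv (space_deriv u) s y + time_deriv u s y
     - (1 - y\<^sup>2) * space_deriv (space_deriv u) s y + 2 * y * space_deriv u s y - u s y"

definition is_wave_solution ::
    "(real \<Rightarrow> real) \<Rightarrow> (real \<Rightarrow> real) \<Rightarrow> (real \<Rightarrow> real \<Rightarrow> real) \<Rightarrow> bool" where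
  "is_wave_solution f g u \<longleftrightarrow>
     smooth_on ({0..} \<times> {-1<..<1}) (\<lambda>(s, y). u s y) \<and>
     (\<forall>s>0. \<forall>y\<in>{-1<..<1}. wave_op u s y = 0) \<and>
     (\<forall>y\<in>{-1<..<1}. u 0 y = f y \<and> time_deriv u 0 y = g y) \<and>
     (\<forall>s\<ge>0. finite_energy (u s) (time_deriv u s))"

text \<open>
  The solution \<open>u\<^bsub>f,g\<^esub>\<close>.  It is unique on \<open>[0,\<infinity>) \<times> (-1,1)\<close>; the choice only concerns the
  irrelevant values elsewhere.
\<close>

definition wave_solution :: "(real \<Rightarrow> real) \<Rightarrow> (real \<Rightarrow> real) \<Rightarrow> real \<Rightarrow> real \<Rightarrow> real" where
  "wave_solution f g = (SOME u. is_wave_solution f g u)"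

definition C_prop :: "real \<Rightarrow> (real \<Rightarrow> real) \<Rightarrow> 6 Lodd" where
  "C_prop s f = Lclass (wave_solution f (\<lambda>_. 0) s)"

text \<open>The unique bounded extension of \<open>g \<mapsto> u\<^bsub>0,g\<^esub>(s, \<cdot>)\<close> from the smooth odd functions.\<close>

definition S_prop :: "real \<Rightarrow> 2 Lodd \<Rightarrow> 6 Lodd" where
  "S_prop s = (THE T. bounded_linear T \<and>
     (\<forall>g. smooth_odd g \<longrightarrow> T (Lclass g) = Lclass (wave_solution (\<lambda>_. 0) g s)))"

text \<open>
  \<open>u \<in> C([0,\<infinity>), L\<^sup>6)\<close> solves the integral equation, the integral being a Bochner integral in
  \<open>L\<^sup>6\<close>.  Only the values of \<open>u\<close> on \<open>[0,\<infinity>)\<close> matter.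
\<close>

definition is_Duhamel_solution ::
    "(real \<Rightarrow> real) \<Rightarrow> (real \<Rightarrow> real) \<Rightarrow> (real \<Rightarrow> 6 Lodd) \<Rightarrow> bool" where
  "is_Duhamel_solution f g u \<longleftrightarrow>
     continuous_on {0..} u \<and>
     (\<forall>s\<ge>0. set_integrable lborel {0..s} (\<lambda>s'. S_prop (s - s') (cube (u s'))) \<and>
        u s = C_prop s f + S_prop s (Lclass g)
          - (LBINT s':{0..s}. S_prop (s - s') (cube (u s'))))"

end

theory Submission
  imports Defs "HOL-Real_Asymp.Real_Asymp"
begin

text \<open>
  In the null coordinates \<open>a = e\<^sup>-\<^sup>s (1 - y)\<close>, \<open>b = e\<^sup>-\<^sup>s (1 + y)\<close> the linear equation becomes
  \<open>\<partial>\<^sub>a \<partial>\<^sub>b v = v / (a + b)\<^sup>2\<close>, which is equivalent to an integral equation over the backward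
  triangle.  This equation has exactly one continuous solution, it is smooth, and every wave
  solution satisfies it.  For odd data the antisymmetry \<open>v(b, a) = - v(a, b)\<close> leaves, for \<open>a \<le> b\<close>,
  a positive kernel on \<open>{a \<le> \<alpha> \<le> b \<le> \<beta>}\<close> which maps the function \<open>y = (\<beta> - \<alpha>) / (\<alpha> + \<beta>)\<close> to at most
  \<open>y / 2\<close>.  Iterating it bounds \<open>v\<close> by the energy, up to a logarithm at \<open>y = \<plusminus>1\<close>, both pointwise and,
  because the equation commutes with dilations of \<open>(a, b)\<close>, in \<open>L\<^sup>2\<close> along the dilation orbits, i.e. in
  time.  The logarithm is harmless in \<open>L\<^sup>6\<close>, so \<open>C\<close> and \<open>S\<close> map the energy space to
  \<open>L\<^sup>\<infinity>L\<^sup>6 \<inter> L\<^sup>3L\<^sup>6\<close>.  By Hoelder the cube maps \<open>L\<^sup>3L\<^sup>6\<close> to \<open>L\<^sup>1L\<^sup>2\<close>, by Minkowski the Duhamel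
  integral maps \<open>L\<^sup>1L\<^sup>2\<close> back, and Picard iteration converges for small data.  Two continuous
  solutions agree because their difference satisfies a Gronwall inequality on every bounded interval.
\<close>

section \<open>Integration along null lines\<close>

text \<open>Oddness is what excludes growth. On functions of \<open>y\<close> alone the operator is
  the Legendre operator minus one, with eigenvalues \<open>l * (l + 1) - 1\<close>; the even mode
  \<open>l = 0\<close> generates the growing solution \<open>exp (\<lambda> * s)\<close>, where
  \<open>\<lambda> > 0\<close> and \<open>\<lambda> * (\<lambda> + 1) = 1\<close>. Absolute values
  may therefore enter the integral equation only after the antisymmetry has removed the symmetric
  part of the triangle. The lowest odd mode is \<open>y\<close>, with Legendre eigenvalue 2, and
  this is the origin of the factor 1/2. Without this folding the contraction needs a weight that
  tolerates growth. That cruder version yields existence, uniqueness and smoothness, on which every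
  estimate depends, since \<open>wave_solution\<close> and \<open>S_prop\<close> are given by a
  choice and a description operator. The energy controls the square integral of
  \<open>c * h (1 - c)\<close> against \<open>dc / c\<close>, where \<open>h\<close> is the
  derivative of the profile carried by a null coordinate. For \<open>c = exp (- s)\<close> this
  measure is \<open>ds\<close>; so integrability in time comes out in L2, and the third power that
  the nonlinearity requires follows together with the sup bound.\<close>

definition tri :: "(real \<times> real) set" where
  "tri = {(a, b). 0 \<le> a \<and> 0 \<le> b \<and> 0 < a + b \<and> a + b \<le> 2}"

text \<open>\<open>tri\<close> is the image of \<open>0 \<le> s\<close>,
  \<open>-1 \<le> y \<le> 1\<close>: the line \<open>a + b = 2\<close> is \<open>s = 0\<close>, and
  the omitted origin is \<open>s = \<infinity>\<close>. \<open>- J1 w\<close> and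
  \<open>- J2 w\<close> are the antiderivatives of \<open>w\<close> in \<open>b\<close> and in
  \<open>a\<close> that vanish on the initial line.\<close>

definition J1 :: "(real \<times> real \<Rightarrow> real) \<Rightarrow> real \<times> real \<Rightarrow> real" where
  "J1 w p = integral {snd p..2 - fst p} (\<lambda>x. w (fst p, x))"

definition J2 :: "(real \<times> real \<Rightarrow> real) \<Rightarrow> real \<times> real \<Rightarrow> real" where
  "J2 w p = integral {fst p..2 - snd p} (\<lambda>x. w (x, snd p))"

lemma tri_iff: "(a, b) \<in> tri \<longleftrightarrow> 0 \<le> a \<and> 0 \<le> b \<and> 0 < a + b \<and> a + b \<le> 2"
  by (simp add: tri_def)

lemma tri_upward: "(a, b) \<in> tri \<Longrightarrow> a \<le> a' \<Longrightarrow> b \<le> b' \<Longrightarrow> a' + b' \<le> 2 \<Longrightarrow> (a', b') \<in> tri"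
  by (auto simp: tri_iff)

lemma swap_tri: "prod.swap ` tri = tri"
  by (auto simp: tri_def image_def)

lemma J2_swap: "J2 w (a, b) = J1 (\<lambda>p. w (prod.swap p)) (b, a)"
  by (simp add: J1_def J2_def)

lemma continuous_on_tri_swap:
  assumes "continuous_on tri w" shows "continuous_on tri (\<lambda>p. w (prod.swap p))"
  by (rule continuous_on_compose2[OF assms]) (auto intro!: continuous_intros simp: swap_tri continuous_on_swap)

lemma continuous_on_tri_vertical:
  assumes "continuous_on tri w" "(a, b) \<in> tri"
  shows "continuous_on {b..2 - a} (\<lambda>x. w (a, x))"
  by (rule continuous_on_compose2[OF assms(1)]) (use assms(2) in \<open>auto intro!: continuous_intros simp: tri_iff\<close>)

lemma continuous_on_tri_horizontal:
  assumes "continuous_on tri w" "(a, b) \<in> tri"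
  shows "continuous_on {a..2 - b} (\<lambda>x. w (x, b))"
  by (rule continuous_on_compose2[OF assms(1)]) (use assms(2) in \<open>auto intro!: continuous_intros simp: tri_iff\<close>)

text \<open>After rescaling, the interval of integration no longer depends on the point, and
  continuity of \<open>J1 w\<close> becomes continuity of a parameter integral over
  \<open>{0..1}\<close>.\<close>

lemma J1_rescaled:
  assumes "continuous_on tri w" "(a, b) \<in> tri"
  shows "J1 w (a, b) = (2 - a - b) * integral {0..1} (\<lambda>t. w (a, b + t * (2 - a - b)))"
proof (cases "a + b = 2")
  case True
  then have "2 - a = b" by simp
  then show ?thesis by (simp add: J1_def)
next
  case False
  let ?L = "2 - a - b"
  have L: "?L > 0" using False assms(2) by (simp add: tri_iff)
  have "((\<lambda>t. ?L *\<^sub>R w (a, b + t * ?L)) has_integral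
        integral {b + 0 * ?L..b + 1 * ?L} (\<lambda>x. w (a, x))) {0..1}"
  proof (rule has_integral_substitution[where c = b and d = "2 - a"])
    show "(\<lambda>x. b + x * ?L) ` {0..1} \<subseteq> {b..2 - a}"
    proof clarsimp
      fix t :: real assume "0 \<le> t" "t \<le> 1"
      then have "0 \<le> t * ?L" "t * ?L \<le> ?L"
        using L mult_left_le_one_le[of ?L t] by auto
      then show "0 \<le> t * ?L \<and> b + t * ?L \<le> 2 - a" by linarith
    qed
  qed (use L assms in \<open>auto intro!: derivative_eq_intros continuous_on_tri_vertical\<close>)
  then show ?thesis by (simp add: J1_def integral_unique integral_mult_right[symmetric] algebra_simps)
qed

lemma continuous_on_J1:
  assumes "continuous_on tri w"
  shows "continuous_on tri (J1 w)"
proof -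
  have "continuous_on (tri \<times> cbox 0 1) (\<lambda>(p, t). w (fst p, snd p + t * (2 - fst p - snd p)))"
    unfolding case_prod_unfold
  proof (rule continuous_on_compose2[OF assms])
    show "(\<lambda>x. (fst (fst x), snd (fst x) + snd x * (2 - fst (fst x) - snd (fst x)))) ` (tri \<times> cbox (0::real) 1) \<subseteq> tri"
    proof clarsimp
      fix a b t :: real assume *: "(a, b) \<in> tri" "0 \<le> t" "t \<le> 1"
      then have "0 \<le> t * (2 - a - b)" "t * (2 - a - b) \<le> 2 - a - b"
        by (auto simp: tri_iff mult_left_le_one_le)
      with * show "(a, b + t * (2 - a - b)) \<in> tri" by (auto simp: tri_iff)
    qed
  qed (auto intro!: continuous_intros)
  then have "continuous_on tri (\<lambda>p. integral (cbox 0 1) (\<lambda>t. w (fst p, snd p + t * (2 - fst p - snd p))))"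
    by (rule integral_continuous_on_param)
  then have "continuous_on tri (\<lambda>p. (2 - fst p - snd p) * integral {0..1} (\<lambda>t. w (fst p, snd p + t * (2 - fst p - snd p))))"
    by (auto intro!: continuous_intros)
  then show ?thesis
    by (rule continuous_on_eq) (auto simp: J1_rescaled[OF assms])
qed

lemma continuous_on_J2:
  assumes "continuous_on tri w"
  shows "continuous_on tri (J2 w)"
  using continuous_on_tri_swap[OF continuous_on_J1[OF continuous_on_tri_swap[OF assms]]]
  by (rule continuous_on_eq) (auto simp: J2_swap)

section \<open>Derivatives of integrals along null lines\<close>

lemma J1_deriv_snd:
  assumes "continuous_on tri w" "(a, b) \<in> tri"
  shows "((\<lambda>x. J1 w (a, x)) has_field_derivative - w (a, b)) (at b within {x. (a, x) \<in> tri})"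
proof -
  \<comment> \<open>For \<open>a = 0\<close> the slice of \<open>tri\<close> is half-open at 0, so
    its lower end is cut off at \<open>b / 2\<close>; the derivative at \<open>b\<close> does not
    see the cut.\<close>
  define b0 where "b0 = (if a > 0 then 0 else b / 2)"
  have b0: "(a, b0) \<in> tri" "b0 \<le> b" "b0 = 0 \<or> b0 < b" using assms(2) by (auto simp: b0_def tri_iff)
  have "((\<lambda>x. integral {x..2 - a} (\<lambda>x. w (a, x))) has_real_derivative - w (a, b)) (at b within {b0..2 - a})"
    using b0 assms(2)
    by (intro integral_has_real_derivative' continuous_on_tri_vertical assms(1)) (auto simp: tri_iff)
  then have "((\<lambda>x. J1 w (a, x)) has_field_derivative - w (a, b)) (at b within {b0..2 - a})"
    by (simp add: J1_def)
  moreover have "at b within {x. (a, x) \<in> tri} = at b within {b0..2 - a}"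
  proof (rule at_within_nhd[where S = "if b0 = 0 then UNIV else {b0<..}"])
    show "{x. (a, x) \<in> tri} \<inter> (if b0 = 0 then UNIV else {b0<..}) - {b} =
          {b0..2 - a} \<inter> (if b0 = 0 then UNIV else {b0<..}) - {b}"
      using b0 assms(2) by (auto simp: tri_iff)
  qed (use b0 in auto)
  ultimately show ?thesis by simp
qed

lemma J2_deriv_fst:
  assumes "continuous_on tri w" "(a, b) \<in> tri"
  shows "((\<lambda>x. J2 w (x, b)) has_field_derivative - w (a, b)) (at a within {x. (x, b) \<in> tri})"
proof -
  have "{x. (b, x) \<in> tri} = {x. (x, b) \<in> tri}" by (auto simp: tri_iff)
  then show ?thesis
    using J1_deriv_snd[OF continuous_on_tri_swap[OF assms(1)], of b a] assms(2)
    by (simp add: J2_swap tri_iff add.commute)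
qed

lemma compact_tri_upper:
  "compact {(a', b'). a \<le> a' \<and> b \<le> b' \<and> a' + b' \<le> (2::real)}"
proof -
  have "{(a', b'). a \<le> a' \<and> b \<le> b' \<and> a' + b' \<le> 2} = cbox (a, b) (2 - b, 2 - a) \<inter> {p. fst p + snd p \<le> 2}"
    by auto
  moreover have "closed {p::real\<times>real. fst p + snd p \<le> 2}"
    by (intro closed_Collect_le continuous_intros)
  ultimately show ?thesis using compact_Int_closed[OF compact_cbox] by metis
qed

text \<open>Both sides are the integral of \<open>w\<close> over the backward triangle of
  \<open>(a, b)\<close>, computed in the two orders.\<close>

lemma J1_J2_commute:
  assumes w: "continuous_on tri w" and p: "(a, b) \<in> tri"
  shows "J1 (J2 w) (a, b) = J2 (J1 w) (a, b)"
proof -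
  define S where "S = {(a', b'). a \<le> a' \<and> b \<le> b' \<and> a' + b' \<le> (2::real)}"
  have St: "S \<subseteq> tri" using p by (auto simp: S_def tri_iff)
  have "integrable lborel (\<lambda>x. indicator S x *\<^sub>R w x)"
    by (rule borel_integrable_compact)
      (use compact_tri_upper continuous_on_subset[OF w St] in \<open>auto simp: S_def\<close>)
  then have int: "integrable (lborel \<Otimes>\<^sub>M lborel) (case_prod (\<lambda>x y. indicator S (x, y) *\<^sub>R w (x, y)))"
    by (simp add: lborel_prod case_prod_unfold)
  have 1: "(LINT y|lborel. indicator S (x, y) *\<^sub>R w (x, y)) = indicator {a..2 - b} x *\<^sub>R J1 w (x, b)" for x
  proof (cases "a \<le> x \<and> x \<le> 2 - b")
    case True
    then have xt: "(x, b) \<in> tri" using tri_upward[OF p, of x b] by simp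
    have "(LINT y|lborel. indicator S (x, y) *\<^sub>R w (x, y)) = (LINT y:{b..2 - x}|lborel. w (x, y))"
      unfolding set_lebesgue_integral_def using True
      by (intro Bochner_Integration.integral_cong) (auto simp: S_def indicator_def)
    also have "\<dots> = integral {b..2 - x} (\<lambda>y. w (x, y))"
      by (intro set_borel_integral_eq_integral borel_integrable_atLeastAtMost'
          continuous_on_tri_vertical[OF w xt])
    finally show ?thesis using True by (simp add: J1_def)
  next
    case False
    then have "(x, y) \<notin> S" for y by (auto simp: S_def)
    then show ?thesis using False by (auto simp: indicator_def)
  qed
  have 2: "(LINT x|lborel. indicator S (x, y) *\<^sub>R w (x, y)) = indicator {b..2 - a} y *\<^sub>R J2 w (a, y)" for y
  proof (cases "b \<le> y \<and> y \<le> 2 - a")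
    case True
    then have yt: "(a, y) \<in> tri" using tri_upward[OF p, of a y] by simp
    have "(LINT x|lborel. indicator S (x, y) *\<^sub>R w (x, y)) = (LINT x:{a..2 - y}|lborel. w (x, y))"
      unfolding set_lebesgue_integral_def using True
      by (intro Bochner_Integration.integral_cong) (auto simp: S_def indicator_def)
    also have "\<dots> = integral {a..2 - y} (\<lambda>x. w (x, y))"
      by (intro set_borel_integral_eq_integral borel_integrable_atLeastAtMost'
          continuous_on_tri_horizontal[OF w yt])
    finally show ?thesis using True by (simp add: J2_def)
  next
    case False
    then have "(x, y) \<notin> S" for x by (auto simp: S_def)
    then show ?thesis using False by (auto simp: indicator_def)
  qed
  have "J1 (J2 w) (a, b) = (LINT y:{b..2 - a}|lborel. J2 w (a, y))"
    by (simp add: J1_def set_borel_integral_eq_integral(2)[OF borel_integrable_atLeastAtMost'[OF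
          continuous_on_tri_vertical[OF continuous_on_J2[OF w] p]]])
  also have "\<dots> = (LINT y|lborel. LINT x|lborel. indicator S (x, y) *\<^sub>R w (x, y))"
    unfolding set_lebesgue_integral_def 2 ..
  also have "\<dots> = (LINT x|lborel. LINT y|lborel. indicator S (x, y) *\<^sub>R w (x, y))"
    by (rule lborel_pair.Fubini_integral[OF int])
  also have "\<dots> = (LINT x:{a..2 - b}|lborel. J1 w (x, b))"
    unfolding set_lebesgue_integral_def 1 ..
  also have "\<dots> = J2 (J1 w) (a, b)"
    by (simp add: J2_def set_borel_integral_eq_integral(2)[OF borel_integrable_atLeastAtMost'[OF
          continuous_on_tri_horizontal[OF continuous_on_J1[OF w] p]]])
  finally show ?thesis .
qed

text \<open>The derivative is transversal to the direction of integration, and the upper limit moves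
  as well. Writing \<open>w\<close> as its value on the initial line minus \<open>J2 w1\<close> and
  exchanging \<open>J1\<close> with \<open>J2\<close> leaves only integrals that the fundamental
  theorem differentiates; \<open>- w (a, 2 - a)\<close> comes from the moving end point.\<close>

lemma J1_deriv_fst:
  assumes w: "continuous_on tri w" and w1: "continuous_on tri w1"
    and d: "\<And>a b. (a, b) \<in> tri \<Longrightarrow> ((\<lambda>x. w (x, b)) has_field_derivative w1 (a, b)) (at a within {x. (x, b) \<in> tri})"
    and p: "(a, b) \<in> tri"
  shows "((\<lambda>x. J1 w (x, b)) has_field_derivative - w (a, 2 - a) + J1 w1 (a, b)) (at a within {x. (x, b) \<in> tri})"
proof -
  have diag: "continuous_on {b..2} (\<lambda>x. w (2 - x, x))"
    by (rule continuous_on_compose2[OF w]) (use p in \<open>auto intro!: continuous_intros simp: tri_iff\<close>)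
  have rep: "w (x, y) = w (2 - y, y) - J2 w1 (x, y)" if "(x, y) \<in> tri" for x y
  proof -
    have "((\<lambda>x. w1 (x, y)) has_integral w (2 - y, y) - w (x, y)) {x..2 - y}"
    proof (rule fundamental_theorem_of_calculus)
      fix z assume z: "z \<in> {x..2 - y}"
      then have "((\<lambda>x. w (x, y)) has_field_derivative w1 (z, y)) (at z within {x. (x, y) \<in> tri})"
        using that by (intro d) (auto simp: tri_iff)
      then show "((\<lambda>x. w (x, y)) has_vector_derivative w1 (z, y)) (at z within {x..2 - y})"
        unfolding has_real_derivative_iff_has_vector_derivative
        by (rule has_vector_derivative_within_subset) (use that in \<open>auto simp: tri_iff\<close>)
    qed (use that in \<open>auto simp: tri_iff\<close>)
    then show ?thesis by (simp add: J2_def integral_unique)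
  qed
  have eq: "J1 w (x, b) = integral {b..2 - x} (\<lambda>y. w (2 - y, y)) - J2 (J1 w1) (x, b)" if "(x, b) \<in> tri" for x
  proof -
    have "J1 w (x, b) = integral {b..2 - x} (\<lambda>y. w (2 - y, y) - J2 w1 (x, y))"
      unfolding J1_def fst_conv snd_conv
      using that by (intro Henstock_Kurzweil_Integration.integral_cong rep) (auto simp: tri_iff)
    also have "\<dots> = integral {b..2 - x} (\<lambda>y. w (2 - y, y)) - J1 (J2 w1) (x, b)"
      unfolding J1_def fst_conv snd_conv
      using that by (intro Henstock_Kurzweil_Integration.integral_diff integrable_continuous_real
          continuous_on_tri_vertical continuous_on_J2 w1 continuous_on_subset[OF diag]) (auto simp: tri_iff)
    finally show ?thesis by (simp add: J1_J2_commute[OF w1 that])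
  qed
  have "((\<lambda>x. integral {b..x} (\<lambda>y. w (2 - y, y))) has_real_derivative w (a, 2 - a)) (at (2 - a) within {b..2})"
    using p integral_has_real_derivative[OF diag, of "2 - a"] by (simp add: tri_iff)
  then have "((\<lambda>x. integral {b..x} (\<lambda>y. w (2 - y, y))) has_real_derivative w (a, 2 - a))
      (at (2 - a) within (\<lambda>x. 2 - x) ` {x. (x, b) \<in> tri})"
    by (rule has_field_derivative_subset) (auto simp: tri_iff)
  moreover have "((\<lambda>x. 2 - x) has_real_derivative - 1) (at a within {x. (x, b) \<in> tri})"
    by (auto intro!: derivative_eq_intros)
  ultimately
  have "((\<lambda>x. integral {b..x} (\<lambda>y. w (2 - y, y))) \<circ> (\<lambda>x. 2 - x) has_real_derivative w (a, 2 - a) * (- 1)) (at a within {x. (x, b) \<in> tri})"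
    by (rule DERIV_image_chain)
  then have "((\<lambda>x. integral {b..2 - x} (\<lambda>y. w (2 - y, y)) - J2 (J1 w1) (x, b)) has_real_derivative
      w (a, 2 - a) * (- 1) - (- J1 w1 (a, b))) (at a within {x. (x, b) \<in> tri})"
    unfolding o_def by (intro DERIV_diff J2_deriv_fst continuous_on_J1 w1 p)
  then have "((\<lambda>x. integral {b..2 - x} (\<lambda>y. w (2 - y, y)) - J2 (J1 w1) (x, b)) has_real_derivative
      - w (a, 2 - a) + J1 w1 (a, b)) (at a within {x. (x, b) \<in> tri})"
    by simp
  then show ?thesis
    unfolding has_field_derivative_def
    by (rule has_derivative_transform[rotated 2]) (use p eq in \<open>auto simp: fun_eq_iff algebra_simps\<close>)
qed

lemma J2_deriv_snd:
  assumes w: "continuous_on tri w" and w2: "continuous_on tri w2"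
    and d: "\<And>a b. (a, b) \<in> tri \<Longrightarrow> ((\<lambda>x. w (a, x)) has_field_derivative w2 (a, b)) (at b within {x. (a, x) \<in> tri})"
    and p: "(a, b) \<in> tri"
  shows "((\<lambda>x. J2 w (a, x)) has_field_derivative - w (2 - b, b) + J2 w2 (a, b)) (at b within {x. (a, x) \<in> tri})"
proof -
  have eq: "{x. (b, x) \<in> tri} = {x. (x, b) \<in> tri}" for b by (auto simp: tri_iff)
  show ?thesis
    using J1_deriv_fst[OF continuous_on_tri_swap[OF w] continuous_on_tri_swap[OF w2], of b a] d p
    by (simp add: J2_swap eq) (simp add: tri_iff add.commute)
qed

text \<open>The usual proof that continuous partial derivatives give total differentiability,
  arranged so that the path stays in the triangle up to its boundary: an increment is split at one
  of the two corners \<open>(x, b)\<close> and \<open>(a, y)\<close>.\<close>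

lemma tri_has_derivative:
  fixes F :: "real \<times> real \<Rightarrow> real"
  assumes p: "p \<in> tri"
    and F1: "\<And>a b. (a, b) \<in> tri \<Longrightarrow> ((\<lambda>x. F (x, b)) has_field_derivative F1 (a, b)) (at a within {x. (x, b) \<in> tri})"
    and F2: "\<And>a b. (a, b) \<in> tri \<Longrightarrow> ((\<lambda>x. F (a, x)) has_field_derivative F2 (a, b)) (at b within {x. (a, x) \<in> tri})"
    and c1: "continuous_on tri F1" and c2: "continuous_on tri F2"
  shows "(F has_derivative (\<lambda>v. fst v * F1 p + snd v * F2 p)) (at p within tri)"
proof -
  obtain a b where ab: "p = (a, b)" by (cases p)
  have mvt: "\<exists>\<xi>\<in>closed_segment x x'. f x' - f x = (x' - x) * f' \<xi>"
    if S: "closed_segment x x' \<subseteq> S" and d: "\<And>z. z \<in> S \<Longrightarrow> (f has_field_derivative f' z) (at z within S)"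
    for x x' :: real and S f f'
  proof -
    have *: "\<exists>\<xi>\<in>{y..y'}. f y' - f y = f' \<xi> * (y' - y)" if "y \<le> y'" "{y..y'} \<subseteq> S" for y y'
    proof (rule mvt_very_simple[OF that(1)])
      fix z assume "y \<le> z" "z \<le> y'"
      then have "(f has_field_derivative f' z) (at z within {y..y'})"
        using that(2) by (intro has_field_derivative_subset[OF d]) auto
      then show "(f has_derivative (*) (f' z)) (at z within {y..y'})"
        by (simp add: has_field_derivative_def)
    qed
    show ?thesis
    proof (cases "x \<le> x'")
      case True
      then show ?thesis using *[of x x'] S by (auto simp: closed_segment_eq_real_ivl mult.commute)
    next
      case False
      then obtain \<xi> where "\<xi> \<in> {x'..x}" "f x - f x' = f' \<xi> * (x - x')"
        using *[of x' x] S by (auto simp: closed_segment_eq_real_ivl)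
      then show ?thesis using False
        by (intro bexI[of _ \<xi>]) (auto simp: closed_segment_eq_real_ivl algebra_simps)
    qed
  qed
  have mv1: "\<exists>\<xi>\<in>closed_segment x x'. F (x', y) - F (x, y) = (x' - x) * F1 (\<xi>, y)"
    if "(x, y) \<in> tri" "(x', y) \<in> tri" for x x' y
    using that F1 by (intro mvt[where S = "{x. (x, y) \<in> tri}"]) (auto simp: closed_segment_eq_real_ivl tri_iff split: if_splits)
  have mv2: "\<exists>\<xi>\<in>closed_segment y y'. F (x, y') - F (x, y) = (y' - y) * F2 (x, \<xi>)"
    if "(x, y) \<in> tri" "(x, y') \<in> tri" for x y y'
    using that F2 by (intro mvt[where S = "{y. (x, y) \<in> tri}"]) (auto simp: closed_segment_eq_real_ivl tri_iff split: if_splits)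
  show ?thesis
    unfolding has_derivative_within_alt
  proof (intro conjI allI impI)
    show "bounded_linear (\<lambda>v. fst v * F1 p + snd v * F2 p)"
      by (auto intro!: bounded_linear_intros)
    fix e :: real assume e: "e > 0"
    obtain d1 where d1: "d1 > 0" "\<And>q. q \<in> tri \<Longrightarrow> dist q p < d1 \<Longrightarrow> dist (F1 q) (F1 p) < e / 2"
      using c1 p e unfolding continuous_on_iff by (meson half_gt_zero)
    obtain d2 where d2: "d2 > 0" "\<And>q. q \<in> tri \<Longrightarrow> dist q p < d2 \<Longrightarrow> dist (F2 q) (F2 p) < e / 2"
      using c2 p e unfolding continuous_on_iff by (meson half_gt_zero)
    \<comment> \<open>The bound \<open>(a + b) / 2\<close> keeps both corners away from the omitted
      origin.\<close>
    define d where "d = min (min d1 d2) ((a + b) / 2)"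
    have ab0: "0 \<le> a" "0 \<le> b" "a + b > 0" using p by (auto simp: ab tri_iff)
    have "norm (F q - F p - (fst (q - p) * F1 p + snd (q - p) * F2 p)) \<le> e * norm (q - p)"
      if q: "q \<in> tri" "norm (q - p) < d" for q
    proof -
      obtain x y where xy: "q = (x, y)" by (cases q)
      have n: "\<bar>x - a\<bar> \<le> norm (q - p)" "\<bar>y - b\<bar> \<le> norm (q - p)"
        by (simp_all add: xy ab norm_Pair real_sqrt_sum_squares_ge1 real_sqrt_sum_squares_ge2
          flip: real_sqrt_abs del: real_sqrt_abs)
      have near: "dist (x', y') p < d" if "\<bar>x' - a\<bar> \<le> \<bar>x - a\<bar>" "\<bar>y' - b\<bar> \<le> \<bar>y - b\<bar>" for x' y'
      proof -
        have "dist (x', y') p \<le> dist q p"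
          unfolding xy ab dist_Pair_Pair using that
          by (intro real_sqrt_le_mono add_mono power_mono) (auto simp: dist_real_def)
        with q show ?thesis by (simp add: dist_norm)
      qed
      have fin: ?thesis if "\<bar>A - F1 p\<bar> \<le> e / 2" "\<bar>B - F2 p\<bar> \<le> e / 2" "F q - F p = (x - a) * A + (y - b) * B" for A B
      proof -
        have "F q - F p - (fst (q - p) * F1 p + snd (q - p) * F2 p) = (x - a) * (A - F1 p) + (y - b) * (B - F2 p)"
          using that(3) by (simp add: xy ab algebra_simps)
        moreover have "\<bar>(x - a) * (A - F1 p)\<bar> \<le> norm (q - p) * (e / 2)" "\<bar>(y - b) * (B - F2 p)\<bar> \<le> norm (q - p) * (e / 2)"
          unfolding abs_mult using n that(1,2) by (intro mult_mono; simp)+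
        moreover have "norm (q - p) * (e / 2) + norm (q - p) * (e / 2) = e * norm (q - p)" by simp
        ultimately show ?thesis unfolding real_norm_def by linarith
      qed
      have qt: "0 \<le> x" "0 \<le> y" "x + y \<le> 2" using q by (auto simp: xy tri_iff)
      have pt: "a + b \<le> 2" using p by (auto simp: ab tri_iff)
      have dd: "\<bar>x - a\<bar> < (a + b) / 2" "\<bar>y - b\<bar> < (a + b) / 2" using n q(2) by (auto simp: d_def)
      then have dd': "0 < x + b" "0 < a + y" 
        using ab0 abs_ge_minus_self[of "x - a"] abs_ge_minus_self[of "y - b"] by argo+
      show ?thesis
      \<comment> \<open>The coordinates of the two corners together add up to at most 4, so at least
        one corner satisfies the constraint that its sum is at most 2.\<close>
      proof (cases "x + b \<le> 2")
        case True
        then have c: "(x, b) \<in> tri" using qt ab0 dd' unfolding tri_iff by auto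
        obtain \<xi> where \<xi>: "\<xi> \<in> closed_segment a x" "F (x, b) - F (a, b) = (x - a) * F1 (\<xi>, b)"
          using mv1[of a b x] c p by (auto simp: ab)
        obtain \<eta> where \<eta>: "\<eta> \<in> closed_segment b y" "F (x, y) - F (x, b) = (y - b) * F2 (x, \<eta>)"
          using mv2[of x b y] c q by (auto simp: xy)
        have "(\<xi>, b) \<in> tri" "(x, \<eta>) \<in> tri" using \<xi>(1) \<eta>(1) c p q
          by (auto simp: ab xy closed_segment_eq_real_ivl tri_iff split: if_splits)
        moreover have "dist (\<xi>, b) p < d" "dist (x, \<eta>) p < d"
          using \<xi>(1) \<eta>(1) by (auto intro!: near simp: closed_segment_eq_real_ivl split: if_splits)
        ultimately have "\<bar>F1 (\<xi>, b) - F1 p\<bar> \<le> e / 2" "\<bar>F2 (x, \<eta>) - F2 p\<bar> \<le> e / 2"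
          using d1(2)[of "(\<xi>, b)"] d2(2)[of "(x, \<eta>)"] by (auto simp: d_def dist_real_def)
        then show ?thesis by (rule fin) (use \<xi>(2) \<eta>(2) in \<open>simp add: xy ab\<close>)
      next
        case False
        then have c: "(a, y) \<in> tri" using qt pt ab0 dd' unfolding tri_iff by auto
        obtain \<xi> where \<xi>: "\<xi> \<in> closed_segment a x" "F (x, y) - F (a, y) = (x - a) * F1 (\<xi>, y)"
          using mv1[of a y x] c q by (auto simp: xy)
        obtain \<eta> where \<eta>: "\<eta> \<in> closed_segment b y" "F (a, y) - F (a, b) = (y - b) * F2 (a, \<eta>)"
          using mv2[of a b y] c p by (auto simp: ab)
        have "(\<xi>, y) \<in> tri" "(a, \<eta>) \<in> tri" using \<xi>(1) \<eta>(1) c p q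
          by (auto simp: ab xy closed_segment_eq_real_ivl tri_iff split: if_splits)
        moreover have "dist (\<xi>, y) p < d" "dist (a, \<eta>) p < d"
          using \<xi>(1) \<eta>(1) by (auto intro!: near simp: closed_segment_eq_real_ivl split: if_splits)
        ultimately have "\<bar>F1 (\<xi>, y) - F1 p\<bar> \<le> e / 2" "\<bar>F2 (a, \<eta>) - F2 p\<bar> \<le> e / 2"
          using d1(2)[of "(\<xi>, y)"] d2(2)[of "(a, \<eta>)"] by (auto simp: d_def dist_real_def)
        then show ?thesis by (rule fin) (use \<xi>(2) \<eta>(2) in \<open>simp add: xy ab\<close>)
      qed
    qed
    moreover have "d > 0" using d1(1) d2(1) ab0 by (simp add: d_def)
    ultimately show "\<exists>d>0. \<forall>q\<in>tri. norm (q - p) < d \<longrightarrow>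
        norm (F q - F p - (fst (q - p) * F1 p + snd (q - p) * F2 p)) \<le> e * norm (q - p)" by blast
  qed
qed

lemma continuous_on_J12:
  assumes "continuous_on tri w"
  shows "continuous_on tri (J2 (J1 w))"
  by (intro continuous_on_J1 continuous_on_J2 assms)

section \<open>The integral equation in null coordinates\<close>

text \<open>\<open>Kop\<close> solves \<open>\<partial>\<^sub>a \<partial>\<^sub>b w = v / (a + b)\<^sup>2\<close> with zero Cauchy data on the line \<open>a + b = 2\<close>, that is,
  at \<open>s = 0\<close>.\<close>

definition pot :: "(real \<times> real \<Rightarrow> real) \<Rightarrow> real \<times> real \<Rightarrow> real" where
  "pot v p = v p / (fst p + snd p)\<^sup>2"

definition Kop :: "(real \<times> real \<Rightarrow> real) \<Rightarrow> real \<times> real \<Rightarrow> real" where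
  "Kop v = J2 (J1 (pot v))"

lemma tri_sum_pos: "p \<in> tri \<Longrightarrow> 0 < fst p + snd p"
  by (auto simp: tri_def)

lemma continuous_on_pot: "continuous_on tri v \<Longrightarrow> continuous_on tri (pot v)"
  unfolding pot_def[abs_def] by (intro continuous_intros) (auto dest: tri_sum_pos)

lemma continuous_on_Kop: "continuous_on tri v \<Longrightarrow> continuous_on tri (Kop v)"
  unfolding Kop_def by (intro continuous_on_J12 continuous_on_pot)

lemma J2_cong: "(\<And>q. q \<in> tri \<Longrightarrow> f q = g q) \<Longrightarrow> p \<in> tri \<Longrightarrow> J2 f p = J2 g p"
  unfolding J2_def by (intro Henstock_Kurzweil_Integration.integral_cong) (cases p, auto simp: tri_iff)

lemma J1_diff:
  assumes "continuous_on tri f" "continuous_on tri g" "p \<in> tri"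
  shows "J1 (\<lambda>q. f q - g q) p = J1 f p - J1 g p"
proof (cases p)
  case (Pair a b)
  then show ?thesis unfolding J1_def using assms
    by (auto intro!: Henstock_Kurzweil_Integration.integral_diff integrable_continuous_real continuous_on_tri_vertical)
qed

lemma J2_diff:
  assumes "continuous_on tri f" "continuous_on tri g" "p \<in> tri"
  shows "J2 (\<lambda>q. f q - g q) p = J2 f p - J2 g p"
proof (cases p)
  case (Pair a b)
  then show ?thesis unfolding J2_def using assms
    by (auto intro!: Henstock_Kurzweil_Integration.integral_diff integrable_continuous_real continuous_on_tri_horizontal)
qed

lemma Kop_diff:
  assumes f: "continuous_on tri f" and g: "continuous_on tri g" and p: "p \<in> tri"
  shows "Kop (\<lambda>q. f q - g q) p = Kop f p - Kop g p"
proof -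
  have "Kop (\<lambda>q. f q - g q) p = J2 (J1 (\<lambda>q. pot f q - pot g q)) p"
    by (simp add: Kop_def pot_def[abs_def] diff_divide_distrib)
  also have "\<dots> = J2 (\<lambda>q. J1 (pot f) q - J1 (pot g) q) p"
    by (intro J2_cong J1_diff continuous_on_pot f g p)
  also have "\<dots> = Kop f p - Kop g p"
    unfolding Kop_def by (intro J2_diff continuous_on_J1 continuous_on_pot f g p)
  finally show ?thesis .
qed

lemma integral_inverse_power_le:
  fixes a b B :: real
  assumes "0 < a + b" "b \<le> B" "k > 0"
  shows "integral {b..B} (\<lambda>x. 1 / (a + x) ^ Suc k) \<le> 1 / (real k * (a + b) ^ k)"
    and "(\<lambda>x. 1 / (a + x) ^ Suc k) integrable_on {b..B}"
proof -
  have "((\<lambda>x. 1 / (a + x) ^ Suc k) has_integral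
      (- 1 / (real k * (a + B) ^ k)) - (- 1 / (real k * (a + b) ^ k))) {b..B}"
  proof (rule fundamental_theorem_of_calculus[OF assms(2)])
    fix x assume "x \<in> {b..B}"
    then have x: "a + x > 0" using assms(1) by auto
    obtain j where j: "k = Suc j" using assms(3) by (cases k) auto
    have "(a + x) ^ k * (a + x) ^ k = (a + x) ^ j * (a + x) ^ Suc k"
      by (simp add: j)
    then have eq: "real k * (a + x) ^ j / (real k * ((a + x) ^ k * (a + x) ^ k)) = 1 / (a + x) ^ Suc k"
      using x assms(3) by simp
    have "((\<lambda>x. (a + x) ^ k) has_real_derivative real k * (a + x) ^ j) (at x within {b..B})"
      by (rule DERIV_cong[OF DERIV_power[where D = 1]]) (auto simp: j intro!: derivative_eq_intros)
    from DERIV_cmult[OF DERIV_inverse'[OF this], of "- 1 / real k"]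
    have "((\<lambda>x. - 1 / (real k * (a + x) ^ k)) has_real_derivative
        real k * (a + x) ^ j / (real k * ((a + x) ^ k * (a + x) ^ k))) (at x within {b..B})"
      using x by (simp add: divide_inverse ac_simps)
    then have "((\<lambda>x. - 1 / (real k * (a + x) ^ k)) has_real_derivative 1 / (a + x) ^ Suc k) (at x within {b..B})"
      unfolding eq .
    then show "((\<lambda>x. - 1 / (real k * (a + x) ^ k)) has_vector_derivative 1 / (a + x) ^ Suc k) (at x within {b..B})"
      by (simp add: has_real_derivative_iff_has_vector_derivative)
  qed
  then show "integral {b..B} (\<lambda>x. 1 / (a + x) ^ Suc k) \<le> 1 / (real k * (a + b) ^ k)"
    "(\<lambda>x. 1 / (a + x) ^ Suc k) integrable_on {b..B}"
    using assms by (auto simp: integral_unique has_integral_integrable)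
qed

text \<open>On functions weighted with \<open>(a + b)\<^sup>2\<close> the operator \<open>Kop\<close> is a contraction: this weight turns
  the scale-invariant potential into the factor \<open>1 / (2 \<cdot> 3)\<close>.\<close>

lemma Kop_bound:
  assumes v: "continuous_on tri v" and p: "(a, b) \<in> tri"
    and m: "\<And>x y. a \<le> x \<Longrightarrow> b \<le> y \<Longrightarrow> x + y \<le> 2 \<Longrightarrow> \<bar>v (x, y)\<bar> \<le> m / (x + y)\<^sup>2"
  shows "\<bar>Kop v (a, b)\<bar> \<le> (m / 6) / (a + b)\<^sup>2"
proof -
  have "0 \<le> m / (a + b)\<^sup>2" using m[of a b] p by (auto simp: tri_iff)
  then have m0: "m \<ge> 0" using p by (auto simp: tri_iff zero_le_divide_iff)
  have 1: "\<bar>J1 (pot v) (x, b)\<bar> \<le> m / 3 * (1 / (b + x) ^ Suc 2)" if x: "a \<le> x" "x \<le> 2 - b" for x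
  proof -
    have xt: "(x, b) \<in> tri" and xb: "0 < x + b" using p x tri_upward[OF p, of x b] by (auto simp: tri_iff)
    have "norm (J1 (pot v) (x, b)) \<le> integral {b..2 - x} (\<lambda>y. m * (1 / (x + y) ^ Suc 3))"
      unfolding J1_def fst_conv snd_conv
    proof (rule integral_norm_bound_integral)
      show "(\<lambda>y. pot v (x, y)) integrable_on {b..2 - x}"
        by (intro integrable_continuous_real continuous_on_tri_vertical continuous_on_pot v xt)
      show "(\<lambda>y. m * (1 / (x + y) ^ Suc 3)) integrable_on {b..2 - x}"
        using x xb by (intro integrable_on_mult_right integral_inverse_power_le(2)) auto
      fix y assume y: "y \<in> {b..2 - x}"
      have "\<bar>v (x, y)\<bar> / (x + y)\<^sup>2 \<le> (m / (x + y)\<^sup>2) / (x + y)\<^sup>2"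
        using m[of x y] x y by (intro divide_right_mono) auto
      moreover have "(m / (x + y)\<^sup>2) / (x + y)\<^sup>2 = m * (1 / (x + y) ^ Suc 3)"
        by (simp add: eval_nat_numeral)
      ultimately show "norm (pot v (x, y)) \<le> m * (1 / (x + y) ^ Suc 3)"
        by (simp add: pot_def)
    qed
    also have "\<dots> = m * integral {b..2 - x} (\<lambda>y. 1 / (x + y) ^ Suc 3)"
      by (rule integral_mult_right)
    also have "\<dots> \<le> m * (1 / (real 3 * (x + b) ^ 3))"
      using x xb m0 by (intro mult_left_mono integral_inverse_power_le(1)) auto
    finally show ?thesis by (simp add: add.commute)
  qed
  have "norm (Kop v (a, b)) \<le> integral {a..2 - b} (\<lambda>x. m / 3 * (1 / (b + x) ^ Suc 2))"
    unfolding Kop_def J2_def fst_conv snd_conv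
  proof (rule integral_norm_bound_integral)
    show "(\<lambda>x. J1 (pot v) (x, b)) integrable_on {a..2 - b}"
      by (intro integrable_continuous_real continuous_on_tri_horizontal continuous_on_J1 continuous_on_pot v p)
    show "(\<lambda>x. m / 3 * (1 / (b + x) ^ Suc 2)) integrable_on {a..2 - b}"
      using p by (intro integrable_on_mult_right integral_inverse_power_le(2)) (auto simp: tri_iff)
  qed (use 1 in auto)
  also have "\<dots> = m / 3 * integral {a..2 - b} (\<lambda>x. 1 / (b + x) ^ Suc 2)"
    by (rule integral_mult_right)
  also have "\<dots> \<le> m / 3 * (1 / (real 2 * (b + a) ^ 2))"
    using p m0 by (intro mult_left_mono integral_inverse_power_le(1)) (auto simp: tri_iff)
  finally show ?thesis by (simp add: add.commute)
qed

text \<open>A fixed point is bounded by a multiple of the weight on the compact backward triangle,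
  and each application of \<open>Kop\<close> gains a factor 1/6. Only the backward triangle enters,
  so the lemma applies to functions whose equation is known for positive \<open>a\<close> and
  \<open>b\<close>.\<close>

lemma Kop_fixed_point_zero:
  assumes w: "continuous_on tri w" and p: "(a, b) \<in> tri"
    and eq: "\<And>x y. a \<le> x \<Longrightarrow> b \<le> y \<Longrightarrow> x + y \<le> 2 \<Longrightarrow> w (x, y) = Kop w (x, y)"
  shows "w (a, b) = 0"
proof -
  let ?U = "{(x, y). a \<le> x \<and> b \<le> y \<and> x + y \<le> (2::real)}"
  have U: "?U \<subseteq> tri" using p by (auto simp: tri_iff)
  have "compact ((\<lambda>p. w p * (fst p + snd p)\<^sup>2) ` ?U)"
    by (intro compact_continuous_image compact_tri_upper continuous_intros continuous_on_subset[OF w U])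
  from compact_imp_bounded[OF this]
  obtain m where "\<forall>z\<in>(\<lambda>p. w p * (fst p + snd p)\<^sup>2) ` ?U. norm z \<le> m"
    unfolding bounded_iff by (rule exE)
  then have m: "\<bar>w (x, y) * (x + y)\<^sup>2\<bar> \<le> m" if "(x, y) \<in> ?U" for x y
    using imageI[OF that, of "\<lambda>p. w p * (fst p + snd p)\<^sup>2"] by (simp only: fst_conv snd_conv real_norm_def)
  have "\<forall>x y. (x, y) \<in> ?U \<longrightarrow> \<bar>w (x, y)\<bar> \<le> (m / 6 ^ n) / (x + y)\<^sup>2" for n
  proof (induction n)
    case 0
    show ?case
    proof (intro allI impI)
      fix x y assume *: "(x, y) \<in> ?U"
      then have "x + y > 0" using U by (auto simp: tri_iff)
      then show "\<bar>w (x, y)\<bar> \<le> m / 6 ^ 0 / (x + y)\<^sup>2"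
        using m[OF *] by (simp add: field_simps abs_mult)
    qed
  next
    case (Suc n)
    show ?case
    proof (intro allI impI)
      fix x y assume *: "(x, y) \<in> ?U"
      then have "\<bar>Kop w (x, y)\<bar> \<le> (m / 6 ^ n / 6) / (x + y)\<^sup>2"
        using Suc U by (intro Kop_bound[OF w]) auto
      then show "\<bar>w (x, y)\<bar> \<le> (m / 6 ^ Suc n) / (x + y)\<^sup>2"
        using eq[of x y] * by (simp add: mult.commute)
    qed
  qed
  then have le: "\<bar>w (a, b)\<bar> \<le> (m / (a + b)\<^sup>2) * (1 / 6) ^ n" for n
    using p by (auto simp: tri_iff power_one_over field_simps)
  have "(\<lambda>n. (m / (a + b)\<^sup>2) * (1 / 6) ^ n) \<longlonglongrightarrow> (m / (a + b)\<^sup>2) * 0"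
    by (intro tendsto_intros LIMSEQ_realpow_zero) auto
  then have "\<bar>w (a, b)\<bar> \<le> (m / (a + b)\<^sup>2) * 0"
    by (rule LIMSEQ_le_const) (use le in auto)
  then show ?thesis by simp
qed

text \<open>Reflection at the diagonal exchanges \<open>J1\<close> and \<open>J2\<close>, and these
  commute.\<close>

lemma Kop_swap:
  assumes v: "continuous_on tri v" and p: "(a, b) \<in> tri"
  shows "Kop (\<lambda>q. v (prod.swap q)) (a, b) = Kop v (b, a)"
proof -
  have p': "(b, a) \<in> tri" using p by (auto simp: tri_iff)
  have "pot (\<lambda>q. v (prod.swap q)) = (\<lambda>q. pot v (prod.swap q))"
    by (auto simp: pot_def add.commute)
  then have "Kop (\<lambda>q. v (prod.swap q)) (a, b) = J1 (J2 (pot v)) (b, a)"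
    by (simp add: Kop_def J1_def J2_def)
  then show ?thesis by (simp add: J1_J2_commute continuous_on_pot v p' Kop_def)
qed

text \<open>Neumann series, summed with a weight. Relative to \<open>1 / (a + b)\<^sup>2\<close> the
  terms decay like \<open>1 / 6 ^ n\<close>, so the series multiplied by
  \<open>(a + b)\<^sup>2\<close> converges uniformly on all of \<open>tri\<close>, although the
  solution may grow towards the origin. The 4 bounds \<open>(a + b)\<^sup>2\<close>.\<close>

lemma Kop_fixed_point_exists:
  assumes v0: "continuous_on tri v0" and B: "\<And>p. p \<in> tri \<Longrightarrow> \<bar>v0 p\<bar> \<le> B"
  shows "\<exists>v. continuous_on tri v \<and> (\<forall>p\<in>tri. v p = v0 p + Kop v p)"
proof -
  define V where "V = rec_nat v0 (\<lambda>_ u p. v0 p + Kop u p)"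
  have V0: "V 0 = v0" and VS: "V (Suc n) = (\<lambda>p. v0 p + Kop (V n) p)" for n
    by (simp_all add: V_def)
  have cV: "continuous_on tri (V n)" for n
    by (induction n) (auto simp: V0 VS v0 intro!: continuous_intros continuous_on_Kop)
  define d where "d n p = V (Suc n) p - V n p" for n p
  have cd: "continuous_on tri (d n)" for n
    unfolding d_def[abs_def] by (intro continuous_intros cV)
  have B0: "B \<ge> 0" using B[of "(1, 1)"] by (auto simp: tri_iff)
  have s2: "0 < (fst p + snd p)\<^sup>2" "(fst p + snd p)\<^sup>2 \<le> 4" if "p \<in> tri" for p
    using that power_mono[of "fst p + snd p" 2 2] by (auto simp: tri_def case_prod_unfold)
  have bd: "p \<in> tri \<Longrightarrow> \<bar>d n p\<bar> \<le> (4 * B / 6 ^ n) / (fst p + snd p)\<^sup>2" for n p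
  proof (induction n arbitrary: p)
    case 0
    obtain a b where ab: "p = (a, b)" by (cases p)
    have "\<bar>Kop v0 (a, b)\<bar> \<le> (4 * B / 6) / (a + b)\<^sup>2"
    proof (rule Kop_bound[OF v0])
      fix x y assume "a \<le> x" "b \<le> y" "x + y \<le> 2"
      then have "(x, y) \<in> tri" using tri_upward 0 ab by blast
      then show "\<bar>v0 (x, y)\<bar> \<le> 4 * B / (x + y)\<^sup>2"
        using B[of "(x, y)"] s2[of "(x, y)"] mult_mono[of "\<bar>v0 (x, y)\<bar>" B "(x + y)\<^sup>2" 4] B0 by (simp add: field_simps)
    qed (use 0 ab in auto)
    also have "\<dots> \<le> (4 * B) / (a + b)\<^sup>2" using B0 by (intro divide_right_mono) auto
    finally show ?case by (simp add: d_def VS V0 ab)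
  next
    case (Suc n)
    obtain a b where ab: "p = (a, b)" by (cases p)
    have "d (Suc n) p = Kop (d n) p"
      using Kop_diff[OF cV cV Suc.prems, of "Suc n" n] by (simp add: d_def[abs_def] VS)
    moreover have "\<bar>Kop (d n) (a, b)\<bar> \<le> (4 * B / 6 ^ n / 6) / (a + b)\<^sup>2"
    proof (rule Kop_bound[OF cd])
      fix x y assume "a \<le> x" "b \<le> y" "x + y \<le> 2"
      then show "\<bar>d n (x, y)\<bar> \<le> 4 * B / 6 ^ n / (x + y)\<^sup>2"
        using tri_upward Suc ab by fastforce
    qed (use Suc ab in auto)
    ultimately show ?case by (simp add: ab mult.commute)
  qed
  define g where "g n p = (fst p + snd p)\<^sup>2 * d n p" for n p
  define G where "G p = suminf (\<lambda>n. g n p)" for p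
  have "uniform_limit tri (\<lambda>n p. \<Sum>i<n. g i p) G sequentially"
    unfolding G_def
  proof (rule Weierstrass_m_test)
    show "norm (g n p) \<le> 4 * B * (1 / 6) ^ n" if "p \<in> tri" for n p
      using bd[OF that, of n] s2[OF that] by (simp add: g_def abs_mult field_simps power_one_over)
    show "summable (\<lambda>n. 4 * B * (1 / 6) ^ n)" by (intro summable_mult summable_geometric) auto
  qed
  moreover have sum: "(\<Sum>i<n. g i p) = (fst p + snd p)\<^sup>2 * (V n p - v0 p)" for n p
    unfolding g_def d_def sum_distrib_left[symmetric] using sum_lessThan_telescope[of "\<lambda>i. V i p" n] by (simp add: V0)
  ultimately have ul: "uniform_limit tri (\<lambda>n p. (fst p + snd p)\<^sup>2 * (V n p - v0 p)) G sequentially"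
    by simp
  have cG: "continuous_on tri G"
    by (rule uniform_limit_theorem[OF always_eventually ul]) (auto intro!: continuous_intros cV v0)
  define v where "v p = v0 p + G p / (fst p + snd p)\<^sup>2" for p
  have cv: "continuous_on tri v"
    unfolding v_def[abs_def] using cG v0 by (intro continuous_intros) (auto dest: s2)
  have "v p = v0 p + Kop v p" if p: "p \<in> tri" for p
  proof -
    obtain a b where ab: "p = (a, b)" by (cases p)
    have s: "0 < (a + b)\<^sup>2" using s2[OF p] by (simp add: ab)
    have "\<bar>v p - (v0 p + Kop v p)\<bar> \<le> 2 * e / (a + b)\<^sup>2" if e: "e > 0" for e
    proof -
      \<comment> \<open>Both sides of the equation are compared with the same late iterate, the left
        one directly and the right one through \<open>Kop\<close>, which does not increase the
        weighted error.\<close>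
      from uniform_limitD[OF ul e] obtain N where
        N: "\<And>n q. n \<ge> N \<Longrightarrow> q \<in> tri \<Longrightarrow> dist ((fst q + snd q)\<^sup>2 * (V n q - v0 q)) (G q) < e"
        unfolding eventually_sequentially by blast
      have close: "\<bar>v q - V n q\<bar> \<le> e / (fst q + snd q)\<^sup>2" if "n \<ge> N" "q \<in> tri" for n q
      proof -
        have "(fst q + snd q)\<^sup>2 * (v q - V n q) = G q - (fst q + snd q)\<^sup>2 * (V n q - v0 q)"
          using s2[OF that(2)] by (simp add: v_def field_simps)
        then have "(fst q + snd q)\<^sup>2 * \<bar>v q - V n q\<bar> < e"
          using N[OF that] abs_mult[of "(fst q + snd q)\<^sup>2" "v q - V n q"]
          by (simp add: dist_real_def abs_minus_commute)
        then show ?thesis using s2[OF that(2)] by (simp add: field_simps)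
      qed
      have "\<bar>Kop (\<lambda>q. v q - V N q) (a, b)\<bar> \<le> (e / 6) / (a + b)\<^sup>2"
      proof (rule Kop_bound)
        fix x y assume "a \<le> x" "b \<le> y" "x + y \<le> 2"
        then show "\<bar>v (x, y) - V N (x, y)\<bar> \<le> e / (x + y)\<^sup>2"
          using close[of N "(x, y)"] tri_upward p ab by fastforce
      qed (use p ab in \<open>auto intro!: continuous_intros cv cV\<close>)
      then have "\<bar>Kop v p - Kop (V N) p\<bar> \<le> (e / 6) / (a + b)\<^sup>2"
        using Kop_diff[OF cv cV p] by (simp add: ab)
      also have "\<dots> \<le> e / (a + b)\<^sup>2" using e by (intro divide_right_mono) auto
      finally have 1: "\<bar>Kop v p - Kop (V N) p\<bar> \<le> e / (a + b)\<^sup>2" .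
      have 2: "\<bar>v p - V (Suc N) p\<bar> \<le> e / (a + b)\<^sup>2"
        using close[of "Suc N" p] p by (simp add: ab)
      have "v p - (v0 p + Kop v p) = (v p - V (Suc N) p) - (Kop v p - Kop (V N) p)"
        by (simp add: VS)
      then have "\<bar>v p - (v0 p + Kop v p)\<bar> \<le> e / (a + b)\<^sup>2 + e / (a + b)\<^sup>2"
        using 1 2 by linarith
      then show ?thesis by simp
    qed
    note * = this
    have "\<bar>v p - (v0 p + Kop v p)\<bar> \<le> e" if "e > 0" for e
      using *[of "e * (a + b)\<^sup>2 / 2"] s that by simp
    then have "\<bar>v p - (v0 p + Kop v p)\<bar> \<le> 0" by (rule field_le_epsilon) simp
    then show ?thesis by simp
  qed
  with cv show ?thesis by blast
qed

section \<open>Smoothness of the solutions\<close>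

text \<open>A family closed under directional differentiation produces the iterated derivatives by
  recursion on the list of directions. Smoothness is thus reduced to exhibiting such a family,
  without formulas for higher derivatives.\<close>

lemma smooth_on_coinduct:
  assumes step: "\<And>w. w \<in> F \<Longrightarrow> \<exists>d. (\<forall>v. d v \<in> F) \<and> (\<forall>x\<in>A. (w has_derivative (\<lambda>v. d v x)) (at x within A))"
    and f: "f \<in> F"
  shows "smooth_on A f"
proof -
  obtain d where d: "\<And>w v. w \<in> F \<Longrightarrow> d w v \<in> F"
    "\<And>w x. w \<in> F \<Longrightarrow> x \<in> A \<Longrightarrow> (w has_derivative (\<lambda>v. d w v x)) (at x within A)"
    using step by metis
  define D where "D vs = rec_list f (\<lambda>v vs r. d r v) vs" for vs
  have D: "D [] = f" "D (v # vs) = d (D vs) v" for v vs by (simp_all add: D_def)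
  have "D vs \<in> F" for vs by (induction vs) (auto simp: D f d)
  then show ?thesis
    unfolding smooth_on_def by (intro exI[of _ D]) (auto simp: D d)
qed

lemma smooth_on_derivative:
  assumes "smooth_on A f"
  shows "\<exists>d. (\<forall>v. smooth_on A (d v)) \<and> (\<forall>x\<in>A. (f has_derivative (\<lambda>v. d v x)) (at x within A))"
proof -
  from assms obtain D where D0: "\<forall>x\<in>A. D [] x = f x"
    and D: "\<forall>vs. \<forall>x\<in>A. (D vs has_derivative (\<lambda>v. D (v # vs) x)) (at x within A)"
    unfolding smooth_on_def by (elim exE conjE)
  \<comment> \<open>New directions are put in front of the list, so the direction of the innermost
    derivative is its last element.\<close>
  have "smooth_on A (D [v])" for v
    unfolding smooth_on_def using D by (intro exI[of _ "\<lambda>vs. D (vs @ [v])"]) auto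
  moreover have "(f has_derivative (\<lambda>v. D [v] x)) (at x within A)" if "x \<in> A" for x
    using that D0 by (intro has_derivative_transform[OF _ _ D[rule_format, of x "[]"]]) auto
  ultimately show ?thesis by (intro exI[of _ "\<lambda>v. D [v]"]) auto
qed

lemma smooth_on_subset:
  assumes "smooth_on A f" "B \<subseteq> A"
  shows "smooth_on B f"
proof -
  from assms(1) obtain D where "\<forall>x\<in>A. D [] x = f x"
    "\<forall>vs. \<forall>x\<in>A. (D vs has_derivative (\<lambda>v. D (v # vs) x)) (at x within A)"
    unfolding smooth_on_def by (elim exE conjE)
  then show ?thesis
    unfolding smooth_on_def using assms(2)
    by (intro exI[of _ D]) (auto intro!: has_derivative_subset[OF _ assms(2)])
qed

lemma smooth_on_real_derivative:
  fixes f :: "real \<Rightarrow> real"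
  assumes "smooth_on A f"
  shows "\<exists>f'. smooth_on A f' \<and> (\<forall>x\<in>A. (f has_real_derivative f' x) (at x within A))"
proof -
  obtain d where d: "\<And>v. smooth_on A (d v)" "\<And>x. x \<in> A \<Longrightarrow> (f has_derivative (\<lambda>v. d v x)) (at x within A)"
    using smooth_on_derivative[OF assms] by blast
  have *: "(f has_real_derivative d 1 x) (at x within A)" if "x \<in> A" for x
  proof -
    have "(\<lambda>v. d v x) = (*) (d 1 x)"
    proof
      fix v show "d v x = d 1 x * v"
        using linear_scale[OF has_derivative_linear[OF d(2)[OF that]], of v 1] by simp
    qed
    with d(2)[OF that] show ?thesis by (simp add: has_field_derivative_def)
  qed
  show ?thesis by (intro exI[of _ "d 1"] conjI ballI d(1) *)
qed

lemma smooth_on_reflect: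
  fixes f :: "real \<Rightarrow> real"
  assumes "smooth_on {-1..1} f"
  shows "smooth_on {-1..1} (\<lambda>x. f (- x))"
proof (rule smooth_on_coinduct)
  let ?F = "{\<lambda>x. w (- x) | w :: real \<Rightarrow> real. smooth_on {-1..1} w}"
  show "(\<lambda>x. f (- x)) \<in> ?F" using assms by auto
  fix u assume "u \<in> ?F"
  then obtain w where w: "u = (\<lambda>x. w (- x))" "smooth_on {-1..1} w" by auto
  obtain w' where w': "smooth_on {-1..1} w'" "\<And>x. x \<in> {-1..1} \<Longrightarrow> (w has_real_derivative w' x) (at x within {-1..1})"
    using smooth_on_real_derivative[OF w(2)] by blast
  have "(u has_derivative (\<lambda>v. (- v) * w' (- x))) (at x within {-1..1})" if "x \<in> {-1..1}" for x
  proof -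
    have "((w \<circ> uminus) has_real_derivative w' (- x) * (- 1)) (at x within {-1..1})"
      using w'(2)[of "- x"] that by (intro DERIV_image_chain) (auto intro!: derivative_eq_intros)
    moreover have "(\<lambda>v. (- v) * w' (- x)) = (*) (w' (- x) * (- 1))" by auto
    ultimately show ?thesis by (simp only: w(1) o_def has_field_derivative_def)
  qed
  moreover have "(\<lambda>x. (- v) * w' (- x)) \<in> ?F" for v
    using w'(1) by (auto intro!: exI[of _ "\<lambda>x. (- v) * w' x"] smooth_on_mult smooth_on_const)
  ultimately show "\<exists>d. (\<forall>v. d v \<in> ?F) \<and> (\<forall>x\<in>{-1..1}. (u has_derivative (\<lambda>v. d v x)) (at x within {-1..1}))"
    by (intro exI[of _ "\<lambda>v x. (- v) * w' (- x)"]) blast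
qed

section \<open>Calculus of continuously differentiable functions on the triangle\<close>

definition tri_C1 :: "(real \<times> real \<Rightarrow> real) \<Rightarrow> (real \<times> real \<Rightarrow> real) \<Rightarrow> (real \<times> real \<Rightarrow> real) \<Rightarrow> bool" where
  "tri_C1 w w1 w2 \<longleftrightarrow> continuous_on tri w1 \<and> continuous_on tri w2 \<and>
     (\<forall>p\<in>tri. (w has_derivative (\<lambda>v. fst v * w1 p + snd v * w2 p)) (at p within tri))"

lemma tri_C1_D:
  assumes "tri_C1 w w1 w2"
  shows "continuous_on tri w" "continuous_on tri w1" "continuous_on tri w2"
    "\<And>p. p \<in> tri \<Longrightarrow> (w has_derivative (\<lambda>v. fst v * w1 p + snd v * w2 p)) (at p within tri)"
  using assms unfolding tri_C1_def
  by (auto simp: continuous_on_eq_continuous_within intro: has_derivative_continuous)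

lemma tri_C1_fst_deriv:
  assumes "tri_C1 w w1 w2" "(a, b) \<in> tri"
  shows "((\<lambda>x. w (x, b)) has_field_derivative w1 (a, b)) (at a within {x. (x, b) \<in> tri})"
proof -
  have "((\<lambda>x. w (x, b)) has_derivative (\<lambda>h. fst (h, 0 :: real) * w1 (a, b) + snd (h, 0 :: real) * w2 (a, b)))
      (at a within {x. (x, b) \<in> tri})"
    by (rule has_derivative_in_compose2[where f = "\<lambda>x. (x, b)" and t = tri and f' = "\<lambda>h. (h, 0)"
          and g' = "\<lambda>p v. fst v * w1 p + snd v * w2 p"])
      (use assms in \<open>auto intro!: derivative_eq_intros tri_C1_D(4)\<close>)
  then show ?thesis by (simp add: has_field_derivative_def mult_commute_abs)
qed

lemma tri_C1_snd_deriv: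
  assumes "tri_C1 w w1 w2" "(a, b) \<in> tri"
  shows "((\<lambda>x. w (a, x)) has_field_derivative w2 (a, b)) (at b within {x. (a, x) \<in> tri})"
proof -
  have "((\<lambda>x. w (a, x)) has_derivative (\<lambda>h. fst (0 :: real, h) * w1 (a, b) + snd (0 :: real, h) * w2 (a, b)))
      (at b within {x. (a, x) \<in> tri})"
    by (rule has_derivative_in_compose2[where f = "\<lambda>x. (a, x)" and t = tri and f' = "\<lambda>h. (0, h)"
          and g' = "\<lambda>p v. fst v * w1 p + snd v * w2 p"])
      (use assms in \<open>auto intro!: derivative_eq_intros tri_C1_D(4)\<close>)
  then show ?thesis by (simp add: has_field_derivative_def mult_commute_abs)
qed

lemma tri_C1_I:
  assumes "continuous_on tri w1" "continuous_on tri w2"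
    "\<And>a b. (a, b) \<in> tri \<Longrightarrow> ((\<lambda>x. w (x, b)) has_field_derivative w1 (a, b)) (at a within {x. (x, b) \<in> tri})"
    "\<And>a b. (a, b) \<in> tri \<Longrightarrow> ((\<lambda>x. w (a, x)) has_field_derivative w2 (a, b)) (at b within {x. (a, x) \<in> tri})"
  shows "tri_C1 w w1 w2"
  unfolding tri_C1_def using assms tri_has_derivative[of _ w w1 w2] by blast

lemma tri_C1_add:
  assumes "tri_C1 f f1 f2" "tri_C1 g g1 g2"
  shows "tri_C1 (\<lambda>p. f p + g p) (\<lambda>p. f1 p + g1 p) (\<lambda>p. f2 p + g2 p)"
  unfolding tri_C1_def
  by (auto intro!: continuous_intros derivative_eq_intros tri_C1_D[OF assms(1)] tri_C1_D[OF assms(2)] simp: algebra_simps)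

lemma tri_C1_mult:
  assumes "tri_C1 f f1 f2" "tri_C1 g g1 g2"
  shows "tri_C1 (\<lambda>p. f p * g p) (\<lambda>p. f1 p * g p + f p * g1 p) (\<lambda>p. f2 p * g p + f p * g2 p)"
  unfolding tri_C1_def
  by (auto intro!: continuous_intros derivative_eq_intros tri_C1_D[OF assms(1)] tri_C1_D[OF assms(2)] simp: algebra_simps)

lemma tri_C1_const: "tri_C1 (\<lambda>p. c) (\<lambda>p. 0) (\<lambda>p. 0)"
  by (simp add: tri_C1_def)

lemma tri_C1_fst: "tri_C1 fst (\<lambda>p. 1) (\<lambda>p. 0)"
  by (auto simp: tri_C1_def intro!: derivative_eq_intros)

lemma tri_C1_snd: "tri_C1 snd (\<lambda>p. 0) (\<lambda>p. 1)"
  by (auto simp: tri_C1_def intro!: derivative_eq_intros)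

lemma has_real_derivative_reflect_at:
  assumes \<phi>: "\<And>x. x \<in> {-1..1} \<Longrightarrow> (\<phi> has_real_derivative \<phi>' x) (at x within {-1..1})"
    and "1 - a \<in> {-1..1}" "\<And>x. x \<in> S \<Longrightarrow> 1 - x \<in> {-1..1}"
  shows "((\<lambda>x. \<phi> (1 - x)) has_real_derivative - \<phi>' (1 - a)) (at a within S)"
proof -
  have "((\<phi> \<circ> (\<lambda>x. 1 - x)) has_real_derivative \<phi>' (1 - a) * (- 1)) (at a within S)"
    using assms by (intro DERIV_image_chain) (auto intro!: derivative_eq_intros has_field_derivative_subset[OF \<phi>])
  then show ?thesis by (simp add: o_def)
qed

lemma continuous_on_fst_reflect:
  assumes "continuous_on {-1..1} \<phi>"
  shows "continuous_on tri (\<lambda>p. \<phi> (1 - fst p))" "continuous_on tri (\<lambda>p. \<phi> (1 - snd p))"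
  by (rule continuous_on_compose2[OF assms]; auto intro!: continuous_intros simp: tri_iff)+

lemma tri_C1_fst_reflect:
  assumes "continuous_on {-1..1} \<phi>'" "\<And>x. x \<in> {-1..1} \<Longrightarrow> (\<phi> has_real_derivative \<phi>' x) (at x within {-1..1})"
  shows "tri_C1 (\<lambda>p. \<phi> (1 - fst p)) (\<lambda>p. - \<phi>' (1 - fst p)) (\<lambda>p. 0)"
  by (rule tri_C1_I) (auto intro!: continuous_intros continuous_on_fst_reflect assms
      has_real_derivative_reflect_at simp: tri_iff)

lemma tri_C1_snd_reflect:
  assumes "continuous_on {-1..1} \<phi>'" "\<And>x. x \<in> {-1..1} \<Longrightarrow> (\<phi> has_real_derivative \<phi>' x) (at x within {-1..1})"
  shows "tri_C1 (\<lambda>p. \<phi> (1 - snd p)) (\<lambda>p. 0) (\<lambda>p. - \<phi>' (1 - snd p))"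
  by (rule tri_C1_I) (auto intro!: continuous_intros continuous_on_fst_reflect assms
      has_real_derivative_reflect_at simp: tri_iff)

text \<open>Here and below minus signs are written as factors \<open>- 1\<close>, the form in which
  the closure rules for constants and products of \<open>null_family\<close> apply.\<close>

lemma tri_C1_inverse_sum:
  "tri_C1 (\<lambda>p. 1 / (fst p + snd p)) (\<lambda>p. - 1 * ((1 / (fst p + snd p)) * (1 / (fst p + snd p))))
     (\<lambda>p. - 1 * ((1 / (fst p + snd p)) * (1 / (fst p + snd p))))"
proof (rule tri_C1_I)
  show "continuous_on tri (\<lambda>p. - 1 * ((1 / (fst p + snd p)) * (1 / (fst p + snd p))))"
    by (intro continuous_intros) (auto dest: tri_sum_pos)
  then show "continuous_on tri (\<lambda>p. - 1 * ((1 / (fst p + snd p)) * (1 / (fst p + snd p))))" .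
qed (auto intro!: derivative_eq_intros simp: tri_iff)

lemma tri_C1_J1:
  assumes "tri_C1 w w1 w2"
  shows "tri_C1 (J1 w) (\<lambda>p. - 1 * w (fst p, 2 - fst p) + J1 w1 p) (\<lambda>p. - 1 * w p)"
proof (rule tri_C1_I)
  note D = tri_C1_D[OF assms]
  have "continuous_on tri (\<lambda>p. w (fst p, 2 - fst p))"
    by (rule continuous_on_compose2[OF D(1)]) (auto intro!: continuous_intros simp: tri_iff)
  then show "continuous_on tri (\<lambda>p. - 1 * w (fst p, 2 - fst p) + J1 w1 p)"
    by (intro continuous_intros continuous_on_J1 D)
  show "continuous_on tri (\<lambda>p. - 1 * w p)" by (intro continuous_intros D)
qed (use J1_deriv_fst[OF tri_C1_D(1,2)[OF assms] tri_C1_fst_deriv[OF assms]]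
    J1_deriv_snd[OF tri_C1_D(1)[OF assms]] in simp_all)

lemma tri_C1_J2:
  assumes "tri_C1 w w1 w2"
  shows "tri_C1 (J2 w) (\<lambda>p. - 1 * w p) (\<lambda>p. - 1 * w (2 - snd p, snd p) + J2 w2 p)"
proof (rule tri_C1_I)
  note D = tri_C1_D[OF assms]
  have "continuous_on tri (\<lambda>p. w (2 - snd p, snd p))"
    by (rule continuous_on_compose2[OF D(1)]) (auto intro!: continuous_intros simp: tri_iff)
  then show "continuous_on tri (\<lambda>p. - 1 * w (2 - snd p, snd p) + J2 w2 p)"
    by (intro continuous_intros continuous_on_J2 D)
  show "continuous_on tri (\<lambda>p. - 1 * w p)" by (intro continuous_intros D)
qed (use J2_deriv_snd[OF tri_C1_D(1,3)[OF assms] tri_C1_snd_deriv[OF assms]]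
    J2_deriv_fst[OF tri_C1_D(1)[OF assms]] in simp_all)

lemma tri_C1_trace_fst:
  assumes "tri_C1 w w1 w2"
  shows "tri_C1 (\<lambda>p. w (fst p, 2 - fst p)) (\<lambda>p. w1 (fst p, 2 - fst p) + - 1 * w2 (fst p, 2 - fst p)) (\<lambda>p. 0)"
  unfolding tri_C1_def
proof (intro conjI ballI)
  note D = tri_C1_D[OF assms]
  have c: "continuous_on tri u \<Longrightarrow> continuous_on tri (\<lambda>p. u (fst p, 2 - fst p))" for u :: "real \<times> real \<Rightarrow> real"
    by (rule continuous_on_compose2[where g = u]) (auto intro!: continuous_intros simp: tri_iff)
  show "continuous_on tri (\<lambda>p. w1 (fst p, 2 - fst p) + - 1 * w2 (fst p, 2 - fst p))"
    by (intro continuous_intros c D)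
  fix p assume p: "p \<in> tri"
  have "((\<lambda>p. w (fst p, 2 - fst p)) has_derivative
     (\<lambda>v. fst (fst v, - fst v) * w1 (fst p, 2 - fst p) + snd (fst v, - fst v) * w2 (fst p, 2 - fst p))) (at p within tri)"
    by (rule has_derivative_in_compose2[where f = "\<lambda>p. (fst p, 2 - fst p)" and t = tri and f' = "\<lambda>v. (fst v, - fst v)"
          and g' = "\<lambda>p v. fst v * w1 p + snd v * w2 p"])
      (use p D in \<open>auto intro!: derivative_eq_intros simp: tri_iff\<close>)
  then show "((\<lambda>p. w (fst p, 2 - fst p)) has_derivative
     (\<lambda>v. fst v * (w1 (fst p, 2 - fst p) + - 1 * w2 (fst p, 2 - fst p)) + snd v * 0)) (at p within tri)"
    by (simp add: algebra_simps)
qed auto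

lemma tri_C1_trace_snd:
  assumes "tri_C1 w w1 w2"
  shows "tri_C1 (\<lambda>p. w (2 - snd p, snd p)) (\<lambda>p. 0) (\<lambda>p. w2 (2 - snd p, snd p) + - 1 * w1 (2 - snd p, snd p))"
  unfolding tri_C1_def
proof (intro conjI ballI)
  note D = tri_C1_D[OF assms]
  have c: "continuous_on tri u \<Longrightarrow> continuous_on tri (\<lambda>p. u (2 - snd p, snd p))" for u :: "real \<times> real \<Rightarrow> real"
    by (rule continuous_on_compose2[where g = u]) (auto intro!: continuous_intros simp: tri_iff)
  show "continuous_on tri (\<lambda>p. w2 (2 - snd p, snd p) + - 1 * w1 (2 - snd p, snd p))"
    by (intro continuous_intros c D)
  fix p assume p: "p \<in> tri"
  have "((\<lambda>p. w (2 - snd p, snd p)) has_derivative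
     (\<lambda>v. fst (- snd v, snd v) * w1 (2 - snd p, snd p) + snd (- snd v, snd v) * w2 (2 - snd p, snd p))) (at p within tri)"
    by (rule has_derivative_in_compose2[where f = "\<lambda>p. (2 - snd p, snd p)" and t = tri and f' = "\<lambda>v. (- snd v, snd v)"
          and g' = "\<lambda>p v. fst v * w1 p + snd v * w2 p"])
      (use p D in \<open>auto intro!: derivative_eq_intros simp: tri_iff\<close>)
  then show "((\<lambda>p. w (2 - snd p, snd p)) has_derivative
     (\<lambda>v. fst v * 0 + snd v * (w2 (2 - snd p, snd p) + - 1 * w1 (2 - snd p, snd p)))) (at p within tri)"
    by (simp add: algebra_simps)
qed auto

text \<open>The partial derivatives of \<open>v\<close> of all orders stay in this class, because those of \<open>v\<close>, of
  \<open>J1 w\<close> and of \<open>J2 w\<close> are expressed by integrals and by traces on the line \<open>a + b = 2\<close>.\<close>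

inductive_set null_family :: "(real \<times> real \<Rightarrow> real) \<Rightarrow> (real \<times> real \<Rightarrow> real) set"
  for v :: "real \<times> real \<Rightarrow> real" where
  sol: "v \<in> null_family v"
| refl_fst: "smooth_on {-1..1} \<phi> \<Longrightarrow> (\<lambda>p. \<phi> (1 - fst p)) \<in> null_family v"
| refl_snd: "smooth_on {-1..1} \<phi> \<Longrightarrow> (\<lambda>p. \<phi> (1 - snd p)) \<in> null_family v"
| inv_sum: "(\<lambda>p. 1 / (fst p + snd p)) \<in> null_family v"
| add: "w \<in> null_family v \<Longrightarrow> w' \<in> null_family v \<Longrightarrow> (\<lambda>p. w p + w' p) \<in> null_family v"
| mult: "w \<in> null_family v \<Longrightarrow> w' \<in> null_family v \<Longrightarrow> (\<lambda>p. w p * w' p) \<in> null_family v"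
| J1: "w \<in> null_family v \<Longrightarrow> J1 w \<in> null_family v"
| J2: "w \<in> null_family v \<Longrightarrow> J2 w \<in> null_family v"
| trace_fst: "w \<in> null_family v \<Longrightarrow> (\<lambda>p. w (fst p, 2 - fst p)) \<in> null_family v"
| trace_snd: "w \<in> null_family v \<Longrightarrow> (\<lambda>p. w (2 - snd p, snd p)) \<in> null_family v"

lemma null_family_const: "(\<lambda>p. c) \<in> null_family v"
  using null_family.refl_fst[OF smooth_on_const[of _ c]] .

lemma null_family_uminus: "w \<in> null_family v \<Longrightarrow> (\<lambda>p. - w p) \<in> null_family v"
  using null_family.mult[OF null_family_const[of "-1"], of w v] by simp

lemma null_family_fst: "fst \<in> null_family v" and null_family_snd: "snd \<in> null_family v"
proof -
  have *: "smooth_on {-1..1} (\<lambda>x::real. 1 + (- 1) * x)"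
    by (intro smooth_on_add smooth_on_mult smooth_on_const smooth_on_id)
  show "fst \<in> null_family v" "snd \<in> null_family v"
    using null_family.refl_fst[OF *, of v] null_family.refl_snd[OF *, of v] by simp_all
qed

lemma null_family_pot: "w \<in> null_family v \<Longrightarrow> pot w \<in> null_family v"
  using null_family.mult[OF _ null_family.mult[OF null_family.inv_sum null_family.inv_sum], of w v]
  by (simp add: pot_def[abs_def] power2_eq_square)

text \<open>Induction on the generation of the family. The partial derivatives of \<open>v\<close>
  are supplied by the assumptions; those of an integral or of a trace are expressed by integrals and
  traces of the function underneath and of its partial derivatives.\<close>

lemma null_family_C1:
  assumes v: "v1 \<in> null_family v" "v2 \<in> null_family v" "tri_C1 v v1 v2"
    and w: "w \<in> null_family v"
  shows "\<exists>w1\<in>null_family v. \<exists>w2\<in>null_family v. tri_C1 w w1 w2"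
proof -
  have I: "\<exists>w1\<in>null_family v. \<exists>w2\<in>null_family v. tri_C1 w w1 w2"
    if "tri_C1 w w1 w2" "w1 \<in> null_family v" "w2 \<in> null_family v" for w w1 w2
    using that by blast
  show ?thesis using w
proof induction
  case sol
  show ?case using v by blast
next
  case (refl_fst \<phi>)
  obtain \<phi>' where \<phi>': "smooth_on {-1..1} \<phi>'" "\<And>x. x \<in> {-1..1} \<Longrightarrow> (\<phi> has_real_derivative \<phi>' x) (at x within {-1..1})"
    using smooth_on_real_derivative[OF refl_fst] by blast
  show ?case
    using tri_C1_fst_reflect[OF smooth_on_continuous[OF \<phi>'(1)] \<phi>'(2)]
      null_family_uminus[OF null_family.refl_fst[OF \<phi>'(1)]] null_family_const[of 0] by blast
next
  case (refl_snd \<phi>)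
  obtain \<phi>' where \<phi>': "smooth_on {-1..1} \<phi>'" "\<And>x. x \<in> {-1..1} \<Longrightarrow> (\<phi> has_real_derivative \<phi>' x) (at x within {-1..1})"
    using smooth_on_real_derivative[OF refl_snd] by blast
  show ?case
    using tri_C1_snd_reflect[OF smooth_on_continuous[OF \<phi>'(1)] \<phi>'(2)]
      null_family_uminus[OF null_family.refl_snd[OF \<phi>'(1)]] null_family_const[of 0] by blast
next
  case inv_sum
  have "(\<lambda>p. - 1 * ((1 / (fst p + snd p)) * (1 / (fst p + snd p)))) \<in> null_family v"
    by (intro null_family.mult null_family_const null_family.inv_sum)
  then show ?case using tri_C1_inverse_sum by (intro bexI)
next
  case (add w w')
  then obtain w1 w2 w1' w2' where
    "w1 \<in> null_family v" "w2 \<in> null_family v" "tri_C1 w w1 w2"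
    "w1' \<in> null_family v" "w2' \<in> null_family v" "tri_C1 w' w1' w2'" by blast
  then show ?case
    by (intro bexI[of _ "\<lambda>p. w1 p + w1' p"] bexI[of _ "\<lambda>p. w2 p + w2' p"] tri_C1_add null_family.add)
next
  case (mult w w')
  then obtain w1 w2 w1' w2' where
    "w1 \<in> null_family v" "w2 \<in> null_family v" "tri_C1 w w1 w2"
    "w1' \<in> null_family v" "w2' \<in> null_family v" "tri_C1 w' w1' w2'" by blast
  then show ?case using mult
    by (intro bexI[of _ "\<lambda>p. w1 p * w' p + w p * w1' p"] bexI[of _ "\<lambda>p. w2 p * w' p + w p * w2' p"]
        tri_C1_mult null_family.add null_family.mult)
next
  case (J1 w)
  then obtain w1 w2 where *: "w1 \<in> null_family v" "w2 \<in> null_family v" "tri_C1 w w1 w2" by blast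
  show ?case
    by (rule I[OF tri_C1_J1[OF *(3)]]; intro null_family.add null_family.mult null_family_const null_family.J1 null_family.trace_fst * J1.hyps)
next
  case (J2 w)
  then obtain w1 w2 where *: "w1 \<in> null_family v" "w2 \<in> null_family v" "tri_C1 w w1 w2" by blast
  show ?case
    by (rule I[OF tri_C1_J2[OF *(3)]]; intro null_family.add null_family.mult null_family_const null_family.J2 null_family.trace_snd * J2.hyps)
next
  case (trace_fst w)
  then obtain w1 w2 where *: "w1 \<in> null_family v" "w2 \<in> null_family v" "tri_C1 w w1 w2" by blast
  show ?case
    by (rule I[OF tri_C1_trace_fst[OF *(3)]]; intro null_family.add null_family.mult null_family_const null_family.trace_fst *)
next
  case (trace_snd w)
  then obtain w1 w2 where *: "w1 \<in> null_family v" "w2 \<in> null_family v" "tri_C1 w w1 w2" by blast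
  show ?case
    by (rule I[OF tri_C1_trace_snd[OF *(3)]]; intro null_family.add null_family.mult null_family_const null_family.trace_snd *)
qed
qed

section \<open>Existence of the wave solution\<close>

definition nc :: "real \<times> real \<Rightarrow> real \<times> real" where
  "nc q = (exp (- fst q) * (1 - snd q), exp (- fst q) * (1 + snd q))"

lemma nc_sum: "fst (nc q) + snd (nc q) = 2 * exp (- fst q)"
  by (simp add: nc_def algebra_simps)

lemma nc_in_tri: "0 \<le> s \<Longrightarrow> y \<in> {-1..1} \<Longrightarrow> nc (s, y) \<in> tri"
  using nc_sum[of "(s, y)"] by (auto simp: nc_def tri_iff)

lemma nc_zero: "nc (0, y) = (1 - y, 1 + y)"
  by (simp add: nc_def)

lemma nc_has_derivative:
  "(nc has_derivative (\<lambda>v. (- (fst v * fst (nc q)) - snd v * ((fst (nc q) + snd (nc q)) / 2),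
      - (fst v * snd (nc q)) + snd v * ((fst (nc q) + snd (nc q)) / 2)))) (at q within A)"
  unfolding nc_sum
  unfolding nc_def[abs_def]
  by (auto intro!: derivative_eq_intros simp: algebra_simps)

text \<open>In null coordinates \<open>\<partial>\<^sub>s\<close> is
  \<open>- (a * \<partial>\<^sub>a + b * \<partial>\<^sub>b)\<close>, minus the generator of
  dilations, and \<open>\<partial>\<^sub>y\<close> is
  \<open>(a + b) / 2 * (\<partial>\<^sub>b - \<partial>\<^sub>a)\<close>.\<close>

lemma tri_C1_nc:
  assumes w: "tri_C1 w w1 w2" and q: "q \<in> A" and A: "A \<subseteq> {0..} \<times> {-1..1}"
  shows "((\<lambda>q. w (nc q)) has_derivative (\<lambda>v.
     fst v * (- (fst (nc q) * w1 (nc q) + snd (nc q) * w2 (nc q)))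
     + snd v * ((fst (nc q) + snd (nc q)) / 2 * (w2 (nc q) - w1 (nc q))))) (at q within A)"
proof -
  have "((\<lambda>q. w (nc q)) has_derivative (\<lambda>v.
      (- (fst v * fst (nc q)) - snd v * ((fst (nc q) + snd (nc q)) / 2)) * w1 (nc q)
    + (- (fst v * snd (nc q)) + snd v * ((fst (nc q) + snd (nc q)) / 2)) * w2 (nc q))) (at q within A)"
    using has_derivative_in_compose2[where f = nc and t = tri and g' = "\<lambda>p v. fst v * w1 p + snd v * w2 p",
        OF tri_C1_D(4)[OF w] _ q nc_has_derivative] A nc_in_tri
    by fastforce
  then show ?thesis by (rule has_derivative_eq_rhs) (simp add: fun_eq_iff field_simps)
qed

lemma tri_C1_nc_time:
  assumes w: "tri_C1 w w1 w2" and s: "0 \<le> s" and y: "y \<in> {-1..1}"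
  shows "((\<lambda>s. w (nc (s, y))) has_real_derivative
     - (fst (nc (s, y)) * w1 (nc (s, y)) + snd (nc (s, y)) * w2 (nc (s, y)))) (at s within {0..})"
proof -
  have "((\<lambda>s. w (nc (s, y))) has_derivative (\<lambda>h.
     fst (h, 0::real) * (- (fst (nc (s, y)) * w1 (nc (s, y)) + snd (nc (s, y)) * w2 (nc (s, y))))
     + snd (h, 0::real) * ((fst (nc (s, y)) + snd (nc (s, y))) / 2 * (w2 (nc (s, y)) - w1 (nc (s, y)))))) (at s within {0..})"
    using y s
    by (intro has_derivative_in_compose[where f = "\<lambda>s. (s, y)" and g = "\<lambda>q. w (nc q)", OF _ tri_C1_nc[OF w]])
      (auto intro!: derivative_eq_intros)
  then show ?thesis unfolding has_field_derivative_def by (rule has_derivative_eq_rhs) (auto simp: fun_eq_iff)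
qed

lemma tri_C1_nc_space:
  assumes w: "tri_C1 w w1 w2" and s: "0 \<le> s" and y: "y \<in> {-1..1}"
  shows "((\<lambda>y. w (nc (s, y))) has_real_derivative
     (fst (nc (s, y)) + snd (nc (s, y))) / 2 * (w2 (nc (s, y)) - w1 (nc (s, y)))) (at y within {-1..1})"
proof -
  have "((\<lambda>y. w (nc (s, y))) has_derivative (\<lambda>h.
     fst (0::real, h) * (- (fst (nc (s, y)) * w1 (nc (s, y)) + snd (nc (s, y)) * w2 (nc (s, y))))
     + snd (0::real, h) * ((fst (nc (s, y)) + snd (nc (s, y))) / 2 * (w2 (nc (s, y)) - w1 (nc (s, y)))))) (at y within {-1..1})"
    using y s
    by (intro has_derivative_in_compose[where f = "\<lambda>y. (s, y)" and g = "\<lambda>q. w (nc q)", OF _ tri_C1_nc[OF w]])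
      (auto intro!: derivative_eq_intros)
  then show ?thesis unfolding has_field_derivative_def by (rule has_derivative_eq_rhs) (auto simp: fun_eq_iff)
qed

text \<open>Both coordinate derivatives have coefficients that belong to the family, so its members
  composed with \<open>nc\<close> are closed under directional differentiation.\<close>

lemma null_family_smooth:
  assumes v: "v1 \<in> null_family v" "v2 \<in> null_family v" "tri_C1 v v1 v2" and w: "w \<in> null_family v"
  shows "smooth_on ({0..} \<times> {-1..1}) (\<lambda>q. w (nc q))"
proof (rule smooth_on_coinduct)
  let ?F = "{\<lambda>q. w (nc q) | w. w \<in> null_family v}"
  show "(\<lambda>q. w (nc q)) \<in> ?F" using w by auto
  fix u assume "u \<in> ?F"
  then obtain w where w: "u = (\<lambda>q. w (nc q))" "w \<in> null_family v" by auto
  obtain w1 w2 where w12: "w1 \<in> null_family v" "w2 \<in> null_family v" "tri_C1 w w1 w2"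
    using null_family_C1[OF v w(2)] by blast
  define d where "d z p = fst z * (- 1 * (fst p * w1 p + snd p * w2 p))
     + snd z * (1 / 2 * (fst p + snd p) * (w2 p + - 1 * w1 p))" for z p :: "real \<times> real"
  have "d z \<in> null_family v" for z
    unfolding d_def[abs_def]
    by (intro null_family.add null_family.mult null_family_const null_family_fst null_family_snd w12)
  moreover have "(u has_derivative (\<lambda>z. d z (nc q))) (at q within {0..} \<times> {-1..1})" if "q \<in> {0..} \<times> {-1..1}" for q
    unfolding w(1) by (rule has_derivative_eq_rhs[OF tri_C1_nc[OF w12(3) that]]) (auto simp: d_def fun_eq_iff)
  ultimately show "\<exists>d. (\<forall>z. d z \<in> ?F) \<and>
      (\<forall>q\<in>{0..} \<times> {-1..1}. (u has_derivative (\<lambda>z. d z q)) (at q within {0..} \<times> {-1..1}))"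
    by (intro exI[of _ "\<lambda>z q. d z (nc q)"]) auto
qed

lemma tri_C1_cong:
  assumes "tri_C1 w w1 w2" "\<And>p. p \<in> tri \<Longrightarrow> u p = w p" "\<And>p. p \<in> tri \<Longrightarrow> w1 p = u1 p" "\<And>p. p \<in> tri \<Longrightarrow> w2 p = u2 p"
  shows "tri_C1 u u1 u2"
  unfolding tri_C1_def
proof (intro conjI ballI)
  show "continuous_on tri u1" "continuous_on tri u2"
    using continuous_on_eq[OF tri_C1_D(2)[OF assms(1)] assms(3)] continuous_on_eq[OF tri_C1_D(3)[OF assms(1)] assms(4)] by simp_all
  fix p assume p: "p \<in> tri"
  show "(u has_derivative (\<lambda>v. fst v * u1 p + snd v * u2 p)) (at p within tri)"
    using has_derivative_transform[OF p assms(2) tri_C1_D(4)[OF assms(1) p]] assms(3,4) p by simp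
qed

lemma J1_diagonal: "J1 w (a, 2 - a) = 0" and J2_diagonal: "J2 w (2 - b, b) = 0"
  by (simp_all add: J1_def J2_def)

text \<open>\<open>J1 (pot v)\<close> vanishes on the initial line, so no boundary term remains and
  both partial derivatives are integrals of \<open>pot v\<close>. Thus \<open>Kop\<close> turns
  continuity into differentiability, which starts the bootstrap.\<close>

lemma tri_C1_Kop:
  assumes v: "continuous_on tri v"
  shows "tri_C1 (Kop v) (\<lambda>p. - J1 (pot v) p) (\<lambda>p. - J2 (pot v) p)"
proof (rule tri_C1_I)
  note N = continuous_on_pot[OF v]
  show "continuous_on tri (\<lambda>p. - J1 (pot v) p)" "continuous_on tri (\<lambda>p. - J2 (pot v) p)"
    by (intro continuous_intros continuous_on_J1 continuous_on_J2 N)+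
  fix a b assume p: "(a, b) \<in> tri"
  show "((\<lambda>x. Kop v (x, b)) has_field_derivative - J1 (pot v) (a, b)) (at a within {x. (x, b) \<in> tri})"
    unfolding Kop_def by (intro J2_deriv_fst continuous_on_J1 N p)
  have "((\<lambda>x. J2 (J1 (pot v)) (a, x)) has_field_derivative
      - J1 (pot v) (2 - b, b) + J2 (\<lambda>p. - pot v p) (a, b)) (at b within {x. (a, x) \<in> tri})"
    by (intro J2_deriv_snd continuous_on_J1 continuous_intros N J1_deriv_snd p)
  then show "((\<lambda>x. Kop v (a, x)) has_field_derivative - J2 (pot v) (a, b)) (at b within {x. (a, x) \<in> tri})"
    using J1_diagonal[of "pot v" "2 - b"] by (simp add: Kop_def J2_def)
qed

text \<open>The free part is d'Alembert's formula for odd data: by antisymmetry the two null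
  coordinates carry the same profile \<open>\<Psi>\<close> with opposite signs.\<close>

definition null_solution :: "(real \<Rightarrow> real) \<Rightarrow> (real \<times> real \<Rightarrow> real) \<Rightarrow> bool" where
  "null_solution \<Psi> v \<longleftrightarrow> continuous_on tri v \<and> (\<forall>p\<in>tri. v p = (\<Psi> (1 - fst p) - \<Psi> (1 - snd p)) / 2 + Kop v p)"

lemma null_solution_exists:
  assumes "continuous_on {-1..1} \<Psi>"
  shows "\<exists>v. null_solution \<Psi> v"
proof -
  obtain B where "\<forall>z\<in>\<Psi> ` {-1..1}. norm z \<le> B"
    using compact_imp_bounded[OF compact_continuous_image[OF assms compact_Icc]] unfolding bounded_iff by (elim exE)
  then have B: "\<bar>\<Psi> x\<bar> \<le> B" if "x \<in> {-1..1}" for x using that by auto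
  show ?thesis
    unfolding null_solution_def
  proof (rule Kop_fixed_point_exists)
    show "continuous_on tri (\<lambda>p. (\<Psi> (1 - fst p) - \<Psi> (1 - snd p)) / 2)"
      by (intro continuous_intros continuous_on_fst_reflect assms) auto
    fix p :: "real \<times> real" assume "p \<in> tri"
    then have "1 - fst p \<in> {-1..1}" "1 - snd p \<in> {-1..1}" by (auto simp: tri_def)
    from B[OF this(1)] B[OF this(2)] show "\<bar>(\<Psi> (1 - fst p) - \<Psi> (1 - snd p)) / 2\<bar> \<le> B"
      by (simp add: abs_le_iff)
  qed
qed

text \<open>\<open>v (a, b) + v (b, a)\<close> is a fixed point of \<open>Kop\<close>, since the
  free part is antisymmetric and \<open>Kop\<close> commutes with the reflection.\<close>

lemma null_solution_antisym:
  assumes v: "null_solution \<Psi> v" and p: "(a, b) \<in> tri"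
  shows "v (b, a) = - v (a, b)"
proof -
  have cv: "continuous_on tri v" and eq: "\<And>p. p \<in> tri \<Longrightarrow> v p = (\<Psi> (1 - fst p) - \<Psi> (1 - snd p)) / 2 + Kop v p"
    using v by (auto simp: null_solution_def)
  have cs: "continuous_on tri (\<lambda>q. - v (prod.swap q))"
    by (intro continuous_intros continuous_on_tri_swap cv)
  have "(\<lambda>q. v q - (- v (prod.swap q))) (a, b) = 0"
  proof (rule Kop_fixed_point_zero[OF _ p])
    show "continuous_on tri (\<lambda>q. v q - (- v (prod.swap q)))" by (intro continuous_intros cv cs)
    fix x y assume "a \<le> x" "b \<le> y" "x + y \<le> 2"
    then have xy: "(x, y) \<in> tri" using tri_upward[OF p] by blast
    then have yx: "(y, x) \<in> tri" by (auto simp: tri_iff)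
    have c0: "continuous_on tri (\<lambda>q::real\<times>real. 0 :: real)" by simp
    have "Kop (\<lambda>q. 0 - v (prod.swap q)) (x, y) = Kop (\<lambda>q. 0) (x, y) - Kop (\<lambda>q. v (prod.swap q)) (x, y)"
      by (intro Kop_diff c0 continuous_on_tri_swap cv xy)
    also have "\<dots> = - Kop v (y, x)"
      using Kop_diff[OF c0 c0 xy] Kop_swap[OF cv xy] by simp
    finally have "Kop (\<lambda>q. v q - (- v (prod.swap q))) (x, y) = Kop v (x, y) + Kop v (y, x)"
      using Kop_diff[OF cv cs xy] by simp
    then show "v (x, y) - (- v (prod.swap (x, y))) = Kop (\<lambda>q. v q - (- v (prod.swap q))) (x, y)"
      using eq[OF xy] eq[OF yx] by (simp add: field_simps)
  qed
  then show ?thesis by simp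
qed

lemma null_solution_diagonal:
  assumes v: "null_solution \<Psi> v" and p: "(a, 2 - a) \<in> tri"
  shows "v (a, 2 - a) = (\<Psi> (1 - a) - \<Psi> (a - 1)) / 2"
  using v p J2_diagonal[of "J1 (pot v)" "2 - a"] by (auto simp: null_solution_def Kop_def)

lemma null_solution_C1:
  assumes v: "null_solution \<Psi> v" and \<psi>: "smooth_on {-1..1} \<psi>"
    and d: "\<And>x. x \<in> {-1..1} \<Longrightarrow> (\<Psi> has_real_derivative \<psi> x) (at x within {-1..1})"
  defines "v1 \<equiv> \<lambda>p. - 1 / 2 * \<psi> (1 - fst p) + - 1 * J1 (pot v) p"
    and "v2 \<equiv> \<lambda>p. 1 / 2 * \<psi> (1 - snd p) + - 1 * J2 (pot v) p"
  shows "v1 \<in> null_family v" "v2 \<in> null_family v" "tri_C1 v v1 v2"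
proof -
  show "v1 \<in> null_family v" "v2 \<in> null_family v"
    unfolding v1_def v2_def
    by (intro null_family.add null_family.mult null_family_const null_family.refl_fst null_family.refl_snd
        null_family.J1 null_family.J2 null_family_pot null_family.sol \<psi>)+
  have cv: "continuous_on tri v" using v unfolding null_solution_def by (rule conjunct1)
  note c = smooth_on_continuous[OF \<psi>]
  note * = tri_C1_add[OF tri_C1_mult[OF tri_C1_const[of "1/2"] tri_C1_fst_reflect[OF c d]]
      tri_C1_add[OF tri_C1_mult[OF tri_C1_const[of "- 1/2"] tri_C1_snd_reflect[OF c d]] tri_C1_Kop[OF cv]]]
  show "tri_C1 v v1 v2"
  proof (rule tri_C1_cong[OF *])
    fix p assume "p \<in> tri"
    then have "v p = (\<Psi> (1 - fst p) - \<Psi> (1 - snd p)) / 2 + Kop v p"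
      using v by (simp add: null_solution_def)
    then show "v p = 1 / 2 * \<Psi> (1 - fst p) + (- 1 / 2 * \<Psi> (1 - snd p) + Kop v p)" by simp
  qed (auto simp: v1_def v2_def)
qed

lemma at_within_Ici_neq_bot: "0 \<le> s \<Longrightarrow> at (s::real) within {0..} \<noteq> bot"
  using islimpt_subset[of s "{s..s + 1}" "{0..}"] by (auto simp: trivial_limit_within)

lemma time_deriv_eq:
  assumes "(g has_real_derivative d) (at s within {0..})" "0 \<le> s" "\<And>s. 0 \<le> s \<Longrightarrow> u s y = g s"
  shows "time_deriv u s y = d"
proof -
  have "((\<lambda>s. u s y) has_vector_derivative d) (at s within {0..})"
    using assms has_derivative_transform[of s "{0..}" "\<lambda>s. u s y" g]
    by (auto simp: has_vector_derivative_def has_field_derivative_def mult_commute_abs)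
  then show ?thesis
    unfolding time_deriv_def by (intro vector_derivative_within at_within_Ici_neq_bot assms)
qed

lemma space_deriv_eq:
  assumes "(g has_real_derivative d) (at y within {-1..1})" "y \<in> {-1<..<1}" "\<And>y. y \<in> {-1<..<1} \<Longrightarrow> u s y = g y"
  shows "space_deriv u s y = d"
proof -
  have "(g has_real_derivative d) (at y)"
    using assms(1,2) by (simp add: at_within_Icc_at)
  then have "(u s has_real_derivative d) (at y)"
    by (rule has_field_derivative_transform_within_open[of _ _ _ "{-1<..<1}"]) (use assms in auto)
  then show ?thesis by (simp add: space_deriv_def DERIV_imp_deriv)
qed

lemma null_solution_wave_op:
  assumes v: "tri_C1 v v1 v2" and 1: "tri_C1 v1 v11 (pot v)" and 2: "tri_C1 v2 (pot v) v22"
    and s: "0 \<le> s" and y: "y \<in> {-1<..<1}"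
  shows "wave_op (\<lambda>s y. v (nc (s, y))) s y = 0"
    and "time_deriv (\<lambda>s y. v (nc (s, y))) s y = - (fst (nc (s, y)) * v1 (nc (s, y)) + snd (nc (s, y)) * v2 (nc (s, y)))"
    and "space_deriv (\<lambda>s y. v (nc (s, y))) s y = (fst (nc (s, y)) + snd (nc (s, y))) / 2 * (v2 (nc (s, y)) - v1 (nc (s, y)))"
proof -
  let ?u = "\<lambda>s y. v (nc (s, y))"
  \<comment> \<open>\<open>T\<close> and \<open>Y\<close> are the time and the space derivative as
    functions on the triangle. They are again continuously differentiable there, so the chain rule
    applies a second time.\<close>
  define T where "T p = - 1 * (fst p * v1 p + snd p * v2 p)" for p :: "real \<times> real"
  define Y where "Y p = (1 / 2 * (fst p + snd p)) * (v2 p + - 1 * v1 p)" for p :: "real \<times> real"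
  note CT = tri_C1_mult[OF tri_C1_const[of "-1"] tri_C1_add[OF tri_C1_mult[OF tri_C1_fst 1] tri_C1_mult[OF tri_C1_snd 2]],
      folded T_def]
  note CY = tri_C1_mult[OF tri_C1_mult[OF tri_C1_const[of "1/2"] tri_C1_add[OF tri_C1_fst tri_C1_snd]]
      tri_C1_add[OF 2 tri_C1_mult[OF tri_C1_const[of "-1"] 1]], folded Y_def]
  have t: "time_deriv ?u s y = T (nc (s, y))" if "0 \<le> s" "y \<in> {-1<..<1}" for s y
    by (rule trans[OF time_deriv_eq[OF tri_C1_nc_time[OF v]]]) (use that in \<open>auto simp: T_def\<close>)
  have x: "space_deriv ?u s y = Y (nc (s, y))" if "0 \<le> s" "y \<in> {-1<..<1}" for s y
    by (rule trans[OF space_deriv_eq[OF tri_C1_nc_space[OF v]]]) (use that in \<open>auto simp: Y_def\<close>)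
  show "time_deriv ?u s y = - (fst (nc (s, y)) * v1 (nc (s, y)) + snd (nc (s, y)) * v2 (nc (s, y)))"
    "space_deriv ?u s y = (fst (nc (s, y)) + snd (nc (s, y))) / 2 * (v2 (nc (s, y)) - v1 (nc (s, y)))"
    using t[OF s y] x[OF s y] by (simp_all add: T_def Y_def)
  define e where "e = exp (- s)"
  have e: "e > 0" by (simp add: e_def)
  have yI: "y \<in> {-1..1}" using y by auto
  have fs: "fst (nc (s, y)) = e * (1 - y)" "snd (nc (s, y)) = e * (1 + y)"
    by (simp_all add: nc_def e_def)
  have tt: "time_deriv (time_deriv ?u) s y = (let p = nc (s, y); a = e * (1 - y); b = e * (1 + y) in
      a * (v1 p + a * v11 p + b * pot v p) + b * (a * pot v p + v2 p + b * v22 p))"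
    by (rule trans[OF time_deriv_eq[OF tri_C1_nc_time[OF CT s yI] s]])
      (use t y in \<open>auto simp: fs Let_def algebra_simps\<close>)
  have tx: "time_deriv (space_deriv ?u) s y = (let p = nc (s, y); a = e * (1 - y); b = e * (1 + y) in
      - e * (v2 p - v1 p) - e * (a * pot v p - a * v11 p + b * v22 p - b * pot v p))"
    by (rule trans[OF time_deriv_eq[OF tri_C1_nc_time[OF CY s yI] s]])
      (use x y in \<open>auto simp: fs Let_def field_simps\<close>)
  have xx: "space_deriv (space_deriv ?u) s y = (let p = nc (s, y) in e * e * (v22 p - pot v p - pot v p + v11 p))"
    by (rule trans[OF space_deriv_eq[OF tri_C1_nc_space[OF CY s yI] y]])
      (use x s in \<open>auto simp: fs Let_def field_simps\<close>)
  \<comment> \<open>Since \<open>a + b = 2 * e\<close>, the term of order zero is a multiple of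
    \<open>pot v\<close>. The mixed second derivatives are \<open>pot v\<close> as well, and what
    remains is a polynomial identity.\<close>
  have N: "v (nc (s, y)) = 4 * (e * e) * pot v (nc (s, y))"
    using e by (simp add: pot_def fs power2_eq_square field_simps)
  show "wave_op ?u s y = 0"
    unfolding wave_op_def tt tx xx t[OF s y] x[OF s y] T_def Y_def fs Let_def N
    by algebra
qed

section \<open>Odd initial data and their profile\<close>

lemma smooth_odd_derivative:
  assumes "smooth_odd f"
  shows "\<exists>f'. smooth_on {-1..1} f' \<and> (\<forall>x. f' (- x) = f' x) \<and>
    (\<forall>x\<in>{-1..1}. (f has_real_derivative f' x) (at x within {-1..1}))"
proof -
  obtain d where d: "smooth_on {-1..1} d" "\<And>x. x \<in> {-1..1} \<Longrightarrow> (f has_real_derivative d x) (at x within {-1..1})"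
    using smooth_on_real_derivative[of "{-1..1}" f] assms by (auto simp: smooth_odd_def)
  \<comment> \<open>The derivative of \<open>f\<close> is even on \<open>{-1..1}\<close> at first;
    symmetrising makes it even on the whole line and keeps its values on the interval.\<close>
  define f' where "f' x = (1 / 2) * (d x + d (- x))" for x
  have "smooth_on {-1..1} f'"
    unfolding f'_def[abs_def] by (intro smooth_on_mult smooth_on_add smooth_on_const smooth_on_reflect d)
  moreover have "f' (- x) = f' x" for x by (simp add: f'_def)
  moreover have "(f has_real_derivative f' x) (at x within {-1..1})" if x: "x \<in> {-1..1}" for x
  proof -
    have r: "((f \<circ> uminus) has_real_derivative d (- x) * (- 1)) (at x within {-1..1})"
      using d(2)[of "- x"] x by (intro DERIV_image_chain) (auto intro!: derivative_eq_intros)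
    have "((\<lambda>x. (1 / 2) * (f x - (f \<circ> uminus) x)) has_real_derivative (1 / 2) * (d x - d (- x) * (- 1))) (at x within {-1..1})"
      by (intro DERIV_cmult DERIV_diff d x r)
    then have "((\<lambda>x. (1 / 2) * (f x - (f \<circ> uminus) x)) has_real_derivative f' x) (at x within {-1..1})"
      by (simp add: f'_def)
    then show ?thesis
      unfolding has_field_derivative_def
      by (rule has_derivative_transform[OF x, rotated]) (use assms in \<open>auto simp: smooth_odd_def\<close>)
  qed
  ultimately show ?thesis by blast
qed

text \<open>The derivative of \<open>\<Psi>\<close> is the part of the initial data that is carried by either null coordinate.\<close>

definition profile :: "(real \<Rightarrow> real) \<Rightarrow> (real \<Rightarrow> real) \<Rightarrow> (real \<Rightarrow> real) \<Rightarrow> (real \<Rightarrow> real) \<Rightarrow> bool" where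
  "profile f f' g \<Psi> \<longleftrightarrow> smooth_on {-1..1} f' \<and> (\<forall>x. f' (- x) = f' x) \<and>
     (\<forall>x\<in>{-1..1}. (f has_real_derivative f' x) (at x within {-1..1})) \<and>
     (\<forall>x\<in>{-1..1}. (\<Psi> has_real_derivative (1 + x) * f' x + g x) (at x within {-1..1}))"

lemma profile_exists:
  assumes "smooth_odd f" "smooth_odd g"
  shows "\<exists>f' \<Psi>. profile f f' g \<Psi>"
proof -
  obtain f' where f': "smooth_on {-1..1} f'" "\<And>x. f' (- x) = f' x"
    "\<And>x. x \<in> {-1..1} \<Longrightarrow> (f has_real_derivative f' x) (at x within {-1..1})"
    using smooth_odd_derivative[OF assms(1)] by blast
  have "continuous_on {-1..1} (\<lambda>x. (1 + x) * f' x + g x)"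
    using smooth_on_continuous f'(1) assms(2) by (intro continuous_intros) (auto simp: smooth_odd_def)
  then have "\<And>x. x \<in> {-1..1} \<Longrightarrow> ((\<lambda>x. integral {-1..x} (\<lambda>x. (1 + x) * f' x + g x)) has_real_derivative
      (1 + x) * f' x + g x) (at x within {-1..1})"
    by (rule integral_has_real_derivative)
  with f' show ?thesis unfolding profile_def by blast
qed

lemma profile_smooth:
  assumes "profile f f' g \<Psi>" "smooth_odd g"
  shows "smooth_on {-1..1} (\<lambda>x. (1 + x) * f' x + g x)" "continuous_on {-1..1} \<Psi>"
proof -
  show "smooth_on {-1..1} (\<lambda>x. (1 + x) * f' x + g x)"
    using assms by (intro smooth_on_add smooth_on_mult smooth_on_const smooth_on_id) (auto simp: profile_def smooth_odd_def)
  show "continuous_on {-1..1} \<Psi>"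
    using assms(1) by (intro DERIV_continuous_on) (auto simp: profile_def)
qed

text \<open>For even \<open>f'\<close> and odd \<open>g\<close> the derivatives of
  \<open>\<Psi> x\<close> and of \<open>- \<Psi> (- x)\<close> add up to \<open>2 * f' x\<close>, so
  the two sides differ by a constant, which is zero because \<open>f 0 = 0\<close>.\<close>

lemma profile_odd_part:
  assumes p: "profile f f' g \<Psi>" and f: "smooth_odd f" and g: "smooth_odd g" and y: "y \<in> {-1..1}"
  shows "(\<Psi> y - \<Psi> (- y)) / 2 = f y"
proof -
  define G where "G y = \<Psi> y - \<Psi> (- y) - 2 * f y" for y
  have "(G has_real_derivative 0) (at x within {-1..1})" if x: "x \<in> {-1..1}" for x
  proof -
    have x': "- x \<in> {-1..1}" using x by auto
    have "(\<Psi> has_real_derivative (1 + - x) * f' (- x) + g (- x)) (at (- x) within {-1..1})"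
      using p x' unfolding profile_def by blast
    then have "((\<Psi> \<circ> uminus) has_real_derivative ((1 + - x) * f' (- x) + g (- x)) * (- 1)) (at x within {-1..1})"
      by (intro DERIV_image_chain) (auto intro!: derivative_eq_intros)
    moreover have "(\<Psi> has_real_derivative (1 + x) * f' x + g x) (at x within {-1..1})"
      "(f has_real_derivative f' x) (at x within {-1..1})"
      using p x by (auto simp: profile_def)
    ultimately have "((\<lambda>y. \<Psi> y - (\<Psi> \<circ> uminus) y - 2 * f y) has_real_derivative
        ((1 + x) * f' x + g x) - ((1 + - x) * f' (- x) + g (- x)) * (- 1) - 2 * f' x) (at x within {-1..1})"
      by (intro DERIV_diff DERIV_cmult)
    moreover have "((1 + x) * f' x + g x) - ((1 + - x) * f' (- x) + g (- x)) * (- 1) - 2 * f' x = 0"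
      using p g x by (simp add: profile_def smooth_odd_def algebra_simps)
    ultimately show ?thesis by (simp add: G_def[abs_def] o_def)
  qed
  then have "\<exists>c. \<forall>x\<in>{-1..1}. G x = c"
    by (intro has_field_derivative_zero_constant) auto
  then have "G y = G 0" using y by force
  moreover have "f 0 = 0" using f unfolding smooth_odd_def by (metis add.inverse_neutral atLeastAtMost_iff
      equal_neg_zero neg_le_0_iff_le zero_le_one)
  ultimately show ?thesis by (simp add: G_def)
qed

text \<open>Smoothness is claimed up to \<open>y = \<plusminus>1\<close>, so that each time slice is
  again a smooth function on the closed interval.\<close>

theorem null_solution_is_wave_solution:
  assumes f: "smooth_odd f" and g: "smooth_odd g" and p: "profile f f' g \<Psi>" and v: "null_solution \<Psi> v"
  shows "is_wave_solution f g (\<lambda>s y. v (nc (s, y)))"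
    and "smooth_on ({0..} \<times> {-1..1}) (\<lambda>q. v (nc q))"
    and "\<exists>v1 v2. tri_C1 v v1 v2"
proof -
  let ?u = "\<lambda>s y. v (nc (s, y))"
  \<comment> \<open>On the initial line \<open>f' = v2 - v1\<close> and
    \<open>g = - ((1 - y) * v1 + (1 + y) * v2)\<close>; solving for \<open>v1\<close> gives
    \<open>- 2 * v1 = (1 + y) * f' + g\<close>.\<close>
  define \<psi> where "\<psi> = (\<lambda>x. (1 + x) * f' x + g x)"
  have \<psi>: "smooth_on {-1..1} \<psi>" unfolding \<psi>_def by (rule profile_smooth[OF p g])
  have d: "\<And>x. x \<in> {-1..1} \<Longrightarrow> (\<Psi> has_real_derivative \<psi> x) (at x within {-1..1})"
    using p by (simp add: profile_def \<psi>_def)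
  define v1 where "v1 = (\<lambda>p. - 1 / 2 * \<psi> (1 - fst p) + - 1 * J1 (pot v) p)"
  define v2 where "v2 = (\<lambda>p. 1 / 2 * \<psi> (1 - snd p) + - 1 * J2 (pot v) p)"
  have F: "v1 \<in> null_family v" "v2 \<in> null_family v" "tri_C1 v v1 v2"
    unfolding v1_def v2_def using null_solution_C1[OF v \<psi> d] by blast+
  then show "\<exists>v1 v2. tri_C1 v v1 v2" by blast
  show smooth: "smooth_on ({0..} \<times> {-1..1}) (\<lambda>q. v (nc q))"
    by (rule null_family_smooth[OF F null_family.sol])
  have cv: "continuous_on tri v" using v unfolding null_solution_def by (rule conjunct1)
  obtain w1 w2 where w: "tri_C1 (pot v) w1 w2"
    using null_family_C1[OF F null_family_pot[OF null_family.sol]] by blast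
  obtain \<psi>' where \<psi>': "smooth_on {-1..1} \<psi>'" "\<And>x. x \<in> {-1..1} \<Longrightarrow> (\<psi> has_real_derivative \<psi>' x) (at x within {-1..1})"
    using smooth_on_real_derivative[OF \<psi>] by blast
  note c' = smooth_on_continuous[OF \<psi>'(1)]
  define v11 where "v11 = (\<lambda>p. 1 / 2 * \<psi>' (1 - fst p) - (- 1 * pot v (fst p, 2 - fst p) + J1 w1 p))"
  define v22 where "v22 = (\<lambda>p. - 1 / 2 * \<psi>' (1 - snd p) - (- 1 * pot v (2 - snd p, snd p) + J2 w2 p))"
  have C1: "tri_C1 v1 v11 (pot v)"
    by (rule tri_C1_cong[OF tri_C1_add[OF tri_C1_mult[OF tri_C1_const[of "- 1/2"] tri_C1_fst_reflect[OF c' \<psi>'(2)]]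
        tri_C1_mult[OF tri_C1_const[of "-1"] tri_C1_J1[OF w]]]]) (auto simp: v1_def v11_def)
  have C2: "tri_C1 v2 (pot v) v22"
    by (rule tri_C1_cong[OF tri_C1_add[OF tri_C1_mult[OF tri_C1_const[of "1/2"] tri_C1_snd_reflect[OF c' \<psi>'(2)]]
        tri_C1_mult[OF tri_C1_const[of "-1"] tri_C1_J2[OF w]]]]) (auto simp: v2_def v22_def)
  note W = null_solution_wave_op[OF F(3) C1 C2]
  have init: "v (nc (0, y)) = f y" if "y \<in> {-1<..<1}" for y
    using null_solution_diagonal[OF v, of "1 - y"] profile_odd_part[OF p f g, of y] that
    by (simp add: nc_zero tri_iff)
  have init': "time_deriv ?u 0 y = g y" if y: "y \<in> {-1<..<1}" for y
  proof -
    have "f' (- y) = f' y" "g (- y) = - g y" using p g y by (auto simp: profile_def smooth_odd_def)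
    moreover have "J1 (pot v) (1 - y, 1 + y) = 0" "J2 (pot v) (1 - y, 1 + y) = 0"
      using J1_diagonal[of "pot v" "1 - y"] J2_diagonal[of "pot v" "1 + y"] by (simp_all add: algebra_simps)
    ultimately show ?thesis
      using W(2)[OF order_refl y] by (simp add: nc_zero v1_def v2_def \<psi>_def field_simps)
  qed
  have energy: "finite_energy (?u s) (time_deriv ?u s)" if s: "0 \<le> s" for s
  proof -
    have cnc: "continuous_on {-1..1} (\<lambda>y. w (nc (s, y)))" if "continuous_on tri w" for w :: "real \<times> real \<Rightarrow> real"
      by (rule continuous_on_compose2[OF that]) (use s in \<open>auto simp: nc_def[abs_def] nc_in_tri[unfolded nc_def, simplified] intro!: continuous_intros\<close>)
    have cfs: "continuous_on {-1..1} (\<lambda>y. fst (nc (s, y)))" "continuous_on {-1..1} (\<lambda>y. snd (nc (s, y)))"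
      by (auto simp: nc_def intro!: continuous_intros)
    define Y where "Y y = (fst (nc (s, y)) + snd (nc (s, y))) / 2 * (v2 (nc (s, y)) - v1 (nc (s, y)))" for y
    define T where "T y = - (fst (nc (s, y)) * v1 (nc (s, y)) + snd (nc (s, y)) * v2 (nc (s, y)))" for y
    have "continuous_on {-1..1} Y" "continuous_on {-1..1} T"
      unfolding Y_def[abs_def] T_def[abs_def]
      by (intro continuous_intros cfs cnc tri_C1_D(2)[OF F(3)] tri_C1_D(3)[OF F(3)]; simp)+
    then have "set_integrable lborel {-1..1} (\<lambda>y. (1 - y\<^sup>2) * \<bar>Y y\<bar>\<^sup>2)" "set_integrable lborel {-1..1} (\<lambda>y. \<bar>T y\<bar>\<^sup>2)"
      by (intro borel_integrable_atLeastAtMost' continuous_intros; simp)+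
    then have "set_integrable lborel {-1<..<1} (\<lambda>y. (1 - y\<^sup>2) * \<bar>Y y\<bar>\<^sup>2)" "set_integrable lborel {-1<..<1} (\<lambda>y. \<bar>T y\<bar>\<^sup>2)"
      by (auto elim!: set_integrable_subset)
    moreover have "deriv (?u s) y = Y y" "time_deriv ?u s y = T y" if "y \<in> {-1<..<1}" for y
      using W(2,3)[OF s that] by (simp_all add: Y_def T_def space_deriv_def)
    then have "set_integrable lborel {-1<..<1} (\<lambda>y. (1 - y\<^sup>2) * \<bar>deriv (?u s) y\<bar>\<^sup>2) =
        set_integrable lborel {-1<..<1} (\<lambda>y. (1 - y\<^sup>2) * \<bar>Y y\<bar>\<^sup>2)"
      "set_integrable lborel {-1<..<1} (\<lambda>y. \<bar>time_deriv ?u s y\<bar>\<^sup>2) = set_integrable lborel {-1<..<1} (\<lambda>y. \<bar>T y\<bar>\<^sup>2)"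
      by (intro set_integrable_cong; simp)+
    ultimately show ?thesis
      unfolding finite_energy_def by blast
  qed
  have "smooth_on ({0..} \<times> {-1<..<1}) (\<lambda>q. v (nc q))"
    by (rule smooth_on_subset[OF smooth]) auto
  then show "is_wave_solution f g ?u"
    unfolding is_wave_solution_def using W(1) init init' energy by (auto simp: case_prod_unfold)
qed

section \<open>Uniqueness of the wave solution\<close>

text \<open>\<open>D vs\<close> plays the role of the iterated derivative in the directions \<open>vs\<close>.\<close>

definition jet_on :: "(real \<times> real) set \<Rightarrow> ((real \<times> real) list \<Rightarrow> real \<times> real \<Rightarrow> real) \<Rightarrow> bool" where
  "jet_on A D \<longleftrightarrow> (\<forall>vs. \<forall>q\<in>A. (D vs has_derivative (\<lambda>v. D (v # vs) q)) (at q within A))"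

abbreviation cyl :: "(real \<times> real) set" where "cyl \<equiv> {0..} \<times> {-1<..<1}"

lemma jet_linear:
  assumes "jet_on A D" "q \<in> A"
  shows "D (v # vs) q = fst v * D ((1, 0) # vs) q + snd v * D ((0, 1) # vs) q"
proof -
  have lin: "linear (\<lambda>v. D (v # vs) q)"
    by (rule has_derivative_linear) (use assms in \<open>auto simp: jet_on_def\<close>)
  have "v = fst v *\<^sub>R (1, 0) + snd v *\<^sub>R (0, 1)" by (cases v) simp
  then have "D (v # vs) q = D ((fst v *\<^sub>R (1, 0) + snd v *\<^sub>R (0, 1)) # vs) q" by simp
  then show ?thesis
    by (simp only: linear_add[OF lin] linear_scale[OF lin] real_scaleR_def)
qed

lemma jet_chain:
  assumes D: "jet_on A D" and c: "c ` S \<subseteq> A" "x \<in> S"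
    and "(c has_vector_derivative (\<alpha>, \<beta>)) (at x within S)"
  shows "((\<lambda>x. D vs (c x)) has_real_derivative \<alpha> * D ((1, 0) # vs) (c x) + \<beta> * D ((0, 1) # vs) (c x)) (at x within S)"
proof -
  have cx: "c x \<in> A" using c by auto
  have "((\<lambda>x. D vs (c x)) has_derivative (\<lambda>h. D ((h *\<^sub>R (\<alpha>, \<beta>)) # vs) (c x))) (at x within S)"
    by (rule has_derivative_in_compose2[where t = A and g' = "\<lambda>q v. D (v # vs) q"])
      (use assms in \<open>auto simp: jet_on_def has_vector_derivative_def\<close>)
  then show ?thesis
    unfolding has_field_derivative_def
    by (rule has_derivative_eq_rhs) (auto simp: jet_linear[OF D cx, of "(_ * \<alpha>, _ * \<beta>)"] fun_eq_iff algebra_simps)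
qed

lemma jet_time:
  assumes D: "jet_on cyl D" "0 \<le> s" "y \<in> {-1<..<1}"
  shows "((\<lambda>s. D vs (s, y)) has_real_derivative D ((1, 0) # vs) (s, y)) (at s within {0..})"
proof -
  have "((\<lambda>s. (s, y)) has_vector_derivative (1, 0)) (at s within {0..})"
    by (intro has_vector_derivative_Pair has_vector_derivative_const has_vector_derivative_id)
  from jet_chain[OF D(1) _ _ this, of vs] show ?thesis using assms by (auto simp: image_subset_iff)
qed

lemma jet_space:
  assumes D: "jet_on cyl D" "0 \<le> s" "y \<in> {-1<..<1}"
  shows "((\<lambda>y. D vs (s, y)) has_real_derivative D ((0, 1) # vs) (s, y)) (at y)"
proof -
  have "((\<lambda>y. D vs (s, y)) has_real_derivative D ((0, 1) # vs) (s, y)) (at y within {-1<..<1})"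
  proof -
    have "((\<lambda>y. (s, y)) has_vector_derivative (0, 1)) (at y within {-1<..<1})"
      by (intro has_vector_derivative_Pair has_vector_derivative_const has_vector_derivative_id)
    from jet_chain[OF D(1) _ _ this, of vs] show ?thesis using assms by (auto simp: image_subset_iff)
  qed
  then show ?thesis using D(3) at_within_open[of y "{-1<..<1}"] by simp
qed

lemma jet_continuous:
  assumes "jet_on A D" shows "continuous_on A (D vs)"
  using assms unfolding jet_on_def continuous_on_eq_continuous_within by (blast intro: has_derivative_continuous)

text \<open>The domain is closed at \<open>s = 0\<close>, and the symmetry is needed up to this
  boundary. Differentiation under the integral sign writes the space increment of the time
  derivative as an integral, and this integral is differentiated in \<open>y\<close>.\<close>

lemma jet_symmetric:
  assumes D: "jet_on cyl D" and s: "0 \<le> s" and y: "y \<in> {-1<..<1}"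
  shows "D ((0, 1) # (1, 0) # vs) (s, y) = D ((1, 0) # (0, 1) # vs) (s, y)"
proof -
  define l r where "l = (y - 1) / 2" and "r = (y + 1) / 2"
  have lr: "-1 < l" "l < y" "y < r" "r < 1" using y by (auto simp: l_def r_def field_simps)
  have sub: "continuous_on {l..x} (\<lambda>\<eta>. D vs (s, \<eta>))" if "x \<le> r" "0 \<le> s" for x vs s
    by (rule continuous_on_compose2[OF jet_continuous[OF D, of vs]])
      (use lr that in \<open>auto intro!: continuous_intros\<close>)
  have eq: "D ((1, 0) # vs) (s, x) - D ((1, 0) # vs) (s, l) = integral {l..x} (\<lambda>\<eta>. D ((1, 0) # (0, 1) # vs) (s, \<eta>))"
    if x: "l \<le> x" "x \<le> r" for x
  proof -
    have "((\<lambda>\<sigma>. integral (cbox l x) (\<lambda>\<eta>. D ((0, 1) # vs) (\<sigma>, \<eta>))) has_real_derivative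
        integral (cbox l x) (\<lambda>\<eta>. D ((1, 0) # (0, 1) # vs) (s, \<eta>))) (at s within {0..})"
    proof (rule leibniz_rule_field_derivative)
      fix \<sigma> \<eta> :: real assume "\<sigma> \<in> {0..}" "\<eta> \<in> cbox l x"
      then show "((\<lambda>\<sigma>. D ((0, 1) # vs) (\<sigma>, \<eta>)) has_real_derivative D ((1, 0) # (0, 1) # vs) (\<sigma>, \<eta>)) (at \<sigma> within {0..})"
        using lr x by (intro jet_time[OF D]) auto
    next
      fix \<sigma> :: real assume "\<sigma> \<in> {0..}"
      then show "(\<lambda>\<eta>. D ((0, 1) # vs) (\<sigma>, \<eta>)) integrable_on cbox l x"
        using sub[OF x(2), of \<sigma>] by (auto intro: integrable_continuous_real)
    next
      show "continuous_on ({0..} \<times> cbox l x) (\<lambda>(\<sigma>, \<eta>). D ((1, 0) # (0, 1) # vs) (\<sigma>, \<eta>))"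
        unfolding case_prod_unfold prod.collapse
        by (rule continuous_on_subset[OF jet_continuous[OF D]]) (use lr x in auto)
    qed (use s in auto)
    moreover have "integral (cbox l x) (\<lambda>\<eta>. D ((0, 1) # vs) (\<sigma>, \<eta>)) = D vs (\<sigma>, x) - D vs (\<sigma>, l)" if "0 \<le> \<sigma>" for \<sigma>
    proof -
      have "((\<lambda>\<eta>. D ((0, 1) # vs) (\<sigma>, \<eta>)) has_integral (D vs (\<sigma>, x) - D vs (\<sigma>, l))) {l..x}"
      proof (rule fundamental_theorem_of_calculus[where f = "\<lambda>\<eta>. D vs (\<sigma>, \<eta>)"])
        fix z assume "z \<in> {l..x}"
        then have "((\<lambda>\<eta>. D vs (\<sigma>, \<eta>)) has_real_derivative D ((0, 1) # vs) (\<sigma>, z)) (at z within {l..x})"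
          using x lr by (intro has_field_derivative_at_within[OF jet_space[OF D that]]) auto
        then show "((\<lambda>\<eta>. D vs (\<sigma>, \<eta>)) has_vector_derivative D ((0, 1) # vs) (\<sigma>, z)) (at z within {l..x})"
          by (simp add: has_real_derivative_iff_has_vector_derivative)
      qed (use x in auto)
      then show ?thesis by (simp add: integral_unique)
    qed
    \<comment> \<open>\<open>time_deriv\<close> serves here to express the uniqueness of one-sided
      derivatives; the space argument 0 is a dummy.\<close>
    ultimately have "time_deriv (\<lambda>\<sigma> _. D vs (\<sigma>, x) - D vs (\<sigma>, l)) s 0 =
        integral (cbox l x) (\<lambda>\<eta>. D ((1, 0) # (0, 1) # vs) (s, \<eta>))"
      using s by (intro time_deriv_eq[where g = "\<lambda>\<sigma>. integral (cbox l x) (\<lambda>\<eta>. D ((0, 1) # vs) (\<sigma>, \<eta>))"]) auto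
    moreover have "time_deriv (\<lambda>\<sigma> _. D vs (\<sigma>, x) - D vs (\<sigma>, l)) s 0 = D ((1, 0) # vs) (s, x) - D ((1, 0) # vs) (s, l)"
      using lr x by (intro time_deriv_eq[OF DERIV_diff[OF jet_time[OF D s] jet_time[OF D s]] s]) auto
    ultimately show ?thesis by simp
  qed
  have "((\<lambda>x. integral {l..x} (\<lambda>\<eta>. D ((1, 0) # (0, 1) # vs) (s, \<eta>))) has_real_derivative
      D ((1, 0) # (0, 1) # vs) (s, y)) (at y within {l..r})"
    using lr by (intro integral_has_real_derivative sub s) auto
  then have "((\<lambda>x. integral {l..x} (\<lambda>\<eta>. D ((1, 0) # (0, 1) # vs) (s, \<eta>)) + D ((1, 0) # vs) (s, l)) has_real_derivative
      D ((1, 0) # (0, 1) # vs) (s, y)) (at y)"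
    using lr by (simp add: at_within_Icc_at) (auto intro!: derivative_eq_intros)
  then have "((\<lambda>x. D ((1, 0) # vs) (s, x)) has_real_derivative D ((1, 0) # (0, 1) # vs) (s, y)) (at y)"
    by (rule has_field_derivative_transform_within_open[of _ _ _ "{l<..<r}"]) (use lr eq in \<open>auto simp: algebra_simps simp flip: eq\<close>)
  then show ?thesis
    using jet_space[OF D s y, of "(1, 0) # vs"] DERIV_unique by blast
qed

section \<open>From the wave equation back to the integral equation\<close>

definition cn :: "real \<times> real \<Rightarrow> real \<times> real" where
  "cn p = (- ln ((fst p + snd p) / 2), (snd p - fst p) / (fst p + snd p))"

lemma cn_nc: "cn (nc (s, y)) = (s, y)"
proof -
  have "fst (nc (s, y)) + snd (nc (s, y)) = 2 * exp (- s)" using nc_sum[of "(s, y)"] by simp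
  moreover have "snd (nc (s, y)) - fst (nc (s, y)) = 2 * exp (- s) * y" by (simp add: nc_def algebra_simps)
  ultimately show ?thesis by (simp add: cn_def)
qed

lemma cn_in_cyl:
  assumes "0 < a" "0 < b" "a + b \<le> 2"
  shows "cn (a, b) \<in> cyl"
  using assms by (auto simp: cn_def field_simps)

lemma cn_fst_deriv:
  assumes "0 < a + b"
  shows "((\<lambda>x. cn (x, b)) has_vector_derivative (- 1 / (a + b), - 2 * b / (a + b)\<^sup>2)) (at a within S)"
  unfolding cn_def using assms
  by (auto intro!: has_vector_derivative_Pair derivative_eq_intros
      simp: has_real_derivative_iff_has_vector_derivative[symmetric] field_simps power2_eq_square)

lemma cn_snd_deriv:
  assumes "0 < a + b"
  shows "((\<lambda>x. cn (a, x)) has_vector_derivative (- 1 / (a + b), 2 * a / (a + b)\<^sup>2)) (at b within S)"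
  unfolding cn_def using assms
  by (auto intro!: has_vector_derivative_Pair derivative_eq_intros
      simp: has_real_derivative_iff_has_vector_derivative[symmetric] field_simps power2_eq_square)

text \<open>\<open>P\<close> is the \<open>a\<close>-derivative of the solution in null coordinates.
  The wave equation says that the \<open>b\<close>-derivative of \<open>P\<close> is the potential
  term; with zero data two integrations give a fixed point of \<open>Kop\<close>, which vanishes.
  The argument stays at positive \<open>a\<close> and \<open>b\<close>, away from
  \<open>y = \<plusminus>1\<close>.\<close>

lemma wave_jet_zero:
  assumes D: "jet_on cyl D"
    and pde: "\<And>s y. s > 0 \<Longrightarrow> y \<in> {-1<..<1} \<Longrightarrow>
      D [(1, 0), (1, 0)] (s, y) + 2 * y * D [(1, 0), (0, 1)] (s, y) + D [(1, 0)] (s, y)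
      - (1 - y\<^sup>2) * D [(0, 1), (0, 1)] (s, y) + 2 * y * D [(0, 1)] (s, y) - D [] (s, y) = 0"
    and init: "\<And>y. y \<in> {-1<..<1} \<Longrightarrow> D [] (0, y) = 0" "\<And>y. y \<in> {-1<..<1} \<Longrightarrow> D [(1, 0)] (0, y) = 0"
    and s: "0 \<le> s" and y: "y \<in> {-1<..<1}"
  shows "D [] (s, y) = 0"
proof -
  define \<omega> where "\<omega> p = D [] (cn p)" for p
  define P where "P p = - (1 / (fst p + snd p)) * D [(1, 0)] (cn p) - 2 * snd p / (fst p + snd p)\<^sup>2 * D [(0, 1)] (cn p)" for p
  have init3: "D [(0, 1)] (0, y) = 0" if "y \<in> {-1<..<1}" for y
  proof -
    have "((\<lambda>y. D [] (0, y)) has_real_derivative 0) (at y)"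
      by (rule has_field_derivative_transform_within_open[of "\<lambda>_. 0" _ _ "{-1<..<1}"]) (use init(1) that in auto)
    then show ?thesis using jet_space[OF D order_refl that, of "[]"] DERIV_unique by blast
  qed
  have d1: "((\<lambda>x. \<omega> (x, b)) has_real_derivative P (a, b)) (at a within {x. 0 < x \<and> x + b \<le> 2})"
    if "0 < a" "0 < b" "a + b \<le> 2" for a b
    unfolding \<omega>_def P_def using jet_chain[OF D, of "\<lambda>x. cn (x, b)" "{x. 0 < x \<and> x + b \<le> 2}" a
        "- 1 / (a + b)" "- 2 * b / (a + b)\<^sup>2" "[]", OF _ _ cn_fst_deriv] that cn_in_cyl by fastforce
  have D2: "((\<lambda>x. D vs (cn (a, x))) has_real_derivative - 1 / (a + b) * D ((1, 0) # vs) (cn (a, b))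
       + 2 * a / (a + b)\<^sup>2 * D ((0, 1) # vs) (cn (a, b))) (at b within {x. 0 < x \<and> a + x \<le> 2})"
    if "0 < a" "0 < b" "a + b \<le> 2" for a b vs
    using jet_chain[OF D, of "\<lambda>x. cn (a, x)" "{x. 0 < x \<and> a + x \<le> 2}" b
        "- 1 / (a + b)" "2 * a / (a + b)\<^sup>2" vs, OF _ _ cn_snd_deriv] that cn_in_cyl by fastforce
  have d2: "((\<lambda>x. P (a, x)) has_real_derivative pot \<omega> (a, b)) (at b within {x. 0 < x \<and> a + x \<le> 2})"
    if "0 < a" "0 < b" "a + b < 2" for a b
  proof -
    have S: "a + b > 0" "a + b \<noteq> 0" using that by auto
    obtain \<sigma> \<eta> where se: "cn (a, b) = (\<sigma>, \<eta>)" by (cases "cn (a, b)")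
    have \<eta>: "\<eta> = (b - a) / (a + b)" "\<sigma> = - ln ((a + b) / 2)" using se by (auto simp: cn_def)
    have \<sigma>: "\<sigma> > 0" using that by (simp add: \<eta> ln_less_zero)
    have \<eta>I: "\<eta> \<in> {-1<..<1}" using cn_in_cyl[of a b] that se by auto
    have sym: "D [(0, 1), (1, 0)] (\<sigma>, \<eta>) = D [(1, 0), (0, 1)] (\<sigma>, \<eta>)"
      using jet_symmetric[OF D _ \<eta>I, of \<sigma> "[]"] \<sigma> by simp
    note pde' = pde[OF \<sigma> \<eta>I]
    have q: "(2 * S\<^sup>2 - 2 * b * (2 * S)) / (S\<^sup>2 * S\<^sup>2) = 2 / S\<^sup>2 - 4 * b / S ^ 3" if "S \<noteq> 0" for S
      using that by (simp add: field_simps eval_nat_numeral)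
    have r1: "((\<lambda>x. - (1 / (a + x))) has_real_derivative 1 / (a + b)\<^sup>2) (at b within T)" for T
      using S by (auto intro!: derivative_eq_intros simp: field_simps eval_nat_numeral)
    have r2: "((\<lambda>x. 2 * x / (a + x)\<^sup>2) has_real_derivative 2 / (a + b)\<^sup>2 - 4 * b / (a + b) ^ 3) (at b within T)" for T
      unfolding q[OF S(2), symmetric] using S by (auto intro!: derivative_eq_intros)
    have "((\<lambda>x. P (a, x)) has_real_derivative
       (1 / (a + b)\<^sup>2 * D [(1, 0)] (cn (a, b)) + (- 1 / (a + b) * D [(1, 0), (1, 0)] (cn (a, b))
       + 2 * a / (a + b)\<^sup>2 * D [(0, 1), (1, 0)] (cn (a, b))) * - (1 / (a + b)))
       - ((2 / (a + b)\<^sup>2 - 4 * b / (a + b) ^ 3) * D [(0, 1)] (cn (a, b)) + (- 1 / (a + b) * D [(1, 0), (0, 1)] (cn (a, b))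
       + 2 * a / (a + b)\<^sup>2 * D [(0, 1), (0, 1)] (cn (a, b))) * (2 * b / (a + b)\<^sup>2))) (at b within {x. 0 < x \<and> a + x \<le> 2})"
      unfolding P_def fst_conv snd_conv
      using that by (intro DERIV_diff DERIV_mult r1 r2 D2) auto
    moreover have "(1 / (a + b)\<^sup>2 * D [(1, 0)] (cn (a, b)) + (- 1 / (a + b) * D [(1, 0), (1, 0)] (cn (a, b))
       + 2 * a / (a + b)\<^sup>2 * D [(0, 1), (1, 0)] (cn (a, b))) * - (1 / (a + b)))
       - ((2 / (a + b)\<^sup>2 - 4 * b / (a + b) ^ 3) * D [(0, 1)] (cn (a, b)) + (- 1 / (a + b) * D [(1, 0), (0, 1)] (cn (a, b))
       + 2 * a / (a + b)\<^sup>2 * D [(0, 1), (0, 1)] (cn (a, b))) * (2 * b / (a + b)\<^sup>2))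
       = (D [(1, 0), (1, 0)] (\<sigma>, \<eta>) + 2 * \<eta> * D [(1, 0), (0, 1)] (\<sigma>, \<eta>) + D [(1, 0)] (\<sigma>, \<eta>)
      - (1 - \<eta>\<^sup>2) * D [(0, 1), (0, 1)] (\<sigma>, \<eta>) + 2 * \<eta> * D [(0, 1)] (\<sigma>, \<eta>)) / (a + b)\<^sup>2"
    proof -
      \<comment> \<open>In terms of \<open>k\<close> and \<open>t\<close> the fractions become
        polynomials, and \<open>\<eta>\<close> becomes \<open>1 - 2 * t\<close>.\<close>
      define k t where "k = 1 / (a + b)" and "t = a / (a + b)"
      have "1 / (a + b)\<^sup>2 = k\<^sup>2" "- 1 / (a + b) = - k" "1 / (a + b) = k" "2 * a / (a + b)\<^sup>2 = 2 * t * k"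
        "2 * b / (a + b)\<^sup>2 = 2 * (1 - t) * k" "2 / (a + b)\<^sup>2 = 2 * k\<^sup>2" "4 * b / (a + b) ^ 3 = 4 * (1 - t) * k\<^sup>2"
        "\<eta> = 1 - 2 * t" "\<And>x. x / (a + b)\<^sup>2 = x * k\<^sup>2"
        using S by (simp_all add: \<eta> k_def t_def field_simps eval_nat_numeral)
      note * = this
      show ?thesis
        unfolding se sym *(1-7) unfolding *(8,9) by algebra
    qed
    ultimately show ?thesis
      using pde' by (simp add: pot_def \<omega>_def se)
  qed
  have cont: "continuous_on {p. 0 < fst p \<and> 0 < snd p \<and> fst p + snd p \<le> 2} (\<lambda>p. D vs (cn p))" for vs
    by (rule continuous_on_compose2[OF jet_continuous[OF D]])
      (use cn_in_cyl in \<open>auto simp: cn_def[abs_def] intro!: continuous_intros\<close>)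
  then have cP: "continuous_on {p. 0 < fst p \<and> 0 < snd p \<and> fst p + snd p \<le> 2} P"
    unfolding P_def[abs_def] by (auto intro!: continuous_intros)
  have P_eq: "P (a, b) = - J1 (pot \<omega>) (a, b)" if "0 < a" "0 < b" "a + b \<le> 2" for a b
  proof -
    have "(pot \<omega> \<circ> Pair a has_integral P (a, 2 - a) - P (a, b)) {b..2 - a}"
    \<comment> \<open>The equation is given for \<open>s > 0\<close> only, that is, strictly below
      the line \<open>a + b = 2\<close>.\<close>
    proof (rule fundamental_theorem_of_calculus_interior[where f = "\<lambda>x. P (a, x)"])
      show "continuous_on {b..2 - a} (\<lambda>x. P (a, x))"
        by (rule continuous_on_compose2[OF cP]) (use that in \<open>auto intro!: continuous_intros\<close>)
      fix x assume x: "x \<in> {b<..<2 - a}"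
      have "((\<lambda>x. P (a, x)) has_real_derivative pot \<omega> (a, x)) (at x within {b<..<2 - a})"
        by (rule has_field_derivative_subset[OF d2]) (use x that in auto)
      then show "((\<lambda>x. P (a, x)) has_vector_derivative (pot \<omega> \<circ> Pair a) x) (at x)"
        using x at_within_open[of x "{b<..<2 - a}"] by (simp add: has_real_derivative_iff_has_vector_derivative)
    qed (use that in auto)
    moreover have "cn (a, 2 - a) = (0, 1 - a)" by (simp add: cn_def)
    then have "P (a, 2 - a) = 0" using init(2) init3 that by (simp add: P_def)
    ultimately show ?thesis by (simp add: J1_def o_def integral_unique)
  qed
  have \<omega>_eq: "\<omega> (a, b) = Kop \<omega> (a, b)" if "0 < a" "0 < b" "a + b \<le> 2" for a b
  proof -
    have "((\<lambda>x. P (x, b)) has_integral \<omega> (2 - b, b) - \<omega> (a, b)) {a..2 - b}"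
    proof (rule fundamental_theorem_of_calculus[where f = "\<lambda>x. \<omega> (x, b)"])
      fix x assume x: "x \<in> {a..2 - b}"
      have "((\<lambda>x. \<omega> (x, b)) has_real_derivative P (x, b)) (at x within {a..2 - b})"
        by (rule has_field_derivative_subset[OF d1]) (use x that in auto)
      then show "((\<lambda>x. \<omega> (x, b)) has_vector_derivative P (x, b)) (at x within {a..2 - b})"
        by (simp add: has_real_derivative_iff_has_vector_derivative)
    qed (use that in auto)
    moreover have "cn (2 - b, b) = (0, b - 1)" by (simp add: cn_def)
    then have "\<omega> (2 - b, b) = 0" using init(1) that by (simp add: \<omega>_def)
    ultimately have "\<omega> (a, b) = integral {a..2 - b} (\<lambda>x. - P (x, b))"
      by (simp add: integral_unique)
    also have "\<dots> = integral {a..2 - b} (\<lambda>x. J1 (pot \<omega>) (x, b))"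
      using that by (intro Henstock_Kurzweil_Integration.integral_cong) (auto simp: P_eq)
    finally show ?thesis by (simp add: Kop_def J2_def)
  qed
  obtain a b where ab: "nc (s, y) = (a, b)" by (cases "nc (s, y)")
  have p: "(a, b) \<in> tri" using nc_in_tri[OF s, of y] y ab by auto
  have ab0: "0 < a" "0 < b" using ab y by (auto simp: nc_def)
  \<comment> \<open>\<open>\<rho>\<close> retracts \<open>tri\<close> onto the backward triangle of
    the point. Composition with it gives a continuous function on all of \<open>tri\<close> and
    changes nothing where the equation is used.\<close>
  define \<rho> where "\<rho> p = (max a (min (fst p) (2 - b)), max b (min (snd p) (2 - max a (min (fst p) (2 - b)))))" for p :: "real \<times> real"
  have \<rho>: "\<rho> q \<in> {p. 0 < fst p \<and> 0 < snd p \<and> fst p + snd p \<le> 2}" for q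
    using p ab0 by (auto simp: \<rho>_def tri_iff max_def min_def)
  have \<rho>id: "\<rho> (x, z) = (x, z)" if "a \<le> x" "b \<le> z" "x + z \<le> 2" for x z
    using that by (auto simp: \<rho>_def max_def min_def)
  have "continuous_on tri \<rho>" unfolding \<rho>_def[abs_def] by (intro continuous_intros)
  then have "continuous_on tri (\<lambda>q. \<omega> (\<rho> q))"
    unfolding \<omega>_def by (rule continuous_on_compose2[OF cont[of "[]"]]) (use \<rho> in auto)
  then have "\<omega> (\<rho> (a, b)) = 0"
  proof (rule Kop_fixed_point_zero[OF _ p])
    fix x z assume xz: "a \<le> x" "b \<le> z" "x + z \<le> 2"
    have "Kop (\<lambda>q. \<omega> (\<rho> q)) (x, z) = Kop \<omega> (x, z)"
      unfolding Kop_def J1_def J2_def pot_def fst_conv snd_conv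
      by (intro Henstock_Kurzweil_Integration.integral_cong) (use xz \<rho>id in auto)
    then show "\<omega> (\<rho> (x, z)) = Kop (\<lambda>q. \<omega> (\<rho> q)) (x, z)"
      using \<omega>_eq[of x z] xz ab0 \<rho>id[OF xz] by simp
  qed
  then show ?thesis
    using \<rho>id[of a b] p cn_nc[of s y] by (simp add: \<omega>_def ab tri_iff)
qed

text \<open>The one-sided time derivatives and the space derivatives become entries of a single jet,
  in which mixed derivatives can be exchanged.\<close>

lemma is_wave_solution_jet:
  assumes "is_wave_solution f g u"
  shows "\<exists>D. jet_on cyl D \<and> (\<forall>s\<ge>0. \<forall>y\<in>{-1<..<1}. D [] (s, y) = u s y)
    \<and> (\<forall>s>0. \<forall>y\<in>{-1<..<1}. D [(1, 0), (1, 0)] (s, y) + 2 * y * D [(1, 0), (0, 1)] (s, y) + D [(1, 0)] (s, y)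
      - (1 - y\<^sup>2) * D [(0, 1), (0, 1)] (s, y) + 2 * y * D [(0, 1)] (s, y) - D [] (s, y) = 0)
    \<and> (\<forall>y\<in>{-1<..<1}. D [] (0, y) = f y \<and> D [(1, 0)] (0, y) = g y)"
proof -
  have "smooth_on cyl (\<lambda>(s, y). u s y)" using assms by (simp add: is_wave_solution_def)
  then obtain D where D0: "\<forall>q\<in>cyl. D [] q = (\<lambda>(s, y). u s y) q" and D: "jet_on cyl D"
    unfolding smooth_on_def jet_on_def by (elim exE conjE)
  have u: "D [] (s, y) = u s y" if "0 \<le> s" "y \<in> {-1<..<1}" for s y using D0 that by auto
  have t: "time_deriv w s y = D ((1, 0) # vs) (s, y)"
    if "\<And>s y. 0 \<le> s \<Longrightarrow> y \<in> {-1<..<1} \<Longrightarrow> w s y = D vs (s, y)" "0 \<le> s" "y \<in> {-1<..<1}" for w vs s y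
    using jet_time[OF D that(2,3), of vs] that by (intro time_deriv_eq) auto
  have x: "space_deriv w s y = D ((0, 1) # vs) (s, y)"
    if "\<And>s y. 0 \<le> s \<Longrightarrow> y \<in> {-1<..<1} \<Longrightarrow> w s y = D vs (s, y)" "0 \<le> s" "y \<in> {-1<..<1}" for w vs s y
  proof -
    have "(w s has_real_derivative D ((0, 1) # vs) (s, y)) (at y)"
      by (rule has_field_derivative_transform_within_open[OF jet_space[OF D that(2,3)], of "{-1<..<1}"]) (use that in auto)
    then show ?thesis by (simp add: space_deriv_def DERIV_imp_deriv)
  qed
  have "wave_op u s y = D [(1, 0), (1, 0)] (s, y) + 2 * y * D [(1, 0), (0, 1)] (s, y) + D [(1, 0)] (s, y)
      - (1 - y\<^sup>2) * D [(0, 1), (0, 1)] (s, y) + 2 * y * D [(0, 1)] (s, y) - D [] (s, y)"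
    if "0 \<le> s" "y \<in> {-1<..<1}" for s y
    using t[of u "[]"] x[of u "[]"] t[of "time_deriv u" "[(1, 0)]"] t[of "space_deriv u" "[(0, 1)]"]
      x[of "space_deriv u" "[(0, 1)]"] u that
    by (simp add: wave_op_def)
  moreover have "D [(1, 0)] (0, y) = g y" if "y \<in> {-1<..<1}" for y
    using t[of u "[]" 0 y] u that assms by (simp add: is_wave_solution_def)
  ultimately show ?thesis
    using D u assms by (intro exI[of _ D]) (auto simp: is_wave_solution_def)
qed

theorem wave_solution_unique:
  assumes u: "is_wave_solution f g u" and u': "is_wave_solution f g u'" and s: "0 \<le> s" and y: "y \<in> {-1<..<1}"
  shows "u s y = u' s y"
proof -
  obtain D where D: "jet_on cyl D" "\<And>s y. 0 \<le> s \<Longrightarrow> y \<in> {-1<..<1} \<Longrightarrow> D [] (s, y) = u s y"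
    "\<And>s y. 0 < s \<Longrightarrow> y \<in> {-1<..<1} \<Longrightarrow> D [(1, 0), (1, 0)] (s, y) + 2 * y * D [(1, 0), (0, 1)] (s, y) + D [(1, 0)] (s, y)
      - (1 - y\<^sup>2) * D [(0, 1), (0, 1)] (s, y) + 2 * y * D [(0, 1)] (s, y) - D [] (s, y) = 0"
    "\<And>y. y \<in> {-1<..<1} \<Longrightarrow> D [] (0, y) = f y" "\<And>y. y \<in> {-1<..<1} \<Longrightarrow> D [(1, 0)] (0, y) = g y"
    using is_wave_solution_jet[OF u] by auto
  obtain E where E: "jet_on cyl E" "\<And>s y. 0 \<le> s \<Longrightarrow> y \<in> {-1<..<1} \<Longrightarrow> E [] (s, y) = u' s y"
    "\<And>s y. 0 < s \<Longrightarrow> y \<in> {-1<..<1} \<Longrightarrow> E [(1, 0), (1, 0)] (s, y) + 2 * y * E [(1, 0), (0, 1)] (s, y) + E [(1, 0)] (s, y)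
      - (1 - y\<^sup>2) * E [(0, 1), (0, 1)] (s, y) + 2 * y * E [(0, 1)] (s, y) - E [] (s, y) = 0"
    "\<And>y. y \<in> {-1<..<1} \<Longrightarrow> E [] (0, y) = f y" "\<And>y. y \<in> {-1<..<1} \<Longrightarrow> E [(1, 0)] (0, y) = g y"
    using is_wave_solution_jet[OF u'] by auto
  have "jet_on cyl (\<lambda>vs q. D vs q - E vs q)"
    using D(1) E(1) unfolding jet_on_def by (auto intro!: has_derivative_diff)
  then have "(\<lambda>vs q. D vs q - E vs q) [] (s, y) = 0"
  proof (rule wave_jet_zero[OF _ _ _ _ s y])
    fix s y :: real assume *: "0 < s" "y \<in> {-1<..<1}"
    show "D [(1, 0), (1, 0)] (s, y) - E [(1, 0), (1, 0)] (s, y) + 2 * y * (D [(1, 0), (0, 1)] (s, y) - E [(1, 0), (0, 1)] (s, y))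
      + (D [(1, 0)] (s, y) - E [(1, 0)] (s, y)) - (1 - y\<^sup>2) * (D [(0, 1), (0, 1)] (s, y) - E [(0, 1), (0, 1)] (s, y))
      + 2 * y * (D [(0, 1)] (s, y) - E [(0, 1)] (s, y)) - (D [] (s, y) - E [] (s, y)) = 0"
      using D(3)[OF *] E(3)[OF *] by (simp add: algebra_simps)
  qed (use D(4,5) E(4,5) in simp_all)
  then show ?thesis by (simp add: D(2)[OF s y] E(2)[OF s y])
qed

section \<open>Pointwise and mean square bounds in null coordinates\<close>

lemma ennreal_abs_integral_le:
  fixes f :: "real \<Rightarrow> real"
  assumes "continuous_on {l..u} f"
  shows "ennreal \<bar>integral {l..u} f\<bar> \<le> (\<integral>\<^sup>+x. indicator {l..u} x * ennreal \<bar>f x\<bar> \<partial>lborel)"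
proof -
  have i: "set_integrable lborel {l..u} f"
    using assms by (rule borel_integrable_atLeastAtMost')
  then have "ennreal \<bar>integral {l..u} f\<bar> \<le> (\<integral>\<^sup>+x. norm (indicator {l..u} x *\<^sub>R f x) \<partial>lborel)"
    using integral_norm_bound_ennreal[OF i[unfolded set_integrable_def]] set_borel_integral_eq_integral(2)[OF i]
    by (simp add: set_lebesgue_integral_def)
  also have "\<dots> = (\<integral>\<^sup>+x. indicator {l..u} x * ennreal \<bar>f x\<bar> \<partial>lborel)"
    by (intro nn_integral_cong) (auto simp: indicator_def)
  finally show ?thesis .
qed

text \<open>Cauchy--Schwarz with the weights that are sharp for \<open>x : y = P : Q\<close>. If
  \<open>P\<close> and \<open>Q\<close> bound two L2 norms, the integrated right-hand side is at
  most \<open>(P + Q)\<^sup>2\<close>; this is the triangle inequality without roots of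
  integrals.\<close>

lemma ennreal_square_sum_le:
  fixes x y :: ennreal and P Q :: real
  assumes "P > 0" "Q > 0"
  shows "(x + y)\<^sup>2 \<le> ennreal ((P + Q) / P) * x\<^sup>2 + ennreal ((P + Q) / Q) * y\<^sup>2"
proof (cases "x = \<infinity> \<or> y = \<infinity>")
  case True
  then have "ennreal ((P + Q) / P) * x\<^sup>2 + ennreal ((P + Q) / Q) * y\<^sup>2 = top"
    using assms by (auto simp: ennreal_mult_eq_top_iff power2_eq_square)
  then show ?thesis by (simp only: top_greatest)
next
  case False
  then obtain a b where ab: "x = ennreal a" "0 \<le> a" "y = ennreal b" "0 \<le> b"
    by (cases x; cases y) auto
  have "(P + Q) / P * a\<^sup>2 + (P + Q) / Q * b\<^sup>2 - (a + b)\<^sup>2 = (Q * a - P * b)\<^sup>2 / (P * Q)"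
    using assms by (simp add: field_simps power2_eq_square)
  moreover have "0 \<le> (Q * a - P * b)\<^sup>2 / (P * Q)" using assms by simp
  ultimately have "(a + b)\<^sup>2 \<le> (P + Q) / P * a\<^sup>2 + (P + Q) / Q * b\<^sup>2" by linarith
  then have "ennreal ((a + b)\<^sup>2) \<le> ennreal ((P + Q) / P * a\<^sup>2 + (P + Q) / Q * b\<^sup>2)"
    by (rule ennreal_leI)
  also have "\<dots> = ennreal ((P + Q) / P) * ennreal (a\<^sup>2) + ennreal ((P + Q) / Q) * ennreal (b\<^sup>2)"
    using assms by (simp only: ennreal_mult[symmetric] ennreal_plus[symmetric] zero_le_power2 divide_nonneg_nonneg
        less_imp_le add_nonneg_nonneg mult_nonneg_nonneg)
  finally show ?thesis
    using ab by (simp add: ennreal_power[symmetric])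
qed

lemma nn_integral_L2_add:
  fixes X Y :: "'a \<Rightarrow> ennreal" and P Q :: real
  assumes [measurable]: "X \<in> borel_measurable M" "Y \<in> borel_measurable M" and PQ: "P > 0" "Q > 0"
    and X: "(\<integral>\<^sup>+x. (X x)\<^sup>2 \<partial>M) \<le> ennreal (P\<^sup>2)" and Y: "(\<integral>\<^sup>+x. (Y x)\<^sup>2 \<partial>M) \<le> ennreal (Q\<^sup>2)"
  shows "(\<integral>\<^sup>+x. (X x + Y x)\<^sup>2 \<partial>M) \<le> ennreal ((P + Q)\<^sup>2)"
proof -
  have "(\<integral>\<^sup>+x. (X x + Y x)\<^sup>2 \<partial>M) \<le>
      (\<integral>\<^sup>+x. ennreal ((P + Q) / P) * (X x)\<^sup>2 + ennreal ((P + Q) / Q) * (Y x)\<^sup>2 \<partial>M)"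
    by (intro nn_integral_mono ennreal_square_sum_le PQ)
  also have "\<dots> = ennreal ((P + Q) / P) * (\<integral>\<^sup>+x. (X x)\<^sup>2 \<partial>M) + ennreal ((P + Q) / Q) * (\<integral>\<^sup>+x. (Y x)\<^sup>2 \<partial>M)"
    by (simp add: nn_integral_add nn_integral_cmult)
  also have "\<dots> \<le> ennreal ((P + Q) / P) * ennreal (P\<^sup>2) + ennreal ((P + Q) / Q) * ennreal (Q\<^sup>2)"
    by (intro add_mono mult_left_mono X Y) auto
  also have "\<dots> = ennreal ((P + Q) / P * P\<^sup>2 + (P + Q) / Q * Q\<^sup>2)"
    using PQ by (simp flip: ennreal_mult ennreal_plus)
  also have "(P + Q) / P * P\<^sup>2 + (P + Q) / Q * Q\<^sup>2 = (P + Q)\<^sup>2"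
    using PQ by (simp add: field_simps power2_eq_square)
  finally show ?thesis .
qed

text \<open>Minkowski's integral inequality in \<open>L\<^sup>2\<close>, by Cauchy--Schwarz with the weight \<open>A\<close>.\<close>

lemma nn_integral_L2_Minkowski:
  fixes w A :: "'a \<Rightarrow> real" and F :: "'b \<Rightarrow> 'a \<Rightarrow> ennreal"
  assumes "sigma_finite_measure S" "sigma_finite_measure M"
    and F[measurable]: "case_prod F \<in> borel_measurable (S \<Otimes>\<^sub>M M)"
    and [measurable]: "w \<in> borel_measurable M" "A \<in> borel_measurable M"
    and w: "\<And>x. 0 \<le> w x" and A: "\<And>x. w x \<noteq> 0 \<Longrightarrow> 0 < A x"
    and le: "\<And>x. w x \<noteq> 0 \<Longrightarrow> (\<integral>\<^sup>+s. (F s x)\<^sup>2 \<partial>S) \<le> ennreal ((A x)\<^sup>2)"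
  shows "(\<integral>\<^sup>+s. (\<integral>\<^sup>+x. ennreal (w x) * F s x \<partial>M)\<^sup>2 \<partial>S) \<le> (\<integral>\<^sup>+x. ennreal (w x * A x) \<partial>M)\<^sup>2"
proof -
  interpret S: sigma_finite_measure S by fact
  interpret M: sigma_finite_measure M by fact
  interpret SM: pair_sigma_finite S M ..
  define I where "I = (\<integral>\<^sup>+x. ennreal (w x * A x) \<partial>M)"
  have wA: "0 \<le> w x * A x" "0 \<le> w x / A x" for x
    using w[of x] A[of x] by (cases "w x = 0"; auto intro!: mult_nonneg_nonneg divide_nonneg_nonneg)+
  have "(\<integral>\<^sup>+x. ennreal (w x) * F s x \<partial>M)\<^sup>2 \<le> I * (\<integral>\<^sup>+x. ennreal (w x / A x) * (F s x)\<^sup>2 \<partial>M)" if s: "s \<in> space S" for s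
  proof -
    have [measurable]: "F s \<in> borel_measurable M"
      using measurable_Pair2[OF F s] by simp
    have "(\<integral>\<^sup>+x. ennreal (w x) * F s x \<partial>M) = (\<integral>\<^sup>+x. ennreal (sqrt (w x * A x)) * (ennreal (sqrt (w x / A x)) * F s x) \<partial>M)"
    proof (intro nn_integral_cong)
      fix x
      have "sqrt (w x * A x) * sqrt (w x / A x) = w x"
        using w[of x] A[of x] by (cases "w x = 0") (auto simp flip: real_sqrt_mult)
      then show "ennreal (w x) * F s x = ennreal (sqrt (w x * A x)) * (ennreal (sqrt (w x / A x)) * F s x)"
        using wA[of x] by (simp add: mult.assoc[symmetric] flip: ennreal_mult)
    qed
    also have "\<dots>\<^sup>2 \<le> (\<integral>\<^sup>+x. (ennreal (sqrt (w x * A x)))\<^sup>2 \<partial>M) * (\<integral>\<^sup>+x. (ennreal (sqrt (w x / A x)) * F s x)\<^sup>2 \<partial>M)"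
      by (intro Cauchy_Schwarz_nn_integral) measurable
    also have "(\<integral>\<^sup>+x. (ennreal (sqrt (w x * A x)))\<^sup>2 \<partial>M) = I"
      unfolding I_def using wA by (simp add: ennreal_power)
    also have "(\<integral>\<^sup>+x. (ennreal (sqrt (w x / A x)) * F s x)\<^sup>2 \<partial>M) = (\<integral>\<^sup>+x. ennreal (w x / A x) * (F s x)\<^sup>2 \<partial>M)"
      using wA by (simp add: ennreal_power power_mult_distrib)
    finally show ?thesis .
  qed
  then have "(\<integral>\<^sup>+s. (\<integral>\<^sup>+x. ennreal (w x) * F s x \<partial>M)\<^sup>2 \<partial>S) \<le> (\<integral>\<^sup>+s. I * (\<integral>\<^sup>+x. ennreal (w x / A x) * (F s x)\<^sup>2 \<partial>M) \<partial>S)"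
    by (rule nn_integral_mono)
  also have "\<dots> = I * (\<integral>\<^sup>+s. (\<integral>\<^sup>+x. ennreal (w x / A x) * (F s x)\<^sup>2 \<partial>M) \<partial>S)"
    by (intro nn_integral_cmult) measurable
  also have "(\<integral>\<^sup>+s. (\<integral>\<^sup>+x. ennreal (w x / A x) * (F s x)\<^sup>2 \<partial>M) \<partial>S) = (\<integral>\<^sup>+x. (\<integral>\<^sup>+s. ennreal (w x / A x) * (F s x)\<^sup>2 \<partial>S) \<partial>M)"
    using SM.Fubini'[of "\<lambda>s x. ennreal (w x / A x) * (F s x)\<^sup>2"] by simp
  also have "\<dots> \<le> (\<integral>\<^sup>+x. ennreal (w x * A x) \<partial>M)"
  proof (intro nn_integral_mono)
    fix x assume x: "x \<in> space M"
    have [measurable]: "(\<lambda>s. F s x) \<in> borel_measurable S"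
      using measurable_Pair1[OF F x] by simp
    have "(\<integral>\<^sup>+s. ennreal (w x / A x) * (F s x)\<^sup>2 \<partial>S) = ennreal (w x / A x) * (\<integral>\<^sup>+s. (F s x)\<^sup>2 \<partial>S)"
      by (intro nn_integral_cmult) measurable
    also have "\<dots> \<le> ennreal (w x * A x)"
    proof (cases "w x = 0")
      case False
      then have "ennreal (w x / A x) * (\<integral>\<^sup>+s. (F s x)\<^sup>2 \<partial>S) \<le> ennreal (w x / A x) * ennreal ((A x)\<^sup>2)"
        by (intro mult_left_mono le) auto
      also have "\<dots> = ennreal (w x * A x)"
        using A[OF False] w[of x] by (simp add: power2_eq_square flip: ennreal_mult)
      finally show ?thesis .
    qed simp
    finally show "(\<integral>\<^sup>+s. ennreal (w x / A x) * (F s x)\<^sup>2 \<partial>S) \<le> ennreal (w x * A x)" .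
  qed
  finally show ?thesis by (simp add: I_def power2_eq_square mult_left_mono)
qed

text \<open>For \<open>p \<le> q\<close> the antisymmetry of the solutions cancels the part of the backward triangle of \<open>(p, q)\<close>
  that is symmetric about the diagonal; \<open>reg p q\<close> contains what is left.\<close>

definition reg :: "real \<Rightarrow> real \<Rightarrow> (real \<times> real) set" where
  "reg p q = {x. p \<le> fst x \<and> fst x \<le> q \<and> q \<le> snd x}"

definition ker :: "real \<Rightarrow> real \<Rightarrow> real \<times> real \<Rightarrow> real" where
  "ker p q x = indicator (reg p q) x / (fst x + snd x)\<^sup>2"

lemma sets_reg[measurable]: "reg p q \<in> sets borel"
proof -
  have "closed (reg p q)"
    unfolding reg_def by (intro closed_Collect_conj closed_Collect_le continuous_intros)
  then show ?thesis by simp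
qed

lemma measurable_fst_borel[measurable]: "(fst :: real \<times> real \<Rightarrow> real) \<in> borel_measurable borel"
  and measurable_snd_borel[measurable]: "(snd :: real \<times> real \<Rightarrow> real) \<in> borel_measurable borel"
  by (intro borel_measurable_continuous_onI continuous_intros)+

lemma ker_measurable[measurable]: "ker p q \<in> borel_measurable borel"
  unfolding ker_def[abs_def] by measurable

lemma ker_nonneg: "0 \<le> ker p q x"
  by (simp add: ker_def)

text \<open>The logarithmic part dominates the free solution: it is what Cauchy--Schwarz gives for
  the energy on \<open>{a..b}\<close>. The other part is a multiple of the eigenfunction, and it is
  what the iteration improves, from \<open>m\<close> to \<open>6 * E + m / 2\<close>.\<close>

definition env :: "real \<Rightarrow> real \<Rightarrow> real \<times> real \<Rightarrow> real" where
  "env E m x = E * (1 + ln (snd x / fst x)) + m * (snd x - fst x) / (fst x + snd x)"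

lemma env_measurable[measurable]: "env E m \<in> borel_measurable borel"
  unfolding env_def[abs_def] by measurable

lemma nn_integral_lborel_prod:
  fixes f :: "real \<times> real \<Rightarrow> ennreal"
  assumes [measurable]: "f \<in> borel_measurable borel"
  shows "(\<integral>\<^sup>+x. f x \<partial>lborel) = (\<integral>\<^sup>+a. (\<integral>\<^sup>+b. f (a, b) \<partial>lborel) \<partial>lborel)"
proof -
  have "f \<in> borel_measurable (lborel \<Otimes>\<^sub>M lborel)"
    using assms by (simp add: lborel_prod)
  from lborel.nn_integral_fst[OF this] show ?thesis by (simp add: lborel_prod)
qed

text \<open>The weight \<open>(\<beta> - \<alpha>) / (\<alpha> + \<beta>)\<close>, which is \<open>y\<close> in the original coordinates, is an
  eigenfunction of the kernel with eigenvalue \<open>1/2\<close>; this makes the Neumann series converge.\<close>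

lemma nn_integral_ker_env:
  assumes p: "0 < p" "p \<le> q" and E: "0 \<le> E" "0 \<le> m"
  shows "(\<integral>\<^sup>+x. ennreal (ker p q x * env E m x) \<partial>lborel) \<le> ennreal ((6 * E + m / 2) * (q - p) / (p + q))"
proof -
  have inner: "(\<integral>\<^sup>+b. ennreal (ker p q (a, b) * env E m (a, b)) \<partial>lborel)
      \<le> ennreal (E * (ln (q / a) + 2) / q + m * q / (a + q)\<^sup>2) * indicator {p..q} a" for a
  proof (cases "a \<in> {p..q}")
    case True
    then have a: "0 < a" "a \<le> q" "0 < q" using p by auto
    \<comment> \<open>In the logarithmic part the denominator is weakened to
      \<open>b\<^sup>2\<close>, which gives an elementary antiderivative. The part with
      \<open>m\<close> is kept exactly, in order not to lose the eigenvalue.\<close>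
    define G where "G b = E * (1 + ln (b / a)) / b\<^sup>2 + m * (b - a) / (a + b) ^ 3" for b
    have "(\<integral>\<^sup>+b. ennreal (ker p q (a, b) * env E m (a, b)) \<partial>lborel) \<le> (\<integral>\<^sup>+b. ennreal (G b) * indicator {q..} b \<partial>lborel)"
    proof (intro nn_integral_mono)
      fix b
      show "ennreal (ker p q (a, b) * env E m (a, b)) \<le> ennreal (G b) * indicator {q..} b"
      proof (cases "q \<le> b")
        case b: True
        have l: "0 \<le> ln (b / a)" using a b by (intro ln_ge_zero) (simp add: field_simps)
        have "E * (1 + ln (b / a)) / (a + b)\<^sup>2 \<le> E * (1 + ln (b / a)) / b\<^sup>2"
          using a b l E by (intro divide_left_mono power_mono mult_nonneg_nonneg) auto
        moreover have "(a + b) * (a + b)\<^sup>2 = (a + b) ^ 3"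
          by (simp add: eval_nat_numeral)
        ultimately have "env E m (a, b) / (a + b)\<^sup>2 \<le> G b"
          by (simp add: env_def G_def add_divide_distrib)
        then show ?thesis using b True by (simp add: ker_def reg_def ennreal_leI)
      qed (simp add: ker_def reg_def)
    qed
    also have "\<dots> = 0 - (- E * (ln (q / a) + 2) / q - m * q / (a + q)\<^sup>2)"
    proof (rule nn_integral_FTC_atLeast)
      show "G \<in> borel_measurable borel" unfolding G_def[abs_def] by measurable
      fix b assume b: "q \<le> b"
      then have b0: "b > 0" "a + b > 0" using a by auto
      have "DERIV (\<lambda>b. - E * (ln (b / a) + 2) / b) b :> E * (1 + ln (b / a)) / b\<^sup>2"
        using a b0 by (auto intro!: derivative_eq_intros simp: field_simps power2_eq_square)
      moreover have "DERIV (\<lambda>b. m * b / (a + b)\<^sup>2) b :> - (m * (b - a) / (a + b) ^ 3)"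
      proof -
        have "DERIV (\<lambda>b. m * b / (a + b)\<^sup>2) b :> (m * (a + b)\<^sup>2 - m * b * (2 * (a + b))) / ((a + b)\<^sup>2 * (a + b)\<^sup>2)"
          using b0 by (auto intro!: derivative_eq_intros)
        moreover have "(m * S\<^sup>2 - m * b * (2 * S)) / (S\<^sup>2 * S\<^sup>2) = - (m * (2 * b - S) / S ^ 3)" if "S \<noteq> 0" for S
          using that by (simp add: field_simps eval_nat_numeral)
        from this[of "a + b"] have "(m * (a + b)\<^sup>2 - m * b * (2 * (a + b))) / ((a + b)\<^sup>2 * (a + b)\<^sup>2) = - (m * (b - a) / (a + b) ^ 3)"
          using b0 by simp
        ultimately show ?thesis by simp
      qed
      ultimately show "DERIV (\<lambda>b. - E * (ln (b / a) + 2) / b - m * b / (a + b)\<^sup>2) b :> G b"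
        unfolding G_def using DERIV_diff by fastforce
      have "0 \<le> ln (b / a)" using a b by (intro ln_ge_zero) (simp add: field_simps)
      then show "0 \<le> G b" using E a b unfolding G_def by auto
    next
      have "((\<lambda>b. (ln (b / a) + 2) / b) \<longlongrightarrow> 0) at_top" "((\<lambda>b. b / (a + b)\<^sup>2) \<longlongrightarrow> 0) at_top"
        using a by real_asymp+
      from tendsto_diff[OF tendsto_mult[OF tendsto_const[of "- E"] this(1)] tendsto_mult[OF tendsto_const[of m] this(2)]]
      show "((\<lambda>b. - E * (ln (b / a) + 2) / b - m * b / (a + b)\<^sup>2) \<longlongrightarrow> 0) at_top" by simp
    qed
    finally show ?thesis using True by (simp add: add.commute)
  next
    case False
    then show ?thesis by (auto simp: ker_def reg_def indicator_def)
  qed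
  have "(\<integral>\<^sup>+x. ennreal (ker p q x * env E m x) \<partial>lborel) = (\<integral>\<^sup>+a. (\<integral>\<^sup>+b. ennreal (ker p q (a, b) * env E m (a, b)) \<partial>lborel) \<partial>lborel)"
    by (intro nn_integral_lborel_prod) measurable
  also have "\<dots> \<le> (\<integral>\<^sup>+a. ennreal (E * (ln (q / a) + 2) / q + m * q / (a + q)\<^sup>2) * indicator {p..q} a \<partial>lborel)"
    by (intro nn_integral_mono inner)
  also have "\<dots> = (E * (q * ln (q / q) + 3 * q) / q - m * q / (q + q)) - (E * (p * ln (q / p) + 3 * p) / q - m * q / (p + q))"
  proof (rule nn_integral_FTC_Icc)
    fix a assume a: "a \<in> {p..q}"
    then have a0: "a > 0" "q > 0" "a + q \<noteq> 0" using p by auto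
    have "DERIV (\<lambda>a. E * (a * ln (q / a) + 3 * a) / q) a :> E * (ln (q / a) + 2) / q"
      using a0 by (auto intro!: derivative_eq_intros simp: field_simps)
    moreover have "DERIV (\<lambda>a. - (m * q / (a + q))) a :> m * q / (a + q)\<^sup>2"
      using a0 by (auto intro!: derivative_eq_intros simp: power2_eq_square)
    ultimately have "DERIV (\<lambda>a. E * (a * ln (q / a) + 3 * a) / q + - (m * q / (a + q))) a :>
        E * (ln (q / a) + 2) / q + m * q / (a + q)\<^sup>2"
      by (rule DERIV_add)
    then show "((\<lambda>a. E * (a * ln (q / a) + 3 * a) / q - m * q / (a + q)) has_real_derivative
        E * (ln (q / a) + 2) / q + m * q / (a + q)\<^sup>2) (at a)" by simp
    have "0 \<le> ln (q / a)" using a a0 by (intro ln_ge_zero) (simp add: field_simps)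
    then show "0 \<le> E * (ln (q / a) + 2) / q + m * q / (a + q)\<^sup>2" using E a0 by simp
  qed (use p in auto)
  also have "\<dots> \<le> ennreal ((6 * E + m / 2) * (q - p) / (p + q))"
  proof (rule ennreal_leI)
    have q: "q > 0" using p by simp
    have l: "0 \<le> ln (q / p)" using p q by (intro ln_ge_zero) (simp add: field_simps)
    have "E * (3 * q) / q - E * (p * ln (q / p) + 3 * p) / q \<le> 3 * E * ((q - p) / q)"
      using q p l E by (simp add: field_simps)
    \<comment> \<open>\<open>p + q \<le> 2 * q\<close> trades the denominator \<open>q\<close> for
      the one of the eigenfunction and turns 3 into 6.\<close>
    also have "\<dots> \<le> 3 * E * (2 * (q - p) / (p + q))"
    proof (intro mult_left_mono)
      have "(q - p) * (p + q) \<le> (q - p) * (2 * q)" using p by (intro mult_left_mono) auto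
      then show "(q - p) / q \<le> 2 * (q - p) / (p + q)" using p q by (simp add: field_simps)
    qed (use E in auto)
    also have "3 * E * (2 * (q - p) / (p + q)) = 6 * E * (q - p) / (p + q)" by simp
    finally have 1: "E * (3 * q) / q - E * (p * ln (q / p) + 3 * p) / q \<le> 6 * E * (q - p) / (p + q)" .
    have "m * q / (p + q) - m * q / (q + q) = m / 2 * (q - p) / (p + q)"
      using p q by (simp add: field_simps)
    moreover have "(6 * E + m / 2) * (q - p) / (p + q) = 6 * E * (q - p) / (p + q) + m / 2 * (q - p) / (p + q)"
      by (simp add: add_divide_distrib distrib_right)
    ultimately show "(E * (q * ln (q / q) + 3 * q) / q - m * q / (q + q)) - (E * (p * ln (q / p) + 3 * p) / q - m * q / (p + q))
      \<le> (6 * E + m / 2) * (q - p) / (p + q)"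
      using 1 q by simp
  qed
  finally show ?thesis .
qed

lemma nn_integral_lborel_scale2:
  fixes f :: "real \<times> real \<Rightarrow> ennreal"
  assumes [measurable]: "f \<in> borel_measurable borel" and r: "0 < r"
  shows "(\<integral>\<^sup>+x. f x \<partial>lborel) = ennreal (r\<^sup>2) * (\<integral>\<^sup>+x. f (r * fst x, r * snd x) \<partial>lborel)"
proof -
  have [measurable]: "(\<lambda>x. f (r * fst x, r * snd x)) \<in> borel_measurable borel"
    by (rule measurable_compose[OF _ assms(1)]) (intro borel_measurable_continuous_onI continuous_intros)
  have f1: "f \<in> borel_measurable (lborel \<Otimes>\<^sub>M lborel)" by (simp add: lborel_prod)
  have [measurable]: "case_prod (\<lambda>a b. f (a, b)) \<in> borel_measurable (borel \<Otimes>\<^sub>M lborel)"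
    using f1 by (simp add: case_prod_unfold cong: measurable_cong_sets)
  have m1: "(\<lambda>b. f (a, b)) \<in> borel_measurable borel" for a
    by (rule measurable_compose[OF _ assms(1)]) (intro borel_measurable_continuous_onI continuous_intros)
  have "(\<integral>\<^sup>+x. f x \<partial>lborel) = (\<integral>\<^sup>+a. (\<integral>\<^sup>+b. f (a, b) \<partial>lborel) \<partial>lborel)"
    by (rule nn_integral_lborel_prod) simp
  also have "\<dots> = ennreal \<bar>r\<bar> * (\<integral>\<^sup>+a. (\<integral>\<^sup>+b. f (0 + r * a, b) \<partial>lborel) \<partial>lborel)"
    using r by (intro nn_integral_real_affine) (auto intro: lborel.borel_measurable_nn_integral)
  also have "(\<integral>\<^sup>+a. (\<integral>\<^sup>+b. f (0 + r * a, b) \<partial>lborel) \<partial>lborel)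
      = (\<integral>\<^sup>+a. ennreal \<bar>r\<bar> * (\<integral>\<^sup>+b. f (0 + r * a, 0 + r * b) \<partial>lborel) \<partial>lborel)"
    using r by (intro nn_integral_cong nn_integral_real_affine m1) auto
  also have "\<dots> = (\<integral>\<^sup>+a. (\<integral>\<^sup>+b. ennreal r * f (r * a, r * b) \<partial>lborel) \<partial>lborel)"
  proof (intro nn_integral_cong)
    fix a
    have [measurable]: "(\<lambda>b. f (r * a, r * b)) \<in> borel_measurable borel"
      by (rule measurable_compose[OF _ assms(1)]) (intro borel_measurable_continuous_onI continuous_intros)
    show "ennreal \<bar>r\<bar> * (\<integral>\<^sup>+b. f (0 + r * a, 0 + r * b) \<partial>lborel) = (\<integral>\<^sup>+b. ennreal r * f (r * a, r * b) \<partial>lborel)"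
      using r by (simp add: nn_integral_cmult)
  qed
  also have "\<dots> = (\<integral>\<^sup>+x. ennreal r * f (r * fst x, r * snd x) \<partial>lborel)"
    by (subst nn_integral_lborel_prod) auto
  also have "\<dots> = ennreal r * (\<integral>\<^sup>+x. f (r * fst x, r * snd x) \<partial>lborel)"
    by (intro nn_integral_cmult) simp
  finally show ?thesis using r by (simp add: power2_eq_square ennreal_mult mult.assoc)
qed

text \<open>\<open>h\<close> is the derivative of the profile and \<open>E\<close> bounds the square
  root of its energy. The energy integral is that of \<open>(c * h (1 - c))\<^sup>2\<close> against
  \<open>dc / c\<close>, the measure invariant under dilations.\<close>

locale null_wave =
  fixes h \<Psi> :: "real \<Rightarrow> real" and v :: "real \<times> real \<Rightarrow> real" and E :: real
  assumes h: "continuous_on {-1..1} h"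
    and \<Psi>: "\<And>x. x \<in> {-1..1} \<Longrightarrow> (\<Psi> has_real_derivative h x) (at x within {-1..1})"
    and v: "null_solution \<Psi> v"
    and C1: "\<exists>v1 v2. tri_C1 v v1 v2"
    and E: "E > 0"
    and energy: "integral {0..2} (\<lambda>c. c * (h (1 - c))\<^sup>2) \<le> E\<^sup>2"
begin

section \<open>The pointwise bound\<close>

lemma v_cont: "continuous_on tri v"
  using v unfolding null_solution_def by (rule conjunct1)

definition hb :: "real \<Rightarrow> real" where
  "hb c = indicator {0..2} c * \<bar>h (1 - c)\<bar>"

text \<open>Extension by zero of the absolute value from the half \<open>a \<le> b\<close>; dilated
  copies can then be integrated over the whole unbounded region of the kernel.\<close>

definition vt :: "real \<times> real \<Rightarrow> real" where
  "vt x = indicator {x. 0 < fst x \<and> fst x \<le> snd x \<and> fst x + snd x \<le> 2} x * \<bar>v x\<bar>"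

lemma hb_cont: "continuous_on {0..2} (\<lambda>c. h (1 - c))"
  by (rule continuous_on_compose2[OF h]) (auto intro!: continuous_intros)

lemma hb_measurable[measurable]: "hb \<in> borel_measurable borel"
proof -
  have "(\<lambda>c. indicator {0..2} c *\<^sub>R \<bar>h (1 - c)\<bar>) \<in> borel_measurable borel"
    by (intro borel_measurable_continuous_on_indicator continuous_intros hb_cont) auto
  then show ?thesis by (simp add: hb_def[abs_def])
qed

lemma vt_measurable[measurable]: "vt \<in> borel_measurable borel"
proof -
  let ?S = "{x :: real \<times> real. 0 < fst x \<and> fst x \<le> snd x \<and> fst x + snd x \<le> 2}"
  have "?S = {x \<in> space borel. 0 < fst x \<and> fst x \<le> snd x \<and> fst x + snd x \<le> 2}" by simp
  also have "\<dots> \<in> sets borel" by measurable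
  finally have S: "?S \<in> sets borel" .
  have "?S \<subseteq> tri" by (auto simp: tri_iff)
  then have c: "continuous_on ?S (\<lambda>x. \<bar>v x\<bar>)"
    by (rule continuous_on_rabs[OF continuous_on_subset[OF v_cont]])
  from borel_measurable_continuous_on_indicator[OF S c]
  show ?thesis unfolding vt_def[abs_def] real_scaleR_def .
qed

lemma vt_nonneg: "0 \<le> vt x" by (simp add: vt_def)

lemma hb_nonneg: "0 \<le> hb c" by (simp add: hb_def)

lemma vt_eq: "0 < a \<Longrightarrow> a \<le> b \<Longrightarrow> a + b \<le> 2 \<Longrightarrow> vt (a, b) = \<bar>v (a, b)\<bar>"
  by (simp add: vt_def)

lemma v_diag: "0 < b \<Longrightarrow> b \<le> 1 \<Longrightarrow> v (b, b) = 0"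
  using null_solution_antisym[OF v, of b b] by (simp add: tri_iff)

text \<open>For \<open>b \<le> 1\<close> the part of the backward triangle of \<open>(a, b)\<close>
  beyond \<open>x = b\<close> is the backward triangle of \<open>(b, b)\<close>, and
  \<open>Kop v (b, b) = 0\<close> because \<open>v\<close> and the free part vanish on the diagonal.
  Absolute values are taken only after this part has been dropped.\<close>

lemma v_integral_bound:
  assumes "0 < a" "a \<le> b" "a + b \<le> 2"
  shows "ennreal \<bar>v (a, b)\<bar> \<le> ennreal (1 / 2) * (\<integral>\<^sup>+c. indicator {a..b} c * ennreal (hb c) \<partial>lborel)
     + (\<integral>\<^sup>+x. ennreal (ker a b x) * ennreal (vt x) \<partial>lborel)"
proof -
  have p: "(a, b) \<in> tri" using assms by (simp add: tri_iff)
  \<comment> \<open>For \<open>b > 1\<close> the backward triangle ends at \<open>x = 2 - b\<close>,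
    before it reaches the diagonal.\<close>
  define c where "c = min b (2 - b)"
  have c: "a \<le> c" "c \<le> b" "c \<le> 2 - b" using assms by (auto simp: c_def)
  have eq: "v (x, y) = (\<Psi> (1 - x) - \<Psi> (1 - y)) / 2 + Kop v (x, y)" if "(x, y) \<in> tri" for x y
    using v that unfolding null_solution_def by fastforce
  note cJ = continuous_on_tri_horizontal[OF continuous_on_J1[OF continuous_on_pot[OF v_cont]] p]
  have K: "Kop v (a, b) = integral {a..c} (\<lambda>x. J1 (pot v) (x, b))"
  proof (cases "b \<le> 1")
    case True
    then have cb: "c = b" by (simp add: c_def)
    have "Kop v (b, b) = 0" using eq[of b b] v_diag[of b] assms True by (simp add: tri_iff)
    moreover have "Kop v (a, b) = integral {a..c} (\<lambda>x. J1 (pot v) (x, b)) + integral {c..2 - b} (\<lambda>x. J1 (pot v) (x, b))"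
      unfolding Kop_def J2_def fst_conv snd_conv using c
      by (intro Henstock_Kurzweil_Integration.integral_combine[symmetric] integrable_continuous_real cJ) auto
    ultimately show ?thesis by (simp add: Kop_def J2_def cb)
  qed (simp add: Kop_def J2_def c_def)
  have G_meas: "(\<lambda>x. ennreal (ker a b x) * ennreal (vt x)) \<in> borel_measurable borel" by measurable
  have "ennreal \<bar>Kop v (a, b)\<bar> \<le> (\<integral>\<^sup>+x. indicator {a..c} x * ennreal \<bar>J1 (pot v) (x, b)\<bar> \<partial>lborel)"
    unfolding K using c by (intro ennreal_abs_integral_le continuous_on_subset[OF cJ]) auto
  also have "\<dots> \<le> (\<integral>\<^sup>+x. (\<integral>\<^sup>+y. ennreal (ker a b (x, y)) * ennreal (vt (x, y)) \<partial>lborel) \<partial>lborel)"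
  proof (intro nn_integral_mono)
    fix x
    show "indicator {a..c} x * ennreal \<bar>J1 (pot v) (x, b)\<bar> \<le> (\<integral>\<^sup>+y. ennreal (ker a b (x, y)) * ennreal (vt (x, y)) \<partial>lborel)"
    proof (cases "x \<in> {a..c}")
      case True
      then have xb: "(x, b) \<in> tri" using tri_upward[OF p, of x b] c by auto
      have "ennreal \<bar>J1 (pot v) (x, b)\<bar> \<le> (\<integral>\<^sup>+y. indicator {b..2 - x} y * ennreal \<bar>pot v (x, y)\<bar> \<partial>lborel)"
        unfolding J1_def fst_conv snd_conv
        by (intro ennreal_abs_integral_le continuous_on_tri_vertical[OF continuous_on_pot[OF v_cont] xb])
      also have "\<dots> \<le> (\<integral>\<^sup>+y. ennreal (ker a b (x, y)) * ennreal (vt (x, y)) \<partial>lborel)"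
        using True c assms
        by (intro nn_integral_mono)
          (auto simp: indicator_def ker_def reg_def vt_def pot_def simp flip: ennreal_mult)
      finally show ?thesis using True by simp
    qed simp
  qed
  also have "\<dots> = (\<integral>\<^sup>+x. ennreal (ker a b x) * ennreal (vt x) \<partial>lborel)"
    by (rule nn_integral_lborel_prod[OF G_meas, symmetric])
  finally have 1: "ennreal \<bar>Kop v (a, b)\<bar> \<le> (\<integral>\<^sup>+x. ennreal (ker a b x) * ennreal (vt x) \<partial>lborel)" .
  have "((\<lambda>c. h (1 - c)) has_integral (- \<Psi> (1 - b)) - (- \<Psi> (1 - a))) {a..b}"
  proof (rule fundamental_theorem_of_calculus[where f = "\<lambda>c. - \<Psi> (1 - c)"])
    fix z assume z: "z \<in> {a..b}"
    have "((\<lambda>c. \<Psi> (1 - c)) has_real_derivative - h (1 - z)) (at z within {a..b})"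
      by (rule has_real_derivative_reflect_at[OF \<Psi>]) (use z assms in auto)
    from DERIV_minus[OF this]
    show "((\<lambda>c. - \<Psi> (1 - c)) has_vector_derivative h (1 - z)) (at z within {a..b})"
      by (simp add: has_real_derivative_iff_has_vector_derivative)
  qed (use assms in auto)
  then have "\<Psi> (1 - a) - \<Psi> (1 - b) = integral {a..b} (\<lambda>c. h (1 - c))"
    by (simp add: integral_unique)
  then have "ennreal \<bar>\<Psi> (1 - a) - \<Psi> (1 - b)\<bar> \<le> (\<integral>\<^sup>+c. indicator {a..b} c * ennreal \<bar>h (1 - c)\<bar> \<partial>lborel)"
    using ennreal_abs_integral_le[OF continuous_on_subset[OF hb_cont], of a b] assms by auto
  also have "\<dots> = (\<integral>\<^sup>+c. indicator {a..b} c * ennreal (hb c) \<partial>lborel)"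
    using assms by (intro nn_integral_cong) (auto simp: hb_def indicator_def)
  finally have 2: "ennreal \<bar>\<Psi> (1 - a) - \<Psi> (1 - b)\<bar> \<le> (\<integral>\<^sup>+c. indicator {a..b} c * ennreal (hb c) \<partial>lborel)" .
  have "\<bar>v (a, b)\<bar> \<le> 1 / 2 * \<bar>\<Psi> (1 - a) - \<Psi> (1 - b)\<bar> + \<bar>Kop v (a, b)\<bar>"
    using eq[OF p] abs_triangle_ineq[of "(\<Psi> (1 - a) - \<Psi> (1 - b)) / 2" "Kop v (a, b)"] by simp
  then have "ennreal \<bar>v (a, b)\<bar> \<le> ennreal (1 / 2 * \<bar>\<Psi> (1 - a) - \<Psi> (1 - b)\<bar> + \<bar>Kop v (a, b)\<bar>)"
    by (rule ennreal_leI)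
  also have "\<dots> = ennreal (1 / 2) * ennreal \<bar>\<Psi> (1 - a) - \<Psi> (1 - b)\<bar> + ennreal \<bar>Kop v (a, b)\<bar>"
    by (simp only: ennreal_plus ennreal_mult abs_ge_zero zero_le_divide_1_iff mult_nonneg_nonneg zero_le_numeral)
  finally show ?thesis using 1 2 by (meson add_mono mult_left_mono order_trans zero_le)
qed

text \<open>\<open>v\<close> vanishes on the diagonal, and away from the origin its derivatives are
  bounded by compactness; the mean value theorem is applied along a line of constant
  \<open>a + b\<close>. The constant is not explicit and only starts the iteration.\<close>

lemma v_lipschitz:
  assumes "\<epsilon> > 0"
  shows "\<exists>M\<ge>0. \<forall>a b. 0 \<le> a \<longrightarrow> a \<le> b \<longrightarrow> a + b \<le> 2 \<longrightarrow> \<epsilon> \<le> a + b \<longrightarrow> \<bar>v (a, b)\<bar> \<le> M * (b - a) / (a + b)"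
proof -
  obtain v1 v2 where C: "tri_C1 v v1 v2" using C1 by blast
  let ?S = "{(0, 0)..(2, 2)} \<inter> {p :: real \<times> real. \<epsilon> \<le> fst p + snd p} \<inter> {p. fst p + snd p \<le> 2}"
  have St: "?S \<subseteq> tri" using assms by (auto simp: tri_iff less_eq_prod_def)
  have "compact ({(0, 0)..(2, 2)} :: (real \<times> real) set)"
    using compact_cbox[of "(0::real, 0::real)" "(2, 2)"] by (simp add: cbox_interval)
  then have cS: "compact ?S"
    by (intro compact_Int_closed closed_Collect_le continuous_intros)
  have "compact ((\<lambda>p. v2 p - v1 p) ` ?S)"
    by (intro compact_continuous_image cS continuous_intros continuous_on_subset[OF tri_C1_D(2)[OF C] St]
        continuous_on_subset[OF tri_C1_D(3)[OF C] St])
  from compact_imp_bounded[OF this] obtain B where B0: "\<forall>z\<in>(\<lambda>p. v2 p - v1 p) ` ?S. norm z \<le> B"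
    unfolding bounded_iff by (rule exE)
  then have B: "\<bar>v2 (a, b) - v1 (a, b)\<bar> \<le> max B 0" if "0 \<le> a" "0 \<le> b" "a + b \<le> 2" "\<epsilon> \<le> a + b" for a b
  proof -
    have "(a, b) \<in> ?S" using that by (auto simp: less_eq_prod_def)
    then have "norm (v2 (a, b) - v1 (a, b)) \<le> B"
      using B0 by blast
    then show ?thesis by simp
  qed
  have "\<bar>v (a, b)\<bar> \<le> max B 0 * (b - a) / (a + b)" if ab: "0 \<le> a" "a \<le> b" "a + b \<le> 2" "\<epsilon> \<le> a + b" for a b
  proof -
    define m where "m = (a + b) / 2"
    define d where "d = (b - a) / 2"
    have md: "a = m - d" "b = m + d" "0 \<le> d" "d \<le> m" "2 * m \<le> 2" "\<epsilon> \<le> 2 * m"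
      using ab by (auto simp: m_def d_def field_simps)
    have sub: "(m - t, m + t) \<in> tri" if "t \<in> {0..d}" for t using md that assms by (auto simp: tri_iff)
    have der: "((\<lambda>t. v (m - t, m + t)) has_derivative (\<lambda>k. k * (v2 (m - t, m + t) - v1 (m - t, m + t)))) (at t within {0..d})"
      if t: "t \<in> {0..d}" for t
    proof -
      have "((\<lambda>t. v (m - t, m + t)) has_derivative (\<lambda>k. fst (- k, k) * v1 (m - t, m + t) + snd (- k, k) * v2 (m - t, m + t))) (at t within {0..d})"
        by (rule has_derivative_in_compose2[where f = "\<lambda>t. (m - t, m + t)" and t = tri and f' = "\<lambda>k. (- k, k)"
              and g' = "\<lambda>p v. fst v * v1 p + snd v * v2 p"])
          (use t sub tri_C1_D(4)[OF C] in \<open>auto intro!: derivative_eq_intros\<close>)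
      then show ?thesis by (rule has_derivative_eq_rhs) (auto simp: algebra_simps)
    qed
    obtain t where t: "t \<in> {0..d}" "v (m - d, m + d) - v (m - 0, m + 0) = (d - 0) * (v2 (m - t, m + t) - v1 (m - t, m + t))"
    proof (rule bexE)
      show "\<exists>t\<in>{0..d}. v (m - d, m + d) - v (m - 0, m + 0) = (d - 0) * (v2 (m - t, m + t) - v1 (m - t, m + t))"
        by (rule mvt_very_simple[OF md(3)]) (rule der, simp)
    qed
    have "v (m, m) = 0" using v_diag[of m] md assms by auto
    then have "\<bar>v (a, b)\<bar> = d * \<bar>v2 (m - t, m + t) - v1 (m - t, m + t)\<bar>"
      using t(2) md by (simp add: abs_mult)
    also have "\<dots> \<le> d * max B 0"
      using t(1) md by (intro mult_left_mono B) auto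
    also have "\<dots> \<le> (2 * d / (2 * m)) * max B 0"
    proof (rule mult_right_mono)
      have "m > 0" "d * m \<le> d * 1" using md assms mult_left_mono[of m 1 d] by auto
      then show "d \<le> 2 * d / (2 * m)" by (simp add: field_simps)
    qed simp
    also have "\<dots> = max B 0 * (b - a) / (a + b)" using md(1,2) by simp
    finally show ?thesis .
  qed
  then show ?thesis by (intro exI[of _ "max B 0"]) auto
qed

lemma energy_nn: "(\<integral>\<^sup>+c. ennreal (c * (hb c)\<^sup>2) \<partial>lborel) \<le> ennreal (E\<^sup>2)"
proof -
  have i: "set_integrable lborel {0..2} (\<lambda>c. c * (h (1 - c))\<^sup>2)"
    by (intro borel_integrable_atLeastAtMost' continuous_intros hb_cont)
  have eq: "indicator {0..2} c *\<^sub>R (c * (h (1 - c))\<^sup>2) = c * (hb c)\<^sup>2" for c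
    by (auto simp: hb_def indicator_def)
  have "(\<integral>\<^sup>+c. ennreal (c * (hb c)\<^sup>2) \<partial>lborel) = (\<integral>\<^sup>+c. ennreal (indicator {0..2} c *\<^sub>R (c * (h (1 - c))\<^sup>2)) \<partial>lborel)"
    unfolding eq ..
  also have "\<dots> = ennreal (LINT c:{0..2}|lborel. c * (h (1 - c))\<^sup>2)"
    unfolding set_lebesgue_integral_def
    by (intro nn_integral_eq_integral i[unfolded set_integrable_def]) (auto simp: indicator_def)
  also have "\<dots> \<le> ennreal (E\<^sup>2)"
    using energy by (simp add: set_borel_integral_eq_integral(2)[OF i] ennreal_leI)
  finally show ?thesis .
qed

text \<open>Cauchy--Schwarz in the additive form
  \<open>hb c \<le> c * (hb c)\<^sup>2 / E + E / c\<close>: the integral of the first term is at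
  most \<open>E\<close>, that of the second is \<open>E * ln (b / a)\<close>.\<close>

lemma free_sup_bound:
  assumes "0 < a" "a \<le> b"
  shows "ennreal (1 / 2) * (\<integral>\<^sup>+c. indicator {a..b} c * ennreal (hb c) \<partial>lborel) \<le> ennreal (E * (1 + ln (b / a)))"
proof -
  have l: "0 \<le> ln (b / a)" using assms by (intro ln_ge_zero) (simp add: field_simps)
  have "(\<integral>\<^sup>+c. indicator {a..b} c * ennreal (hb c) \<partial>lborel)
      \<le> (\<integral>\<^sup>+c. ennreal (1 / E) * ennreal (c * (hb c)\<^sup>2) + ennreal (E / c) * indicator {a..b} c \<partial>lborel)"
  proof (intro nn_integral_mono)
    fix c
    show "indicator {a..b} c * ennreal (hb c) \<le> ennreal (1 / E) * ennreal (c * (hb c)\<^sup>2) + ennreal (E / c) * indicator {a..b} c"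
    proof (cases "c \<in> {a..b}")
      case True
      then have c: "c > 0" using assms by auto
      have "1 / E * (c * (hb c)\<^sup>2) + E / c - hb c = ((c * hb c - E / 2)\<^sup>2 + 3 / 4 * E\<^sup>2) / (E * c)"
        using c E by (simp add: field_simps power2_eq_square)
      moreover have "0 \<le> ((c * hb c - E / 2)\<^sup>2 + 3 / 4 * E\<^sup>2) / (E * c)" using c E by simp
      ultimately have "hb c \<le> 1 / E * (c * (hb c)\<^sup>2) + E / c" by linarith
      then have "ennreal (hb c) \<le> ennreal (1 / E * (c * (hb c)\<^sup>2) + E / c)" by (rule ennreal_leI)
      also have "\<dots> = ennreal (1 / E) * ennreal (c * (hb c)\<^sup>2) + ennreal (E / c)"
        using c E ennreal_mult[of "1 / E" "c * (hb c)\<^sup>2"] by simp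
      finally show ?thesis using True by simp
    qed simp
  qed
  also have "\<dots> = ennreal (1 / E) * (\<integral>\<^sup>+c. ennreal (c * (hb c)\<^sup>2) \<partial>lborel) + (\<integral>\<^sup>+c. ennreal (E / c) * indicator {a..b} c \<partial>lborel)"
    by (simp add: nn_integral_add nn_integral_cmult)
  also have "(\<integral>\<^sup>+c. ennreal (E / c) * indicator {a..b} c \<partial>lborel) = ennreal (E * ln b - E * ln a)"
    using assms E by (intro nn_integral_FTC_Icc) (auto intro!: derivative_eq_intros)
  also have "ennreal (1 / E) * (\<integral>\<^sup>+c. ennreal (c * (hb c)\<^sup>2) \<partial>lborel) \<le> ennreal (1 / E) * ennreal (E\<^sup>2)"
    by (intro mult_left_mono energy_nn) auto
  also have "\<dots> = ennreal E" using E by (simp add: power2_eq_square flip: ennreal_mult)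
  also have "ennreal E + ennreal (E * ln b - E * ln a) = ennreal (E * (1 + ln (b / a)))"
    using E l assms by (subst ennreal_plus[symmetric]) (auto simp: ln_div algebra_simps)
  finally have "(\<integral>\<^sup>+c. indicator {a..b} c * ennreal (hb c) \<partial>lborel) \<le> ennreal (E * (1 + ln (b / a)))"
    by (simp add: add_right_mono)
  then have "ennreal (1 / 2) * (\<integral>\<^sup>+c. indicator {a..b} c * ennreal (hb c) \<partial>lborel) \<le> ennreal (1 / 2) * ennreal (E * (1 + ln (b / a)))"
    by (rule mult_left_mono) simp
  also have "\<dots> = ennreal (1 / 2 * (E * (1 + ln (b / a))))"
    using E l by (intro ennreal_mult[symmetric]) auto
  also have "\<dots> \<le> ennreal (E * (1 + ln (b / a)))"
    using E l by (intro ennreal_leI) auto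
  finally show ?thesis .
qed

lemma env_pos: "0 < a \<Longrightarrow> a \<le> b \<Longrightarrow> 0 \<le> m \<Longrightarrow> 0 < env E m (a, b)"
proof -
  assume *: "0 < a" "a \<le> b" "0 \<le> m"
  then have "0 \<le> ln (b / a)" by (intro ln_ge_zero) (simp add: field_simps)
  then have "0 < E * (1 + ln (b / a))" using E by (intro mult_pos_pos) auto
  moreover have "0 \<le> m * (b - a) / (a + b)" using * by auto
  ultimately show ?thesis by (simp add: env_def)
qed

lemma env_nonneg: "0 < a \<Longrightarrow> a \<le> b \<Longrightarrow> 0 \<le> m \<Longrightarrow> 0 \<le> env E m (a, b)"
  by (rule less_imp_le[OF env_pos])

text \<open>\<open>12 * E\<close> is the fixed point of \<open>m \<mapsto> 6 * E + m / 2\<close>, so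
  the limit forgets the starting value \<open>M\<close>.\<close>

lemma iterate_env:
  assumes base: "P M" "0 \<le> M" and step: "\<And>m. 0 \<le> m \<Longrightarrow> P m \<Longrightarrow> P (6 * E + m / 2)"
  shows "P (12 * E + (M - 12 * E) * (1 / 2) ^ n)"
proof (induction n)
  case 0
  show ?case using base by simp
next
  case (Suc n)
  have "0 \<le> 12 * E * (1 - (1 / 2) ^ n) + M * (1 / 2) ^ n"
    using E base by (intro add_nonneg_nonneg mult_nonneg_nonneg) (auto simp: power_le_one)
  then have pos: "0 \<le> 12 * E + (M - 12 * E) * (1 / 2) ^ n" by (simp add: algebra_simps)
  have eq: "6 * E + (12 * E + (M - 12 * E) * (1 / 2) ^ n) / 2 = 12 * E + (M - 12 * E) * (1 / 2) ^ Suc n"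
    by (simp add: field_simps)
  from step[OF pos Suc] show ?case unfolding eq .
qed

lemma iterate_env_limit:
  "(\<lambda>n. env E (12 * E + (M - 12 * E) * (1 / 2) ^ n) x) \<longlonglongrightarrow> env E (12 * E) x"
proof -
  have "(\<lambda>n. 12 * E + (M - 12 * E) * (1 / 2) ^ n) \<longlonglongrightarrow> 12 * E + (M - 12 * E) * 0"
    by (intro tendsto_intros LIMSEQ_realpow_zero) auto
  then have "(\<lambda>n. 12 * E + (M - 12 * E) * (1 / 2) ^ n) \<longlonglongrightarrow> 12 * E" by simp
  then show ?thesis unfolding env_def divide_inverse[where 'a = real and a = "_ * (snd x - fst x)"]
    by (intro tendsto_add tendsto_const tendsto_mult)
qed

theorem v_sup_bound:
  assumes ab: "0 < a" "a \<le> b" "a + b \<le> 2"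
  shows "\<bar>v (a, b)\<bar> \<le> env E (12 * E) (a, b)"
proof -
  \<comment> \<open>The restriction to \<open>a + b \<le> x + y\<close> makes a finite Lipschitz
    constant available. It is inherited, because the kernel at \<open>(x, y)\<close> only involves
    points whose sum is at least \<open>x + y\<close>.\<close>
  define P where "P m \<longleftrightarrow> (\<forall>x y. 0 < x \<longrightarrow> x \<le> y \<longrightarrow> x + y \<le> 2 \<longrightarrow> a + b \<le> x + y \<longrightarrow> \<bar>v (x, y)\<bar> \<le> env E m (x, y))" for m
  obtain M where M: "M \<ge> 0"
    "\<And>x y. 0 \<le> x \<Longrightarrow> x \<le> y \<Longrightarrow> x + y \<le> 2 \<Longrightarrow> a + b \<le> x + y \<Longrightarrow> \<bar>v (x, y)\<bar> \<le> M * (y - x) / (x + y)"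
    using v_lipschitz[of "a + b"] ab by auto
  have base: "P M"
    unfolding P_def
  proof (intro allI impI)
    fix x y :: real assume *: "0 < x" "x \<le> y" "x + y \<le> 2" "a + b \<le> x + y"
    then have "0 \<le> E * (1 + ln (y / x))" using env_nonneg[of x y 0] by (simp add: env_def)
    then show "\<bar>v (x, y)\<bar> \<le> env E M (x, y)" using M(2)[of x y] * by (simp add: env_def)
  qed
  have step: "P (6 * E + m / 2)" if m: "0 \<le> m" and P: "P m" for m
    unfolding P_def
  proof (intro allI impI)
    fix x y :: real assume *: "0 < x" "x \<le> y" "x + y \<le> 2" "a + b \<le> x + y"
    have l: "0 \<le> E * (1 + ln (y / x))" using env_nonneg[of x y 0] * by (simp add: env_def)
    have "(\<integral>\<^sup>+z. ennreal (ker x y z) * ennreal (vt z) \<partial>lborel) \<le> (\<integral>\<^sup>+z. ennreal (ker x y z * env E m z) \<partial>lborel)"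
    proof (intro nn_integral_mono)
      fix z :: "real \<times> real"
      obtain z1 z2 where z: "z = (z1, z2)" by (cases z)
      have "ker x y z * vt z \<le> ker x y z * env E m z"
      proof (cases "z \<in> reg x y")
        case True
        then have r: "x \<le> z1" "z1 \<le> y" "y \<le> z2" by (auto simp: reg_def z)
        have "vt z \<le> env E m z"
        proof (cases "z1 + z2 \<le> 2")
          case True
          then have "\<bar>v (z1, z2)\<bar> \<le> env E m (z1, z2)"
            using P r * unfolding P_def by auto
          then show ?thesis using r * True by (simp add: z vt_eq)
        next
          case False
          then have "vt z = 0" by (simp add: vt_def z)
          then show ?thesis using env_nonneg[of z1 z2 m] r * m by (simp add: z)
        qed
        then show ?thesis by (intro mult_left_mono ker_nonneg)
      qed (simp add: ker_def)
      then have "ennreal (ker x y z * vt z) \<le> ennreal (ker x y z * env E m z)" by (rule ennreal_leI)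
      then show "ennreal (ker x y z) * ennreal (vt z) \<le> ennreal (ker x y z * env E m z)"
        by (simp add: ennreal_mult ker_nonneg vt_nonneg)
    qed
    also have "\<dots> \<le> ennreal ((6 * E + m / 2) * (y - x) / (x + y))"
      using * E m by (intro nn_integral_ker_env) auto
    finally have "ennreal \<bar>v (x, y)\<bar> \<le> ennreal (E * (1 + ln (y / x))) + ennreal ((6 * E + m / 2) * (y - x) / (x + y))"
      using v_integral_bound[of x y] free_sup_bound[of x y] * by (meson add_mono order_trans)
    also have "\<dots> = ennreal (env E (6 * E + m / 2) (x, y))"
      using l * E m by (simp add: env_def flip: ennreal_plus)
    finally show "\<bar>v (x, y)\<bar> \<le> env E (6 * E + m / 2) (x, y)"
      using env_nonneg[of x y "6 * E + m / 2"] * E m by (simp add: ennreal_le_iff)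
  qed
  have "\<bar>v (a, b)\<bar> \<le> env E (12 * E + (M - 12 * E) * (1 / 2) ^ n) (a, b)" for n
    using iterate_env[of P M n] base M(1) step ab unfolding P_def by blast
  then show ?thesis
    using LIMSEQ_le_const[OF iterate_env_limit[of M "(a, b)"]] by blast
qed

section \<open>Square integrability along dilation orbits\<close>

definition H :: "real \<Rightarrow> real" where "H c = c * hb c"

lemma H_measurable[measurable]: "H \<in> borel_measurable borel"
  unfolding H_def[abs_def] by measurable

lemma H_nonneg: "0 \<le> c \<Longrightarrow> 0 \<le> H c" by (simp add: H_def hb_nonneg)

text \<open>The substitution \<open>c = exp (- s)\<close> turns \<open>dc / c\<close> into
  \<open>ds\<close>.\<close>

lemma H_energy: "(\<integral>\<^sup>+s. ennreal ((H (exp (- s)))\<^sup>2) \<partial>lborel) \<le> ennreal (E\<^sup>2)"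
proof -
  \<comment> \<open>Clamping \<open>c\<close> to \<open>{0..2}\<close> extends the integrand
    continuously to the whole line, so that its antiderivative is differentiable at every positive
    point.\<close>
  define k where "k c = (let c' = max 0 (min 2 c) in c' * (h (1 - c'))\<^sup>2)" for c :: real
  have ck: "continuous_on A k" for A
  proof -
    have "continuous_on A (\<lambda>c. h (1 - max 0 (min 2 c)))"
      by (rule continuous_on_compose2[OF hb_cont]) (auto intro!: continuous_intros)
    then show ?thesis unfolding k_def[abs_def] Let_def by (intro continuous_intros)
  qed
  have k0: "0 \<le> k c" for c by (simp add: k_def Let_def)
  have [measurable]: "k \<in> borel_measurable borel" by (intro borel_measurable_continuous_onI ck)
  define \<Theta> where "\<Theta> x = integral {0..x} k" for x
  have d\<Theta>: "DERIV \<Theta> x :> k x" if "x > 0" for x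
    using integral_has_real_derivative[OF ck, of x 0 "x + 1"] that at_within_Icc_at[of 0 x "x + 1"]
    by (simp add: \<Theta>_def[abs_def])
  have "(\<integral>\<^sup>+s. ennreal ((H (exp (- s)))\<^sup>2) \<partial>lborel) \<le> (\<integral>\<^sup>+s. ennreal (k (exp (- s)) * exp (- s)) * indicator {- ln 2..} s \<partial>lborel)"
  proof (intro nn_integral_mono)
    fix s :: real
    show "ennreal ((H (exp (- s)))\<^sup>2) \<le> ennreal (k (exp (- s)) * exp (- s)) * indicator {- ln 2..} s"
    proof (cases "exp (- s) \<le> 2")
      case True
      then have "- s \<le> ln 2" by (metis exp_gt_zero ln_exp ln_mono)
      then have "s \<in> {- ln 2..}" by simp
      moreover have "(H (exp (- s)))\<^sup>2 = k (exp (- s)) * exp (- s)"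
        using True by (simp add: H_def hb_def k_def Let_def power2_eq_square)
      ultimately show ?thesis by simp
    qed (simp add: H_def hb_def)
  qed
  also have "\<dots> = 0 - (- \<Theta> (exp (- (- ln 2))))"
  proof (rule nn_integral_FTC_atLeast)
    fix s :: real
    have "DERIV (\<lambda>s. \<Theta> (exp (- s))) s :> k (exp (- s)) * (- exp (- s))"
      by (rule DERIV_chain2[OF d\<Theta>]) (auto intro!: derivative_eq_intros)
    from DERIV_minus[OF this] show "DERIV (\<lambda>s. - \<Theta> (exp (- s))) s :> k (exp (- s)) * exp (- s)" by simp
    show "0 \<le> k (exp (- s)) * exp (- s)" using k0 by simp
  next
    have "continuous_on {0..2} \<Theta>"
      unfolding \<Theta>_def[abs_def] by (intro indefinite_integral_continuous_1 integrable_continuous_real ck)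
    then have "(\<Theta> \<longlongrightarrow> \<Theta> 0) (at 0 within {0..2})" by (simp add: continuous_on_def)
    moreover have "filterlim (\<lambda>s::real. exp (- s)) (at 0 within {0..2}) at_top"
      unfolding filterlim_at
    proof
      have "\<forall>\<^sub>F s in at_top. (0::real) \<le> s" by (rule eventually_ge_at_top)
      then show "\<forall>\<^sub>F s::real in at_top. exp (- s) \<in> {0..2} \<and> exp (- s) \<noteq> 0"
        by eventually_elim (auto intro: order_trans[of _ 1])
      show "((\<lambda>s::real. exp (- s)) \<longlongrightarrow> 0) at_top"
        by (rule filterlim_compose[OF exp_at_bot filterlim_uminus_at_bot_at_top])
    qed
    ultimately have "((\<lambda>s. \<Theta> (exp (- s))) \<longlongrightarrow> \<Theta> 0) at_top" by (rule filterlim_compose)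
    moreover have "\<Theta> 0 = 0" by (simp add: \<Theta>_def)
    ultimately show "((\<lambda>s. - \<Theta> (exp (- s))) \<longlongrightarrow> 0) at_top"
      using tendsto_minus by fastforce
  qed measurable
  also have "0 - (- \<Theta> (exp (- (- ln 2)))) = integral {0..2} (\<lambda>c. c * (h (1 - c))\<^sup>2)"
    unfolding \<Theta>_def by (simp, intro Henstock_Kurzweil_Integration.integral_cong) (simp add: k_def)
  finally show ?thesis using energy by (meson ennreal_leI order_trans)
qed

text \<open>Dilation by \<open>\<gamma>\<close> is translation by \<open>ln \<gamma>\<close> in
  \<open>s\<close>, and the integral over all times is translation invariant.\<close>

lemma H_energy_scaled:
  assumes "0 < \<gamma>"
  shows "(\<integral>\<^sup>+s. (ennreal (H (exp (- s) * \<gamma>)))\<^sup>2 \<partial>lborel) \<le> ennreal (E\<^sup>2)"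
proof -
  have "(\<integral>\<^sup>+s. ennreal ((H (exp (- s)))\<^sup>2) \<partial>lborel) = ennreal \<bar>1\<bar> * (\<integral>\<^sup>+s. ennreal ((H (exp (- (- ln \<gamma> + 1 * s))))\<^sup>2) \<partial>lborel)"
    by (intro nn_integral_real_affine) measurable
  also have "\<dots> = (\<integral>\<^sup>+s. (ennreal (H (exp (- s) * \<gamma>)))\<^sup>2 \<partial>lborel)"
    using assms by (simp add: exp_diff exp_minus ennreal_power H_nonneg field_simps)
  finally show ?thesis using H_energy by simp
qed

end

lemma borel_measurable_scaled_pair[measurable]:
  fixes f :: "real \<times> real \<Rightarrow> 'b::topological_space"
  assumes [measurable]: "f \<in> borel_measurable borel"
  shows "(\<lambda>(s, x). f (exp (- s) * fst x, exp (- s) * snd x)) \<in> borel_measurable (lborel \<Otimes>\<^sub>M lborel)"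
    and "(\<lambda>s. f (exp (- s) * a, exp (- s) * b)) \<in> borel_measurable borel"
    and "(\<lambda>x. f (r * fst x, r * snd x)) \<in> borel_measurable borel"
proof -
  have [measurable]: "(\<lambda>z :: real \<times> real \<times> real. f (exp (- fst z) * fst (snd z), exp (- fst z) * snd (snd z))) \<in> borel_measurable borel"
    by (rule measurable_compose[OF _ assms(1)]) (intro borel_measurable_continuous_onI continuous_intros)
  then show "(\<lambda>(s, x). f (exp (- s) * fst x, exp (- s) * snd x)) \<in> borel_measurable (lborel \<Otimes>\<^sub>M lborel)"
    by (simp add: lborel_prod case_prod_unfold)
  show "(\<lambda>s. f (exp (- s) * a, exp (- s) * b)) \<in> borel_measurable borel"
    by (rule measurable_compose[OF _ assms(1)]) (intro borel_measurable_continuous_onI continuous_intros)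
  show "(\<lambda>x. f (r * fst x, r * snd x)) \<in> borel_measurable borel"
    by (rule measurable_compose[OF _ assms(1)]) (intro borel_measurable_continuous_onI continuous_intros)
qed

lemma sigma_finite_lborel: "sigma_finite_measure lborel"
  by (rule lborel.sigma_finite_measure_axioms)

context null_wave begin

text \<open>The truncation makes the norms below finite a priori, so that the contraction can be iterated.\<close>

definition vT :: "real \<Rightarrow> real \<times> real \<Rightarrow> real" where
  "vT T x = indicator {x. 2 * exp (- T) \<le> fst x + snd x} x * vt x"

lemma vT_measurable[measurable]: "vT T \<in> borel_measurable borel"
proof -
  have "{x :: real \<times> real. 2 * exp (- T) \<le> fst x + snd x} = {x \<in> space borel. 2 * exp (- T) \<le> fst x + snd x}" by simp
  also have "\<dots> \<in> sets borel" by measurable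
  finally have [measurable]: "{x :: real \<times> real. 2 * exp (- T) \<le> fst x + snd x} \<in> sets borel" .
  show ?thesis unfolding vT_def[abs_def] by measurable
qed

text \<open>The kernel is homogeneous of degree -2, so a dilation of \<open>(p, q)\<close> is
  absorbed by the change of variables: one kernel, independent of \<open>s\<close>, acts on the
  solution along all orbits.\<close>

lemma vt_scaled_bound:
  assumes p: "0 < p" "p \<le> q"
  shows "ennreal (vt (exp (- s) * p, exp (- s) * q)) \<le>
     (\<integral>\<^sup>+\<gamma>. ennreal (indicator {p..q} \<gamma> / (2 * \<gamma>)) * ennreal (H (exp (- s) * \<gamma>)) \<partial>lborel)
     + (\<integral>\<^sup>+x. ennreal (ker p q x) * ennreal (vt (exp (- s) * fst x, exp (- s) * snd x)) \<partial>lborel)"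
proof (cases "exp (- s) * p + exp (- s) * q \<le> 2")
  case True
  define e where "e = exp (- s)"
  have e: "e > 0" by (simp add: e_def)
  have 1: "ennreal (1 / 2) * (\<integral>\<^sup>+c. indicator {e * p..e * q} c * ennreal (hb c) \<partial>lborel)
      = (\<integral>\<^sup>+\<gamma>. ennreal (indicator {p..q} \<gamma> / (2 * \<gamma>)) * ennreal (H (e * \<gamma>)) \<partial>lborel)"
  proof -
    have "(\<integral>\<^sup>+c. indicator {e * p..e * q} c * ennreal (hb c) \<partial>lborel)
        = ennreal \<bar>e\<bar> * (\<integral>\<^sup>+\<gamma>. indicator {e * p..e * q} (0 + e * \<gamma>) * ennreal (hb (0 + e * \<gamma>)) \<partial>lborel)"
      using e by (intro nn_integral_real_affine) auto
    then have "ennreal (1 / 2) * (\<integral>\<^sup>+c. indicator {e * p..e * q} c * ennreal (hb c) \<partial>lborel)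
        = (\<integral>\<^sup>+\<gamma>. ennreal (1 / 2) * (ennreal e * (indicator {e * p..e * q} (e * \<gamma>) * ennreal (hb (e * \<gamma>)))) \<partial>lborel)"
      using e by (simp add: nn_integral_cmult)
    also have "\<dots> = (\<integral>\<^sup>+\<gamma>. ennreal (indicator {p..q} \<gamma> / (2 * \<gamma>)) * ennreal (H (e * \<gamma>)) \<partial>lborel)"
    proof (intro nn_integral_cong)
      fix \<gamma>
      show "ennreal (1 / 2) * (ennreal e * (indicator {e * p..e * q} (e * \<gamma>) * ennreal (hb (e * \<gamma>))))
          = ennreal (indicator {p..q} \<gamma> / (2 * \<gamma>)) * ennreal (H (e * \<gamma>))"
      proof (cases "\<gamma> \<in> {p..q}")
        case True
        then have g: "\<gamma> > 0" using p by auto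
        have "ennreal (1 / 2) * (ennreal e * ennreal (hb (e * \<gamma>))) = ennreal (1 / 2 * (e * hb (e * \<gamma>)))"
          using e hb_nonneg by (simp only: ennreal_mult mult_nonneg_nonneg less_imp_le zero_le_divide_1_iff zero_le_numeral)
        also have "1 / 2 * (e * hb (e * \<gamma>)) = 1 / (2 * \<gamma>) * H (e * \<gamma>)"
          using g by (simp add: H_def)
        also have "ennreal \<dots> = ennreal (1 / (2 * \<gamma>)) * ennreal (H (e * \<gamma>))"
          using g e by (intro ennreal_mult H_nonneg) auto
        finally show ?thesis using True e by simp
      qed (use e in auto)
    qed
    finally show ?thesis .
  qed
  have 2: "(\<integral>\<^sup>+x. ennreal (ker (e * p) (e * q) x) * ennreal (vt x) \<partial>lborel)
      = (\<integral>\<^sup>+x. ennreal (ker p q x) * ennreal (vt (e * fst x, e * snd x)) \<partial>lborel)"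
  proof -
    have "(\<integral>\<^sup>+x. ennreal (ker (e * p) (e * q) x) * ennreal (vt x) \<partial>lborel)
        = ennreal (e\<^sup>2) * (\<integral>\<^sup>+x. ennreal (ker (e * p) (e * q) (e * fst x, e * snd x)) * ennreal (vt (e * fst x, e * snd x)) \<partial>lborel)"
      using e by (intro nn_integral_lborel_scale2) auto
    also have "\<dots> = (\<integral>\<^sup>+x. ennreal (e\<^sup>2) * (ennreal (ker (e * p) (e * q) (e * fst x, e * snd x)) * ennreal (vt (e * fst x, e * snd x))) \<partial>lborel)"
      by (intro nn_integral_cmult[symmetric]) measurable
    also have "\<dots> = (\<integral>\<^sup>+x. ennreal (ker p q x) * ennreal (vt (e * fst x, e * snd x)) \<partial>lborel)"
    proof (intro nn_integral_cong)
      fix x :: "real \<times> real"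
      have "(e * fst x + e * snd x)\<^sup>2 = e\<^sup>2 * (fst x + snd x)\<^sup>2"
        by (simp add: power_mult_distrib flip: distrib_left)
      moreover have "(e * fst x, e * snd x) \<in> reg (e * p) (e * q) \<longleftrightarrow> x \<in> reg p q"
        using e by (simp add: reg_def)
      ultimately have "e\<^sup>2 * ker (e * p) (e * q) (e * fst x, e * snd x) = ker p q x"
        using e by (simp add: ker_def indicator_def)
      then show "ennreal (e\<^sup>2) * (ennreal (ker (e * p) (e * q) (e * fst x, e * snd x)) * ennreal (vt (e * fst x, e * snd x)))
          = ennreal (ker p q x) * ennreal (vt (e * fst x, e * snd x))"
        using ennreal_mult[of "e\<^sup>2" "ker (e * p) (e * q) (e * fst x, e * snd x)"] ker_nonneg
        by (simp add: mult.assoc[symmetric])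
    qed
    finally show ?thesis .
  qed
  have "ennreal (vt (e * p, e * q)) = ennreal \<bar>v (e * p, e * q)\<bar>"
    using p e True by (subst vt_eq) (auto simp: e_def)
  also have "\<dots> \<le> ennreal (1 / 2) * (\<integral>\<^sup>+c. indicator {e * p..e * q} c * ennreal (hb c) \<partial>lborel)
      + (\<integral>\<^sup>+x. ennreal (ker (e * p) (e * q) x) * ennreal (vt x) \<partial>lborel)"
    using p e True by (intro v_integral_bound) (auto simp: e_def)
  finally show ?thesis unfolding 1 2 unfolding e_def .
next
  case False
  then show ?thesis by (simp add: vt_def)
qed

text \<open>The kernel only involves points whose sum is at least \<open>p + q\<close>, so the
  truncation passes under the integral.\<close>

lemma vT_scaled_bound:
  assumes p: "0 < p" "p \<le> q"
  shows "ennreal (vT T (exp (- s) * p, exp (- s) * q)) \<le>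
     (\<integral>\<^sup>+\<gamma>. ennreal (indicator {p..q} \<gamma> / (2 * \<gamma>)) * ennreal (H (exp (- s) * \<gamma>)) \<partial>lborel)
     + (\<integral>\<^sup>+x. ennreal (ker p q x) * ennreal (vT T (exp (- s) * fst x, exp (- s) * snd x)) \<partial>lborel)"
proof (cases "2 * exp (- T) \<le> exp (- s) * p + exp (- s) * q")
  case True
  have "(\<integral>\<^sup>+x. ennreal (ker p q x) * ennreal (vt (exp (- s) * fst x, exp (- s) * snd x)) \<partial>lborel)
      = (\<integral>\<^sup>+x. ennreal (ker p q x) * ennreal (vT T (exp (- s) * fst x, exp (- s) * snd x)) \<partial>lborel)"
  proof (intro nn_integral_cong)
    fix x :: "real \<times> real"
    show "ennreal (ker p q x) * ennreal (vt (exp (- s) * fst x, exp (- s) * snd x))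
        = ennreal (ker p q x) * ennreal (vT T (exp (- s) * fst x, exp (- s) * snd x))"
    proof (cases "x \<in> reg p q")
      case r: True
      then have "exp (- s) * p + exp (- s) * q \<le> exp (- s) * fst x + exp (- s) * snd x"
        by (auto simp: reg_def intro!: add_mono)
      then show ?thesis using True by (simp add: vT_def)
    qed (simp add: ker_def)
  qed
  then show ?thesis using vt_scaled_bound[OF p, of s] True by (simp add: vT_def)
qed (simp add: vT_def)

text \<open>The counterpart of the pointwise bound with the supremum replaced by the L2 norm along
  the dilation orbit of \<open>(p, q)\<close>.\<close>

definition L2_bound :: "(real \<times> real \<Rightarrow> real) \<Rightarrow> real \<Rightarrow> bool" where
  "L2_bound w m \<longleftrightarrow> (\<forall>p q. 0 < p \<longrightarrow> p \<le> q \<longrightarrow>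
     (\<integral>\<^sup>+s. (ennreal (w (exp (- s) * p, exp (- s) * q)))\<^sup>2 \<partial>lborel) \<le> ennreal ((env E m (p, q))\<^sup>2))"

text \<open>The truncation confines \<open>s\<close> to an interval of length
  \<open>max T 0\<close>, and the Lipschitz bound is constant along an orbit because
  \<open>(q - p) / (p + q)\<close> is dilation invariant.\<close>

lemma L2_base: "\<exists>m\<ge>0. L2_bound (vT T) m"
proof -
  obtain M where M: "M \<ge> 0"
    "\<And>x y. 0 \<le> x \<Longrightarrow> x \<le> y \<Longrightarrow> x + y \<le> 2 \<Longrightarrow> 2 * exp (- T) \<le> x + y \<Longrightarrow> \<bar>v (x, y)\<bar> \<le> M * (y - x) / (x + y)"
    using v_lipschitz[of "2 * exp (- T)"] by auto
  define T' where "T' = max T 0"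
  have "L2_bound (vT T) (sqrt T' * M)"
    unfolding L2_bound_def
  proof (intro allI impI)
    fix p q :: real assume p: "0 < p" "p \<le> q"
    define y where "y = (q - p) / (p + q)"
    have y: "0 \<le> y" using p by (simp add: y_def)
    define l where "l = ln ((p + q) / 2)"
    have el: "exp l = (p + q) / 2" using p by (simp add: l_def)
    have "(\<integral>\<^sup>+s. (ennreal (vT T (exp (- s) * p, exp (- s) * q)))\<^sup>2 \<partial>lborel) \<le> (\<integral>\<^sup>+s. ennreal ((M * y)\<^sup>2) * indicator {l..l + T'} s \<partial>lborel)"
    proof (intro nn_integral_mono)
      fix s
      show "(ennreal (vT T (exp (- s) * p, exp (- s) * q)))\<^sup>2 \<le> ennreal ((M * y)\<^sup>2) * indicator {l..l + T'} s"
      proof (cases "2 * exp (- T) \<le> exp (- s) * p + exp (- s) * q \<and> exp (- s) * p + exp (- s) * q \<le> 2")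
        case True
        have sum: "exp (- s) * p + exp (- s) * q = 2 * exp (l - s)"
          by (simp add: exp_diff el exp_minus field_simps)
        have "exp (l - s) \<le> exp 0" "exp (- T) \<le> exp (l - s)" using True unfolding sum by auto
        then have "s \<in> {l..l + T'}" unfolding exp_le_cancel_iff by (auto simp: T'_def)
        have "\<bar>v (exp (- s) * p, exp (- s) * q)\<bar> \<le> M * (exp (- s) * q - exp (- s) * p) / (exp (- s) * p + exp (- s) * q)"
          using True p by (intro M(2)) auto
        also have "\<dots> = M * y"
          by (simp add: y_def flip: distrib_left right_diff_distrib)
        finally have "vT T (exp (- s) * p, exp (- s) * q) \<le> M * y"
          using True p by (simp add: vT_def vt_eq)
        moreover have "0 \<le> vT T (exp (- s) * p, exp (- s) * q)" by (simp add: vT_def vt_nonneg)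
        ultimately have "(vT T (exp (- s) * p, exp (- s) * q))\<^sup>2 \<le> (M * y)\<^sup>2" by (intro power_mono)
        then show ?thesis using \<open>s \<in> _\<close> \<open>0 \<le> vT T _\<close> by (simp add: ennreal_power ennreal_leI)
      qed (auto simp: vT_def vt_def)
    qed
    also have "\<dots> = ennreal ((M * y)\<^sup>2) * ennreal T'"
      by (simp add: nn_integral_cmult T'_def)
    also have "\<dots> = ennreal ((sqrt T' * M * y)\<^sup>2)"
      by (simp add: T'_def power_mult_distrib mult_ac flip: ennreal_mult)
    also have "\<dots> \<le> ennreal ((env E (sqrt T' * M) (p, q))\<^sup>2)"
    proof (intro ennreal_leI power_mono)
      have "0 \<le> E * (1 + ln (q / p))" using env_nonneg[of p q 0] p by (simp add: env_def)
      then show "sqrt T' * M * y \<le> env E (sqrt T' * M) (p, q)" by (simp add: env_def y_def)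
      show "0 \<le> sqrt T' * M * y" using M(1) y by (simp add: T'_def)
    qed
    finally show "(\<integral>\<^sup>+s. (ennreal (vT T (exp (- s) * p, exp (- s) * q)))\<^sup>2 \<partial>lborel) \<le> ennreal ((env E (sqrt T' * M) (p, q))\<^sup>2)" .
  qed
  moreover have "0 \<le> sqrt T' * M" using M(1) by (simp add: T'_def)
  ultimately show ?thesis by blast
qed

text \<open>Minkowski's inequality takes the norm in \<open>s\<close> inside both integrals. The
  free part is controlled by the dilation invariance of the energy, and the kernel part becomes the
  integral already evaluated for the pointwise bound.\<close>

lemma L2_step:
  assumes m: "0 \<le> m" and B: "L2_bound (vT T) m"
  shows "L2_bound (vT T) (6 * E + m / 2)"
  unfolding L2_bound_def
proof (intro allI impI)
  fix p q :: real assume p: "0 < p" "p \<le> q"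
  show "(\<integral>\<^sup>+s. (ennreal (vT T (exp (- s) * p, exp (- s) * q)))\<^sup>2 \<partial>lborel) \<le> ennreal ((env E (6 * E + m / 2) (p, q))\<^sup>2)"
  \<comment> \<open>On the diagonal the kernel bound \<open>Q\<close> would be zero, while the
    addition of the two L2 norms divides by it.\<close>
  proof (cases "p = q")
    case True
    have "vT T (exp (- s) * p, exp (- s) * q) = 0" for s
      using v_diag[of "exp (- s) * q"] p True by (auto simp: vT_def vt_def indicator_def mult.commute)
    then show ?thesis by simp
  next
    case False
    define P where "P = E * (1 + ln (q / p))"
    define Q where "Q = (6 * E + m / 2) * (q - p) / (p + q)"
    have l: "0 \<le> ln (q / p)" using p by (intro ln_ge_zero) (simp add: field_simps)
    have PQ: "P > 0" "Q > 0" using E m p False l by (auto simp: P_def Q_def intro!: mult_pos_pos divide_pos_pos add_pos_nonneg)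
    define X where "X s = (\<integral>\<^sup>+\<gamma>. ennreal (indicator {p..q} \<gamma> / (2 * \<gamma>)) * ennreal (H (exp (- s) * \<gamma>)) \<partial>lborel)" for s
    define Y where "Y s = (\<integral>\<^sup>+x. ennreal (ker p q x) * ennreal (vT T (exp (- s) * fst x, exp (- s) * snd x)) \<partial>lborel)" for s
    have [measurable]: "X \<in> borel_measurable lborel"
      unfolding X_def[abs_def] by measurable
    have [measurable]: "(\<lambda>(s, x). vT T (exp (- s) * fst x, exp (- s) * snd x)) \<in> borel_measurable (lborel \<Otimes>\<^sub>M lborel)"
      by (rule borel_measurable_scaled_pair) simp
    then have vm: "(\<lambda>(s, x). ennreal (vT T (exp (- s) * fst x, exp (- s) * snd x))) \<in> borel_measurable (lborel \<Otimes>\<^sub>M lborel)"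
      by (simp add: case_prod_unfold)
    have "(\<lambda>(s, x). ennreal (ker p q x) * ennreal (vT T (exp (- s) * fst x, exp (- s) * snd x))) \<in> borel_measurable (lborel \<Otimes>\<^sub>M lborel)"
      using vm by (simp add: case_prod_unfold)
    then have [measurable]: "Y \<in> borel_measurable lborel"
      unfolding Y_def[abs_def] using lborel.borel_measurable_nn_integral_fst by fastforce
    have "(\<integral>\<^sup>+s. (X s)\<^sup>2 \<partial>lborel) \<le> (\<integral>\<^sup>+\<gamma>. ennreal (indicator {p..q} \<gamma> / (2 * \<gamma>) * E) \<partial>lborel)\<^sup>2"
      unfolding X_def
      by (intro nn_integral_L2_Minkowski sigma_finite_lborel H_energy_scaled E)
        (use p in \<open>auto simp: indicator_def split: if_splits\<close>)
    also have "(\<integral>\<^sup>+\<gamma>. ennreal (indicator {p..q} \<gamma> / (2 * \<gamma>) * E) \<partial>lborel) = (\<integral>\<^sup>+\<gamma>. ennreal (E / (2 * \<gamma>)) * indicator {p..q} \<gamma> \<partial>lborel)"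
      by (intro nn_integral_cong) (auto simp: indicator_def)
    also have "\<dots> = ennreal (E / 2 * ln q - E / 2 * ln p)"
      using p E by (intro nn_integral_FTC_Icc) (auto intro!: derivative_eq_intros)
    also have "\<dots>\<^sup>2 = ennreal ((E / 2 * ln (q / p))\<^sup>2)"
    proof -
      have "E / 2 * ln q - E / 2 * ln p = E / 2 * ln (q / p)" using p by (simp add: ln_div algebra_simps)
      moreover have "0 \<le> E / 2 * ln (q / p)" using l E by simp
      ultimately show ?thesis by (simp add: ennreal_power)
    qed
    also have "\<dots> \<le> ennreal (P\<^sup>2)"
      unfolding P_def using l E by (intro ennreal_leI power_mono) (auto simp: algebra_simps)
    finally have XP: "(\<integral>\<^sup>+s. (X s)\<^sup>2 \<partial>lborel) \<le> ennreal (P\<^sup>2)" .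
    have "(\<integral>\<^sup>+s. (Y s)\<^sup>2 \<partial>lborel) \<le> (\<integral>\<^sup>+x. ennreal (ker p q x * env E m x) \<partial>lborel)\<^sup>2"
      unfolding Y_def
    proof (intro nn_integral_L2_Minkowski sigma_finite_lborel vm ker_nonneg)
      fix x assume "ker p q x \<noteq> 0"
      then have r: "0 < fst x" "fst x \<le> snd x" using p by (auto simp: ker_def reg_def indicator_def split: if_splits)
      then show "0 < env E m x" using env_pos[of "fst x" "snd x" m] m by simp
      show "(\<integral>\<^sup>+s. (ennreal (vT T (exp (- s) * fst x, exp (- s) * snd x)))\<^sup>2 \<partial>lborel) \<le> ennreal ((env E m x)\<^sup>2)"
        using B r unfolding L2_bound_def by (cases x) simp
    qed auto
    also have "\<dots> \<le> (ennreal Q)\<^sup>2"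
      unfolding Q_def using p E m by (intro power_mono nn_integral_ker_env) auto
    also have "\<dots> = ennreal (Q\<^sup>2)" using PQ by (simp add: ennreal_power)
    finally have YQ: "(\<integral>\<^sup>+s. (Y s)\<^sup>2 \<partial>lborel) \<le> ennreal (Q\<^sup>2)" .
    have "(\<integral>\<^sup>+s. (ennreal (vT T (exp (- s) * p, exp (- s) * q)))\<^sup>2 \<partial>lborel) \<le> (\<integral>\<^sup>+s. (X s + Y s)\<^sup>2 \<partial>lborel)"
      unfolding X_def Y_def by (intro nn_integral_mono power_mono vT_scaled_bound p) auto
    also have "\<dots> \<le> ennreal ((P + Q)\<^sup>2)"
      by (intro nn_integral_L2_add XP YQ PQ) auto
    also have "P + Q = env E (6 * E + m / 2) (p, q)" by (simp add: P_def Q_def env_def)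
    finally show ?thesis .
  qed
qed

text \<open>The iteration makes the bound for the truncated function independent of
  \<open>T\<close>, and Fatou's lemma removes the truncation.\<close>

theorem vt_L2_bound:
  assumes p: "0 < p" "p \<le> q"
  shows "(\<integral>\<^sup>+s. (ennreal (vt (exp (- s) * p, exp (- s) * q)))\<^sup>2 \<partial>lborel) \<le> ennreal ((env E (12 * E) (p, q))\<^sup>2)"
proof -
  have T: "(\<integral>\<^sup>+s. (ennreal (vT T (exp (- s) * p, exp (- s) * q)))\<^sup>2 \<partial>lborel) \<le> ennreal ((env E (12 * E) (p, q))\<^sup>2)" for T
  proof -
    obtain M where M: "0 \<le> M" "L2_bound (vT T) M" using L2_base by blast
    have "(\<integral>\<^sup>+s. (ennreal (vT T (exp (- s) * p, exp (- s) * q)))\<^sup>2 \<partial>lborel)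
        \<le> ennreal ((env E (12 * E + (M - 12 * E) * (1 / 2) ^ n) (p, q))\<^sup>2)" for n
      using iterate_env[of "L2_bound (vT T)" M n] M L2_step p unfolding L2_bound_def by blast
    moreover have "(\<lambda>n. ennreal ((env E (12 * E + (M - 12 * E) * (1 / 2) ^ n) (p, q))\<^sup>2)) \<longlonglongrightarrow> ennreal ((env E (12 * E) (p, q))\<^sup>2)"
      by (intro tendsto_ennrealI tendsto_power iterate_env_limit)
    ultimately show ?thesis using LIMSEQ_le_const by blast
  qed
  have "(\<integral>\<^sup>+s. (ennreal (vt (exp (- s) * p, exp (- s) * q)))\<^sup>2 \<partial>lborel)
      = (\<integral>\<^sup>+s. liminf (\<lambda>n. (ennreal (vT (real n) (exp (- s) * p, exp (- s) * q)))\<^sup>2) \<partial>lborel)"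
  proof (intro nn_integral_cong)
    fix s
    obtain n0 where n0: "real n0 \<ge> s - ln ((p + q) / 2)" using real_arch_simple by blast
    have "\<forall>\<^sub>F n in sequentially. (ennreal (vT (real n) (exp (- s) * p, exp (- s) * q)))\<^sup>2 = (ennreal (vt (exp (- s) * p, exp (- s) * q)))\<^sup>2"
    proof (rule eventually_sequentiallyI)
      fix n assume "n0 \<le> n"
      then have "- real n \<le> - s + ln ((p + q) / 2)" using n0 by linarith
      then have "exp (- real n) \<le> exp (- s + ln ((p + q) / 2))" by simp
      also have "\<dots> = exp (- s) * ((p + q) / 2)" unfolding exp_add using p by simp
      finally have "2 * exp (- real n) \<le> exp (- s) * p + exp (- s) * q" by (simp add: algebra_simps)
      then show "(ennreal (vT (real n) (exp (- s) * p, exp (- s) * q)))\<^sup>2 = (ennreal (vt (exp (- s) * p, exp (- s) * q)))\<^sup>2"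
        by (simp add: vT_def)
    qed
    then have "(\<lambda>n. (ennreal (vT (real n) (exp (- s) * p, exp (- s) * q)))\<^sup>2) \<longlonglongrightarrow> (ennreal (vt (exp (- s) * p, exp (- s) * q)))\<^sup>2"
      by (rule tendsto_eventually)
    then show "(ennreal (vt (exp (- s) * p, exp (- s) * q)))\<^sup>2 = liminf (\<lambda>n. (ennreal (vT (real n) (exp (- s) * p, exp (- s) * q)))\<^sup>2)"
      by (intro lim_imp_Liminf[symmetric]) auto
  qed
  also have "\<dots> \<le> liminf (\<lambda>n. \<integral>\<^sup>+s. (ennreal (vT (real n) (exp (- s) * p, exp (- s) * q)))\<^sup>2 \<partial>lborel)"
    by (intro nn_integral_liminf) (auto intro!: borel_measurable_scaled_pair)
  also have "\<dots> \<le> liminf (\<lambda>n::nat. ennreal ((env E (12 * E) (p, q))\<^sup>2))"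
    by (intro Liminf_mono always_eventually allI T)
  also have "\<dots> = ennreal ((env E (12 * E) (p, q))\<^sup>2)" by (intro Liminf_const) simp
  finally show ?thesis .
qed

end

section \<open>Separation of time and space dependence\<close>

lemma nn_integral_indicator_has_integral:
  fixes f :: "real \<Rightarrow> real"
  assumes [measurable]: "f \<in> borel_measurable borel" "\<Omega> \<in> sets borel"
    and "\<And>x. x \<in> \<Omega> \<Longrightarrow> 0 \<le> f x" and I: "(f has_integral I) \<Omega>"
  shows "(\<integral>\<^sup>+x. ennreal (indicator \<Omega> x * f x) \<partial>lborel) = ennreal I"
proof (rule nn_integral_has_integral_lborel)
  have "(\<lambda>x. indicator \<Omega> x * f x) = (\<lambda>x. if x \<in> \<Omega> then f x else 0)" by auto
  then show "((\<lambda>x. indicator \<Omega> x * f x) has_integral I) UNIV"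
    using I by (simp only: has_integral_restrict_UNIV)
qed (use assms in \<open>auto simp: indicator_def\<close>)

context null_wave begin

text \<open>The square root is a crude majorant of the logarithm that is integrable at
  \<open>a = 0\<close> and, against \<open>1 / b\<^sup>2\<close>, at infinity; 14 is 2 + 12.\<close>

lemma env_le_sqrt:
  assumes "0 < a" "a \<le> b"
  shows "env E (12 * E) (a, b) \<le> 14 * E * (a powr (- 1 / 2) * b powr (1 / 2))"
proof -
  have b: "b > 0" using assms by simp
  have r: "1 \<le> b / a" using assms by (simp add: field_simps)
  have "ln (sqrt (b / a)) \<le> sqrt (b / a) - 1" using r by (intro ln_le_minus_one) auto
  then have "1 + ln (b / a) \<le> 2 * sqrt (b / a)" using r by (simp add: ln_sqrt)
  then have 1: "E * (1 + ln (b / a)) \<le> E * (2 * sqrt (b / a))" using E by (intro mult_left_mono) auto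
  have "(b - a) / (a + b) \<le> 1" using assms by (simp add: field_simps)
  also have "1 \<le> sqrt (b / a)" using r by simp
  finally have "12 * E * ((b - a) / (a + b)) \<le> 12 * E * sqrt (b / a)" using E by (intro mult_left_mono) auto
  with 1 have "env E (12 * E) (a, b) \<le> 14 * E * sqrt (b / a)" by (simp add: env_def)
  also have "sqrt (b / a) = a powr (- 1 / 2) * b powr (1 / 2)"
    using assms b by (simp add: powr_half_sqrt[symmetric] powr_divide powr_minus_divide)
  finally show ?thesis .
qed

text \<open>Every exponent of modulus below 1/6 makes the sixth power integrable at the end point,
  and 1/8 is used throughout; 208 is 13 * 16.\<close>

lemma env_le_powr:
  assumes "0 \<le> y" "y < 1"
  shows "env E (12 * E) (1 - y, 1 + y) \<le> 208 * E * (1 - y) powr (- 1 / 8)"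
proof -
  define r where "r = (1 + y) / (1 - y)"
  have r: "1 \<le> r" using assms by (simp add: r_def field_simps)
  have l: "0 \<le> ln r" using r by (rule ln_ge_zero)
  have "ln (r powr (1 / 8)) \<le> r powr (1 / 8) - 1" using r by (intro ln_le_minus_one) auto
  then have "1 + ln r \<le> 8 * r powr (1 / 8)" using r by (simp add: ln_powr)
  also have "r powr (1 / 8) \<le> (2 / (1 - y)) powr (1 / 8)"
    using assms r by (intro powr_mono2) (auto simp: r_def divide_right_mono)
  also have "\<dots> = 2 powr (1 / 8) * (1 - y) powr (- 1 / 8)"
    using assms by (simp add: powr_divide powr_minus_divide)
  also have "\<dots> \<le> 2 powr 1 * (1 - y) powr (- 1 / 8)"
    by (intro mult_right_mono powr_mono) auto
  finally have 1: "1 + ln r \<le> 16 * (1 - y) powr (- 1 / 8)" by simp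
  have "E * (12 * y) \<le> E * (12 * (1 + ln r))" using assms l E by (intro mult_left_mono) auto
  then have "env E (12 * E) (1 - y, 1 + y) \<le> 13 * E * (1 + ln r)"
    by (simp add: env_def r_def algebra_simps)
  also have "\<dots> \<le> 13 * E * (16 * (1 - y) powr (- 1 / 8))" using 1 E by (intro mult_left_mono) auto
  finally show ?thesis by simp
qed

text \<open>\<open>1 / \<gamma>\<close> is split as
  \<open>\<gamma> powr (- 1 / 8) * \<gamma> powr (- 7 / 8)\<close>. On \<open>{1 - y..1 + y}\<close>
  the first factor is at most \<open>(1 - y) powr (- 1 / 8)\<close>, and the second is integrable
  and independent of \<open>y\<close>.\<close>

definition w1 :: "real \<Rightarrow> real" where "w1 \<gamma> = indicator {0..2} \<gamma> * \<gamma> powr (- 7 / 8) / 2"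

text \<open>The set contains \<open>reg (1 - y) (1 + y)\<close> for all
  \<open>0 \<le> y < 1\<close>, so \<open>w2\<close> dominates all these kernels at once.\<close>

definition w2 :: "real \<times> real \<Rightarrow> real" where
  "w2 x = indicator {x. 0 < fst x \<and> fst x \<le> 2 \<and> 1 \<le> snd x \<and> fst x \<le> snd x} x / (fst x + snd x)\<^sup>2"

lemma w1_measurable[measurable]: "w1 \<in> borel_measurable borel"
  unfolding w1_def[abs_def] by measurable

lemma w2_measurable[measurable]: "w2 \<in> borel_measurable borel"
proof -
  have "{x :: real \<times> real. 0 < fst x \<and> fst x \<le> 2 \<and> 1 \<le> snd x \<and> fst x \<le> snd x} =
      {x \<in> space borel. 0 < fst x \<and> fst x \<le> 2 \<and> 1 \<le> snd x \<and> fst x \<le> snd x}" by simp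
  also have "\<dots> \<in> sets borel" by measurable
  finally have [measurable]: "{x :: real \<times> real. 0 < fst x \<and> fst x \<le> 2 \<and> 1 \<le> snd x \<and> fst x \<le> snd x} \<in> sets borel" .
  show ?thesis unfolding w2_def[abs_def] by measurable
qed

definition N1 :: "real \<Rightarrow> ennreal" where
  "N1 s = (\<integral>\<^sup>+\<gamma>. ennreal (w1 \<gamma>) * ennreal (H (exp (- s) * \<gamma>)) \<partial>lborel)"

definition N2 :: "real \<Rightarrow> ennreal" where
  "N2 s = (\<integral>\<^sup>+x. ennreal (w2 x) * ennreal (vt (exp (- s) * fst x, exp (- s) * snd x)) \<partial>lborel)"

lemma N1_measurable[measurable]: "N1 \<in> borel_measurable lborel"
  unfolding N1_def[abs_def] by measurable

lemma vt_pair_measurable: "(\<lambda>(s, x). ennreal (vt (exp (- s) * fst x, exp (- s) * snd x))) \<in> borel_measurable (lborel \<Otimes>\<^sub>M lborel)"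
  using borel_measurable_scaled_pair(1)[OF vt_measurable] by (simp add: case_prod_unfold)

lemma N2_measurable[measurable]: "N2 \<in> borel_measurable lborel"
proof -
  have "(\<lambda>(s, x). ennreal (w2 x) * ennreal (vt (exp (- s) * fst x, exp (- s) * snd x))) \<in> borel_measurable (lborel \<Otimes>\<^sub>M lborel)"
    using vt_pair_measurable by (simp add: case_prod_unfold)
  then show ?thesis
    unfolding N2_def[abs_def] using lborel.borel_measurable_nn_integral_fst by fastforce
qed

text \<open>By Minkowski's inequality the norm is at most \<open>E\<close> times the integral of
  \<open>w1\<close>, that is \<open>4 * 2 powr (1 / 8) * E\<close>.\<close>

lemma N1_L2: "(\<integral>\<^sup>+s. (N1 s)\<^sup>2 \<partial>lborel) \<le> ennreal ((8 * E)\<^sup>2)"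
proof -
  have "(\<integral>\<^sup>+s. (N1 s)\<^sup>2 \<partial>lborel) \<le> (\<integral>\<^sup>+\<gamma>. ennreal (w1 \<gamma> * E) \<partial>lborel)\<^sup>2"
    unfolding N1_def
    by (intro nn_integral_L2_Minkowski sigma_finite_lborel H_energy_scaled E)
      (auto simp: w1_def indicator_def less_le split: if_splits)
  also have "(\<integral>\<^sup>+\<gamma>. ennreal (w1 \<gamma> * E) \<partial>lborel) = (\<integral>\<^sup>+\<gamma>. ennreal (E / 2) * ennreal (indicator {0..2} \<gamma> * \<gamma> powr (- 7 / 8)) \<partial>lborel)"
    using E by (intro nn_integral_cong) (simp add: w1_def ac_simps flip: ennreal_mult)
  also have "\<dots> = ennreal (E / 2) * (\<integral>\<^sup>+\<gamma>. ennreal (indicator {0..2} \<gamma> * \<gamma> powr (- 7 / 8)) \<partial>lborel)"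
    by (rule nn_integral_cmult) measurable
  also have "(\<integral>\<^sup>+\<gamma>. ennreal (indicator {0..2} \<gamma> * \<gamma> powr (- 7 / 8)) \<partial>lborel) = ennreal (2 powr (- 7 / 8 + 1) / (- 7 / 8 + 1))"
    by (intro nn_integral_indicator_has_integral has_integral_powr_from_0) auto
  also have "ennreal (E / 2) * ennreal (2 powr (- 7 / 8 + 1) / (- 7 / 8 + 1)) = ennreal (E / 2 * (2 powr (- 7 / 8 + 1) / (- 7 / 8 + 1)))"
    using E by (intro ennreal_mult[symmetric]) auto
  also have "\<dots> \<le> ennreal (8 * E)"
  proof -
    have "(2::real) powr (1 / 8) \<le> 2 powr 1" by (intro powr_mono) auto
    then have "E / 2 * (2 powr (- 7 / 8 + 1) / (- 7 / 8 + 1)) \<le> 8 * E" using E by simp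
    then show ?thesis by (rule ennreal_leI)
  qed
  finally show ?thesis using E by (simp add: ennreal_power power_mono)
qed

lemma N2_L2: "(\<integral>\<^sup>+s. (N2 s)\<^sup>2 \<partial>lborel) \<le> ennreal ((84 * E)\<^sup>2)"
proof -
  have "(\<integral>\<^sup>+s. (N2 s)\<^sup>2 \<partial>lborel) \<le> (\<integral>\<^sup>+x. ennreal (w2 x * env E (12 * E) x) \<partial>lborel)\<^sup>2"
    unfolding N2_def
  proof (intro nn_integral_L2_Minkowski sigma_finite_lborel vt_pair_measurable)
    fix x assume "w2 x \<noteq> 0"
    then have r: "0 < fst x" "fst x \<le> snd x" by (auto simp: w2_def indicator_def split: if_splits)
    then show "0 < env E (12 * E) x" using env_pos[of "fst x" "snd x" "12 * E"] E by simp
    show "(\<integral>\<^sup>+s. (ennreal (vt (exp (- s) * fst x, exp (- s) * snd x)))\<^sup>2 \<partial>lborel) \<le> ennreal ((env E (12 * E) x)\<^sup>2)"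
      using vt_L2_bound[OF r] by simp
  qed (auto simp: w2_def)
  also have "(\<integral>\<^sup>+x. ennreal (w2 x * env E (12 * E) x) \<partial>lborel) \<le> ennreal (84 * E)"
  proof -
    \<comment> \<open>With \<open>a\<close> dropped from the denominator, the square root bound
      factorises into these two integrable powers. Their integrals are \<open>2 * sqrt 2\<close> and
      2, and \<open>14 * 4 * sqrt 2 \<le> 84\<close>.\<close>
    let ?f = "\<lambda>a. indicator {0..2} a * a powr (- 1 / 2) :: real"
    let ?g = "\<lambda>b. indicator {1..} b * b powr (- 3 / 2) :: real"
    have "(\<integral>\<^sup>+x. ennreal (w2 x * env E (12 * E) x) \<partial>lborel) \<le> (\<integral>\<^sup>+x. ennreal (14 * E) * (ennreal (?f (fst x)) * ennreal (?g (snd x))) \<partial>lborel)"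
    proof (intro nn_integral_mono)
      fix x :: "real \<times> real"
      obtain a b where x: "x = (a, b)" by (cases x)
      show "ennreal (w2 x * env E (12 * E) x) \<le> ennreal (14 * E) * (ennreal (?f (fst x)) * ennreal (?g (snd x)))"
      proof (cases "0 < a \<and> a \<le> 2 \<and> 1 \<le> b \<and> a \<le> b")
        case True
        have "w2 x * env E (12 * E) x = 1 / (a + b)\<^sup>2 * env E (12 * E) (a, b)" using True by (simp add: w2_def x)
        also have "\<dots> \<le> 1 / b\<^sup>2 * (14 * E * (a powr (- 1 / 2) * b powr (1 / 2)))"
          using True E env_nonneg[of a b "12 * E"]
          by (intro mult_mono env_le_sqrt divide_left_mono power_mono) auto
        also have "\<dots> = 14 * E * (a powr (- 1 / 2) * (b powr (1 / 2) * b powr (- 2)))"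
          using True by (simp add: powr_minus_divide powr_numeral)
        also have "b powr (1 / 2) * b powr (- 2) = b powr (- 3 / 2)"
          by (simp add: powr_add[symmetric])
        finally have "w2 x * env E (12 * E) x \<le> 14 * E * (?f a * ?g b)" using True by simp
        then have "ennreal (w2 x * env E (12 * E) x) \<le> ennreal (14 * E * (?f a * ?g b))" by (rule ennreal_leI)
        also have "\<dots> = ennreal (14 * E) * (ennreal (?f a) * ennreal (?g b))"
          using E by (simp only: ennreal_mult mult_nonneg_nonneg powr_ge_zero indicator_pos_le less_imp_le zero_le_numeral)
        finally show ?thesis by (simp add: x)
      next
        case False
        then have "w2 x = 0" by (auto simp: w2_def x indicator_def)
        then show ?thesis by simp
      qed
    qed
    also have "\<dots> = ennreal (14 * E) * (\<integral>\<^sup>+a. (\<integral>\<^sup>+b. ennreal (?f a) * ennreal (?g b) \<partial>lborel) \<partial>lborel)"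
      by (subst nn_integral_cmult) (auto simp: nn_integral_lborel_prod)
    also have "(\<integral>\<^sup>+a. (\<integral>\<^sup>+b. ennreal (?f a) * ennreal (?g b) \<partial>lborel) \<partial>lborel) = (\<integral>\<^sup>+a. ennreal (?f a) \<partial>lborel) * (\<integral>\<^sup>+b. ennreal (?g b) \<partial>lborel)"
      by (simp add: nn_integral_cmult nn_integral_multc)
    also have "(\<integral>\<^sup>+a. ennreal (?f a) \<partial>lborel) = ennreal (2 powr (- 1 / 2 + 1) / (- 1 / 2 + 1))"
      by (intro nn_integral_indicator_has_integral has_integral_powr_from_0) auto
    also have "(\<integral>\<^sup>+b. ennreal (?g b) \<partial>lborel) = ennreal (- (1 powr (- 3 / 2 + 1)) / (- 3 / 2 + 1))"
      by (intro nn_integral_indicator_has_integral has_integral_powr_to_inf) auto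
    also have "ennreal (14 * E) * (ennreal (2 powr (- 1 / 2 + 1) / (- 1 / 2 + 1)) * ennreal (- (1 powr (- 3 / 2 + 1)) / (- 3 / 2 + 1)))
        = ennreal (14 * E * (4 * sqrt 2))"
    proof -
      have "ennreal (14 * E) * (ennreal X * ennreal Y) = ennreal (14 * E * (X * Y))" if "0 \<le> X" "0 \<le> Y" for X Y
        using that E by (simp only: ennreal_mult mult_nonneg_nonneg less_imp_le zero_le_numeral)
      from this[of "2 powr (- 1 / 2 + 1) / (- 1 / 2 + 1)" "- (1 powr (- 3 / 2 + 1)) / (- 3 / 2 + 1)"]
      show ?thesis by (simp add: powr_half_sqrt ac_simps)
    qed
    also have "\<dots> \<le> ennreal (84 * E)"
    proof (rule ennreal_leI)
      have "sqrt 2 \<le> 3 / 2" by (rule real_le_lsqrt) (auto simp: power2_eq_square)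
      then show "14 * E * (4 * sqrt 2) \<le> 84 * E" using E by simp
    qed
    finally show ?thesis .
  qed
  finally show ?thesis using E by (simp add: ennreal_power power_mono)
qed

lemma vt_nc: "0 \<le> s \<Longrightarrow> 0 \<le> y \<Longrightarrow> y < 1 \<Longrightarrow> vt (exp (- s) * (1 - y), exp (- s) * (1 + y)) = \<bar>v (nc (s, y))\<bar>"
  using nc_in_tri[of s y] by (subst vt_eq) (auto simp: nc_def tri_iff)

text \<open>This separates the variables: the factor in \<open>y\<close> is in L6 and the factor in
  \<open>s\<close> is in L2. Hence the norm in \<open>y\<close> can be taken before the one in
  \<open>s\<close>, the order required in space-time norms.\<close>

theorem v_dominated:
  assumes s: "0 \<le> s" and y: "0 \<le> y" "y < 1"
  shows "ennreal \<bar>v (nc (s, y))\<bar> \<le> ennreal ((1 - y) powr (- 1 / 8)) * (N1 s + N2 s)"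
proof -
  let ?c = "ennreal ((1 - y) powr (- 1 / 8))"
  have "ennreal \<bar>v (nc (s, y))\<bar> \<le>
     (\<integral>\<^sup>+\<gamma>. ennreal (indicator {1 - y..1 + y} \<gamma> / (2 * \<gamma>)) * ennreal (H (exp (- s) * \<gamma>)) \<partial>lborel)
     + (\<integral>\<^sup>+x. ennreal (ker (1 - y) (1 + y) x) * ennreal (vt (exp (- s) * fst x, exp (- s) * snd x)) \<partial>lborel)"
    using vt_scaled_bound[of "1 - y" "1 + y" s] y vt_nc[OF s y] by simp
  also have "(\<integral>\<^sup>+\<gamma>. ennreal (indicator {1 - y..1 + y} \<gamma> / (2 * \<gamma>)) * ennreal (H (exp (- s) * \<gamma>)) \<partial>lborel)
      \<le> (\<integral>\<^sup>+\<gamma>. ?c * (ennreal (w1 \<gamma>) * ennreal (H (exp (- s) * \<gamma>))) \<partial>lborel)"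
  proof (intro nn_integral_mono)
    fix \<gamma> :: real
    have "indicator {1 - y..1 + y} \<gamma> / (2 * \<gamma>) \<le> (1 - y) powr (- 1 / 8) * w1 \<gamma>"
    proof (cases "\<gamma> \<in> {1 - y..1 + y}")
      case True
      then have g: "0 < \<gamma>" "\<gamma> \<le> 2" "1 - y \<le> \<gamma>" using y by auto
      have "1 / \<gamma> = \<gamma> powr (- 1 / 8) * \<gamma> powr (- 7 / 8)"
        using g by (simp add: powr_add[symmetric] powr_minus_divide)
      also have "\<dots> \<le> (1 - y) powr (- 1 / 8) * \<gamma> powr (- 7 / 8)"
        using g y by (intro mult_right_mono powr_mono2') auto
      finally show ?thesis using True g by (simp add: w1_def)
    qed (simp add: w1_def)
    then have "ennreal (indicator {1 - y..1 + y} \<gamma> / (2 * \<gamma>)) \<le> ennreal ((1 - y) powr (- 1 / 8) * w1 \<gamma>)" by (rule ennreal_leI)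
    also have "\<dots> = ?c * ennreal (w1 \<gamma>)" by (intro ennreal_mult) (auto simp: w1_def)
    finally show "ennreal (indicator {1 - y..1 + y} \<gamma> / (2 * \<gamma>)) * ennreal (H (exp (- s) * \<gamma>)) \<le> ?c * (ennreal (w1 \<gamma>) * ennreal (H (exp (- s) * \<gamma>)))"
      by (simp add: mult.assoc[symmetric] mult_right_mono)
  qed
  also have "(\<integral>\<^sup>+x. ennreal (ker (1 - y) (1 + y) x) * ennreal (vt (exp (- s) * fst x, exp (- s) * snd x)) \<partial>lborel)
      \<le> (\<integral>\<^sup>+x. ?c * (ennreal (w2 x) * ennreal (vt (exp (- s) * fst x, exp (- s) * snd x))) \<partial>lborel)"
  proof (intro nn_integral_mono)
    fix x :: "real \<times> real"
    have "(1::real) = (1 - y) powr 0" using y by simp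
    also have "\<dots> \<le> (1 - y) powr (- 1 / 8)" using y by (intro powr_mono') auto
    finally have c: "1 \<le> (1 - y) powr (- 1 / 8)" .
    have "ker (1 - y) (1 + y) x \<le> w2 x" using y by (auto simp: ker_def w2_def reg_def indicator_def)
    also have "\<dots> \<le> (1 - y) powr (- 1 / 8) * w2 x" using mult_right_mono[OF c, of "w2 x"] by (simp add: w2_def)
    finally have "ennreal (ker (1 - y) (1 + y) x) \<le> ennreal ((1 - y) powr (- 1 / 8) * w2 x)" by (rule ennreal_leI)
    also have "\<dots> = ?c * ennreal (w2 x)" by (intro ennreal_mult) (auto simp: w2_def)
    finally show "ennreal (ker (1 - y) (1 + y) x) * ennreal (vt (exp (- s) * fst x, exp (- s) * snd x))
       \<le> ?c * (ennreal (w2 x) * ennreal (vt (exp (- s) * fst x, exp (- s) * snd x)))"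
      by (simp add: mult.assoc[symmetric] mult_right_mono)
  qed
  also have "(\<integral>\<^sup>+\<gamma>. ?c * (ennreal (w1 \<gamma>) * ennreal (H (exp (- s) * \<gamma>))) \<partial>lborel) = ?c * N1 s"
    unfolding N1_def by (intro nn_integral_cmult) measurable
  also have "(\<integral>\<^sup>+x. ?c * (ennreal (w2 x) * ennreal (vt (exp (- s) * fst x, exp (- s) * snd x))) \<partial>lborel) = ?c * N2 s"
    unfolding N2_def by (intro nn_integral_cmult) (auto intro!: borel_measurable_times borel_measurable_scaled_pair)
  finally show ?thesis by (simp add: distrib_left add_mono)
qed

theorem v_bounded:
  assumes s: "0 \<le> s" and y: "0 \<le> y" "y < 1"
  shows "\<bar>v (nc (s, y))\<bar> \<le> 208 * E * (1 - y) powr (- 1 / 8)"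
proof -
  have "nc (s, y) \<in> tri" using s y by (intro nc_in_tri) auto
  then have "\<bar>v (nc (s, y))\<bar> \<le> env E (12 * E) (exp (- s) * (1 - y), exp (- s) * (1 + y))"
    using v_sup_bound[of "exp (- s) * (1 - y)" "exp (- s) * (1 + y)"] y by (simp add: nc_def tri_iff)
  \<comment> \<open>\<open>env\<close> depends on \<open>b / a\<close> only and is therefore
    constant in time.\<close>
  also have "\<dots> = env E (12 * E) (1 - y, 1 + y)"
    unfolding env_def fst_conv snd_conv distrib_left[symmetric] right_diff_distrib[symmetric] mult.left_commute[of _ "exp (- s)"] by simp
  also have "\<dots> \<le> 208 * E * (1 - y) powr (- 1 / 8)" by (rule env_le_powr[OF y])
  finally show ?thesis .
qed

lemma v_nc_odd: "0 \<le> s \<Longrightarrow> y \<in> {-1..1} \<Longrightarrow> v (nc (s, - y)) = - v (nc (s, y))"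
  using null_solution_antisym[OF v, of "exp (- s) * (1 - y)" "exp (- s) * (1 + y)"] nc_in_tri[of s y]
  by (simp add: nc_def)

end

section \<open>Space-time bounds in \<open>L\<^sup>6\<close>\<close>

text \<open>The two classes agree as sets of functions. This allows the chosen wave solution, whose
  values outside the open interval are arbitrary, to be replaced by a smooth odd function.\<close>

lemma Lclass_cong:
  assumes "\<And>y. y \<in> {-1<..<1} \<Longrightarrow> f y = g y"
  shows "(Lclass f :: 'q::finite Lodd) = Lclass g"
proof -
  have "AE y in I1. f y = g y" using assms by (intro AE_I2) (simp add: space_restrict_space)
  then have "(AE y in I1. k y = f y) \<longleftrightarrow> (AE y in I1. k y = g y)" for k
    by (auto elim: eventually_elim2)
  then show ?thesis by (simp add: Lclass_def Lq_class_def)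
qed

lemma nn_integral_I1:
  fixes f :: "real \<Rightarrow> ennreal"
  assumes [measurable]: "f \<in> borel_measurable borel"
  shows "(\<integral>\<^sup>+y. f y \<partial>I1) = (\<integral>\<^sup>+y. f y * indicator {-1<..<1} y \<partial>lborel)"
proof -
  have "(\<integral>\<^sup>+y. f y \<partial>I1) = (\<integral>\<^sup>+y. f y * indicator {-1<..<1} y \<partial>lebesgue)"
    by (subst nn_integral_restrict_space) auto
  also have "\<dots> = (\<integral>\<^sup>+y. f y * indicator {-1<..<1} y \<partial>lborel)"
    by (simp add: nn_integral_completion)
  finally show ?thesis .
qed

lemma nn_integral_endpoint_weight:
  "(\<integral>\<^sup>+y. ennreal ((1 - \<bar>y\<bar>) powr (- 3 / 4)) \<partial>I1) \<le> ennreal 8"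
proof -
  let ?k = "\<lambda>y::real. ennreal (indicator {0..1} y * y powr (- 3 / 4))"
  have k: "(\<integral>\<^sup>+y. ?k y \<partial>lborel) = ennreal 4"
  proof -
    have "(\<integral>\<^sup>+y. ?k y \<partial>lborel) = ennreal (1 powr (- 3 / 4 + 1) / (- 3 / 4 + 1))"
      by (intro nn_integral_indicator_has_integral has_integral_powr_from_0) auto
    then show ?thesis by simp
  qed
  have "(\<integral>\<^sup>+y. ennreal ((1 - \<bar>y\<bar>) powr (- 3 / 4)) \<partial>I1) \<le> (\<integral>\<^sup>+y. ?k (1 + - 1 * y) + ?k (1 + 1 * y) \<partial>lborel)"
  proof -
    have "(\<integral>\<^sup>+y. ennreal ((1 - \<bar>y\<bar>) powr (- 3 / 4)) \<partial>I1)
        = (\<integral>\<^sup>+y. ennreal ((1 - \<bar>y\<bar>) powr (- 3 / 4)) * indicator {-1<..<1} y \<partial>lborel)"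
      by (rule nn_integral_I1) measurable
    also have "\<dots> \<le> (\<integral>\<^sup>+y. ?k (1 + - 1 * y) + ?k (1 + 1 * y) \<partial>lborel)"
    proof (rule nn_integral_mono)
      fix y :: real
      show "ennreal ((1 - \<bar>y\<bar>) powr (- 3 / 4)) * indicator {-1<..<1} y \<le> ?k (1 + - 1 * y) + ?k (1 + 1 * y)"
        by (cases "y \<in> {-1<..<1}"; cases "0 \<le> y") (simp_all add: abs_if)
    qed
    finally show ?thesis .
  qed
  also have "\<dots> = (\<integral>\<^sup>+y. ?k (1 + - 1 * y) \<partial>lborel) + (\<integral>\<^sup>+y. ?k (1 + 1 * y) \<partial>lborel)"
    by (intro nn_integral_add) measurable
  also have "(\<integral>\<^sup>+y. ?k (1 + - 1 * y) \<partial>lborel) = ennreal 4"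
    using nn_integral_real_affine[of ?k "- 1" 1] k by simp
  also have "(\<integral>\<^sup>+y. ?k (1 + 1 * y) \<partial>lborel) = ennreal 4"
    using nn_integral_real_affine[of ?k 1 1] k by simp
  also have "ennreal 4 + ennreal 4 = ennreal 8" by (subst ennreal_plus[symmetric]) auto
  finally show ?thesis .
qed

text \<open>The sixth power of the weight is \<open>(1 - \<bar>y\<bar>) powr (- 3 / 4)\<close>,
  whose integral is at most 8, and \<open>8 \<le> 2 ^ 6\<close>.\<close>

lemma Lq_norm_6_le:
  assumes [measurable]: "\<phi> \<in> borel_measurable I1" and m: "0 \<le> m"
    and le: "\<And>y. y \<in> {-1<..<1} \<Longrightarrow> \<bar>\<phi> y\<bar> \<le> m * (1 - \<bar>y\<bar>) powr (- 1 / 8)"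
  shows "Lq_norm 6 \<phi> \<le> 2 * m"
proof (rule nn_integral_Lq_le)
  have "(\<integral>\<^sup>+y. ennreal (\<bar>\<phi> y\<bar> powr 6) \<partial>I1) \<le> (\<integral>\<^sup>+y. ennreal (m powr 6) * ennreal ((1 - \<bar>y\<bar>) powr (- 3 / 4)) \<partial>I1)"
  proof (intro nn_integral_mono)
    fix y assume "y \<in> space I1"
    then have y: "y \<in> {-1<..<1}" by (simp add: space_restrict_space)
    have "\<bar>\<phi> y\<bar> powr 6 \<le> (m * (1 - \<bar>y\<bar>) powr (- 1 / 8)) powr 6"
      by (intro powr_mono2 le y) auto
    also have "\<dots> = m powr 6 * (1 - \<bar>y\<bar>) powr (- 3 / 4)"
      using m y by (simp add: powr_mult powr_powr)
    finally show "ennreal (\<bar>\<phi> y\<bar> powr 6) \<le> ennreal (m powr 6) * ennreal ((1 - \<bar>y\<bar>) powr (- 3 / 4))"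
      by (simp add: ennreal_leI flip: ennreal_mult)
  qed
  also have "\<dots> = ennreal (m powr 6) * (\<integral>\<^sup>+y. ennreal ((1 - \<bar>y\<bar>) powr (- 3 / 4)) \<partial>I1)"
  proof (rule nn_integral_cmult)
    have "(\<lambda>y. ennreal ((1 - \<bar>y\<bar>) powr (- 3 / 4))) \<in> borel_measurable lborel" by measurable
    then show "(\<lambda>y. ennreal ((1 - \<bar>y\<bar>) powr (- 3 / 4))) \<in> borel_measurable I1"
      by (rule measurable_restrict_space1[OF measurable_completion])
  qed
  also have "\<dots> \<le> ennreal (m powr 6) * ennreal 8"
    by (intro mult_left_mono nn_integral_endpoint_weight) auto
  also have "\<dots> = ennreal (m powr 6 * 8)" by (intro ennreal_mult[symmetric]) auto
  also have "\<dots> \<le> ennreal ((2 * m) powr 6)"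
    using m by (intro ennreal_leI) (simp add: powr_mult)
  finally show "(\<integral>\<^sup>+y. ennreal (\<bar>\<phi> y\<bar> powr 6) \<partial>I1) \<le> ennreal ((2 * m) powr 6)" .
qed (use m in auto)

lemma smooth_on_slice:
  fixes F :: "real \<times> real \<Rightarrow> real"
  assumes "smooth_on (A \<times> B) F" "s \<in> A"
  shows "smooth_on B (\<lambda>y. F (s, y))"
proof (rule smooth_on_coinduct)
  let ?F = "{\<lambda>y. w (s, y) | w :: real \<times> real \<Rightarrow> real. smooth_on (A \<times> B) w}"
  show "(\<lambda>y. F (s, y)) \<in> ?F" using assms by auto
  fix u assume "u \<in> ?F"
  then obtain w where w: "u = (\<lambda>y. w (s, y))" "smooth_on (A \<times> B) w" by auto
  obtain d where d: "\<And>v. smooth_on (A \<times> B) (d v)"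
    "\<And>x. x \<in> A \<times> B \<Longrightarrow> (w has_derivative (\<lambda>v. d v x)) (at x within A \<times> B)"
    using smooth_on_derivative[OF w(2)] by blast
  have "(u has_derivative (\<lambda>k. d (0, k) (s, y))) (at y within B)" if "y \<in> B" for y
    unfolding w(1)
    by (rule has_derivative_in_compose2[where f = "\<lambda>y. (s, y)" and t = "A \<times> B" and f' = "\<lambda>k. (0, k)"
          and g' = "\<lambda>x v. d v x"])
      (use that assms(2) d in \<open>auto intro!: derivative_eq_intros\<close>)
  moreover have "(\<lambda>y. d (0, k) (s, y)) \<in> ?F" for k using d(1) by blast
  ultimately show "\<exists>d. (\<forall>v. d v \<in> ?F) \<and> (\<forall>y\<in>B. (u has_derivative (\<lambda>v. d v y)) (at y within B))"
    by (intro exI[of _ "\<lambda>k y. d (0, k) (s, y)"]) blast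
qed

lemma energy_integrals_nonneg:
  fixes f g :: "real \<Rightarrow> real"
  shows "0 \<le> (LBINT y:{-1<..<1}. (1 - y\<^sup>2) * \<bar>deriv f y\<bar>\<^sup>2)" "0 \<le> (LBINT y:{-1<..<1}. \<bar>g y\<bar>\<^sup>2)"
proof -
  show "0 \<le> (LBINT y:{-1<..<1}. (1 - y\<^sup>2) * \<bar>deriv f y\<bar>\<^sup>2)"
    unfolding set_lebesgue_integral_def
    by (rule integral_nonneg_AE, rule AE_I2) (auto simp: indicator_def abs_square_le_1)
  show "0 \<le> (LBINT y:{-1<..<1}. \<bar>g y\<bar>\<^sup>2)"
    unfolding set_lebesgue_integral_def by (rule integral_nonneg_AE, rule AE_I2) simp
qed

lemma energy_norm_nonneg: "0 \<le> energy_norm f g"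
  using energy_integrals_nonneg[of f] energy_integrals_nonneg(2)[of g] by (simp add: energy_norm_def)

text \<open>After \<open>c = 1 - x\<close> the weight is \<open>1 - x\<close>. Multiplied by
  \<open>(1 + x)\<^sup>2\<close> it is at most twice the energy weight \<open>1 - x\<^sup>2\<close>,
  and next to \<open>g\<close> it is at most 2; the square of the sum contributes another factor
  2.\<close>

lemma profile_energy:
  assumes p: "profile f f' g \<Psi>" and g: "smooth_odd g"
  shows "integral {0..2} (\<lambda>c. c * ((1 + (1 - c)) * f' (1 - c) + g (1 - c))\<^sup>2) \<le> (2 * energy_norm f g)\<^sup>2"
proof -
  define F where "F x = (1 - x) * ((1 + x) * f' x + g x)\<^sup>2" for x
  have cf: "continuous_on {-1..1} f'" "continuous_on {-1..1} g"
    using p g by (auto simp: profile_def smooth_odd_def smooth_on_continuous)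
  have cF: "continuous_on {-1..1} F" unfolding F_def[abs_def] by (intro continuous_intros cf)
  have "(F has_integral integral {-1..1} F) {-1..1}"
    using integrable_continuous_real[OF cF] by (rule integrable_integral)
  then have "((\<lambda>x. F (- x)) has_integral integral {-1..1} F) {-1..1}"
    using has_integral_reflect_real[where f = F and a = "-1" and b = 1] by simp
  from has_integral_shift_real_ivl[OF this, of "- 1"]
  have "((\<lambda>c. F (1 - c)) has_integral integral {-1..1} F) {0..2}" by simp
  then have "integral {0..2} (\<lambda>c. c * ((1 + (1 - c)) * f' (1 - c) + g (1 - c))\<^sup>2) = integral {-1..1} F"
    by (simp add: F_def integral_unique)
  also have "\<dots> \<le> integral {-1..1} (\<lambda>x. 4 * ((1 - x\<^sup>2) * \<bar>f' x\<bar>\<^sup>2) + 4 * \<bar>g x\<bar>\<^sup>2)"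
  proof (intro integral_le integrable_continuous_real cF continuous_intros cf)
    fix x :: real assume x: "x \<in> {-1..1}"
    have "(A + B)\<^sup>2 \<le> 2 * A\<^sup>2 + 2 * B\<^sup>2" for A B :: real
      using sum_squares_bound[of A B] by (simp add: power2_sum)
    from this[of "(1 + x) * f' x" "g x"]
    have "((1 + x) * f' x + g x)\<^sup>2 \<le> 2 * ((1 + x)\<^sup>2 * (f' x)\<^sup>2) + 2 * (g x)\<^sup>2"
      by (simp only: power_mult_distrib)
    then have "F x \<le> (1 - x) * (2 * ((1 + x)\<^sup>2 * (f' x)\<^sup>2) + 2 * (g x)\<^sup>2)"
      unfolding F_def using x by (intro mult_left_mono) auto
    also have "\<dots> = 2 * (1 + x) * ((1 - x\<^sup>2) * (f' x)\<^sup>2) + 2 * (1 - x) * (g x)\<^sup>2"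
      by (simp add: power2_eq_square algebra_simps)
    also have "\<dots> \<le> 4 * ((1 - x\<^sup>2) * (f' x)\<^sup>2) + 4 * (g x)\<^sup>2"
    proof (intro add_mono mult_right_mono)
      have "x\<^sup>2 \<le> 1" using x by (simp add: abs_square_le_1 abs_le_iff)
      then show "0 \<le> (1 - x\<^sup>2) * (f' x)\<^sup>2" by simp
    qed (use x in auto)
    finally show "F x \<le> 4 * ((1 - x\<^sup>2) * \<bar>f' x\<bar>\<^sup>2) + 4 * \<bar>g x\<bar>\<^sup>2" by simp
  qed
  also have "\<dots> = 4 * integral {-1..1} (\<lambda>x. (1 - x\<^sup>2) * \<bar>f' x\<bar>\<^sup>2) + 4 * integral {-1..1} (\<lambda>x. \<bar>g x\<bar>\<^sup>2)"
    by (subst Henstock_Kurzweil_Integration.integral_add)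
      (auto intro!: integrable_continuous_real continuous_intros cf)
  also have "integral {-1..1} (\<lambda>x. (1 - x\<^sup>2) * \<bar>f' x\<bar>\<^sup>2) = (LBINT y:{-1<..<1}. (1 - y\<^sup>2) * \<bar>deriv f y\<bar>\<^sup>2)"
  proof -
    have d: "deriv f y = f' y" if "y \<in> {-1<..<1}" for y
    proof -
      have "(f has_real_derivative f' y) (at y within {-1..1})" using p that by (auto simp: profile_def)
      then show ?thesis using that by (simp add: at_within_Icc_at DERIV_imp_deriv)
    qed
    have "set_integrable lborel {-1..1} (\<lambda>y. (1 - y\<^sup>2) * \<bar>f' y\<bar>\<^sup>2)"
      by (intro borel_integrable_atLeastAtMost' continuous_intros cf)
    then have i: "set_integrable lborel {-1<..<1} (\<lambda>y. (1 - y\<^sup>2) * \<bar>f' y\<bar>\<^sup>2)"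
      by (rule set_integrable_subset) auto
    have "(LBINT y:{-1<..<1}. (1 - y\<^sup>2) * \<bar>deriv f y\<bar>\<^sup>2) = (LBINT y:{-1<..<1}. (1 - y\<^sup>2) * \<bar>f' y\<bar>\<^sup>2)"
      by (intro set_lebesgue_integral_cong) (auto simp: d)
    then show ?thesis using set_borel_integral_eq_integral(2)[OF i] by (simp add: integral_open_interval_real)
  qed
  also have "integral {-1..1} (\<lambda>x. \<bar>g x\<bar>\<^sup>2) = (LBINT y:{-1<..<1}. \<bar>g y\<bar>\<^sup>2)"
  proof -
    have "set_integrable lborel {-1..1} (\<lambda>y. \<bar>g y\<bar>\<^sup>2)"
      by (intro borel_integrable_atLeastAtMost' continuous_intros cf)
    then have i: "set_integrable lborel {-1<..<1} (\<lambda>y. \<bar>g y\<bar>\<^sup>2)"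
      by (rule set_integrable_subset) auto
    show ?thesis using set_borel_integral_eq_integral(2)[OF i] by (simp add: integral_open_interval_real)
  qed
  also have "4 * (LBINT y:{-1<..<1}. (1 - y\<^sup>2) * \<bar>deriv f y\<bar>\<^sup>2) + 4 * (LBINT y:{-1<..<1}. \<bar>g y\<bar>\<^sup>2) = (2 * energy_norm f g)\<^sup>2"
    using energy_integrals_nonneg(1)[of f] energy_integrals_nonneg(2)[of g]
    by (simp add: energy_norm_def power_mult_distrib)
  finally show ?thesis .
qed

text \<open>A bound \<open>K\<close> stands in for the energy norm, which may be zero, because the
  parameter of \<open>null_wave\<close> is positive. That parameter is \<open>2 * K\<close>, with
  the factor 2 from \<open>profile_energy\<close>.\<close>

theorem wave_solution_L6:
  assumes f: "smooth_odd f" and g: "smooth_odd g" and K: "K > 0" "energy_norm f g \<le> K"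
  shows "\<And>s. 0 \<le> s \<Longrightarrow> \<exists>\<phi>. smooth_odd \<phi> \<and> (\<forall>y\<in>{-1<..<1}. wave_solution f g s y = \<phi> y)"
    and "\<And>s. 0 \<le> s \<Longrightarrow> norm (Lclass (wave_solution f g s) :: 6 Lodd) \<le> 832 * K"
    and "(\<integral>\<^sup>+s. indicator {0..} s * ennreal (norm (Lclass (wave_solution f g s) :: 6 Lodd) ^ 3) \<partial>lborel) \<le> ennreal ((1000 * K) ^ 3)"
    and "continuous_on {0..} (\<lambda>s. Lclass (wave_solution f g s) :: 6 Lodd)"
    and "is_wave_solution f g (wave_solution f g)"
proof -
  obtain f' \<Psi> where p: "profile f f' g \<Psi>" using profile_exists[OF f g] by blast
  obtain v where v: "null_solution \<Psi> v" using null_solution_exists[OF profile_smooth(2)[OF p g]] by blast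
  note W = null_solution_is_wave_solution[OF f g p v]
  interpret null_wave "\<lambda>x. (1 + x) * f' x + g x" \<Psi> v "2 * K"
  proof
    show "continuous_on {-1..1} (\<lambda>x. (1 + x) * f' x + g x)"
      by (rule smooth_on_continuous[OF profile_smooth(1)[OF p g]])
    show "\<And>x. x \<in> {-1..1} \<Longrightarrow> (\<Psi> has_real_derivative (1 + x) * f' x + g x) (at x within {-1..1})"
      using p by (simp add: profile_def)
    have "(2 * energy_norm f g)\<^sup>2 \<le> (2 * K)\<^sup>2" using K energy_norm_nonneg[of f g] by (intro power_mono) auto
    then show "integral {0..2} (\<lambda>c. c * ((1 + (1 - c)) * f' (1 - c) + g (1 - c))\<^sup>2) \<le> (2 * K)\<^sup>2"
      using profile_energy[OF p g] by simp
  qed (use v W(3) K in auto)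
  define u where "u s y = v (nc (s, y))" for s y
  show sol: "is_wave_solution f g (wave_solution f g)"
    unfolding wave_solution_def using W(1) by (rule someI[where P = "is_wave_solution f g"])
  have eq: "wave_solution f g s y = u s y" if "0 \<le> s" "y \<in> {-1<..<1}" for s y
    using wave_solution_unique[OF sol W(1) that] by (simp add: u_def)
  have so: "smooth_odd (u s)" if "0 \<le> s" for s
    using smooth_on_slice[OF W(2), of s] v_nc_odd[OF that] that by (auto simp: smooth_odd_def u_def[abs_def])
  then show "\<exists>\<phi>. smooth_odd \<phi> \<and> (\<forall>y\<in>{-1<..<1}. wave_solution f g s y = \<phi> y)" if "0 \<le> s" for s
    using eq that by blast
  have cl: "(Lclass (wave_solution f g s) :: 6 Lodd) = Lclass (u s)" if "0 \<le> s" for s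
    using eq[OF that] by (rule Lclass_cong)
  have mem: "u s \<in> Lq_odd 6" if "0 \<le> s" for s using smooth_odd_in_Lq_odd[OF _ so[OF that], of 6] by simp
  have nrm: "norm (Lclass (u s) :: 6 Lodd) \<le> 2 * m"
    if s: "0 \<le> s" and m: "0 \<le> m" "\<And>y. 0 \<le> y \<Longrightarrow> y < 1 \<Longrightarrow> \<bar>u s y\<bar> \<le> m * (1 - y) powr (- 1 / 8)" for s m
  proof -
    have "norm (Lclass (u s) :: 6 Lodd) = Lq_norm 6 (u s)"
      using norm_Lclass[where 'a = 6, of "u s"] mem[OF s] by simp
    also have "\<dots> \<le> 2 * m"
    proof (rule Lq_norm_6_le[OF Lq_spaceD(1)[OF Lq_oddD(1)[OF mem[OF s]]] m(1)])
      fix y :: real assume y: "y \<in> {-1<..<1}"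
      \<comment> \<open>Oddness reduces the estimate to \<open>0 \<le> y\<close>, the half
        \<open>a \<le> b\<close> of the triangle.\<close>
      have "\<bar>u s y\<bar> = \<bar>u s \<bar>y\<bar>\<bar>"
        using v_nc_odd[OF s, of y] y by (auto simp: u_def abs_if)
      also have "\<dots> \<le> m * (1 - \<bar>y\<bar>) powr (- 1 / 8)" using y by (intro m(2)) auto
      finally show "\<bar>u s y\<bar> \<le> m * (1 - \<bar>y\<bar>) powr (- 1 / 8)" .
    qed
    finally show ?thesis .
  qed
  \<comment> \<open>\<open>208 * (2 * K) = 416 * K\<close>, and \<open>Lq_norm_6_le\<close> doubles
    it.\<close>
  have sup: "norm (Lclass (u s) :: 6 Lodd) \<le> 832 * K" if s: "0 \<le> s" for s
    using nrm[OF s, of "416 * K"] v_bounded[OF s] K by (simp add: u_def)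
  then show "norm (Lclass (wave_solution f g s) :: 6 Lodd) \<le> 832 * K" if "0 \<le> s" for s
    using cl that by simp
  have dom: "ennreal (norm (Lclass (u s) :: 6 Lodd)) \<le> 2 * (N1 s + N2 s)" if s: "0 \<le> s" for s
  proof (cases "N1 s + N2 s")
    case (real n)
    have "norm (Lclass (u s) :: 6 Lodd) \<le> 2 * n"
    proof (rule nrm[OF s real(1)])
      fix y :: real assume y: "0 \<le> y" "y < 1"
      have "ennreal \<bar>u s y\<bar> \<le> ennreal ((1 - y) powr (- 1 / 8)) * ennreal n"
        using v_dominated[OF s y] by (simp add: u_def real)
      then have "ennreal \<bar>u s y\<bar> \<le> ennreal (n * (1 - y) powr (- 1 / 8))"
        using real(1) by (simp add: mult.commute flip: ennreal_mult)
      then show "\<bar>u s y\<bar> \<le> n * (1 - y) powr (- 1 / 8)" using real(1) by (simp add: ennreal_le_iff)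
    qed
    then have "ennreal (norm (Lclass (u s) :: 6 Lodd)) \<le> ennreal (2 * n)" by (rule ennreal_leI)
    also have "\<dots> = 2 * ennreal n" using real(1) by (simp add: ennreal_mult)
    finally show ?thesis by (simp add: real)
  next
    case top
    have "(2::ennreal) * top = top" by (simp add: ennreal_mult_top)
    then show ?thesis by (simp only: top top_greatest)
  qed
  have "(\<integral>\<^sup>+s. indicator {0..} s * ennreal (norm (Lclass (wave_solution f g s) :: 6 Lodd) ^ 3) \<partial>lborel)
      \<le> (\<integral>\<^sup>+s. ennreal (3328 * K) * (N1 s + N2 s)\<^sup>2 \<partial>lborel)"
  proof (intro nn_integral_mono)
    fix s :: real
    show "indicator {0..} s * ennreal (norm (Lclass (wave_solution f g s) :: 6 Lodd) ^ 3) \<le> ennreal (3328 * K) * (N1 s + N2 s)\<^sup>2"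
    proof (cases "0 \<le> s")
      case s: True
      let ?n = "norm (Lclass (u s) :: 6 Lodd)"
      \<comment> \<open>Interpolation: one factor is estimated by the sup bound and two by the
        square-integrable majorant.\<close>
      have "ennreal (?n ^ 3) = ennreal ?n * (ennreal ?n)\<^sup>2"
        by (simp add: power3_eq_cube power2_eq_square ennreal_mult mult.assoc)
      also have "\<dots> \<le> ennreal (832 * K) * (2 * (N1 s + N2 s))\<^sup>2"
        by (intro mult_mono power_mono dom[OF s] ennreal_leI sup[OF s]) auto
      also have "\<dots> = ennreal (832 * K) * 4 * (N1 s + N2 s)\<^sup>2"
      proof -
        have "(2::ennreal)\<^sup>2 = 4" by (simp add: power2_eq_square)
        then show ?thesis by (simp only: power_mult_distrib mult.assoc)
      qed
      also have "ennreal (832 * K) * 4 = ennreal (3328 * K)"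
        using K ennreal_mult[of "832 * K" 4] by simp
      finally show ?thesis using s cl[OF s] by simp
    qed simp
  qed
  also have "\<dots> = ennreal (3328 * K) * (\<integral>\<^sup>+s. (N1 s + N2 s)\<^sup>2 \<partial>lborel)"
    by (intro nn_integral_cmult) measurable
  also have "\<dots> \<le> ennreal (3328 * K) * ennreal ((8 * (2 * K) + 84 * (2 * K))\<^sup>2)"
    by (intro mult_left_mono nn_integral_L2_add N1_L2 N2_L2) (use K in auto)
  \<comment> \<open>\<open>3328 * 184 ^ 2 \<le> 1000 ^ 3\<close>, where 184 is twice
    \<open>8 + 84\<close>; the round constant leaves ample room.\<close>
  also have "\<dots> \<le> ennreal ((1000 * K) ^ 3)"
    using K by (simp add: ennreal_leI power2_eq_square power3_eq_cube flip: ennreal_mult)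
  finally show "(\<integral>\<^sup>+s. indicator {0..} s * ennreal (norm (Lclass (wave_solution f g s) :: 6 Lodd) ^ 3) \<partial>lborel) \<le> ennreal ((1000 * K) ^ 3)" .
  have cu: "continuous_on ({0..} \<times> {-1..1}) (\<lambda>(s, y). u s y)"
    using smooth_on_continuous[OF W(2)] by (simp add: u_def case_prod_unfold)
  have "continuous_on {0..} (\<lambda>s. Lclass (u s) :: 6 Lodd)"
    unfolding continuous_on_iff
  proof (intro ballI allI impI)
    fix s e :: real assume s: "s \<in> {0..}" and e: "e > 0"
    \<comment> \<open>Continuity up to \<open>y = \<plusminus>1\<close> makes the relevant set
      compact, so the time slices converge uniformly in \<open>y\<close>, which dominates the L6
      distance.\<close>
    have "uniformly_continuous_on ({0..s + 1} \<times> {-1..1}) (\<lambda>(s, y). u s y)"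
      by (intro compact_uniformly_continuous continuous_on_subset[OF cu] compact_Times) auto
    then obtain d where d: "d > 0" "\<And>x x'. x \<in> {0..s + 1} \<times> {-1..1} \<Longrightarrow> x' \<in> {0..s + 1} \<times> {-1..1} \<Longrightarrow> dist x' x < d \<Longrightarrow>
        dist ((\<lambda>(s, y). u s y) x') ((\<lambda>(s, y). u s y) x) < e / 4"
      unfolding uniformly_continuous_on_def using e by (metis divide_pos_pos zero_less_numeral)
    have "dist (Lclass (u s') :: 6 Lodd) (Lclass (u s)) < e" if s': "s' \<in> {0..}" "dist s' s < min d 1" for s'
    proof -
      have "dist (Lclass (u s') :: 6 Lodd) (Lclass (u s)) = norm (Lclass (\<lambda>y. u s' y - u s y) :: 6 Lodd)"
        using Lclass_diff[where 'a = 6, of "u s'" "u s"] mem s s' by (simp add: dist_norm)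
      also have "\<dots> = Lq_norm 6 (\<lambda>y. u s' y - u s y)"
        using norm_Lclass[where 'a = 6, of "\<lambda>y. u s' y - u s y"] Lq_odd_diff[OF _ mem mem, of s' s] s s' by simp
      also have "\<dots> \<le> 2 * (e / 4)"
      proof (rule bounded_in_Lq_space(2))
        have c: "continuous_on {-1<..<1} (u \<sigma>)" if "0 \<le> \<sigma>" for \<sigma>
          using smooth_on_continuous[of "{-1..1}" "u \<sigma>"] so[OF that] unfolding smooth_odd_def
          by (auto elim: continuous_on_subset)
        show "continuous_on {-1<..<1} (\<lambda>y. u s' y - u s y)"
          using s s' by (intro continuous_intros c) auto
        fix y :: real assume y: "y \<in> {-1<..<1}"
        have "dist ((\<lambda>(s, y). u s y) (s', y)) ((\<lambda>(s, y). u s y) (s, y)) < e / 4"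
          using s s' y by (intro d(2)) (auto simp: dist_real_def dist_Pair_Pair)
        then show "\<bar>u s' y - u s y\<bar> \<le> e / 4" by (simp add: dist_real_def)
      qed simp
      finally show ?thesis using e by simp
    qed
    then show "\<exists>d>0. \<forall>s'\<in>{0..}. dist s' s < d \<longrightarrow> dist (Lclass (u s') :: 6 Lodd) (Lclass (u s)) < e"
      using d(1) by (intro exI[of _ "min d 1"]) auto
  qed
  then show "continuous_on {0..} (\<lambda>s. Lclass (wave_solution f g s) :: 6 Lodd)"
    by (rule continuous_on_eq) (simp add: cl)
qed

section \<open>The extended propagator\<close>

lemma continuous_eq_on_dense:
  fixes f g :: "'a::topological_space \<Rightarrow> 'b::t2_space"
  assumes "closure X = UNIV" "continuous_on UNIV f" "continuous_on UNIV g" "\<And>x. x \<in> X \<Longrightarrow> f x = g x"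
  shows "f x = g x"
proof -
  have "closed {x. f x = g x}" using assms by (intro closed_Collect_eq)
  then have "closure X \<subseteq> {x. f x = g x}" using assms(4) by (intro closure_minimal) auto
  then show ?thesis using assms(1) by auto
qed

text \<open>The classical extension of a bounded operator from a dense subspace: linearity and the
  bound are closed conditions and persist under the continuous extension.\<close>

lemma bounded_linear_extension:
  fixes f :: "'a::real_normed_vector \<Rightarrow> 'b::banach"
  assumes X: "subspace X" "closure X = UNIV"
    and add: "\<And>x y. x \<in> X \<Longrightarrow> y \<in> X \<Longrightarrow> f (x + y) = f x + f y"
    and scale: "\<And>c x. x \<in> X \<Longrightarrow> f (c *\<^sub>R x) = c *\<^sub>R f x"
    and bd: "\<And>x. x \<in> X \<Longrightarrow> norm (f x) \<le> C * norm x"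
  shows "\<exists>T. bounded_linear T \<and> (\<forall>x\<in>X. T x = f x) \<and> (\<forall>x. norm (T x) \<le> C * norm x)"
proof -
  have lip: "dist (f x) (f y) \<le> (max C 0) * dist x y" if "x \<in> X" "y \<in> X" for x y
  proof -
    have "f x = f (x - y) + f y" using add[of "x - y" y] that X(1) by (simp add: subspace_diff)
    then have "dist (f x) (f y) \<le> C * norm (x - y)"
      using bd[of "x - y"] that X(1) by (simp add: dist_norm subspace_diff)
    also have "\<dots> \<le> max C 0 * norm (x - y)" by (intro mult_right_mono) auto
    finally show ?thesis by (simp add: dist_norm)
  qed
  have "uniformly_continuous_on X f"
    by (rule lipschitz_on_uniformly_continuous[where L = "max C 0"]) (auto simp: lipschitz_on_def lip)
  then obtain g where g: "uniformly_continuous_on (closure X) g" "\<And>x. x \<in> X \<Longrightarrow> f x = g x"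
    by (rule uniformly_continuous_on_extension_on_closure) (rule that)
  have cg: "continuous_on UNIV g" using g(1) X(2) uniformly_continuous_imp_continuous by simp
  then have cg': "continuous_on A (\<lambda>x. g (h x))" if "continuous_on A h" for h :: "'c::topological_space \<Rightarrow> 'a" and A
    using that continuous_on_compose2 by blast
  \<comment> \<open>Additivity is treated as one equation between continuous functions on the
    product, where \<open>X \<times> X\<close> is dense.\<close>
  have gsum: "g (fst p + snd p) = g (fst p) + g (snd p)" for p
    by (rule continuous_eq_on_dense[of "X \<times> X"])
      (use g(2) add X in \<open>auto simp: closure_Times intro!: continuous_intros cg' dest: subspace_add simp flip: g(2)\<close>)
  have gadd: "g (x + y) = g x + g y" for x y using gsum[of "(x, y)"] by simp
  have gscale: "g (c *\<^sub>R x) = c *\<^sub>R g x" for c x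
  proof (rule continuous_eq_on_dense[OF X(2)])
    show "continuous_on UNIV (\<lambda>x. g (c *\<^sub>R x))" "continuous_on UNIV (\<lambda>x. c *\<^sub>R g x)"
      by (intro continuous_intros cg' cg)+
    fix x assume x: "x \<in> X"
    then show "g (c *\<^sub>R x) = c *\<^sub>R g x"
      using g(2)[OF x] g(2)[OF subspace_scale[OF X(1) x, of c]] scale[OF x, of c] by simp
  qed
  have "closed {x. norm (g x) \<le> C * norm x}"
    by (intro closed_Collect_le continuous_intros cg)
  then have "closure X \<subseteq> {x. norm (g x) \<le> C * norm x}"
    using bd g(2) by (intro closure_minimal) auto
  then have gb: "norm (g x) \<le> C * norm x" for x using X(2) by auto
  have "bounded_linear g"
    by (rule bounded_linear_intro[where K = C]) (auto simp: gadd gscale gb mult.commute)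
  then show ?thesis using g(2) gb by (intro exI[of _ g]) auto
qed

section \<open>Linear dependence on the data\<close>

lemma Kop_scale: "Kop (\<lambda>q. c * w q) p = c * Kop w p"
proof -
  have "pot (\<lambda>q. c * w q) = (\<lambda>q. c * pot w q)" by (auto simp: pot_def)
  then show ?thesis by (simp add: Kop_def J1_def J2_def)
qed

lemma null_solution_linear:
  assumes v: "null_solution \<Psi> v" and v': "null_solution \<Psi>' v'"
  shows "null_solution (\<lambda>x. \<Psi> x + c * \<Psi>' x) (\<lambda>p. v p + c * v' p)"
proof -
  have cv: "continuous_on tri v" and cv': "continuous_on tri v'"
    using v v' unfolding null_solution_def by blast+
  have cm: "continuous_on tri (\<lambda>q. - c * v' q)" by (intro continuous_intros cv')
  have "Kop (\<lambda>q. v q - (- c * v' q)) p = Kop v p - (- c) * Kop v' p" if "p \<in> tri" for p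
    using Kop_diff[OF cv cm that] Kop_scale[of "- c" v' p] by simp
  then have K: "Kop (\<lambda>q. v q + c * v' q) p = Kop v p + c * Kop v' p" if "p \<in> tri" for p using that by simp
  have eqs: "v p = (\<Psi> (1 - fst p) - \<Psi> (1 - snd p)) / 2 + Kop v p"
    "v' p = (\<Psi>' (1 - fst p) - \<Psi>' (1 - snd p)) / 2 + Kop v' p" if "p \<in> tri" for p
    using v v' that unfolding null_solution_def by blast+
  show ?thesis
    unfolding null_solution_def
  proof (intro conjI ballI)
    show "continuous_on tri (\<lambda>p. v p + c * v' p)" by (intro continuous_intros cv cv')
    fix p assume p: "p \<in> tri"
    show "v p + c * v' p = ((\<Psi> (1 - fst p) + c * \<Psi>' (1 - fst p)) - (\<Psi> (1 - snd p) + c * \<Psi>' (1 - snd p))) / 2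
        + Kop (\<lambda>p. v p + c * v' p) p"
      unfolding K[OF p] eqs[OF p] by (simp add: field_simps)
  qed
qed

lemma profile_linear:
  assumes p: "profile f f' g \<Psi>" and q: "profile k k' l \<Phi>"
  shows "profile (\<lambda>x. f x + c * k x) (\<lambda>x. f' x + c * k' x) (\<lambda>x. g x + c * l x) (\<lambda>x. \<Psi> x + c * \<Phi> x)"
proof -
  have "((\<lambda>x. \<Psi> x + c * \<Phi> x) has_real_derivative (1 + x) * (f' x + c * k' x) + (g x + c * l x)) (at x within {-1..1})"
    if "x \<in> {-1..1}" for x
  proof -
    have "((\<lambda>x. \<Psi> x + c * \<Phi> x) has_real_derivative ((1 + x) * f' x + g x) + c * ((1 + x) * k' x + l x)) (at x within {-1..1})"
      using p q that unfolding profile_def by (intro DERIV_add DERIV_cmult) auto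
    then show ?thesis by (simp add: algebra_simps)
  qed
  moreover have "((\<lambda>x. f x + c * k x) has_real_derivative f' x + c * k' x) (at x within {-1..1})" if "x \<in> {-1..1}" for x
    using p q that unfolding profile_def by (intro DERIV_add DERIV_cmult) auto
  moreover have "smooth_on {-1..1} (\<lambda>x. f' x + c * k' x)"
    using p q unfolding profile_def by (intro smooth_on_add smooth_on_mult smooth_on_const) auto
  ultimately show ?thesis using p q unfolding profile_def by simp
qed

text \<open>Linearity is immediate for the integral equation; uniqueness transfers it to the
  solutions picked by the choice operator.\<close>

lemma wave_solution_linear:
  assumes f: "smooth_odd f" and g: "smooth_odd g" and k: "smooth_odd k" and l: "smooth_odd l"
    and s: "0 \<le> s" and y: "y \<in> {-1<..<1}"
  shows "wave_solution (\<lambda>x. f x + c * k x) (\<lambda>x. g x + c * l x) s y = wave_solution f g s y + c * wave_solution k l s y"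
proof -
  obtain f' \<Psi> where p: "profile f f' g \<Psi>" using profile_exists[OF f g] by blast
  obtain k' \<Phi> where q: "profile k k' l \<Phi>" using profile_exists[OF k l] by blast
  obtain v where v: "null_solution \<Psi> v" using null_solution_exists[OF profile_smooth(2)[OF p g]] by blast
  obtain v' where v': "null_solution \<Phi> v'" using null_solution_exists[OF profile_smooth(2)[OF q l]] by blast
  have ws: "wave_solution F G s y = w (nc (s, y))" if "is_wave_solution F G (\<lambda>s y. w (nc (s, y)))" for F G w
    using wave_solution_unique[OF someI[of "is_wave_solution F G", OF that] that s y] by (simp add: wave_solution_def)
  have fk: "smooth_odd (\<lambda>x. f x + c * k x)" "smooth_odd (\<lambda>x. g x + c * l x)"
    by (intro smooth_odd_add smooth_odd_scale f g k l)+
  show ?thesis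
    using ws[OF null_solution_is_wave_solution(1)[OF fk profile_linear[OF p q] null_solution_linear[OF v v']]]
      ws[OF null_solution_is_wave_solution(1)[OF f g p v]] ws[OF null_solution_is_wave_solution(1)[OF k l q v']]
    by simp
qed

definition sol6 :: "(real \<Rightarrow> real) \<Rightarrow> real \<Rightarrow> 6 Lodd" where
  "sol6 g s = Lclass (wave_solution (\<lambda>_. 0) g s)"

lemma smooth_wave_in_Lq_odd:
  assumes f: "smooth_odd f" and g: "smooth_odd g" and s: "0 \<le> s"
  obtains \<phi> where "\<phi> \<in> Lq_odd 6" "\<And>y. y \<in> {-1<..<1} \<Longrightarrow> wave_solution f g s y = \<phi> y"
proof -
  have "0 < energy_norm f g + 1" using energy_norm_nonneg[of f g] by simp
  from wave_solution_L6(1)[OF f g this _ s]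
  obtain \<phi> where "smooth_odd \<phi>" "\<And>y. y \<in> {-1<..<1} \<Longrightarrow> wave_solution f g s y = \<phi> y" by auto
  then show ?thesis using smooth_odd_in_Lq_odd[of 6 \<phi>] by (intro that) auto
qed

lemma sol6_linear:
  assumes g: "smooth_odd g" and l: "smooth_odd l" and s: "0 \<le> s"
  shows "sol6 (\<lambda>x. g x + c * l x) s = sol6 g s + c *\<^sub>R sol6 l s"
proof -
  have z: "smooth_odd (\<lambda>x. 0)" by (rule smooth_odd_zero)
  obtain \<phi> where \<phi>: "\<phi> \<in> Lq_odd 6" "\<And>y. y \<in> {-1<..<1} \<Longrightarrow> wave_solution (\<lambda>_. 0) g s y = \<phi> y"
    using smooth_wave_in_Lq_odd[OF z g s] by blast
  obtain \<psi> where \<psi>: "\<psi> \<in> Lq_odd 6" "\<And>y. y \<in> {-1<..<1} \<Longrightarrow> wave_solution (\<lambda>_. 0) l s y = \<psi> y"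
    using smooth_wave_in_Lq_odd[OF z l s] by blast
  have "sol6 (\<lambda>x. g x + c * l x) s = Lclass (\<lambda>y. \<phi> y + c * \<psi> y)"
    unfolding sol6_def
    by (rule Lclass_cong) (use wave_solution_linear[OF z g z l s, of _ c] \<phi>(2) \<psi>(2) in simp)
  also have "\<dots> = Lclass \<phi> + c *\<^sub>R Lclass \<psi>"
    using Lclass_add[where 'a = 6, of \<phi> "\<lambda>y. c * \<psi> y"] Lclass_scaleR[where 'a = 6, of \<psi> c] \<phi>(1) \<psi>(1) Lq_odd_scale[of 6 \<psi> c]
    by simp
  also have "Lclass \<phi> = sol6 g s"
    unfolding sol6_def by (rule Lclass_cong) (simp add: \<phi>)
  also have "Lclass \<psi> = sol6 l s"
    unfolding sol6_def by (rule Lclass_cong) (simp add: \<psi>)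
  finally show ?thesis .
qed

lemma energy_norm_eq_norm:
  assumes g: "smooth_odd g"
  shows "norm (Lclass g :: 2 Lodd) = sqrt (LBINT y:{-1<..<1}. \<bar>g y\<bar>\<^sup>2)"
proof -
  have mem: "g \<in> Lq_odd 2" using smooth_odd_in_Lq_odd[OF _ g, of 2] by simp
  have c: "continuous_on {-1<..<1} (\<lambda>y. \<bar>g y\<bar>\<^sup>2)"
    using g by (intro continuous_intros) (auto simp: smooth_odd_def intro: continuous_on_subset[OF smooth_on_continuous])
  have "(LINT y|I1. \<bar>g y\<bar>\<^sup>2) = (LINT y|lebesgue. indicator {-1<..<1} y *\<^sub>R \<bar>g y\<bar>\<^sup>2)"
    by (subst integral_restrict_space) auto
  also have "\<dots> = (LBINT y:{-1<..<1}. \<bar>g y\<bar>\<^sup>2)"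
    unfolding set_lebesgue_integral_def
    using borel_measurable_continuous_on_indicator[OF _ c] by (intro integral_completion) auto
  finally have "(LINT y|I1. \<bar>g y\<bar> powr 2) = (LBINT y:{-1<..<1}. \<bar>g y\<bar>\<^sup>2)" by simp
  then show ?thesis
    using norm_Lclass[where 'a = 2, of g] mem energy_integrals_nonneg(2)[of g]
    by (simp add: Lq_norm_def powr_half_sqrt)
qed

lemma norm_le_energy_norm: "smooth_odd g \<Longrightarrow> norm (Lclass g :: 2 Lodd) \<le> energy_norm f g"
  using energy_integrals_nonneg(1)[of f] by (simp add: energy_norm_eq_norm energy_norm_def)

lemma energy_norm_zero_left: "smooth_odd g \<Longrightarrow> energy_norm (\<lambda>_. 0) g = norm (Lclass g :: 2 Lodd)"
  by (simp add: energy_norm_eq_norm energy_norm_def)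

lemma energy_norm_zero_right: "energy_norm f (\<lambda>_. 0) \<le> energy_norm f g"
  using energy_integrals_nonneg(2)[of g] by (simp add: energy_norm_def)

text \<open>The estimates are available for every positive \<open>K\<close> above the norm. Taking
  \<open>K\<close> slightly larger than the norm and passing to the limit includes the case of norm
  zero.\<close>

lemma sol6_bounds:
  assumes g: "smooth_odd g"
  shows "0 \<le> s \<Longrightarrow> norm (sol6 g s) \<le> 832 * norm (Lclass g :: 2 Lodd)"
    and "(\<integral>\<^sup>+s. indicator {0..} s * ennreal (norm (sol6 g s) ^ 3) \<partial>lborel) \<le> ennreal ((1000 * norm (Lclass g :: 2 Lodd)) ^ 3)"
    and "continuous_on {0..} (sol6 g)"
proof -
  let ?n = "norm (Lclass g :: 2 Lodd)"
  note W = wave_solution_L6[OF smooth_odd_zero g, of "?n + e" for e, unfolded energy_norm_zero_left[OF g], folded sol6_def]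
  have e0: "0 < ?n + e" if "e > 0" for e using that by (simp add: add_nonneg_pos)
  show "norm (sol6 g s) \<le> 832 * ?n" if s: "0 \<le> s"
  proof (rule field_le_epsilon)
    fix e :: real assume e: "e > 0"
    have "norm (sol6 g s) \<le> 832 * (?n + e / 832)" by (rule W(2)) (use e s e0[of "e / 832"] in auto)
    then show "norm (sol6 g s) \<le> 832 * ?n + e" by simp
  qed
  have "(\<lambda>n. ennreal ((1000 * (?n + 1 / Suc n)) ^ 3)) \<longlonglongrightarrow> ennreal ((1000 * (?n + 0)) ^ 3)"
    by (intro tendsto_intros LIMSEQ_Suc lim_1_over_n tendsto_ennrealI)
  then show "(\<integral>\<^sup>+s. indicator {0..} s * ennreal (norm (sol6 g s) ^ 3) \<partial>lborel) \<le> ennreal ((1000 * ?n) ^ 3)"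
    using LIMSEQ_le_const[of _ "ennreal ((1000 * (?n + 0)) ^ 3)"] W(3)[of "1 / Suc n" for n] e0[of "1 / Suc n" for n]
    by fastforce
  show "continuous_on {0..} (sol6 g)" using W(4)[of 1] e0[of 1] by simp
qed

section \<open>The propagator on all of L2\<close>

lemma smooth_classes_dense: "closure (Lclass ` Collect smooth_odd) = (UNIV :: 2 Lodd set)"
proof -
  have "u \<in> closure (Lclass ` Collect smooth_odd)" for u :: "2 Lodd"
    unfolding closure_approachable
  proof (intro allI impI)
    fix e :: real assume e: "e > 0"
    obtain f where f: "f \<in> Lq_odd 2" "u = Lclass f" using Lodd_exhaust[of u] by auto
    obtain \<phi> where \<phi>: "smooth_odd \<phi>" "Lq_norm 2 (\<lambda>y. f y - \<phi> y) < e" using Lq_oddD(2)[OF f(1) e] by blast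
    have m: "\<phi> \<in> Lq_odd 2" using smooth_odd_in_Lq_odd[OF _ \<phi>(1), of 2] by simp
    have "dist (Lclass \<phi>) u = norm (u - Lclass \<phi>)" by (simp add: dist_norm norm_minus_commute)
    also have "u - Lclass \<phi> = Lclass (\<lambda>y. f y - \<phi> y)"
      using Lclass_diff[where 'a = 2, of f \<phi>] f m by simp
    also have "norm (Lclass (\<lambda>y. f y - \<phi> y) :: 2 Lodd) < e"
      using norm_Lclass[where 'a = 2, of "\<lambda>y. f y - \<phi> y"] \<phi>(2) Lq_odd_diff[OF _ f(1) m] by simp
    finally show "\<exists>y\<in>Lclass ` Collect smooth_odd. dist y u < e" using \<phi>(1) by blast
  qed
  then show ?thesis by auto
qed

lemma Lclass_linear:
  assumes "smooth_odd g" "smooth_odd l"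
  shows "Lclass g + c *\<^sub>R Lclass l = (Lclass (\<lambda>x. g x + c * l x) :: 2 Lodd)"
  using Lclass_add[where 'a = 2, of g "\<lambda>x. c * l x"] Lclass_scaleR[where 'a = 2, of l c] smooth_odd_in_Lq_odd[of 2]
    assms smooth_odd_scale[of l c] by simp

lemma S_prop_exists:
  assumes s: "0 \<le> s"
  shows "\<exists>T. bounded_linear T \<and> (\<forall>g. smooth_odd g \<longrightarrow> T (Lclass g) = sol6 g s) \<and> (\<forall>x :: 2 Lodd. norm (T x) \<le> 832 * norm x)"
proof -
  let ?X = "Lclass ` Collect smooth_odd :: 2 Lodd set"
  define r where "r x = (SOME g. smooth_odd g \<and> Lclass g = x)" for x :: "2 Lodd"
  define f where "f x = sol6 (r x) s" for x
  \<comment> \<open>The choice of a smooth representative is harmless: for two representatives of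
    one class the difference has norm zero, and so has its solution by the bound.\<close>
  have fL: "f (Lclass g) = sol6 g s" if g: "smooth_odd g" for g
  proof -
    have r: "smooth_odd (r (Lclass g))" "(Lclass (r (Lclass g)) :: 2 Lodd) = Lclass g"
      using someI[of "\<lambda>g'. smooth_odd g' \<and> (Lclass g' :: 2 Lodd) = Lclass g" g] g unfolding r_def by auto
    have "norm (sol6 (\<lambda>x. r (Lclass g) x + (- 1) * g x) s) \<le> 832 * norm (Lclass (\<lambda>x. r (Lclass g) x + (- 1) * g x) :: 2 Lodd)"
      using g r s by (intro sol6_bounds smooth_odd_add smooth_odd_scale)
    then show ?thesis
      using sol6_linear[OF r(1) g s, of "- 1"] Lclass_linear[OF r(1) g, of "- 1"] r(2) by (simp add: f_def)
  qed
  have "\<exists>T. bounded_linear T \<and> (\<forall>x\<in>?X. T x = f x) \<and> (\<forall>x. norm (T x) \<le> 832 * norm x)"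
  proof (rule bounded_linear_extension)
    have z: "smooth_odd (\<lambda>x. 0)" by (rule smooth_odd_zero)
    show "subspace ?X"
      unfolding subspace_def
    proof (intro conjI ballI allI)
      show "0 \<in> ?X" using z by (auto simp: zero_Lodd_def)
      fix x y :: "2 Lodd" and c :: real assume "x \<in> ?X" "y \<in> ?X"
      then obtain g l where gl: "smooth_odd g" "smooth_odd l" "x = Lclass g" "y = Lclass l" by auto
      show "x + y \<in> ?X"
        using Lclass_linear[OF gl(1,2), of 1] smooth_odd_add[OF gl(1,2)] gl by auto
    next
      fix x :: "2 Lodd" and c :: real assume "x \<in> ?X"
      then obtain g where g: "smooth_odd g" "x = Lclass g" by auto
      show "c *\<^sub>R x \<in> ?X"
        using Lclass_linear[OF z g(1), of c] smooth_odd_scale[OF g(1), of c] g by (auto simp flip: zero_Lodd_def)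
    qed
    show "closure ?X = UNIV" by (rule smooth_classes_dense)
    fix x :: "2 Lodd" assume x: "x \<in> ?X"
    then obtain g where g: "smooth_odd g" "x = Lclass g" by auto
    show "norm (f x) \<le> 832 * norm x" using sol6_bounds(1)[OF g(1) s] by (simp add: g fL)
    show "f (c *\<^sub>R x) = c *\<^sub>R f x" for c
      using Lclass_linear[OF z g(1), of c] sol6_linear[OF z g(1) s, of c] sol6_linear[OF z z s, of 1]
        fL[OF smooth_odd_scale[OF g(1), of c]] by (simp add: g fL flip: zero_Lodd_def)
    fix y assume "y \<in> ?X"
    then obtain l where l: "smooth_odd l" "y = Lclass l" by auto
    show "f (x + y) = f x + f y"
      using Lclass_linear[OF g(1) l(1), of 1] sol6_linear[OF g(1) l(1) s, of 1] fL[OF smooth_odd_add[OF g(1) l(1)]]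
      by (simp add: g l fL)
  qed
  then show ?thesis using fL by auto
qed

text \<open>Two bounded operators that agree on the dense set of smooth classes coincide, so the
  definite description denotes the operator constructed above.\<close>

lemma S_prop:
  assumes s: "0 \<le> s"
  shows "bounded_linear (S_prop s)" "\<And>g. smooth_odd g \<Longrightarrow> S_prop s (Lclass g) = sol6 g s" "norm (S_prop s x) \<le> 832 * norm x"
proof -
  obtain T where T: "bounded_linear T" "\<And>g. smooth_odd g \<Longrightarrow> T (Lclass g) = sol6 g s" "\<And>x :: 2 Lodd. norm (T x) \<le> 832 * norm x"
    using S_prop_exists[OF s] by blast
  have "S_prop s = T"
    unfolding S_prop_def
  proof (rule the_equality)
    show "bounded_linear T \<and> (\<forall>g. smooth_odd g \<longrightarrow> T (Lclass g) = Lclass (wave_solution (\<lambda>_. 0) g s))"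
      using T by (simp add: sol6_def)
    fix T' :: "2 Lodd \<Rightarrow> 6 Lodd"
    assume T': "bounded_linear T' \<and> (\<forall>g. smooth_odd g \<longrightarrow> T' (Lclass g) = Lclass (wave_solution (\<lambda>_. 0) g s))"
    have "T' x = T x" for x
      by (rule continuous_eq_on_dense[OF smooth_classes_dense])
        (use T T' in \<open>auto intro: linear_continuous_on simp: sol6_def\<close>)
    then show "T' = T" by blast
  qed
  with T show "bounded_linear (S_prop s)" "\<And>g. smooth_odd g \<Longrightarrow> S_prop s (Lclass g) = sol6 g s" "norm (S_prop s x) \<le> 832 * norm x"
    by auto
qed

lemma smooth_approx: "\<exists>g. (\<forall>n. smooth_odd (g n)) \<and> (\<lambda>n. Lclass (g n)) \<longlonglongrightarrow> (x :: 2 Lodd)"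
proof -
  have "x \<in> closure (Lclass ` Collect smooth_odd)" using smooth_classes_dense by auto
  then obtain X where X: "\<And>n. X n \<in> Lclass ` Collect smooth_odd" "X \<longlonglongrightarrow> x"
    unfolding closure_sequential by blast
  have "\<forall>n. \<exists>g. smooth_odd g \<and> X n = Lclass g" using X(1) by blast
  then obtain g where g: "\<And>n. smooth_odd (g n)" "\<And>n. X n = Lclass (g n)" by metis
  have "X = (\<lambda>n. Lclass (g n))" by (rule ext) (rule g(2))
  then show ?thesis using X(2) g(1) by auto
qed

text \<open>The bound 832 does not depend on \<open>s\<close>, so smooth approximations converge
  uniformly in time and continuity survives.\<close>

lemma S_prop_continuous: "continuous_on {0..} (\<lambda>s. S_prop s x)"
proof -
  obtain g where g: "\<And>n. smooth_odd (g n)" "(\<lambda>n. Lclass (g n)) \<longlonglongrightarrow> x"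
    using smooth_approx[of x] by blast
  have ul: "uniform_limit {0..} (\<lambda>n s. sol6 (g n) s) (\<lambda>s. S_prop s x) sequentially"
  proof (rule uniform_limitI)
    fix e :: real assume e: "e > 0"
    then have "\<forall>\<^sub>F n in sequentially. dist (Lclass (g n)) x < e / 832" using g(2) by (intro tendstoD) auto
    then show "\<forall>\<^sub>F n in sequentially. \<forall>s\<in>{0..}. dist (sol6 (g n) s) (S_prop s x) < e"
    proof eventually_elim
      case (elim n)
      show ?case
      proof
        fix s :: real assume "s \<in> {0..}"
        then have s: "0 \<le> s" by simp
        have "dist (sol6 (g n) s) (S_prop s x) = norm (S_prop s (Lclass (g n) - x))"
          using S_prop(1)[OF s] S_prop(2)[OF s g(1)] by (simp add: dist_norm bounded_linear.linear linear_diff)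
        also have "\<dots> \<le> 832 * norm (Lclass (g n) - x)" by (rule S_prop(3)[OF s])
        also have "\<dots> < e" using elim by (simp add: dist_norm)
        finally show "dist (sol6 (g n) s) (S_prop s x) < e" .
      qed
    qed
  qed
  have "continuous_on {0..} (\<lambda>s. sol6 (g n) s)" for n using sol6_bounds(3)[OF g(1)] by simp
  then show ?thesis
    using uniform_limit_theorem[OF always_eventually ul] by simp
qed

text \<open>Smooth approximations converge at every time, and Fatou's lemma carries the bound
  over.\<close>

lemma S_prop_L3: "(\<integral>\<^sup>+s. indicator {0..} s * ennreal (norm (S_prop s x) ^ 3) \<partial>lborel) \<le> ennreal ((1000 * norm x) ^ 3)"
proof -
  obtain g where g: "\<And>n. smooth_odd (g n)" "(\<lambda>n. Lclass (g n)) \<longlonglongrightarrow> x"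
    using smooth_approx[of x] by blast
  have m: "(\<lambda>s. indicator {0..} s * ennreal (norm (sol6 (g n) s) ^ 3)) \<in> borel_measurable borel" for n
  proof -
    have "(\<lambda>s. indicator {0..} s *\<^sub>R (norm (sol6 (g n) s) ^ 3)) \<in> borel_measurable borel"
      by (intro borel_measurable_continuous_on_indicator continuous_intros sol6_bounds(3) g(1)) auto
    then have "(\<lambda>s. ennreal (indicator {0..} s *\<^sub>R (norm (sol6 (g n) s) ^ 3))) \<in> borel_measurable borel" by measurable
    also have "(\<lambda>s. ennreal (indicator {0..} s *\<^sub>R (norm (sol6 (g n) s) ^ 3))) = (\<lambda>s. indicator {0..} s * ennreal (norm (sol6 (g n) s) ^ 3))"
      by (auto simp: indicator_def)
    finally show ?thesis .
  qed
  have "(\<integral>\<^sup>+s. indicator {0..} s * ennreal (norm (S_prop s x) ^ 3) \<partial>lborel)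
      = (\<integral>\<^sup>+s. liminf (\<lambda>n. indicator {0..} s * ennreal (norm (sol6 (g n) s) ^ 3)) \<partial>lborel)"
  proof (intro nn_integral_cong)
    fix s :: real
    have "(\<lambda>n. indicator {0..} s * ennreal (norm (sol6 (g n) s) ^ 3)) \<longlonglongrightarrow> indicator {0..} s * ennreal (norm (S_prop s x) ^ 3)"
    proof (cases "0 \<le> s")
      case True
      have "(\<lambda>n. S_prop s (Lclass (g n))) \<longlonglongrightarrow> S_prop s x"
        by (rule bounded_linear.tendsto[OF S_prop(1)[OF True] g(2)])
      then have "(\<lambda>n. sol6 (g n) s) \<longlonglongrightarrow> S_prop s x" using S_prop(2)[OF True g(1)] by simp
      then have "(\<lambda>n. ennreal (norm (sol6 (g n) s) ^ 3)) \<longlonglongrightarrow> ennreal (norm (S_prop s x) ^ 3)"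
        by (intro tendsto_intros tendsto_ennrealI)
      then show ?thesis using True by simp
    qed simp
    then show "indicator {0..} s * ennreal (norm (S_prop s x) ^ 3) = liminf (\<lambda>n. indicator {0..} s * ennreal (norm (sol6 (g n) s) ^ 3))"
      by (intro lim_imp_Liminf[symmetric]) auto
  qed
  also have "\<dots> \<le> liminf (\<lambda>n. \<integral>\<^sup>+s. indicator {0..} s * ennreal (norm (sol6 (g n) s) ^ 3) \<partial>lborel)"
    using m by (intro nn_integral_liminf) simp
  also have "\<dots> \<le> liminf (\<lambda>n. ennreal ((1000 * norm (Lclass (g n) :: 2 Lodd)) ^ 3))"
    by (intro Liminf_mono always_eventually allI sol6_bounds(2) g(1))
  also have "\<dots> = ennreal ((1000 * norm x) ^ 3)"
    by (intro lim_imp_Liminf tendsto_ennrealI tendsto_intros g(2)) auto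
  finally show ?thesis .
qed

lemma cube_lipschitz: "norm (cube a - cube b) \<le> 4 * norm (a - b) * ((norm a)\<^sup>2 + (norm b)\<^sup>2)"
proof (cases "a = b")
  case False
  obtain f where f: "f \<in> Lq_odd 6" "a = Lclass f" using Lodd_exhaust[of a] by auto
  obtain g where g: "g \<in> Lq_odd 6" "b = Lclass g" using Lodd_exhaust[of b] by auto
  have n: "norm (Lclass k :: 6 Lodd) ^ 6 = (LINT y|I1. k y ^ 6)" if "k \<in> Lq_odd 6" for k
    using norm_Lclass[where 'a = 6, of k] that Lq_norm_6[of k] by simp
  have d: "(\<lambda>y. f y - g y) \<in> Lq_odd 6" using Lq_odd_diff[OF _ f(1) g(1)] by simp
  have dab: "a - b = Lclass (\<lambda>y. f y - g y)" using Lclass_diff[where 'a = 6, of f g] f g by simp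
  define D where "D = norm (a - b)"
  define S where "S = (norm a)\<^sup>2 + (norm b)\<^sup>2"
  have D: "D > 0" using False by (simp add: D_def)
  have S: "S > 0"
  proof -
    have "a \<noteq> 0 \<or> b \<noteq> 0" using False by auto
    then show ?thesis by (auto simp: S_def add_pos_nonneg add_nonneg_pos)
  qed
  \<comment> \<open>The parameter balances the two terms of the pointwise inequality:
    \<open>D ^ 6 / c\<^sup>2\<close> and \<open>c * S ^ 3\<close> both become
    \<open>D\<^sup>2 * S\<^sup>2\<close>. The constant 4 of the lemma comes from
    \<open>9 / 4 * 5 \<le> 4\<^sup>2\<close>.\<close>
  define c where "c = D\<^sup>2 / S"
  have c: "c > 0" using D S by (simp add: c_def)
  note ints = Lq_space_6[OF Lq_oddD(1)[OF f(1)]] Lq_space_6[OF Lq_oddD(1)[OF g(1)]] Lq_space_6[OF Lq_oddD(1)[OF d]]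
  have L2: "(\<lambda>y. f y ^ 3 - g y ^ 3) \<in> Lq_odd 2" using Lq_odd_diff[OF _ Lq_odd_cube[OF f(1)] Lq_odd_cube[OF g(1)]] by simp
  have "cube a - cube b = Lclass (\<lambda>y. f y ^ 3 - g y ^ 3)"
    using Lclass_diff[where 'a = 2, of "\<lambda>y. f y ^ 3" "\<lambda>y. g y ^ 3"] Lq_odd_cube[OF f(1)] Lq_odd_cube[OF g(1)]
    by (simp add: f g cube_Lclass)
  then have "(norm (cube a - cube b))\<^sup>2 = Lq_norm 2 (\<lambda>y. f y ^ 3 - g y ^ 3) powr 2"
    using norm_Lclass[where 'a = 2, of "\<lambda>y. f y ^ 3 - g y ^ 3"] L2 by (simp add: Lq_norm_nonneg)
  also have "\<dots> = (LINT y|I1. (f y ^ 3 - g y ^ 3)\<^sup>2)"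
    by (simp add: Lq_norm_powr)
  also have "\<dots> \<le> (LINT y|I1. 9/4 * ((f y - g y) ^ 6 / c\<^sup>2 + 4 * c * (f y ^ 6 + g y ^ 6)))"
    using Lq_spaceD(2)[OF Lq_oddD(1)[OF L2]] ints by (intro integral_mono cube_diff_bound c) auto
  also have "\<dots> = 9/4 * (D ^ 6 / c\<^sup>2 + 4 * c * (norm a ^ 6 + norm b ^ 6))"
  proof -
    have "D ^ 6 = (LINT y|I1. (f y - g y) ^ 6)" unfolding D_def dab by (rule n[OF d])
    then show ?thesis using ints n[OF f(1)] n[OF g(1)] by (simp add: f g)
  qed
  also have "\<dots> \<le> 9/4 * (D\<^sup>2 * S\<^sup>2 + 4 * (D\<^sup>2 * S\<^sup>2))"
  proof (intro mult_left_mono add_mono)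
    show "D ^ 6 / c\<^sup>2 \<le> D\<^sup>2 * S\<^sup>2" using D S by (simp add: c_def power_divide field_simps flip: power_add power_mult)
    have "norm a ^ 6 + norm b ^ 6 \<le> S ^ 3"
      unfolding S_def by (simp add: power3_eq_cube eval_nat_numeral algebra_simps)
    then have "c * (norm a ^ 6 + norm b ^ 6) \<le> c * S ^ 3" using c by (intro mult_left_mono) auto
    also have "c * S ^ 3 = D\<^sup>2 * S\<^sup>2" using S by (simp add: c_def power3_eq_cube power2_eq_square)
    finally show "4 * c * (norm a ^ 6 + norm b ^ 6) \<le> 4 * (D\<^sup>2 * S\<^sup>2)" by simp
  qed simp
  also have "\<dots> \<le> (4 * D * S)\<^sup>2" by (simp add: power_mult_distrib)
  finally show ?thesis
    unfolding D_def S_def by (rule power2_le_imp_le) auto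
qed simp

section \<open>Duhamel integrals and Picard iteration\<close>

text \<open>Convexity of the cube with the weights \<open>p / (p + q)\<close> and
  \<open>q / (p + q)\<close>. With \<open>p ^ 3\<close> and \<open>q ^ 3\<close> in place of the two
  cubes the right-hand side is \<open>(p + q) ^ 3\<close>, which gives the triangle inequality in
  L3.\<close>

lemma weighted_cube_sum:
  fixes x y p q :: real
  assumes "0 \<le> x" "0 \<le> y" "0 < p" "0 < q"
  shows "(x + y) ^ 3 \<le> (p + q)\<^sup>2 * (x ^ 3 / p\<^sup>2 + y ^ 3 / q\<^sup>2)"
proof -
  define X Y where "X = x / p" and "Y = y / q"
  have xy: "x = p * X" "y = q * Y" and nn: "0 \<le> X" "0 \<le> Y" using assms by (auto simp: X_def Y_def)
  have "(p + q)\<^sup>2 * (p * X ^ 3 + q * Y ^ 3) - (p * X + q * Y) ^ 3 = p * q * (X - Y)\<^sup>2 * ((2 * p + q) * X + (p + 2 * q) * Y)"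
    by (simp add: power2_eq_square power3_eq_cube algebra_simps)
  moreover have "0 \<le> p * q * (X - Y)\<^sup>2 * ((2 * p + q) * X + (p + 2 * q) * Y)"
    using assms nn by (intro mult_nonneg_nonneg add_nonneg_nonneg) auto
  moreover have "x ^ 3 / p\<^sup>2 = p * X ^ 3" "y ^ 3 / q\<^sup>2 = q * Y ^ 3"
    using assms by (simp_all add: xy power2_eq_square power3_eq_cube)
  ultimately show ?thesis by (simp add: xy)
qed

text \<open>Young's inequality for the exponents 3 and 3/2, scaled so that \<open>p ^ 3\<close> and
  \<open>q ^ 3\<close> in place of the cubes give \<open>p * q\<^sup>2\<close>: Hoelder's inequality
  in additive form.\<close>

lemma young_cube:
  fixes x y p q :: real
  assumes "0 \<le> x" "0 \<le> y" "0 < p" "0 < q"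
  shows "x * y\<^sup>2 \<le> p * q\<^sup>2 * (x ^ 3 / (3 * p ^ 3) + 2 * y ^ 3 / (3 * q ^ 3))"
proof -
  define X Y where "X = x / p" and "Y = y / q"
  have xy: "x = p * X" "y = q * Y" and nn: "0 \<le> X" "0 \<le> Y" using assms by (auto simp: X_def Y_def)
  have "X ^ 3 + 2 * Y ^ 3 - 3 * (X * Y\<^sup>2) = (X - Y)\<^sup>2 * (X + 2 * Y)"
    by (simp add: power2_eq_square power3_eq_cube algebra_simps)
  moreover have "0 \<le> (X - Y)\<^sup>2 * (X + 2 * Y)" using nn by (intro mult_nonneg_nonneg) auto
  ultimately have "X * Y\<^sup>2 \<le> X ^ 3 / 3 + 2 * Y ^ 3 / 3" by simp
  then have "p * q\<^sup>2 * (X * Y\<^sup>2) \<le> p * q\<^sup>2 * (X ^ 3 / 3 + 2 * Y ^ 3 / 3)"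
    using assms by (intro mult_left_mono) auto
  moreover have "x ^ 3 / (3 * p ^ 3) = X ^ 3 / 3" "2 * y ^ 3 / (3 * q ^ 3) = 2 * Y ^ 3 / 3"
    using assms by (simp_all add: xy power_mult_distrib)
  ultimately show ?thesis by (simp add: xy power_mult_distrib mult_ac)
qed

text \<open>The best parameter is the cube root of \<open>j / A\<close>; for \<open>j = 0\<close>,
  where this is not positive, \<open>l\<close> tends to 0.\<close>

lemma cube_le_of_young:
  fixes i j A :: real
  assumes A: "0 < A" and j: "0 \<le> j" and i: "0 \<le> i" and *: "\<And>l. 0 < l \<Longrightarrow> i \<le> j / (3 * l\<^sup>2) + 2 * l * A / 3"
  shows "i ^ 3 \<le> A\<^sup>2 * j"
proof (cases "j = 0")
  case True
  have "i \<le> 0 + e" if "e > 0" for e using *[of "3 * e / (2 * A)"] that A True by (simp add: field_simps)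
  then have "i \<le> 0" by (rule field_le_epsilon)
  then show ?thesis using True i by simp
next
  case False
  define r where "r = root 3 (j / A)"
  have r: "0 < r" using False j A by (simp add: r_def)
  have j': "j = A * r ^ 3" using j A by (simp add: r_def)
  have "i \<le> r * A" using *[OF r] r by (simp add: j' power2_eq_square power3_eq_cube field_simps)
  then have "i ^ 3 \<le> (r * A) ^ 3" using i by (intro power_mono)
  also have "\<dots> = A\<^sup>2 * j" by (simp add: j' power2_eq_square power3_eq_cube)
  finally show ?thesis .
qed

text \<open>Hoelder's inequality for
  \<open>x = (x / \<phi> powr (2 / 3)) * \<phi> powr (2 / 3)\<close>, obtained from Young's
  inequality with the free scale \<open>l\<close>. Where \<open>\<phi>\<close> vanishes, so does
  \<open>x\<close>, and the quotient is 0 by convention.\<close>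

lemma nn_integral_cube_le:
  fixes x \<phi> :: "'a \<Rightarrow> real"
  assumes [measurable]: "x \<in> borel_measurable M" "\<phi> \<in> borel_measurable M"
    and nn: "\<And>t. 0 \<le> x t" "\<And>t. 0 \<le> \<phi> t" "\<And>t. \<phi> t = 0 \<Longrightarrow> x t = 0"
    and A: "0 < A" "(\<integral>\<^sup>+t. ennreal (\<phi> t) \<partial>M) \<le> ennreal A"
  shows "(\<integral>\<^sup>+t. ennreal (x t) \<partial>M) ^ 3 \<le> ennreal (A\<^sup>2) * (\<integral>\<^sup>+t. ennreal (x t ^ 3 / (\<phi> t)\<^sup>2) \<partial>M)"
proof (cases "\<integral>\<^sup>+t. ennreal (x t ^ 3 / (\<phi> t)\<^sup>2) \<partial>M")
  case top
  then show ?thesis using A(1) by (simp add: ennreal_mult_top)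
next
  case (real j)
  have I: "(\<integral>\<^sup>+t. ennreal (x t) \<partial>M) \<le> ennreal (j / (3 * l\<^sup>2) + 2 * l * A / 3)" if l: "0 < l" for l
  proof -
    have "x t \<le> 1 / (3 * l\<^sup>2) * (x t ^ 3 / (\<phi> t)\<^sup>2) + 2 * l / 3 * \<phi> t" for t
    proof (cases "\<phi> t = 0")
      case False
      then have \<phi>: "0 < \<phi> t" using nn(2)[of t] by simp
      have "x t \<le> l * \<phi> t * (x t ^ 3 / (3 * (l * \<phi> t) ^ 3) + 2 / 3)"
        using young_cube[OF nn(1)[of t] zero_le_one mult_pos_pos[OF l \<phi>] zero_less_one] by simp
      also have "\<dots> = 1 / (3 * l\<^sup>2) * (x t ^ 3 / (\<phi> t)\<^sup>2) + 2 * l / 3 * \<phi> t"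
        using \<phi> l by (simp add: power2_eq_square power3_eq_cube field_simps)
      finally show ?thesis .
    qed (simp add: nn(3))
    then have "(\<integral>\<^sup>+t. ennreal (x t) \<partial>M) \<le> (\<integral>\<^sup>+t. ennreal (1 / (3 * l\<^sup>2)) * ennreal (x t ^ 3 / (\<phi> t)\<^sup>2) + ennreal (2 * l / 3) * ennreal (\<phi> t) \<partial>M)"
      using nn l by (intro nn_integral_mono) (simp add: ennreal_plus[symmetric] ennreal_mult[symmetric] ennreal_leI del: ennreal_plus)
    also have "\<dots> = ennreal (1 / (3 * l\<^sup>2)) * ennreal j + ennreal (2 * l / 3) * (\<integral>\<^sup>+t. ennreal (\<phi> t) \<partial>M)"
      by (simp add: nn_integral_add nn_integral_cmult real)
    also have "\<dots> \<le> ennreal (1 / (3 * l\<^sup>2)) * ennreal j + ennreal (2 * l / 3) * ennreal A"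
      by (intro add_left_mono mult_left_mono A) simp
    also have "\<dots> = ennreal (j / (3 * l\<^sup>2) + 2 * l * A / 3)"
      using l A real by (simp add: ennreal_plus[symmetric] ennreal_mult[symmetric] del: ennreal_plus)
    finally show ?thesis .
  qed
  have "(\<integral>\<^sup>+t. ennreal (x t) \<partial>M) < top" using I[of 1] by (simp add: le_less_trans)
  then obtain i where i: "0 \<le> i" "(\<integral>\<^sup>+t. ennreal (x t) \<partial>M) = ennreal i" by (cases "\<integral>\<^sup>+t. ennreal (x t) \<partial>M") auto
  have "i ^ 3 \<le> A\<^sup>2 * j"
  proof (rule cube_le_of_young)
    fix l :: real assume l: "0 < l"
    have "0 \<le> j / (3 * l\<^sup>2) + 2 * l * A / 3" using l A real by simp
    then show "i \<le> j / (3 * l\<^sup>2) + 2 * l * A / 3" using I[OF l] i by simp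
  qed (use A real i in auto)
  then show ?thesis using i real by (simp add: ennreal_power ennreal_mult[symmetric] ennreal_leI)
qed

text \<open>The closed ball of radius \<open>r\<close> for the maximum of the sup norm and the L3
  norm in time; the fixed point is sought in such a ball.\<close>

definition sup_L3_bound :: "real \<Rightarrow> (real \<Rightarrow> 'b::real_normed_vector) \<Rightarrow> bool" where
  "sup_L3_bound r u \<longleftrightarrow> continuous_on {0..} u \<and> (\<forall>s\<ge>0. norm (u s) \<le> r) \<and>
     (\<integral>\<^sup>+s. indicator {0..} s * ennreal (norm (u s) ^ 3) \<partial>lborel) \<le> ennreal (r ^ 3)"

lemma measurable_indicator_continuous:
  fixes u :: "real \<Rightarrow> real"
  assumes "continuous_on {0..} u"
  shows "(\<lambda>s. indicator {0..} s * ennreal (u s)) \<in> borel_measurable borel"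
proof -
  have "(\<lambda>s. indicator {0..} s *\<^sub>R u s) \<in> borel_measurable borel"
    by (intro borel_measurable_continuous_on_indicator assms) auto
  then have "(\<lambda>s. ennreal (indicator {0..} s *\<^sub>R u s)) \<in> borel_measurable borel" by measurable
  also have "(\<lambda>s. ennreal (indicator {0..} s *\<^sub>R u s)) = (\<lambda>s. indicator {0..} s * ennreal (u s))"
    by (auto simp: indicator_def)
  finally show ?thesis .
qed

lemma sup_L3_bound_mono: "sup_L3_bound p u \<Longrightarrow> 0 \<le> p \<Longrightarrow> p \<le> q \<Longrightarrow> sup_L3_bound q u"
  unfolding sup_L3_bound_def by (meson ennreal_leI order_trans power_mono)

lemma sup_L3_bound_zero: "0 \<le> p \<Longrightarrow> sup_L3_bound p (\<lambda>_. 0)"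
  by (simp add: sup_L3_bound_def)

lemma sup_L3_bound_minus: "sup_L3_bound p u \<Longrightarrow> sup_L3_bound p (\<lambda>s. - u s)"
  by (auto simp: sup_L3_bound_def intro: continuous_intros)

lemma sup_L3_bound_add:
  assumes u: "sup_L3_bound p u" and v: "sup_L3_bound q v" and p: "0 < p" and q: "0 < q"
  shows "sup_L3_bound (p + q) (\<lambda>s. u s + v s)"
proof -
  have cu: "continuous_on {0..} u" and cv: "continuous_on {0..} v" using u v by (auto simp: sup_L3_bound_def)
  note m = measurable_indicator_continuous[of "\<lambda>s. norm (u s) ^ 3"] measurable_indicator_continuous[of "\<lambda>s. norm (v s) ^ 3"]
  have "norm (u s + v s) ^ 3 \<le> (p + q)\<^sup>2 * (norm (u s) ^ 3 / p\<^sup>2 + norm (v s) ^ 3 / q\<^sup>2)" for s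
    using power_mono[OF norm_triangle_ineq norm_ge_zero, of "u s" "v s" 3] weighted_cube_sum[OF norm_ge_zero norm_ge_zero p q, of "u s" "v s"]
    by linarith
  then have le: "norm (u s + v s) ^ 3 \<le> (p + q)\<^sup>2 / p\<^sup>2 * norm (u s) ^ 3 + (p + q)\<^sup>2 / q\<^sup>2 * norm (v s) ^ 3" for s
    by (simp add: distrib_left)
  have "(\<integral>\<^sup>+s. indicator {0..} s * ennreal (norm (u s + v s) ^ 3) \<partial>lborel)
      \<le> (\<integral>\<^sup>+s. ennreal ((p + q)\<^sup>2 / p\<^sup>2) * (indicator {0..} s * ennreal (norm (u s) ^ 3))
        + ennreal ((p + q)\<^sup>2 / q\<^sup>2) * (indicator {0..} s * ennreal (norm (v s) ^ 3)) \<partial>lborel)"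
    using le by (intro nn_integral_mono)
      (auto simp: indicator_def ennreal_plus[symmetric] ennreal_mult[symmetric] ennreal_leI simp del: ennreal_plus)
  also have "\<dots> = ennreal ((p + q)\<^sup>2 / p\<^sup>2) * (\<integral>\<^sup>+s. indicator {0..} s * ennreal (norm (u s) ^ 3) \<partial>lborel)
      + ennreal ((p + q)\<^sup>2 / q\<^sup>2) * (\<integral>\<^sup>+s. indicator {0..} s * ennreal (norm (v s) ^ 3) \<partial>lborel)"
    using m cu cv by (simp add: nn_integral_add nn_integral_cmult continuous_intros)
  also have "\<dots> \<le> ennreal ((p + q)\<^sup>2 / p\<^sup>2) * ennreal (p ^ 3) + ennreal ((p + q)\<^sup>2 / q\<^sup>2) * ennreal (q ^ 3)"
    using u v by (intro add_mono mult_left_mono) (auto simp: sup_L3_bound_def)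
  also have "\<dots> = ennreal ((p + q)\<^sup>2 / p\<^sup>2 * p ^ 3 + (p + q)\<^sup>2 / q\<^sup>2 * q ^ 3)"
    using p q by (simp add: ennreal_plus[symmetric] ennreal_mult[symmetric] del: ennreal_plus)
  also have "(p + q)\<^sup>2 / p\<^sup>2 * p ^ 3 + (p + q)\<^sup>2 / q\<^sup>2 * q ^ 3 = (p + q) ^ 3"
    using p q by (simp add: power2_eq_square power3_eq_cube field_simps)
  finally show ?thesis
    using u v by (auto simp: sup_L3_bound_def intro!: continuous_intros intro: norm_triangle_le add_mono)
qed

lemma sup_L3_bound_diff:
  "sup_L3_bound p u \<Longrightarrow> sup_L3_bound q v \<Longrightarrow> 0 < p \<Longrightarrow> 0 < q \<Longrightarrow> sup_L3_bound (p + q) (\<lambda>s. u s - v s)"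
  using sup_L3_bound_add[of p u q "\<lambda>s. - v s"] sup_L3_bound_minus[of q v] by simp

text \<open>Hoelder's inequality for 1/3 + 2/3 = 1. It is the passage from L3 to L1 in time that
  makes the cubic term integrable.\<close>

lemma nn_integral_mult_square_le:
  fixes x y :: "real \<Rightarrow> real"
  assumes cx: "continuous_on {0..} x" and cy: "continuous_on {0..} y" and nn: "\<And>s. 0 \<le> x s" "\<And>s. 0 \<le> y s"
    and p: "0 < p" "(\<integral>\<^sup>+s. indicator {0..} s * ennreal (x s ^ 3) \<partial>lborel) \<le> ennreal (p ^ 3)"
    and q: "0 < q" "(\<integral>\<^sup>+s. indicator {0..} s * ennreal (y s ^ 3) \<partial>lborel) \<le> ennreal (q ^ 3)"
  shows "(\<integral>\<^sup>+s. indicator {0..} s * ennreal (x s * (y s)\<^sup>2) \<partial>lborel) \<le> ennreal (p * q\<^sup>2)"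
proof -
  define a b where "a = p * q\<^sup>2 / (3 * p ^ 3)" and "b = p * q\<^sup>2 * 2 / (3 * q ^ 3)"
  have ab: "0 \<le> a" "0 \<le> b" using p q by (simp_all add: a_def b_def)
  have le: "x s * (y s)\<^sup>2 \<le> a * x s ^ 3 + b * y s ^ 3" for s
    using young_cube[OF nn p(1) q(1), of s s] by (simp add: a_def b_def distrib_left mult_ac)
  note m = measurable_indicator_continuous[of "\<lambda>s. x s ^ 3"] measurable_indicator_continuous[of "\<lambda>s. y s ^ 3"]
  have "(\<integral>\<^sup>+s. indicator {0..} s * ennreal (x s * (y s)\<^sup>2) \<partial>lborel)
      \<le> (\<integral>\<^sup>+s. ennreal a * (indicator {0..} s * ennreal (x s ^ 3)) + ennreal b * (indicator {0..} s * ennreal (y s ^ 3)) \<partial>lborel)"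
    using le ab nn by (intro nn_integral_mono)
      (auto simp: indicator_def ennreal_plus[symmetric] ennreal_mult[symmetric] ennreal_leI simp del: ennreal_plus)
  also have "\<dots> = ennreal a * (\<integral>\<^sup>+s. indicator {0..} s * ennreal (x s ^ 3) \<partial>lborel)
      + ennreal b * (\<integral>\<^sup>+s. indicator {0..} s * ennreal (y s ^ 3) \<partial>lborel)"
    using m cx cy by (simp add: nn_integral_add nn_integral_cmult continuous_intros)
  also have "\<dots> \<le> ennreal a * ennreal (p ^ 3) + ennreal b * ennreal (q ^ 3)"
    by (intro add_mono mult_left_mono p q) auto
  also have "\<dots> = ennreal (a * p ^ 3 + b * q ^ 3)"
    using p q ab by (simp add: ennreal_plus[symmetric] ennreal_mult[symmetric] del: ennreal_plus)
  also have "a * p ^ 3 + b * q ^ 3 = p * q\<^sup>2"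
    using p q by (simp add: a_def b_def field_simps)
  finally show ?thesis .
qed

section \<open>Duhamel integrals of a bounded propagator that is integrable to the third power in
  time\<close>

locale L3_propagator =
  fixes S :: "real \<Rightarrow> 'a::{banach,second_countable_topology} \<Rightarrow> 'b::{banach,second_countable_topology}" and C :: real
  assumes C_pos: "0 < C"
    and lin: "0 \<le> s \<Longrightarrow> bounded_linear (S s)"
    and bound: "0 \<le> s \<Longrightarrow> norm (S s x) \<le> C * norm x"
    and cont: "continuous_on {0..} (\<lambda>s. S s x)"
    and L3: "(\<integral>\<^sup>+s. indicator {0..} s * ennreal (norm (S s x) ^ 3) \<partial>lborel) \<le> ennreal ((C * norm x) ^ 3)"
begin

text \<open>Strong continuity and a bound uniform in time give joint continuity in time and
  argument.\<close>

lemma joint_tendsto: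
  assumes a: "a \<longlonglongrightarrow> s" "\<And>n. 0 \<le> a n" and s: "0 \<le> s" and x: "x \<longlonglongrightarrow> y"
  shows "(\<lambda>n. S (a n) (x n)) \<longlonglongrightarrow> S s y"
proof -
  have 1: "(\<lambda>n. S (a n) y) \<longlonglongrightarrow> S s y"
    using continuous_on_tendsto_compose[OF cont a(1)] a s by simp
  have "(\<lambda>n. S (a n) (x n - y)) \<longlonglongrightarrow> 0"
  proof (rule Lim_null_comparison)
    show "\<forall>\<^sub>F n in sequentially. norm (S (a n) (x n - y)) \<le> C * norm (x n - y)"
      using bound a(2) by simp
    have "(\<lambda>n. C * norm (x n - y)) \<longlonglongrightarrow> C * norm (y - y)" by (intro tendsto_intros x)
    then show "(\<lambda>n. C * norm (x n - y)) \<longlonglongrightarrow> 0" by simp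
  qed
  from tendsto_add[OF this 1] show ?thesis
    using linear_diff[OF bounded_linear.linear[OF lin[OF a(2)]]] by simp
qed

lemma joint_continuous:
  fixes a :: "'c::metric_space \<Rightarrow> real"
  assumes a: "continuous_on X a" "\<And>p. p \<in> X \<Longrightarrow> 0 \<le> a p" and x: "continuous_on X x"
  shows "continuous_on X (\<lambda>p. S (a p) (x p))"
proof (rule continuous_on_sequentiallyI)
  fix u p assume u: "\<forall>n. u n \<in> X" "p \<in> X" "u \<longlonglongrightarrow> p"
  show "(\<lambda>n. S (a (u n)) (x (u n))) \<longlonglongrightarrow> S (a p) (x p)"
    using u a by (intro joint_tendsto continuous_on_tendsto_compose[OF a(1)] continuous_on_tendsto_compose[OF x]) auto
qed

definition Duh :: "(real \<Rightarrow> 'a) \<Rightarrow> real \<Rightarrow> 'b" where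
  "Duh F s = (LBINT t:{0..s}. S (s - t) (F t))"

context
  fixes F :: "real \<Rightarrow> 'a"
  assumes F: "continuous_on {0..} F"
begin

lemma Duh_integrable: "set_integrable lborel {0..s} (\<lambda>t. S (s - t) (F t))"
  by (intro borel_integrable_atLeastAtMost' joint_continuous continuous_intros continuous_on_subset[OF F]) auto

lemma Duh_kernel_measurable:
  "(\<lambda>(s, t). indicator {0..s} t *\<^sub>R S (s - t) (F t)) \<in> borel_measurable borel"
proof -
  define X where "X = {p. 0 \<le> snd p \<and> snd p \<le> (fst p :: real)}"
  have X: "closed X" unfolding X_def by (intro closed_Collect_conj closed_Collect_le continuous_intros)
  have "(\<lambda>p. indicator X p *\<^sub>R S (fst p - snd p) (F (snd p))) \<in> borel_measurable borel"
  proof (intro borel_measurable_continuous_on_indicator joint_continuous)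
    show "X \<in> sets borel" using X by (rule borel_closed)
    show "continuous_on X (\<lambda>p. F (snd p))"
      by (rule continuous_on_compose2[OF F]) (auto simp: X_def intro: continuous_intros)
  qed (auto simp: X_def intro!: continuous_intros)
  also have "(\<lambda>p. indicator X p *\<^sub>R S (fst p - snd p) (F (snd p))) = (\<lambda>(s, t). indicator {0..s} t *\<^sub>R S (s - t) (F t))"
    by (auto simp: X_def indicator_def)
  finally show ?thesis .
qed

lemma Duh_norm_le: "ennreal (norm (Duh F s)) \<le> (\<integral>\<^sup>+t. ennreal (norm (indicator {0..s} t *\<^sub>R S (s - t) (F t))) \<partial>lborel)"
  using Duh_integrable[of s] unfolding Duh_def set_lebesgue_integral_def set_integrable_def
  by (rule integral_norm_bound_ennreal)

lemma Duh_continuous: "continuous_on {0..} (Duh F)"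
proof (rule continuous_on_sequentiallyI)
  fix a :: "nat \<Rightarrow> real" and s assume a: "\<forall>n. a n \<in> {0..}" "s \<in> {0..}" "a \<longlonglongrightarrow> s"
  obtain M where M: "\<And>n. a n \<le> M"
    using convergent_imp_Bseq[OF convergentI[OF a(3)]] by (auto simp: Bseq_def abs_le_iff)
  define w where "w t = C * norm (indicator {0..M} t *\<^sub>R F t)" for t
  have "set_integrable lborel {0..M} F"
    by (intro borel_integrable_atLeastAtMost' continuous_on_subset[OF F]) auto
  then have w: "integrable lborel w"
    unfolding w_def set_integrable_def by (intro integrable_mult_right integrable_norm)
  show "(\<lambda>n. Duh F (a n)) \<longlonglongrightarrow> Duh F s"
    unfolding Duh_def set_lebesgue_integral_def
  proof (rule integral_dominated_convergence[OF _ _ w])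
    show "(\<lambda>t. indicator {0..s} t *\<^sub>R S (s - t) (F t)) \<in> borel_measurable lborel"
      "(\<lambda>t. indicator {0..a n} t *\<^sub>R S (a n - t) (F t)) \<in> borel_measurable lborel" for n
      using Duh_integrable[of s] Duh_integrable[of "a n"] unfolding set_integrable_def by auto
    show "AE t in lborel. norm (indicator {0..a n} t *\<^sub>R S (a n - t) (F t)) \<le> w t" for n
      using M[of n] bound C_pos by (intro AE_I2) (auto simp: w_def indicator_def)
    show "AE t in lborel. (\<lambda>n. indicator {0..a n} t *\<^sub>R S (a n - t) (F t)) \<longlonglongrightarrow> indicator {0..s} t *\<^sub>R S (s - t) (F t)"
      \<comment> \<open>The indicators converge at every \<open>t\<close> except possibly the moving
        end point \<open>t = s\<close>.\<close>
      using AE_lborel_singleton[of s]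
    proof eventually_elim
      case (elim t)
      consider "t < 0" | "0 \<le> t" "t < s" | "s < t" using elim by linarith
      then show ?case
      proof cases
        case 2
        then have ev: "\<forall>\<^sub>F n in sequentially. t < a n" using a(3) order_tendstoD(1) by blast
        \<comment> \<open>The maximum with 0 keeps the propagator at nonnegative times for the
          finitely many \<open>n\<close> with \<open>a n \<le> t\<close>.\<close>
        have "(\<lambda>n. S (max 0 (a n - t)) (F t)) \<longlonglongrightarrow> S (max 0 (s - t)) (F t)"
          by (rule joint_tendsto) (auto intro!: tendsto_intros a(3))
        then have "(\<lambda>n. S (max 0 (a n - t)) (F t)) \<longlonglongrightarrow> indicator {0..s} t *\<^sub>R S (s - t) (F t)" using 2 by simp
        then show ?thesis
          by (rule Lim_transform_eventually) (use ev 2 in \<open>auto elim: eventually_mono\<close>)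
      next
        case 3
        then have "\<forall>\<^sub>F n in sequentially. a n < t" using a(3) order_tendstoD(2) by blast
        then have "\<forall>\<^sub>F n in sequentially. indicator {0..s} t *\<^sub>R S (s - t) (F t) = indicator {0..a n} t *\<^sub>R S (a n - t) (F t)"
          using 3 by (auto elim!: eventually_mono)
        then show ?thesis by (rule Lim_transform_eventually[OF tendsto_const])
      qed simp
    qed
  qed
qed

text \<open>Minkowski's integral inequality, with the pointwise weight \<open>norm (F t)\<close> in the place of duality.\<close>

lemma Duh_sup_L3_bound:
  assumes A: "0 < A" "(\<integral>\<^sup>+t. indicator {0..} t * ennreal (norm (F t)) \<partial>lborel) \<le> ennreal A"
  shows "sup_L3_bound (C * A) (Duh F)"
proof -
  define \<phi> where "\<phi> t = indicator {0..} t * norm (F t)" for t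
  define x where "x s t = norm (indicator {0..s} t *\<^sub>R S (s - t) (F t))" for s t
  have \<phi>m [measurable]: "\<phi> \<in> borel_measurable borel"
    using borel_measurable_continuous_on_indicator[OF _ continuous_on_norm[OF F]] by (simp add: \<phi>_def[abs_def])
  have "(\<lambda>p. norm (case p of (s, t) \<Rightarrow> indicator {0..s} t *\<^sub>R S (s - t) (F t))) \<in> borel_measurable borel"
    using Duh_kernel_measurable by measurable
  then have xm [measurable]: "(\<lambda>(s, t). x s t) \<in> borel_measurable (borel \<Otimes>\<^sub>M borel)"
    by (simp add: x_def borel_prod split_beta')
  have \<phi>nn: "0 \<le> \<phi> t" and xnn: "0 \<le> x s t" for s t by (simp_all add: \<phi>_def x_def)
  have x\<phi>: "x s t \<le> C * \<phi> t" for s t using bound C_pos by (auto simp: x_def \<phi>_def indicator_def)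
  then have x0: "\<phi> t = 0 \<Longrightarrow> x s t = 0" for s t using xnn[of s t] by (metis mult_zero_right order_antisym)
  have \<phi>A: "(\<integral>\<^sup>+t. ennreal (\<phi> t) \<partial>lborel) \<le> ennreal A"
    using A(2) by (simp add: \<phi>_def ennreal_mult' ennreal_indicator)
  have "norm (Duh F s) \<le> C * A" for s
  proof -
    have "ennreal (norm (Duh F s)) \<le> (\<integral>\<^sup>+t. ennreal (x s t) \<partial>lborel)" using Duh_norm_le by (simp add: x_def)
    also have "\<dots> \<le> (\<integral>\<^sup>+t. ennreal C * ennreal (\<phi> t) \<partial>lborel)"
      using x\<phi> C_pos by (intro nn_integral_mono) (simp add: ennreal_mult'[symmetric] ennreal_leI)
    also have "\<dots> = ennreal C * (\<integral>\<^sup>+t. ennreal (\<phi> t) \<partial>lborel)" by (rule nn_integral_cmult) simp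
    also have "\<dots> \<le> ennreal C * ennreal A" by (intro mult_left_mono \<phi>A) simp
    finally show ?thesis using C_pos A by (simp add: ennreal_mult'[symmetric])
  qed
  moreover have "(\<integral>\<^sup>+s. indicator {0..} s * ennreal (norm (Duh F s) ^ 3) \<partial>lborel) \<le> ennreal ((C * A) ^ 3)"
  proof -
    have "(\<integral>\<^sup>+s. indicator {0..} s * ennreal (norm (Duh F s) ^ 3) \<partial>lborel)
        \<le> (\<integral>\<^sup>+s. ennreal (A\<^sup>2) * (\<integral>\<^sup>+t. ennreal (x s t ^ 3 / (\<phi> t)\<^sup>2) \<partial>lborel) \<partial>lborel)"
    proof (rule nn_integral_mono)
      fix s :: real
      have "indicator {0..} s * ennreal (norm (Duh F s) ^ 3) \<le> ennreal (norm (Duh F s)) ^ 3"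
        by (simp add: indicator_def ennreal_power)
      also have "\<dots> \<le> (\<integral>\<^sup>+t. ennreal (x s t) \<partial>lborel) ^ 3"
        using Duh_norm_le by (intro power_mono) (simp_all add: x_def)
      also have "\<dots> \<le> ennreal (A\<^sup>2) * (\<integral>\<^sup>+t. ennreal (x s t ^ 3 / (\<phi> t)\<^sup>2) \<partial>lborel)"
        by (intro nn_integral_cube_le A \<phi>A xnn \<phi>nn x0) measurable
      finally show "indicator {0..} s * ennreal (norm (Duh F s) ^ 3)
        \<le> ennreal (A\<^sup>2) * (\<integral>\<^sup>+t. ennreal (x s t ^ 3 / (\<phi> t)\<^sup>2) \<partial>lborel)" .
    qed
    also have "\<dots> = ennreal (A\<^sup>2) * (\<integral>\<^sup>+s. \<integral>\<^sup>+t. ennreal (x s t ^ 3 / (\<phi> t)\<^sup>2) \<partial>lborel \<partial>lborel)"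
      by (intro nn_integral_cmult) measurable
    also have "(\<integral>\<^sup>+s. \<integral>\<^sup>+t. ennreal (x s t ^ 3 / (\<phi> t)\<^sup>2) \<partial>lborel \<partial>lborel)
        = (\<integral>\<^sup>+t. \<integral>\<^sup>+s. ennreal (x s t ^ 3 / (\<phi> t)\<^sup>2) \<partial>lborel \<partial>lborel)"
      by (rule lborel_pair.Fubini') measurable
    also have "\<dots> \<le> (\<integral>\<^sup>+t. ennreal (C ^ 3) * ennreal (\<phi> t) \<partial>lborel)"
    proof (rule nn_integral_mono)
      fix t :: real
      show "(\<integral>\<^sup>+s. ennreal (x s t ^ 3 / (\<phi> t)\<^sup>2) \<partial>lborel) \<le> ennreal (C ^ 3) * ennreal (\<phi> t)"
      proof (cases "\<phi> t = 0")
        case False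
        then have t: "0 \<le> t" and \<phi>t: "\<phi> t = norm (F t)" "0 < norm (F t)" by (auto simp: \<phi>_def indicator_def split: if_splits)
        have m3: "(\<lambda>s. ennreal (x s t ^ 3)) \<in> borel_measurable borel" by measurable
        have "(\<integral>\<^sup>+s. ennreal (x s t ^ 3 / (\<phi> t)\<^sup>2) \<partial>lborel) = (\<integral>\<^sup>+s. ennreal (1 / (\<phi> t)\<^sup>2) * ennreal (x s t ^ 3) \<partial>lborel)"
          by (simp add: ennreal_mult[symmetric] xnn)
        also have "\<dots> = ennreal (1 / (\<phi> t)\<^sup>2) * (\<integral>\<^sup>+s. ennreal (x s t ^ 3) \<partial>lborel)"
          using m3 by (intro nn_integral_cmult) simp
        \<comment> \<open>Translation by \<open>t\<close> makes the source time the origin, and the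
          L3 estimate applies to the fixed vector \<open>F t\<close>.\<close>
        also have "(\<integral>\<^sup>+s. ennreal (x s t ^ 3) \<partial>lborel) = (\<integral>\<^sup>+s. ennreal (x (t + s) t ^ 3) \<partial>lborel)"
          using nn_integral_real_affine[OF m3, of 1 t] by simp
        also have "\<dots> = (\<integral>\<^sup>+s. indicator {0..} s * ennreal (norm (S s (F t)) ^ 3) \<partial>lborel)"
          using t by (intro nn_integral_cong) (simp add: x_def indicator_def)
        also have "ennreal (1 / (\<phi> t)\<^sup>2) * \<dots> \<le> ennreal (1 / (\<phi> t)\<^sup>2) * ennreal ((C * \<phi> t) ^ 3)"
          unfolding \<phi>t by (intro mult_left_mono L3) simp
        also have "\<dots> = ennreal (C ^ 3) * ennreal (\<phi> t)"
          using C_pos \<phi>t by (simp add: ennreal_mult[symmetric] power2_eq_square power3_eq_cube)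
        finally show ?thesis .
      qed (simp add: x0)
    qed
    also have "\<dots> = ennreal (C ^ 3) * (\<integral>\<^sup>+t. ennreal (\<phi> t) \<partial>lborel)" by (rule nn_integral_cmult) simp
    also have "ennreal (A\<^sup>2) * \<dots> \<le> ennreal (A\<^sup>2) * (ennreal (C ^ 3) * ennreal A)"
      by (intro mult_left_mono \<phi>A) auto
    also have "\<dots> = ennreal ((C * A) ^ 3)"
      using A C_pos by (simp add: ennreal_mult[symmetric] power2_eq_square power3_eq_cube mult_ac)
    finally show ?thesis by (simp add: mult_left_mono)
  qed
  ultimately show ?thesis using Duh_continuous by (simp add: sup_L3_bound_def)
qed

end

lemma Duh_diff:
  assumes "continuous_on {0..} F" "continuous_on {0..} G"
  shows "Duh (\<lambda>t. F t - G t) s = Duh F s - Duh G s"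
proof -
  have "Duh (\<lambda>t. F t - G t) s = (LBINT t:{0..s}. S (s - t) (F t) - S (s - t) (G t))"
    unfolding Duh_def by (intro set_lebesgue_integral_cong) (auto simp: linear_diff[OF bounded_linear.linear[OF lin]])
  then show ?thesis using Duh_integrable assms by (simp add: Duh_def set_integral_diff)
qed

lemma Duh_norm_le_integral:
  assumes F: "continuous_on {0..} F" and k: "continuous_on {0..s} k" "\<And>t. t \<in> {0..s} \<Longrightarrow> norm (F t) \<le> k t"
  shows "norm (Duh F s) \<le> C * (LBINT t:{0..s}. k t)"
proof -
  have "norm (Duh F s) \<le> (LBINT t:{0..s}. norm (S (s - t) (F t)))"
    unfolding Duh_def by (rule set_integral_norm_bound[OF Duh_integrable[OF F]])
  also have "\<dots> \<le> (LBINT t:{0..s}. C * k t)"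
  proof (rule set_integral_mono)
    show "set_integrable lborel {0..s} (\<lambda>t. norm (S (s - t) (F t)))" by (rule set_integrable_norm[OF Duh_integrable[OF F]])
    show "set_integrable lborel {0..s} (\<lambda>t. C * k t)" by (intro borel_integrable_atLeastAtMost' continuous_intros k)
    show "norm (S (s - t) (F t)) \<le> C * k t" if "t \<in> {0..s}" for t
      using order_trans[OF bound mult_left_mono[OF k(2)[OF that] less_imp_le[OF C_pos]], of "s - t"] that by simp
  qed
  finally show ?thesis by simp
qed

end

section \<open>Picard iteration for a cubic nonlinearity\<close>

locale L3_semilinear = L3_propagator S C
  for S :: "real \<Rightarrow> 'a::{banach,second_countable_topology} \<Rightarrow> 'b::{banach,second_countable_topology}" and C +
  fixes N :: "'b \<Rightarrow> 'a" and L :: real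
  assumes L_pos: "0 < L" and N_zero: "N 0 = 0"
    and N_lipschitz: "norm (N a - N b) \<le> L * norm (a - b) * ((norm a)\<^sup>2 + (norm b)\<^sup>2)"
begin

lemma N_continuous:
  assumes u: "continuous_on X u" shows "continuous_on X (\<lambda>x. N (u x))"
proof -
  have "isCont N a" for a
    unfolding isCont_def
  proof (rule Lim_null[THEN iffD2, OF Lim_null_comparison])
    show "\<forall>\<^sub>F b in at a. norm (N b - N a) \<le> L * norm (b - a) * ((norm b)\<^sup>2 + (norm a)\<^sup>2)"
      using N_lipschitz by simp
    have "((\<lambda>b. L * norm (b - a) * ((norm b)\<^sup>2 + (norm a)\<^sup>2)) \<longlongrightarrow> L * norm (a - a) * ((norm a)\<^sup>2 + (norm a)\<^sup>2)) (at a)"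
      by (intro tendsto_intros)
    then show "((\<lambda>b. L * norm (b - a) * ((norm b)\<^sup>2 + (norm a)\<^sup>2)) \<longlongrightarrow> 0) (at a)" by simp
  qed
  then have "continuous_on UNIV N" by (simp add: continuous_at_imp_continuous_on)
  then show ?thesis using u continuous_on_compose2 by blast
qed

text \<open>The Lipschitz bound and Hoelder's inequality put the difference of the nonlinear terms
  into L1 in time, with norm at most \<open>2 * L * r\<^sup>2 * e\<close>, and the Duhamel integral
  returns to the sup and L3 norms at the cost of \<open>C\<close>. The contraction factor is
  \<open>2 * C * L * r\<^sup>2\<close>.\<close>

lemma Duh_N_contraction:
  assumes u: "sup_L3_bound r u" and v: "sup_L3_bound r v" and d: "sup_L3_bound e (\<lambda>s. u s - v s)"
    and r: "0 < r" and e: "0 < e"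
  shows "sup_L3_bound (C * (2 * L * r\<^sup>2 * e)) (\<lambda>s. Duh (\<lambda>t. N (u t)) s - Duh (\<lambda>t. N (v t)) s)"
proof -
  have cu: "continuous_on {0..} u" and cv: "continuous_on {0..} v" using u v by (auto simp: sup_L3_bound_def)
  have cN: "continuous_on {0..} (\<lambda>t. N (u t) - N (v t))" by (intro continuous_intros N_continuous cu cv)
  have B: "(\<integral>\<^sup>+s. indicator {0..} s * ennreal (norm (u s - v s) * (norm (w s))\<^sup>2) \<partial>lborel) \<le> ennreal (e * r\<^sup>2)"
    if "sup_L3_bound r w" for w :: "real \<Rightarrow> 'b"
    using d r e that unfolding sup_L3_bound_def by (intro nn_integral_mult_square_le) (auto intro!: continuous_intros)
  have m: "(\<lambda>s. indicator {0..} s * ennreal (norm (u s - v s) * (norm (w s))\<^sup>2)) \<in> borel_measurable borel"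
    if "continuous_on {0..} w" for w :: "real \<Rightarrow> 'b"
    by (intro measurable_indicator_continuous continuous_intros cu cv that)
  have "(\<integral>\<^sup>+t. indicator {0..} t * ennreal (norm (N (u t) - N (v t))) \<partial>lborel)
      \<le> (\<integral>\<^sup>+s. ennreal L * (indicator {0..} s * ennreal (norm (u s - v s) * (norm (u s))\<^sup>2)
          + indicator {0..} s * ennreal (norm (u s - v s) * (norm (v s))\<^sup>2)) \<partial>lborel)"
    using N_lipschitz L_pos by (intro nn_integral_mono)
      (auto simp: indicator_def ennreal_plus[symmetric] ennreal_mult[symmetric] ennreal_leI distrib_left mult.assoc simp del: ennreal_plus)
  also have "\<dots> = ennreal L * ((\<integral>\<^sup>+s. indicator {0..} s * ennreal (norm (u s - v s) * (norm (u s))\<^sup>2) \<partial>lborel)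
      + (\<integral>\<^sup>+s. indicator {0..} s * ennreal (norm (u s - v s) * (norm (v s))\<^sup>2) \<partial>lborel))"
    using m cu cv by (simp add: nn_integral_add nn_integral_cmult)
  also have "\<dots> \<le> ennreal L * (ennreal (e * r\<^sup>2) + ennreal (e * r\<^sup>2))"
    by (intro mult_left_mono add_mono B u v) simp
  also have "\<dots> = ennreal (2 * L * r\<^sup>2 * e)"
    using L_pos e by (simp add: ennreal_plus[symmetric] ennreal_mult[symmetric] mult_ac del: ennreal_plus)
  finally have "sup_L3_bound (C * (2 * L * r\<^sup>2 * e)) (Duh (\<lambda>t. N (u t) - N (v t)))"
    using L_pos r e by (intro Duh_sup_L3_bound cN) auto
  moreover have "Duh (\<lambda>t. N (u t) - N (v t)) = (\<lambda>s. Duh (\<lambda>t. N (u t)) s - Duh (\<lambda>t. N (v t)) s)"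
    using Duh_diff N_continuous cu cv by blast
  ultimately show ?thesis by simp
qed

lemma Duh_N_zero: "Duh (\<lambda>t. N 0) s = 0"
proof -
  have "Duh (\<lambda>t. N 0) s = (LBINT t:{0..s}. 0)"
    unfolding Duh_def N_zero
    by (intro set_lebesgue_integral_cong) (auto simp: linear_0[OF bounded_linear.linear[OF lin]])
  then show ?thesis by simp
qed

context
  fixes l :: "real \<Rightarrow> 'b" and r :: real
  assumes l: "sup_L3_bound r l" and r: "0 < r" and small: "16 * C * L * r\<^sup>2 \<le> 1"
begin

primrec picard :: "nat \<Rightarrow> real \<Rightarrow> 'b" where
  "picard 0 = (\<lambda>s. 0)"
| "picard (Suc n) = (\<lambda>s. l s - Duh (\<lambda>t. N (picard n t)) s)"

text \<open>Comparison with the zero function bounds the nonlinear part by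
  \<open>16 * C * L * r\<^sup>2 * r\<close>, hence by \<open>r\<close>; this is the origin of the
  smallness condition. The linear part takes up the other half of the radius
  \<open>2 * r\<close>.\<close>

lemma picard_bound: "sup_L3_bound (2 * r) (picard n)"
proof (induction n)
  case 0
  show ?case using r by (simp add: sup_L3_bound_zero)
next
  case (Suc n)
  have "sup_L3_bound (C * (2 * L * (2 * r)\<^sup>2 * (2 * r))) (\<lambda>s. Duh (\<lambda>t. N (picard n t)) s - Duh (\<lambda>t. N 0) s)"
    using Suc r by (intro Duh_N_contraction) (auto simp: sup_L3_bound_zero)
  then have "sup_L3_bound (C * (2 * L * (2 * r)\<^sup>2 * (2 * r))) (\<lambda>s. Duh (\<lambda>t. N (picard n t)) s)"
    by (simp add: Duh_N_zero)
  moreover have "C * (2 * L * (2 * r)\<^sup>2 * (2 * r)) \<le> r"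
    using mult_right_mono[OF small, of r] r by (simp add: power2_eq_square mult_ac)
  ultimately have "sup_L3_bound r (\<lambda>s. Duh (\<lambda>t. N (picard n t)) s)"
    using C_pos L_pos r by (elim sup_L3_bound_mono) auto
  from sup_L3_bound_diff[OF l this r r] show ?case by (simp only: picard.simps mult_2)
qed

text \<open>On the ball of radius \<open>2 * r\<close> the contraction factor is
  \<open>8 * C * L * r\<^sup>2\<close>, hence at most 1/2.\<close>

lemma picard_diff: "sup_L3_bound (r / 2 ^ n) (\<lambda>s. picard (Suc n) s - picard n s)"
proof (induction n)
  case 0
  show ?case using l by (simp add: Duh_N_zero)
next
  case (Suc n)
  have "sup_L3_bound (C * (2 * L * (2 * r)\<^sup>2 * (r / 2 ^ n)))
      (\<lambda>s. Duh (\<lambda>t. N (picard (Suc n) t)) s - Duh (\<lambda>t. N (picard n t)) s)"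
    using Suc r by (intro Duh_N_contraction picard_bound) auto
  then have "sup_L3_bound (C * (2 * L * (2 * r)\<^sup>2 * (r / 2 ^ n)))
      (\<lambda>s. - (Duh (\<lambda>t. N (picard (Suc n) t)) s - Duh (\<lambda>t. N (picard n t)) s))"
    by (rule sup_L3_bound_minus)
  then have "sup_L3_bound (C * (2 * L * (2 * r)\<^sup>2 * (r / 2 ^ n))) (\<lambda>s. picard (Suc (Suc n)) s - picard (Suc n) s)"
    by simp
  moreover have "C * (2 * L * (2 * r)\<^sup>2 * (r / 2 ^ n)) \<le> r / 2 ^ Suc n"
    using mult_right_mono[OF small, of "r / 2 ^ Suc n"] r by (simp add: power2_eq_square mult_ac)
  ultimately show ?case
    using C_pos L_pos r by (elim sup_L3_bound_mono) auto
qed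

lemma picard_limit:
  obtains u where "uniform_limit {0..} picard u sequentially"
proof -
  have "uniform_limit {0..} (\<lambda>n s. \<Sum>i<n. picard (Suc i) s - picard i s) (\<lambda>s. suminf (\<lambda>i. picard (Suc i) s - picard i s)) sequentially"
  proof (rule Weierstrass_m_test)
    show "norm (picard (Suc i) s - picard i s) \<le> r * (1 / 2) ^ i" if "s \<in> {0..}" for i s
      using picard_diff[of i] that by (simp add: sup_L3_bound_def power_one_over divide_simps)
    show "summable (\<lambda>i. r * (1 / 2) ^ i)" by (intro summable_mult summable_geometric) simp
  qed
  moreover have "(\<Sum>i<n. picard (Suc i) s - picard i s) = picard n s" for n s
    using sum_lessThan_telescope[of "\<lambda>i. picard i s" n] by (simp del: picard.simps(2))
  ultimately show ?thesis by (intro that) simp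
qed

text \<open>Uniform convergence suffices for the equation, since each Duhamel integral extends over
  a bounded interval; the L3 bound reaches the limit by Fatou's lemma.\<close>

lemma semilinear_exists:
  obtains u where "sup_L3_bound (2 * r) u" "\<And>s. 0 \<le> s \<Longrightarrow> u s = l s - Duh (\<lambda>t. N (u t)) s"
proof -
  obtain u where ul: "uniform_limit {0..} picard u sequentially" by (rule picard_limit)
  have cn: "continuous_on {0..} (picard n)" and bn: "0 \<le> s \<Longrightarrow> norm (picard n s) \<le> 2 * r" for n s
    using picard_bound[of n] by (auto simp: sup_L3_bound_def)
  have cu: "continuous_on {0..} u"
    using uniform_limit_theorem[OF always_eventually ul] cn by simp
  have lim: "(\<lambda>n. picard n s) \<longlonglongrightarrow> u s" if "0 \<le> s" for s using tendsto_uniform_limitI[OF ul] that by simp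
  have bu: "norm (u s) \<le> 2 * r" if "0 \<le> s" for s
    using LIMSEQ_le_const2[OF tendsto_norm[OF lim[OF that]]] bn that by blast
  have "(\<integral>\<^sup>+s. indicator {0..} s * ennreal (norm (u s) ^ 3) \<partial>lborel)
      = (\<integral>\<^sup>+s. liminf (\<lambda>n. indicator {0..} s * ennreal (norm (picard n s) ^ 3)) \<partial>lborel)"
  proof (intro nn_integral_cong)
    fix s :: real
    have "(\<lambda>n. indicator {0..} s * ennreal (norm (picard n s) ^ 3)) \<longlonglongrightarrow> indicator {0..} s * ennreal (norm (u s) ^ 3)"
    proof (cases "0 \<le> s")
      case True
      have "(\<lambda>n. ennreal (norm (picard n s) ^ 3)) \<longlonglongrightarrow> ennreal (norm (u s) ^ 3)"
        by (intro tendsto_intros tendsto_ennrealI lim[OF True])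
      then show ?thesis using True by simp
    qed simp
    then show "indicator {0..} s * ennreal (norm (u s) ^ 3) = liminf (\<lambda>n. indicator {0..} s * ennreal (norm (picard n s) ^ 3))"
      by (intro lim_imp_Liminf[symmetric]) auto
  qed
  also have "\<dots> \<le> liminf (\<lambda>n. \<integral>\<^sup>+s. indicator {0..} s * ennreal (norm (picard n s) ^ 3) \<partial>lborel)"
    using measurable_indicator_continuous[of "\<lambda>s. norm (picard n s) ^ 3" for n] cn
    by (intro nn_integral_liminf) (simp add: continuous_intros)
  also have "\<dots> \<le> liminf (\<lambda>n. ennreal ((2 * r) ^ 3))"
    using picard_bound unfolding sup_L3_bound_def by (intro Liminf_mono always_eventually allI) blast
  also have "\<dots> = ennreal ((2 * r) ^ 3)" by (simp add: Liminf_const)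
  finally have bd: "sup_L3_bound (2 * r) u" using cu bu by (simp add: sup_L3_bound_def)
  have "u s = l s - Duh (\<lambda>t. N (u t)) s" if s: "0 \<le> s" for s
  proof -
    define K where "K = C * (L * (2 * (2 * r)\<^sup>2) * s)"
    have "(\<lambda>n. Duh (\<lambda>t. N (picard n t)) s - Duh (\<lambda>t. N (u t)) s) \<longlonglongrightarrow> 0"
    proof (rule tendstoI)
      fix e :: real assume e: "e > 0"
      have K: "0 \<le> K" using C_pos L_pos s by (simp add: K_def)
      have "\<forall>\<^sub>F n in sequentially. \<forall>t\<in>{0..}. dist (picard n t) (u t) < e / (K + 1)"
        using e K by (intro uniform_limitD[OF ul]) simp
      then show "\<forall>\<^sub>F n in sequentially. dist (Duh (\<lambda>t. N (picard n t)) s - Duh (\<lambda>t. N (u t)) s) 0 < e"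
      proof eventually_elim
        case (elim n)
        have "norm (N (picard n t) - N (u t)) \<le> L * (e / (K + 1)) * (2 * (2 * r)\<^sup>2)" if t: "t \<in> {0..s}" for t
        proof -
          have "norm (picard n t - u t) \<le> e / (K + 1)" using elim t by (simp add: dist_norm less_imp_le)
          moreover have "(norm (picard n t))\<^sup>2 + (norm (u t))\<^sup>2 \<le> 2 * (2 * r)\<^sup>2"
            using power_mono[OF bn[of t n], of 2] power_mono[OF bu[of t], of 2] t by simp
          ultimately have "L * norm (picard n t - u t) * ((norm (picard n t))\<^sup>2 + (norm (u t))\<^sup>2) \<le> L * (e / (K + 1)) * (2 * (2 * r)\<^sup>2)"
            using L_pos e K by (intro mult_mono) auto
          then show ?thesis using N_lipschitz[of "picard n t" "u t"] by linarith
        qed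
        then have "norm (Duh (\<lambda>t. N (picard n t) - N (u t)) s) \<le> C * (LBINT t:{0..s}. L * (e / (K + 1)) * (2 * (2 * r)\<^sup>2))"
          by (intro Duh_norm_le_integral continuous_intros N_continuous cn cu)
        also have "\<dots> = K * (e / (K + 1))" using s by (simp add: K_def set_integral_const)
        also have "\<dots> < e" using e K by (simp add: field_simps)
        finally show ?case using Duh_diff[OF N_continuous[OF cn] N_continuous[OF cu], of n s] by simp
      qed
    qed
    then have "(\<lambda>n. Duh (\<lambda>t. N (picard n t)) s) \<longlonglongrightarrow> Duh (\<lambda>t. N (u t)) s" using Lim_null by blast
    then have "(\<lambda>n. picard (Suc n) s) \<longlonglongrightarrow> l s - Duh (\<lambda>t. N (u t)) s" by (auto intro: tendsto_intros)
    then show ?thesis using LIMSEQ_unique LIMSEQ_Suc[OF lim[OF s]] by blast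
  qed
  with bd show ?thesis by (rule that)
qed

end

text \<open>The claim covers all continuous solutions, also those outside the small ball. On
  \<open>{0..T}\<close> both are bounded, so \<open>N\<close> is Lipschitz along them, and the
  integral inequality for the weighted difference is evaluated at the point where that difference is
  maximal.\<close>

lemma semilinear_unique:
  assumes cu: "continuous_on {0..} u" and cv: "continuous_on {0..} v"
    and u: "\<And>s. 0 \<le> s \<Longrightarrow> u s = l s - Duh (\<lambda>t. N (u t)) s"
    and v: "\<And>s. 0 \<le> s \<Longrightarrow> v s = l s - Duh (\<lambda>t. N (v t)) s"
    and T: "0 \<le> T"
  shows "v T = u T"
proof -
  have cu': "continuous_on {0..T} u" and cv': "continuous_on {0..T} v"
    using cu cv by (auto intro: continuous_on_subset)
  obtain R where R: "\<And>t. t \<in> {0..T} \<Longrightarrow> norm (u t) \<le> R" "\<And>t. t \<in> {0..T} \<Longrightarrow> norm (v t) \<le> R"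
  proof -
    have "bounded (u ` {0..T} \<union> v ` {0..T})"
      using cu' cv' by (auto intro!: compact_imp_bounded compact_continuous_image)
    then show ?thesis unfolding bounded_iff using that by (metis UnCI imageI)
  qed
  \<comment> \<open>The summand 1 keeps the exponent positive also when
    \<open>R = 0\<close>.\<close>
  define K where "K = C * L * (2 * R\<^sup>2) + 1"
  have K: "0 < K" using C_pos L_pos by (simp add: K_def add_nonneg_pos)
  \<comment> \<open>In the weighted norm the Duhamel operator is a contraction by \<open>1/2\<close>.\<close>
  define m where "m s = norm (u s - v s) * exp (- 2 * K * s)" for s
  have "continuous_on {0..T} m" unfolding m_def by (intro continuous_intros cu' cv')
  then obtain x where x: "x \<in> {0..T}" and mx: "\<And>t. t \<in> {0..T} \<Longrightarrow> m t \<le> m x"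
    using continuous_attains_sup[of "{0..T}" m] T by auto
  have d: "norm (u t - v t) \<le> m x * exp (2 * K * t)" if "t \<in> {0..T}" for t
    using mx[OF that] by (simp add: m_def exp_minus field_simps)
  have x0: "0 \<le> x" using x by simp
  have "norm (N (v t) - N (u t)) \<le> L * (2 * R\<^sup>2) * (m x * exp (2 * K * t))" if "t \<in> {0..x}" for t
  proof -
    have t: "t \<in> {0..T}" using that x by simp
    have "(norm (v t))\<^sup>2 + (norm (u t))\<^sup>2 \<le> 2 * R\<^sup>2"
      using power_mono[OF R(1)[OF t], of 2] power_mono[OF R(2)[OF t], of 2] by simp
    then have "L * norm (v t - u t) * ((norm (v t))\<^sup>2 + (norm (u t))\<^sup>2) \<le> L * (m x * exp (2 * K * t)) * (2 * R\<^sup>2)"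
      using d[OF t] L_pos by (intro mult_mono) (auto simp: norm_minus_commute m_def)
    then show ?thesis using N_lipschitz[of "v t" "u t"] by (simp add: mult_ac)
  qed
  then have "norm (Duh (\<lambda>t. N (v t) - N (u t)) x) \<le> C * (LBINT t:{0..x}. L * (2 * R\<^sup>2) * (m x * exp (2 * K * t)))"
    by (intro Duh_norm_le_integral continuous_intros N_continuous cu cv)
  also have "u x - v x = Duh (\<lambda>t. N (v t) - N (u t)) x"
    using u[OF x0] v[OF x0] Duh_diff[OF N_continuous[OF cv] N_continuous[OF cu]] by simp
  then have "norm (Duh (\<lambda>t. N (v t) - N (u t)) x) = norm (u x - v x)" by simp
  finally have 1: "norm (u x - v x) \<le> C * L * (2 * R\<^sup>2) * m x * (LBINT t:{0..x}. exp (2 * K * t))"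
    by (simp add: mult_ac)
  have "(LBINT t:{0..x}. exp (2 * K * t)) = exp (2 * K * x) / (2 * K) - exp (2 * K * 0) / (2 * K)"
  proof -
    have "((\<lambda>t. exp (2 * K * t) / (2 * K)) has_real_derivative exp (2 * K * t)) (at t)" for t
      using K by (auto intro!: derivative_eq_intros)
    then show ?thesis
      using integral_FTC_Icc_real[of 0 x "\<lambda>t. exp (2 * K * t) / (2 * K)" "\<lambda>t. exp (2 * K * t)"] x0
      by (simp add: set_lebesgue_integral_def mult.commute)
  qed
  also have "\<dots> \<le> exp (2 * K * x) / (2 * K)" using K by simp
  \<comment> \<open>The weight integrates to at most \<open>1 / (2 * K)\<close> of its end value,
    and \<open>K\<close> dominates the Lipschitz constant; the product of the two factors is
    1/2.\<close>
  finally have "C * L * (2 * R\<^sup>2) * m x * (LBINT t:{0..x}. exp (2 * K * t)) \<le> K * m x * (exp (2 * K * x) / (2 * K))"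
    using C_pos L_pos K by (intro mult_mono) (auto simp: K_def m_def set_lebesgue_integral_def intro!: mult_nonneg_nonneg integral_nonneg)
  with 1 have "norm (u x - v x) \<le> m x * exp (2 * K * x) / 2" using K by simp
  then have "m x \<le> m x / 2" by (simp add: m_def exp_minus field_simps)
  then have "m x * exp (2 * K * T) \<le> 0" by (intro mult_nonpos_nonneg) auto
  with T have "norm (u T - v T) \<le> 0" by (intro order_trans[OF d]) auto
  then show ?thesis by simp
qed

end

text \<open>Interpolation with the sup bound: for finite \<open>q \<ge> 3\<close> the power
  \<open>norm (u s) powr q\<close> is at most
  \<open>r powr (q - 3) * norm (u s) ^ 3\<close>.\<close>

lemma sup_L3_bound_in_Bochner_Lp:
  fixes u :: "real \<Rightarrow> 'b::{banach,second_countable_topology}"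
  assumes u: "sup_L3_bound r u" and p: "3 \<le> p"
  shows "in_Bochner_Lp p {0<..} u"
proof -
  have c: "continuous_on {0<..} u" and b: "\<And>s. 0 < s \<Longrightarrow> norm (u s) \<le> r"
    using u by (auto simp: sup_L3_bound_def intro: continuous_on_subset)
  have m: "u \<in> borel_measurable (lebesgue_on {0<..})"
    by (intro continuous_imp_measurable_on_sets_lebesgue c) simp
  show ?thesis
  proof (cases p)
    case PInf
    have "AE s in lebesgue_on {0<..}. norm (u s) \<le> r"
      by (subst AE_restrict_space_iff) (use b in auto)
    then show ?thesis using m PInf by (auto simp: in_Bochner_Lp_def)
  next
    case (real q)
    then have q: "3 \<le> q" using p by simp
    have "r \<ge> 0" using b[of 1] norm_ge_zero[of "u 1"] by linarith
    define R where "R = r powr (q - 3)"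
    have le: "norm (u s) powr q \<le> R * norm (u s) ^ 3" if "0 < s" for s
    proof (cases "u s = 0")
      case False
      have "norm (u s) powr q = norm (u s) powr (q - 3) * norm (u s) powr 3" by (simp flip: powr_add del: powr_numeral)
      also have "norm (u s) powr (q - 3) \<le> R" unfolding R_def using b[OF that] q by (intro powr_mono2) auto
      finally show ?thesis using False by (simp add: mult_right_mono)
    qed simp
    have "(\<integral>\<^sup>+s. ennreal (norm (norm (u s) powr q)) \<partial>lebesgue_on {0<..})
        = (\<integral>\<^sup>+s. ennreal (norm (u s) powr q) * indicator {0<..} s \<partial>lebesgue)"
      by (subst nn_integral_restrict_space) auto
    also have "\<dots> \<le> (\<integral>\<^sup>+s. ennreal R * (indicator {0..} s * ennreal (norm (u s) ^ 3)) \<partial>lebesgue)"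
      using le by (intro nn_integral_mono) (auto simp: indicator_def ennreal_mult[symmetric] ennreal_leI R_def)
    also have "\<dots> = (\<integral>\<^sup>+s. ennreal R * (indicator {0..} s * ennreal (norm (u s) ^ 3)) \<partial>lborel)"
      using u by (intro nn_integral_completion)
    also have "\<dots> = ennreal R * (\<integral>\<^sup>+s. indicator {0..} s * ennreal (norm (u s) ^ 3) \<partial>lborel)"
      using measurable_indicator_continuous[of "\<lambda>s. norm (u s) ^ 3"] u
      by (intro nn_integral_cmult) (simp add: sup_L3_bound_def continuous_intros)
    also have "\<dots> \<le> ennreal R * ennreal (r ^ 3)"
      using u by (intro mult_left_mono) (auto simp: sup_L3_bound_def)
    also have "\<dots> < \<infinity>" by (simp add: ennreal_mult_less_top)
    finally have "integrable (lebesgue_on {0<..}) (\<lambda>s. norm (u s) powr q)"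
      using m by (intro integrableI_bounded) measurable
    then show ?thesis using m real by (simp add: in_Bochner_Lp_def)
  qed (use p in auto)
qed

section \<open>The cubic wave equation\<close>

text \<open>1000 covers both constants of the propagator, 832 in the sup norm and 1000 in L3; 4 is
  the constant of \<open>cube_lipschitz\<close>.\<close>

interpretation wave: L3_semilinear S_prop 1000 cube 4
proof (intro L3_semilinear.intro L3_propagator.intro L3_semilinear_axioms.intro)
  fix s :: real and x :: "2 Lodd"
  assume s: "0 \<le> s"
  show "bounded_linear (S_prop s)" by (rule S_prop(1)[OF s])
  show "norm (S_prop s x) \<le> 1000 * norm x" using S_prop(3)[OF s, of x] norm_ge_zero[of x] by linarith
next
  show "cube 0 = 0" using cube_Lclass[of "\<lambda>_. 0"] Lq_odd_zero[of 6] by (simp add: zero_Lodd_def)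
qed (rule S_prop_continuous S_prop_L3 cube_lipschitz | simp)+

text \<open>For continuous \<open>u\<close> the integrand is continuous on the compact interval
  \<open>{0..s}\<close>, which supplies its integrability.\<close>

lemma Duhamel_solution_iff:
  "is_Duhamel_solution f g u \<longleftrightarrow> continuous_on {0..} u \<and>
    (\<forall>s\<ge>0. u s = (C_prop s f + S_prop s (Lclass g)) - wave.Duh (\<lambda>t. cube (u t)) s)"
  using wave.Duh_integrable[OF wave.N_continuous] by (auto simp: is_Duhamel_solution_def wave.Duh_def)

text \<open>The two propagators contribute \<open>1000 * r\<close> each, with the data
  \<open>(f, 0)\<close> and \<open>(0, g)\<close>, whose energy norms do not exceed that of
  \<open>(f, g)\<close>.\<close>

lemma linear_part_bound:
  assumes f: "smooth_odd f" and g: "smooth_odd g" and r: "0 < r" and e: "energy_norm f g \<le> r"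
  shows "sup_L3_bound (2000 * r) (\<lambda>s. C_prop s f + S_prop s (Lclass g))"
proof -
  have e': "energy_norm f (\<lambda>_. 0) \<le> r" using energy_norm_zero_right[of f g] e by simp
  note W = wave_solution_L6[OF f smooth_odd_zero r e']
  have "sup_L3_bound (1000 * r) (\<lambda>s. C_prop s f)"
    using W(2,3,4) r by (force simp: sup_L3_bound_def C_prop_def intro: order_trans)
  moreover have "sup_L3_bound (1000 * r) (\<lambda>s. S_prop s (Lclass g))"
  proof -
    have n: "norm (Lclass g :: 2 Lodd) \<le> r" using norm_le_energy_norm[OF g, of f] e by simp
    have "ennreal ((1000 * norm (Lclass g :: 2 Lodd)) ^ 3) \<le> ennreal ((1000 * r) ^ 3)"
      using n by (intro ennreal_leI power_mono) auto
    then show ?thesis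
      using wave.bound[of _ "Lclass g"] n S_prop_L3[of "Lclass g"] S_prop_continuous
      by (force simp: sup_L3_bound_def intro: order_trans)
  qed
  ultimately show ?thesis using sup_L3_bound_add[of "1000 * r" _ "1000 * r"] r by simp
qed

theorem theorem2p3:
  shows "\<exists>\<delta>>0. \<forall>f g. smooth_odd f \<and> smooth_odd g \<and> energy_norm f g < \<delta> \<longrightarrow>
    (\<exists>u. is_Duhamel_solution f g u \<and>
         (\<forall>v. is_Duhamel_solution f g v \<longrightarrow> (\<forall>s\<ge>0. v s = u s)) \<and>
         (\<forall>p\<ge>3. in_Bochner_Lp p {0<..} u))"
proof (rule exI[of _ "1 / 2000000 :: real"], intro conjI allI impI)
  \<comment> \<open>With \<open>r = 2000 * \<delta> = 1 / 1000\<close> the smallness condition reads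
    \<open>16 * 1000 * 4 / 1000\<^sup>2 \<le> 1\<close>.\<close>
  let ?\<delta> = "1 / 2000000 :: real"
  show "0 < ?\<delta>" by simp
  fix f g assume "smooth_odd f \<and> smooth_odd g \<and> energy_norm f g < ?\<delta>"
  then have l: "sup_L3_bound (2000 * ?\<delta>) (\<lambda>s. C_prop s f + S_prop s (Lclass g))"
    by (intro linear_part_bound) auto
  obtain u where u: "sup_L3_bound (2 * (2000 * ?\<delta>)) u"
    "\<And>s. 0 \<le> s \<Longrightarrow> u s = (C_prop s f + S_prop s (Lclass g)) - wave.Duh (\<lambda>t. cube (u t)) s"
    by (rule wave.semilinear_exists[OF l]) (auto simp: power2_eq_square)
  have cu: "continuous_on {0..} u" using u(1) by (simp add: sup_L3_bound_def)
  show "\<exists>u. is_Duhamel_solution f g u \<and> (\<forall>v. is_Duhamel_solution f g v \<longrightarrow> (\<forall>s\<ge>0. v s = u s)) \<and>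
      (\<forall>p\<ge>3. in_Bochner_Lp p {0<..} u)"
  proof (rule exI[of _ u], intro conjI allI impI)
    show "is_Duhamel_solution f g u" using cu u(2) unfolding Duhamel_solution_iff by blast
    show "v s = u s" if v: "is_Duhamel_solution f g v" and s: "0 \<le> s" for v s
      using v wave.semilinear_unique[OF cu _ u(2) _ s, of v] unfolding Duhamel_solution_iff by blast
    show "in_Bochner_Lp p {0<..} u" if "3 \<le> p" for p by (rule sup_L3_bound_in_Bochner_Lp[OF u(1) that])
  qed
qed

end
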